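(* Let $(u,b)$ be a weak solution of the MHD system for which there is a non-negative function $R(\cdot)$ such that for every $T>0$ $$\|u(\cdot,T)\|_{L^2}^2+\|b(\cdot,T)\|_{L^2}^2+\min(\nu,\eta)\int_0^T\big(\|\nabla u(\cdot,s)\|_{L^2}^2+\|\nabla b(\cdot,s)\|_{L^2}^2\big)\,ds\le R^2(T).$$ Let $k\in\mathbb{R}^3\setminus\{0\}$ and $0<\delta<\frac{|k|}{2\sqrt3}$, and let $\widehat\chi_k$, $e_p$, $h_p$ be the associated cutoff and quantities. Suppose that there is a non-decreasing function $R_1(t)$ such that, for every $2\le p<\infty$ and all $t\in[0,\infty)$, $$2^{1/p}(2\delta)^{3/p}R^2(t)+2h_p(k,t)<\frac{\min(\nu,\eta)}{6}R_1(t).$$ If the weak solution satisfies the initial condition $$\sup_{2\le p<\infty}e_p(k,0)<\frac{R_1(0)}{|k|},$$ then for all $t>0$ $$\sup_{2\le p<\infty}e_p(k,t)<\frac{R_1(t)}{|k|}.$$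
   Context: MHD system. Let $D=\mathbb{R}^3$, $\nu,\eta>0$. The system is $$\partial_t u+(u\cdot\nabla)u+\nabla\pi-(b\cdot\nabla)b-\nu\Delta u=f_1,\quad \partial_t b+(u\cdot\nabla)b-(b\cdot\nabla)u-\eta\Delta b=f_2 \quad\text{on }(0,\infty)\times D,$$ $$\operatorname{div}u=\operatorname{div}b=0,\qquad u|_{t=0}=u_0,\quad b|_{t=0}=b_0,$$ where $u(x,t),b(x,t)$ are the velocity and magnetic fields, $\pi$ is the total pressure, and $f_1,f_2$ are divergence-free and belong to $L^\infty_{loc}([0,\infty);H^{-1}(D)\cap L^2(D))$. Function spaces. $L^2_\sigma$ and $H^1_\sigma$ are the closures, in the $L^2$ and $H^1$ norms, of the divergence-free smooth compactly supported vector fields on $D$. Weak solution. For $(u_0,b_0)\in L^2_\sigma(D)$, a pair $(u,b)$ is a weak solution on $D\times[0,\infty)$ if: (1) for every $T>0$, $u,b\in L^\infty([0,T);L^2_\sigma)\cap L^2([0,T);H^1_\sigma)$; (2) for every $T>0$ and all $(\Phi,\Psi)$ in $H^1((0,T);H^1_\sigma\cap L^2)$ with $\Phi(T)=\Psi(T)=0$, $$\int_0^T\{-(u,\partial_t\Phi)+\nu(\nabla u,\nabla\Phi)+(u\cdot\nabla u,\Phi)-(b\cdot\nabla b,\Phi)\}dt=(u_0,\Phi(0))+\int_0^T(f_1,\Phi)dt,$$ $$\int_0^T\{-(b,\partial_t\Psi)+\eta(\nabla b,\nabla\Psi)+(u\cdot\nabla b,\Psi)-(b\cdot\nabla u,\Psi)\}dt=(b_0,\Psi(0))+\int_0^T(f_2,\Psi)dt,$$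 and $u(\cdot,t)\to u_0$, $b(\cdot,t)\to b_0$ strongly in $L^2$ as $t\to0^+$; (3) for all $0<t<\infty$, $$\tfrac12\int_D(|u(x,t)|^2+|b(x,t)|^2)dx+\min(\nu,\eta)\int_0^t\!\int_D(|\nabla u|^2+|\nabla b|^2)dx\,ds-\int_0^t\!\int_D(u\cdot f_1+b\cdot f_2)dx\,ds\le\tfrac12\int_D(|u_0|^2+|b_0|^2)dx.$$ Fourier transform: $\widehat u(\xi)=\int_D e^{-i\xi\cdot x}u(x)\,dx$ (in the space variable). Cutoff. For $k\in\mathbb{R}^3\setminus\{0\}$ and $0<\delta<\frac{|k|}{2\sqrt3}$, $\widehat\chi_k$ is a smooth cutoff function with values in $[0,1]$, supported in the cube $Q_k$ centered at $k$ with side length $2\delta$ (so its support lies in $\{\frac{|k|}2\le|\xi|\le\frac32|k|\}$), and equal to $1$ on the cube with the same center and side $\delta$. For $2\le p<\infty$, $$e_p(k,t)=\Big(\int_D|\widehat\chi_k(\xi)\widehat u(\xi,t)|^p+|\widehat\chi_k(\xi)\widehat b(\xi,t)|^p\,d\xi\Big)^{1/p},$$ $$h_p(k,t)=\sup_{0\le s\le t}\Big(\int_D\frac{|\widehat\chi_k(\xi)\widehat f_1(\xi,s)|^p+|\widehat\chi_k(\xi)\widehat f_2(\xi,s)|^p}{|\xi|^p}\,d\xi\Big)^{1/p}.$$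
   Formalization: The values u(·,t), b(·,t) are taken to be those of the representative that is weakly continuous in time into L²; for an arbitrary representative of the weak solution, altered at a single time, the bound for all t>0 can fail. *)

theory Defs
  imports "HOL-Analysis.Analysis"
begin

text \<open>
  A vector field in \<open>L\<^sup>2\<close> is represented by a Borel function on \<open>real^3\<close>, with no quotient: each
  class modulo null sets has such a representative, and everything below (weak gradients, inner
  products, norms, Fourier transforms) depends on the class only.  Spatial integrals are therefore
  taken over \<^const>\<open>lborel\<close>.  Integrals in time use \<^term>\<open>lebesgue_on I\<close>, because Bochner
  measurability only determines a function of time up to null sets, so that completeness is needed.
\<close>

type_synonym field = "real^3 \<Rightarrow> real^3"


section \<open>Smooth functions\<close>

primrec Ck :: "nat \<Rightarrow> ('a::euclidean_space \<Rightarrow> 'b::real_normed_vector) \<Rightarrow> bool" where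
  "Ck 0 f \<longleftrightarrow> continuous_on UNIV f"
| "Ck (Suc n) f \<longleftrightarrow> (\<forall>x. f differentiable (at x)) \<and>
     (\<forall>v\<in>Basis. Ck n (\<lambda>x. frechet_derivative f (at x) v))"

definition smooth :: "('a::euclidean_space \<Rightarrow> 'b::real_normed_vector) \<Rightarrow> bool" where
  "smooth f \<longleftrightarrow> (\<forall>n. Ck n f)"

definition supp :: "('a::topological_space \<Rightarrow> 'b::zero) \<Rightarrow> 'a set" where
  "supp f = closure {x. f x \<noteq> 0}"

definition test_fun :: "('a::euclidean_space \<Rightarrow> 'b::real_normed_vector) set" where
  "test_fun = {f. smooth f \<and> compact (supp f)}"

definition pderivative :: "3 \<Rightarrow> (real^3 \<Rightarrow> 'b::real_normed_vector) \<Rightarrow> real^3 \<Rightarrow> 'b" where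
  "pderivative j f x = frechet_derivative f (at x) (axis j 1)"

definition solenoidal_test :: "field set" where
  "solenoidal_test = {\<phi> \<in> test_fun. \<forall>x. (\<Sum>j\<in>UNIV. pderivative j \<phi> x $ j) = 0}"


section \<open>Spaces of functions on \<open>real^3\<close>\<close>

definition L2 :: "(real^3 \<Rightarrow> 'b::euclidean_space) set" where
  "L2 = {w \<in> borel_measurable lborel. integrable lborel (\<lambda>x. (norm (w x))\<^sup>2)}"

definition L2_inner :: "(real^3 \<Rightarrow> 'b::euclidean_space) \<Rightarrow> (real^3 \<Rightarrow> 'b) \<Rightarrow> real" where
  "L2_inner v w = (\<integral>x. v x \<bullet> w x \<partial>lborel)"

definition L2_norm :: "(real^3 \<Rightarrow> 'b::euclidean_space) \<Rightarrow> real" where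
  "L2_norm w = sqrt (\<integral>x. (norm (w x))\<^sup>2 \<partial>lborel)"

definition locally_integrable :: "(real^3 \<Rightarrow> 'b::euclidean_space) \<Rightarrow> bool" where
  "locally_integrable w \<longleftrightarrow>
     w \<in> borel_measurable lborel \<and> (\<forall>K. compact K \<longrightarrow> set_integrable lborel K w)"

text \<open>Convention for the Jacobian: \<open>G x $ i $ j\<close> is the \<open>j\<close>-th partial derivative of the \<open>i\<close>-th
  component.  Hence \<open>(v \<cdot> \<nabla>) w = G *v v\<close>; the inner product and the norm on \<open>real^3^3\<close> are
  the Frobenius ones.\<close>

definition is_weak_grad :: "field \<Rightarrow> (real^3 \<Rightarrow> real^3^3) \<Rightarrow> bool" where
  "is_weak_grad w G \<longleftrightarrow> locally_integrable w \<and> locally_integrable G \<and>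
     (\<forall>\<phi>::real^3 \<Rightarrow> real. \<phi> \<in> test_fun \<longrightarrow> (\<forall>i j.
        (\<integral>x. w x $ i * pderivative j \<phi> x \<partial>lborel) = - (\<integral>x. G x $ i $ j * \<phi> x \<partial>lborel)))"

definition wgrad :: "field \<Rightarrow> real^3 \<Rightarrow> real^3^3" where
  "wgrad w = (SOME G. is_weak_grad w G)"

definition H1 :: "field set" where
  "H1 = {w \<in> L2. \<exists>G. is_weak_grad w G \<and> G \<in> L2}"

definition H1_norm :: "field \<Rightarrow> real" where
  "H1_norm w = sqrt ((L2_norm w)\<^sup>2 + (L2_norm (wgrad w))\<^sup>2)"

definition L2_sigma :: "field set" where
  "L2_sigma = {w \<in> L2. \<forall>e>0. \<exists>\<phi>\<in>solenoidal_test. L2_norm (\<lambda>x. w x - \<phi> x) < e}"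

definition H1_sigma :: "field set" where
  "H1_sigma = {w \<in> H1. \<forall>e>0. \<exists>\<phi>\<in>solenoidal_test. H1_norm (\<lambda>x. w x - \<phi> x) < e}"

text \<open>The intersection of \<open>H\<^sup>-\<^sup>1\<close> (the dual of \<open>H\<^sup>1\<close> with respect to the \<open>L\<^sup>2\<close> pairing) with \<open>L\<^sup>2\<close>.\<close>

definition Hm1_L2 :: "field set" where
  "Hm1_L2 = {g \<in> L2. bdd_above {\<bar>L2_inner g \<phi>\<bar> | \<phi>. \<phi> \<in> H1 \<and> H1_norm \<phi> \<le> 1}}"

definition Hm1_L2_norm :: "field \<Rightarrow> real" where
  "Hm1_L2_norm g = Sup {\<bar>L2_inner g \<phi>\<bar> | \<phi>. \<phi> \<in> H1 \<and> H1_norm \<phi> \<le> 1} + L2_norm g"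

definition weakly_div_free :: "field \<Rightarrow> bool" where
  "weakly_div_free g \<longleftrightarrow> (\<forall>\<phi>::real^3 \<Rightarrow> real. \<phi> \<in> test_fun \<longrightarrow>
     (\<integral>x. g x \<bullet> (\<chi> j. pderivative j \<phi> x) \<partial>lborel) = 0)"


section \<open>Bochner spaces\<close>

text \<open>\<open>X\<close> is a space of functions with (semi-)norm \<open>N\<close>, \<open>I\<close> a time interval.\<close>

definition strongly_measurable ::
  "real set \<Rightarrow> ('a \<Rightarrow> 'b::ab_group_add) set \<Rightarrow> (('a \<Rightarrow> 'b) \<Rightarrow> real) \<Rightarrow> (real \<Rightarrow> 'a \<Rightarrow> 'b) \<Rightarrow> bool" where
  "strongly_measurable I X N v \<longleftrightarrow> (AE t in lebesgue_on I. v t \<in> X) \<and>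
     (\<exists>s. (\<forall>n. simple_function (lebesgue_on I) (s n) \<and> s n ` I \<subseteq> X) \<and>
          (AE t in lebesgue_on I. (\<lambda>n::nat. N (\<lambda>x. s n t x - v t x)) \<longlonglongrightarrow> 0))"

definition Linf_time ::
  "real set \<Rightarrow> ('a \<Rightarrow> 'b::ab_group_add) set \<Rightarrow> (('a \<Rightarrow> 'b) \<Rightarrow> real) \<Rightarrow> (real \<Rightarrow> 'a \<Rightarrow> 'b) set" where
  "Linf_time I X N =
     {v. strongly_measurable I X N v \<and> (\<exists>C. AE t in lebesgue_on I. N (v t) \<le> C)}"

definition L2_time ::
  "real set \<Rightarrow> ('a \<Rightarrow> 'b::ab_group_add) set \<Rightarrow> (('a \<Rightarrow> 'b) \<Rightarrow> real) \<Rightarrow> (real \<Rightarrow> 'a \<Rightarrow> 'b) set" where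
  "L2_time I X N =
     {v. strongly_measurable I X N v \<and> integrable (lebesgue_on I) (\<lambda>t. (N (v t))\<^sup>2)}"

text \<open>Distributional time derivative on \<open>(0,T)\<close>.  The identity
  \<open>\<integral> \<theta>' \<Phi> dt = - \<integral> \<theta> \<Phi>' dt\<close> of Bochner integrals is tested against all of \<open>L\<^sup>2\<close>, which separates
  the points of every space used here.\<close>

definition is_weak_time_deriv :: "real \<Rightarrow> (real \<Rightarrow> field) \<Rightarrow> (real \<Rightarrow> field) \<Rightarrow> bool" where
  "is_weak_time_deriv T \<Phi> \<Phi>' \<longleftrightarrow>
     (\<forall>\<theta>::real \<Rightarrow> real. \<theta> \<in> test_fun \<and> supp \<theta> \<subseteq> {0<..<T} \<longrightarrow> (\<forall>w\<in>L2.
        (\<integral>t. deriv \<theta> t * L2_inner (\<Phi> t) w \<partial>lebesgue_on {0<..<T}) =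
        - (\<integral>t. \<theta> t * L2_inner (\<Phi>' t) w \<partial>lebesgue_on {0<..<T})))"

text \<open>\<open>\<Phi> \<in> H\<^sup>1((0,T); H\<^sup>1\<^sub>\<sigma> \<inter> L\<^sup>2)\<close> with time derivative \<open>\<Phi>'\<close>.  The values \<open>\<Phi> 0\<close> and \<open>\<Phi> T\<close> are those of
  the representative that is continuous on \<open>[0,T]\<close>, which \<open>\<Phi>\<close> is required to be.\<close>

definition H1_time_test :: "real \<Rightarrow> (real \<Rightarrow> field) \<Rightarrow> (real \<Rightarrow> field) \<Rightarrow> bool" where
  "H1_time_test T \<Phi> \<Phi>' \<longleftrightarrow>
     \<Phi> \<in> L2_time {0<..<T} (H1_sigma \<inter> L2) H1_norm \<and>
     \<Phi>' \<in> L2_time {0<..<T} (H1_sigma \<inter> L2) H1_norm \<and>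
     is_weak_time_deriv T \<Phi> \<Phi>' \<and>
     (\<forall>t\<in>{0..T}. \<Phi> t \<in> H1_sigma \<inter> L2 \<and>
        ((\<lambda>s. H1_norm (\<lambda>x. \<Phi> s x - \<Phi> t x)) \<longlongrightarrow> 0) (at t within {0..T}))"


section \<open>The MHD system\<close>

text \<open>\<open>trilinear v w \<phi> = ((v \<cdot> \<nabla>) w, \<phi>)\<close>\<close>

definition trilinear :: "field \<Rightarrow> field \<Rightarrow> field \<Rightarrow> real" where
  "trilinear v w \<phi> = L2_inner (\<lambda>x. wgrad w x *v v x) \<phi>"

definition admissible_force :: "(real \<Rightarrow> field) \<Rightarrow> bool" where
  "admissible_force f \<longleftrightarrow>
     (\<forall>T>0. f \<in> Linf_time {0..<T} Hm1_L2 Hm1_L2_norm) \<and>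
     (AE t in lebesgue_on {0..}. weakly_div_free (f t))"

definition weak_solution_MHD ::
  "real \<Rightarrow> real \<Rightarrow> (real \<Rightarrow> field) \<Rightarrow> (real \<Rightarrow> field) \<Rightarrow> field \<Rightarrow> field \<Rightarrow>
   (real \<Rightarrow> field) \<Rightarrow> (real \<Rightarrow> field) \<Rightarrow> bool" where
  "weak_solution_MHD \<nu> \<eta> f1 f2 u0 b0 u b \<longleftrightarrow>
     (\<forall>T>0.
        u \<in> Linf_time {0..<T} L2_sigma L2_norm \<inter> L2_time {0..<T} H1_sigma H1_norm \<and>
        b \<in> Linf_time {0..<T} L2_sigma L2_norm \<inter> L2_time {0..<T} H1_sigma H1_norm) \<and>
     (\<forall>T>0. \<forall>\<Phi> \<Phi>' \<Psi> \<Psi>'.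
        H1_time_test T \<Phi> \<Phi>' \<and> H1_time_test T \<Psi> \<Psi>' \<and>
        (AE x in lborel. \<Phi> T x = 0) \<and> (AE x in lborel. \<Psi> T x = 0) \<longrightarrow>
        (\<integral>t. (- L2_inner (u t) (\<Phi>' t) + \<nu> * L2_inner (wgrad (u t)) (wgrad (\<Phi> t))
              + trilinear (u t) (u t) (\<Phi> t) - trilinear (b t) (b t) (\<Phi> t)) \<partial>lebesgue_on {0<..<T})
          = L2_inner u0 (\<Phi> 0) + (\<integral>t. L2_inner (f1 t) (\<Phi> t) \<partial>lebesgue_on {0<..<T}) \<and>
        (\<integral>t. (- L2_inner (b t) (\<Psi>' t) + \<eta> * L2_inner (wgrad (b t)) (wgrad (\<Psi> t))
              + trilinear (u t) (b t) (\<Psi> t) - trilinear (b t) (u t) (\<Psi> t)) \<partial>lebesgue_on {0<..<T})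
          = L2_inner b0 (\<Psi> 0) + (\<integral>t. L2_inner (f2 t) (\<Psi> t) \<partial>lebesgue_on {0<..<T})) \<and>
     ((\<lambda>t. L2_norm (\<lambda>x. u t x - u0 x)) \<longlongrightarrow> 0) (at_right 0) \<and>
     ((\<lambda>t. L2_norm (\<lambda>x. b t x - b0 x)) \<longlongrightarrow> 0) (at_right 0) \<and>
     (\<forall>t>0.
        1/2 * ((L2_norm (u t))\<^sup>2 + (L2_norm (b t))\<^sup>2)
        + min \<nu> \<eta> * (\<integral>s. ((L2_norm (wgrad (u s)))\<^sup>2 + (L2_norm (wgrad (b s)))\<^sup>2) \<partial>lebesgue_on {0..t})
        - (\<integral>s. (L2_inner (u s) (f1 s) + L2_inner (b s) (f2 s)) \<partial>lebesgue_on {0..t})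
        \<le> 1/2 * ((L2_norm u0)\<^sup>2 + (L2_norm b0)\<^sup>2))"

text \<open>A weak solution is, as a function of time, an element of a Bochner space, so its value at a
  single time is only meaningful for a distinguished representative.  By the equations there is
  exactly one representative (up to null sets in space, for every time) that is weakly continuous
  into \<open>L\<^sup>2\<close>; this is what \<open>u(\<cdot>,t)\<close> refers to in pointwise-in-time statements.\<close>

definition weakly_continuous_rep :: "(real \<Rightarrow> field) \<Rightarrow> bool" where
  "weakly_continuous_rep v \<longleftrightarrow>
     (\<forall>t\<ge>0. v t \<in> L2) \<and> (\<forall>w\<in>L2. continuous_on {0..} (\<lambda>t. L2_inner (v t) w))"


section \<open>Fourier transform and spectral quantities\<close>

definition fourier_integral :: "field \<Rightarrow> real^3 \<Rightarrow> complex^3" where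
  "fourier_integral w \<xi> =
     (\<chi> i. \<integral>x. exp (- \<i> * complex_of_real (\<xi> \<bullet> x)) * complex_of_real (w x $ i) \<partial>lborel)"

text \<open>The Fourier transform on \<open>L\<^sup>2\<close> (Plancherel): the limit in \<open>L\<^sup>2\<close> of the Fourier integrals over
  growing balls.\<close>

definition is_fourier :: "field \<Rightarrow> (real^3 \<Rightarrow> complex^3) \<Rightarrow> bool" where
  "is_fourier w v \<longleftrightarrow> v \<in> L2 \<and>
     (\<lambda>n::nat. \<integral>\<^sup>+\<xi>. ennreal ((norm (v \<xi> -
        fourier_integral (\<lambda>x. indicat_real (cball 0 (real n)) x *\<^sub>R w x) \<xi>))\<^sup>2) \<partial>lborel)
     \<longlonglongrightarrow> 0"

definition fourier :: "field \<Rightarrow> real^3 \<Rightarrow> complex^3" where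
  "fourier w = (SOME v. is_fourier w v)"

text \<open>The cube with centre \<open>k\<close> and side length \<open>2 * r\<close>.\<close>

definition cube :: "real^3 \<Rightarrow> real \<Rightarrow> (real^3) set" where
  "cube k r = {\<xi>. \<forall>i. \<bar>\<xi> $ i - k $ i\<bar> \<le> r}"

definition is_cutoff :: "real^3 \<Rightarrow> real \<Rightarrow> (real^3 \<Rightarrow> real) \<Rightarrow> bool" where
  "is_cutoff k \<delta> c \<longleftrightarrow> smooth c \<and> (\<forall>\<xi>. 0 \<le> c \<xi> \<and> c \<xi> \<le> 1) \<and>
     supp c \<subseteq> cube k \<delta> \<and> (\<forall>\<xi>\<in>cube k (\<delta> / 2). c \<xi> = 1)"

text \<open>\<open>e_p\<close> and \<open>h_p\<close> may be infinite a priori, since the Fourier transform of an \<open>L\<^sup>2\<close> field need not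
  be locally in \<open>L\<^sup>p\<close> for \<open>p > 2\<close>; hence they take values in \<^typ>\<open>ennreal\<close>.\<close>

definition ennroot :: "real \<Rightarrow> ennreal \<Rightarrow> ennreal" where
  "ennroot p a = (if a = \<infinity> then \<infinity> else ennreal (enn2real a powr (1 / p)))"

definition e_spec :: "(real^3 \<Rightarrow> real) \<Rightarrow> (real \<Rightarrow> field) \<Rightarrow> (real \<Rightarrow> field) \<Rightarrow> real \<Rightarrow> real \<Rightarrow> ennreal" where
  "e_spec c u b p t = ennroot p
     (\<integral>\<^sup>+\<xi>. ennreal (norm (c \<xi> *\<^sub>R fourier (u t) \<xi>) powr p
                  + norm (c \<xi> *\<^sub>R fourier (b t) \<xi>) powr p) \<partial>lborel)"

definition h_spec :: "(real^3 \<Rightarrow> real) \<Rightarrow> (real \<Rightarrow> field) \<Rightarrow> (real \<Rightarrow> field) \<Rightarrow> real \<Rightarrow> real \<Rightarrow> ennreal" where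
  "h_spec c f1 f2 p t = (SUP s\<in>{0..t}. ennroot p
     (\<integral>\<^sup>+\<xi>. ennreal ((norm (c \<xi> *\<^sub>R fourier (f1 s) \<xi>) powr p
                   + norm (c \<xi> *\<^sub>R fourier (f2 s) \<xi>) powr p) / norm \<xi> powr p) \<partial>lborel))"

end

theory Submission
  imports Defs "HOL-Probability.Probability"
begin

text \<open>Fix \<open>T > 0\<close> and \<open>p\<close>.  Testing the equations with the band-limited field whose symbol is
  \<open>\<chi> |U|\<^bsup>p-2\<^esup> U\<close>, where \<open>U\<close> is \<open>\<chi>\<close> times the Fourier transform of \<open>u(T)\<close>, and
  likewise for \<open>b\<close>, turns the value of the solution into the \<open>p\<close>-th power of \<open>e\<^sub>p(k,T)\<close>.  On the support of the cutoff \<open>|\<xi>| \<ge> |k|/2\<close>, so the heat flow damps at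
  least at the rate \<open>\<mu> = min(\<nu>,\<eta>) |k|\<^sup>2/4\<close>, whereas the quadratic terms, being in divergence form,
  are pointwise at most \<open>|\<xi>| R\<^sup>2\<close>, with \<open>|\<xi>| \<le> 3|k|/2\<close>.  Hoelder's inequality on the cube, of
  volume \<open>(2\<delta>)\<^sup>3\<close>, and the hypothesis on \<open>R\<^sub>1\<close> bound the source by \<open>\<mu> R\<^sub>1/|k|\<close>, so that Duhamel's
  formula makes \<open>e\<^sub>p(k,T)\<close> at most a convex combination of \<open>a\<close> and \<open>R\<^sub>1(T)/|k|\<close>, where
  \<open>e\<^sub>p(k,0) \<le> a < R\<^sub>1(0)/|k|\<close>.  The weight of \<open>a\<close> is \<open>exp(-\<mu> T)\<close> and \<open>a\<close> does not depend on \<open>p\<close>, hence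
  the strict inequality survives the supremum.\<close>

section \<open>Plancherel's inequality\<close>

text \<open>Neither the Fourier transform of \<open>u T\<close> at a single frequency nor the
  finiteness of \<open>e_spec\<close> at a positive time is available beforehand, so no differential
  inequality for e_p can be integrated. Everything is read off by duality at one fixed time T: the
  dual symbol is cut to a set where it is bounded, its moment I is then finite, and Hoelder's
  inequality gives I <= X I^(1/q), hence I^(1/p) <= X with X free of the truncation. A band-limited
  field has no compact support and is therefore not an admissible test field. Its symbol is
  orthogonal to \<xi> and vanishes near 0, so it is the curl of a band-limited potential and a limit
  of curls of truncated potentials. The constants meet exactly: the 3|k|/2 from the derivative times
  the 1/6 of the hypothesis is |k|/4, which is \<mu> divided by min(\<nu>,\<eta>) |k|, and 2^(1/p)
  (2\<delta>)^(3/p) is the L^p norm of a pair of indicators of the cube. For the first of these the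
  quadratic terms must be estimated with constant 1, without losses from summing over
  components.\<close>

lemma (in pair_sigma_finite) integrable_pair_mult:
  fixes f g :: "_ \<Rightarrow> complex"
  assumes f: "integrable M1 f" and g: "integrable M2 g"
  shows "integrable (M1 \<Otimes>\<^sub>M M2) (\<lambda>p. f (fst p) * g (snd p))"
    and "(\<integral>p. f (fst p) * g (snd p) \<partial>(M1 \<Otimes>\<^sub>M M2)) = (\<integral>x. f x \<partial>M1) * (\<integral>y. g y \<partial>M2)"
proof -
  note [measurable] = borel_measurable_integrable[OF f] borel_measurable_integrable[OF g]
  have "(\<integral>\<^sup>+p. ennreal (norm (f (fst p) * g (snd p))) \<partial>(M1 \<Otimes>\<^sub>M M2))
      = (\<integral>\<^sup>+x. \<integral>\<^sup>+y. ennreal (norm (f x)) * ennreal (norm (g y)) \<partial>M2 \<partial>M1)"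
    by (subst M2.nn_integral_fst[symmetric]) (auto simp: norm_mult ennreal_mult)
  also have "\<dots> = (\<integral>\<^sup>+x. ennreal (norm (f x)) \<partial>M1) * (\<integral>\<^sup>+y. ennreal (norm (g y)) \<partial>M2)"
    by (simp add: nn_integral_cmult nn_integral_multc)
  also have "\<dots> < \<infinity>"
    using f g by (simp add: integrable_iff_bounded ennreal_mult_less_top)
  finally show i: "integrable (M1 \<Otimes>\<^sub>M M2) (\<lambda>p. f (fst p) * g (snd p))"
    by (intro integrableI_bounded) auto
  have "(\<integral>x. (\<integral>y. f x * g y \<partial>M2) \<partial>M1) = (\<integral>p. f (fst p) * g (snd p) \<partial>(M1 \<Otimes>\<^sub>M M2))"
    using integral_fst[of "\<lambda>x y. f x * g y"] i by (simp add: case_prod_beta')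
  then show "(\<integral>p. f (fst p) * g (snd p) \<partial>(M1 \<Otimes>\<^sub>M M2)) = (\<integral>x. f x \<partial>M1) * (\<integral>y. g y \<partial>M2)"
    by simp
qed

text \<open>Fubini over the coordinates; it reduces the three-dimensional Gaussian integrals below
  to one variable.\<close>

lemma integral_lborel_prod:
  fixes f :: "'a::euclidean_space \<Rightarrow> real \<Rightarrow> complex"
  assumes f: "\<And>b. b \<in> Basis \<Longrightarrow> integrable lborel (f b)"
  shows "integrable lborel (\<lambda>x::'a. \<Prod>b\<in>Basis. f b (x \<bullet> b))"
    and "(\<integral>x. (\<Prod>b\<in>Basis. f b (x \<bullet> b)) \<partial>(lborel::'a measure)) = (\<Prod>b\<in>Basis. (\<integral>y. f b y \<partial>lborel))"
proof -
  interpret product_sigma_finite "\<lambda>b::'a. lborel :: real measure" ..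
  have m[measurable]: "(\<lambda>g. \<Sum>b\<in>Basis. g b *\<^sub>R b) \<in> measurable (\<Pi>\<^sub>M b\<in>Basis. lborel) (borel :: 'a measure)"
    by measurable
  have fm: "f b \<in> borel_measurable borel" if "b \<in> Basis" for b
    using borel_measurable_integrable[OF f[OF that]] by simp
  have m2: "(\<lambda>x::'a. \<Prod>b\<in>Basis. f b (x \<bullet> b)) \<in> borel_measurable borel"
    by (intro borel_measurable_prod measurable_compose[OF _ fm]) auto
  have eq: "(\<Prod>b\<in>Basis. f b ((\<Sum>b\<in>Basis. g b *\<^sub>R b) \<bullet> b)) = (\<Prod>b\<in>Basis. f b (g b))" for g :: "'a \<Rightarrow> real"
    by (intro prod.cong refl) (simp add: inner_sum_left_Basis)
  show "integrable lborel (\<lambda>x::'a. \<Prod>b\<in>Basis. f b (x \<bullet> b))"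
    by (subst lborel_eq, subst integrable_distr_eq[OF m])
       (use m2 in \<open>auto simp: eq intro!: product_integrable_prod f\<close>)
  show "(\<integral>x. (\<Prod>b\<in>Basis. f b (x \<bullet> b)) \<partial>(lborel::'a measure)) = (\<Prod>b\<in>Basis. (\<integral>y. f b y \<partial>lborel))"
    by (subst lborel_eq, subst integral_distr[OF m])
       (use m2 in \<open>auto simp: eq intro!: product_integral_prod f\<close>)
qed

text \<open>Complex-valued arguments are allowed because \<open>synth_s\<close> applies the same
  integral to conjugated symbols; the components of \<open>fourier_integral\<close> are the case of
  a real argument.\<close>

definition ftrans :: "(real^3 \<Rightarrow> complex) \<Rightarrow> real^3 \<Rightarrow> complex" where
  "ftrans f \<xi> = (\<integral>x. exp (- \<i> * complex_of_real (\<xi> \<bullet> x)) * f x \<partial>lborel)"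

section \<open>Fourier integrals of integrable functions and of Gaussians\<close>

lemma norm_exp_neg_i [simp]: "norm (exp (- (\<i> * complex_of_real y))) = 1"
  by (simp add: norm_exp_eq_Re)

lemma integrable_ftrans:
  assumes "integrable lborel f"
  shows "integrable lborel (\<lambda>x. exp (- \<i> * complex_of_real (\<xi> \<bullet> x)) * f x)"
  by (rule Bochner_Integration.integrable_bound[OF assms]) (use assms in \<open>auto simp: norm_mult\<close>)

lemma ftrans_measurable [measurable]:
  assumes [measurable]: "f \<in> borel_measurable lborel"
  shows "ftrans f \<in> borel_measurable borel"
proof -
  have "(\<lambda>\<xi>. \<integral>x. exp (- \<i> * complex_of_real (\<xi> \<bullet> x)) * f x \<partial>lborel) \<in> borel_measurable borel"
    by (rule lborel.borel_measurable_lebesgue_integral) measurable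
  then show ?thesis by (simp add: ftrans_def[abs_def])
qed

lemma norm_ftrans_le:
  assumes "integrable lborel f"
  shows "norm (ftrans f \<xi>) \<le> (\<integral>x. norm (f x) \<partial>lborel)"
  unfolding ftrans_def
  by (rule order_trans[OF integral_norm_bound]) (simp add: norm_mult)

text \<open>The characteristic function of the standard normal distribution, evaluated at -z/e and
  rescaled by the substitution y -> e y.\<close>

lemma gauss_transform_1d:
  fixes z e :: real
  assumes e: "e > 0"
  shows "integrable lborel (\<lambda>y. exp (- \<i> * complex_of_real (y * z)) * complex_of_real (exp (- (e * y)\<^sup>2 / 2)))"
    and "(\<integral>y. exp (- \<i> * complex_of_real (y * z)) * complex_of_real (exp (- (e * y)\<^sup>2 / 2)) \<partial>lborel)
       = complex_of_real (sqrt (2 * pi) / e * exp (- (z / e)\<^sup>2 / 2))"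
proof -
  let ?h = "\<lambda>w y. exp (- \<i> * complex_of_real (y * w)) * complex_of_real (exp (- y\<^sup>2 / 2))"
  have i0: "integrable lborel (\<lambda>y. std_normal_density y)" by simp
  have i0': "integrable lborel (\<lambda>y. complex_of_real (sqrt (2 * pi) * std_normal_density y))"
    using i0 by simp
  have i1: "integrable lborel (?h w)" for w
    by (rule Bochner_Integration.integrable_bound[OF i0'])
       (auto simp: norm_mult std_normal_density_def real_sqrt_mult)
  have "char std_normal_distribution (- w) = complex_of_real (exp (- w\<^sup>2 / 2))" for w
    by (simp add: char_std_normal_distribution)
  then have "(\<integral>y. std_normal_density y *\<^sub>R iexp (- w * y) \<partial>lborel) = complex_of_real (exp (- w\<^sup>2 / 2))" for w
    unfolding char_def by (subst (asm) integral_density) auto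
  moreover have "sqrt (2*pi) *\<^sub>R (std_normal_density y *\<^sub>R iexp (- w * y)) = ?h w y" for w y
    by (simp add: std_normal_density_def scaleR_conv_of_real real_sqrt_mult mult_ac)
  then have "(\<integral>y. ?h w y \<partial>lborel) = sqrt (2*pi) *\<^sub>R (\<integral>y. std_normal_density y *\<^sub>R iexp (- w * y) \<partial>lborel)" for w
    by (simp only: integral_scaleR_right[symmetric])
  ultimately have v: "(\<integral>y. ?h w y \<partial>lborel) = sqrt (2*pi) *\<^sub>R complex_of_real (exp (- w\<^sup>2 / 2))" for w
    by simp
  let ?k = "\<lambda>y. exp (- \<i> * complex_of_real (y * z)) * complex_of_real (exp (- (e * y)\<^sup>2 / 2))"
  \<comment> \<open>The summand 0 gives the argument the form that the affine substitution rules
    expect.\<close>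
  have k: "?k y = ?h (z / e) (0 + e * y)" for y
    using e by simp
  show "integrable lborel ?k"
    unfolding k using lborel_integrable_real_affine[OF i1[of "z/e"], of e 0] e by simp
  have "(\<integral>y. ?h (z/e) y \<partial>lborel) = \<bar>e\<bar> *\<^sub>R (\<integral>y. ?k y \<partial>lborel)"
    unfolding k using e by (intro lborel_integral_real_affine) simp
  then show "(\<integral>y. ?k y \<partial>lborel) = complex_of_real (sqrt (2 * pi) / e * exp (- (z / e)\<^sup>2 / 2))"
    unfolding v using e by (simp add: scaleR_conv_of_real field_simps)
qed

text \<open>This is exp(-e^2 |\<xi>|^2 / 2), split into coordinates so that
  \<open>integral_lborel_prod\<close> applies.\<close>

definition gauss :: "real \<Rightarrow> real^3 \<Rightarrow> real" where
  "gauss e \<xi> = (\<Prod>b\<in>Basis. exp (- (e * (\<xi> \<bullet> b))\<^sup>2 / 2))"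

text \<open>The Fourier integral of \<open>gauss e\<close>, that is (2 pi)^(3/2) e^(-3) exp(-|z|^2 /
  (2 e^2)): a probability density times (2 pi)^3.\<close>

definition gauss_kernel :: "real \<Rightarrow> real^3 \<Rightarrow> real" where
  "gauss_kernel e z = (\<Prod>b\<in>Basis. sqrt (2 * pi) / e * exp (- ((z \<bullet> b) / e)\<^sup>2 / 2))"

lemma gauss_measurable [measurable]: "gauss e \<in> borel_measurable borel"
  "gauss_kernel e \<in> borel_measurable borel"
  unfolding gauss_def[abs_def] gauss_kernel_def[abs_def] by measurable

lemma gauss_nonneg: "gauss e \<xi> \<ge> 0" "gauss e \<xi> \<le> 1"
  unfolding gauss_def by (auto intro!: prod_nonneg prod_le_1)

lemma gauss_kernel_nonneg: "e > 0 \<Longrightarrow> gauss_kernel e \<xi> \<ge> 0"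
  unfolding gauss_kernel_def by (auto intro!: prod_nonneg)

lemma exp_inner_eq_prod:
  fixes z \<xi> :: "real^3"
  shows "exp (- \<i> * complex_of_real (z \<bullet> \<xi>)) = (\<Prod>b\<in>Basis. exp (- \<i> * complex_of_real ((\<xi> \<bullet> b) * (z \<bullet> b))))"
  by (subst euclidean_inner) (simp add: exp_sum[symmetric] sum_distrib_left sum_negf mult_ac)

lemma ftrans_gauss:
  assumes e: "e > 0"
  shows "integrable lborel (\<lambda>\<xi>. complex_of_real (gauss e \<xi>))"
    and "ftrans (\<lambda>\<xi>. complex_of_real (gauss e \<xi>)) z = complex_of_real (gauss_kernel e z)"
proof -
  have eq: "exp (- \<i> * complex_of_real (z \<bullet> \<xi>)) * complex_of_real (gauss e \<xi>)
     = (\<Prod>b\<in>Basis. exp (- \<i> * complex_of_real ((\<xi> \<bullet> b) * (z \<bullet> b))) * complex_of_real (exp (- (e * (\<xi> \<bullet> b))\<^sup>2 / 2)))" for z \<xi>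
    unfolding exp_inner_eq_prod gauss_def by (simp add: prod.distrib)
  show "ftrans (\<lambda>\<xi>. complex_of_real (gauss e \<xi>)) z = complex_of_real (gauss_kernel e z)"
    unfolding ftrans_def eq gauss_kernel_def
    by (subst integral_lborel_prod(2)) (use gauss_transform_1d[OF e] in \<open>simp_all\<close>)
  have "integrable lborel (\<lambda>\<xi>. exp (- \<i> * complex_of_real ((0::real^3) \<bullet> \<xi>)) * complex_of_real (gauss e \<xi>))"
    unfolding eq by (intro integral_lborel_prod(1) gauss_transform_1d e)
  then show "integrable lborel (\<lambda>\<xi>. complex_of_real (gauss e \<xi>))" by simp
qed

text \<open>The mass does not depend on e; it becomes the constant in Plancherel's
  inequality.\<close>

lemma gauss_kernel_integral:
  assumes e: "e > 0"
  shows "integrable lborel (gauss_kernel e)" "(\<integral>z. gauss_kernel e z \<partial>lborel) = (2 * pi) ^ 3"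
proof -
  let ?g = "\<lambda>y. complex_of_real (sqrt (2 * pi) / e * exp (- (y / e)\<^sup>2 / 2))"
  have i: "integrable lborel ?g" and v: "(\<integral>y. ?g y \<partial>lborel) = complex_of_real (2 * pi)"
  proof -
    \<comment> \<open>Each factor is itself an integrand of \<open>gauss_transform_1d\<close>, with
      1/e for e and frequency 0.\<close>
    have eq: "?g y = complex_of_real (sqrt (2 * pi) / e) * (exp (- \<i> * complex_of_real (y * 0)) * complex_of_real (exp (- (1 / e * y)\<^sup>2 / 2)))" for y
      by simp
    show "integrable lborel ?g"
      unfolding eq by (intro integrable_mult_right gauss_transform_1d) (use e in simp)
    have "(\<integral>y. ?g y \<partial>lborel) = complex_of_real (sqrt (2 * pi) / e) * complex_of_real (sqrt (2 * pi) / (1 / e) * exp (- (0 / (1 / e))\<^sup>2 / 2))"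
      unfolding eq by (subst integral_mult_right_zero, subst gauss_transform_1d) (use e in simp_all)
    also have "\<dots> = complex_of_real (2 * pi)"
      using e unfolding of_real_mult[symmetric] of_real_eq_iff by simp
    finally show "(\<integral>y. ?g y \<partial>lborel) = complex_of_real (2 * pi)" .
  qed
  have eq: "complex_of_real (gauss_kernel e z) = (\<Prod>b\<in>Basis. ?g (z \<bullet> b))" for z
    by (simp add: gauss_kernel_def)
  have "integrable lborel (\<lambda>z. complex_of_real (gauss_kernel e z))"
    unfolding eq by (rule integral_lborel_prod(1)) (rule i)
  then show "integrable lborel (gauss_kernel e)"
    by (simp add: complex_of_real_integrable_eq)
  have "(\<integral>z. complex_of_real (gauss_kernel e z) \<partial>lborel) = (\<Prod>b\<in>(Basis::(real^3) set). complex_of_real (2 * pi))"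
    unfolding eq by (subst integral_lborel_prod(2)[OF i]) (simp_all only: v)
  also have "\<dots> = complex_of_real ((2 * pi) ^ 3)" by simp
  finally show "(\<integral>z. gauss_kernel e z \<partial>lborel) = (2 * pi) ^ 3"
    unfolding integral_complex_of_real of_real_eq_iff .
qed

lemma integral_lborel_shift:
  fixes f :: "real^3 \<Rightarrow> ennreal"
  assumes [measurable]: "f \<in> borel_measurable borel"
  shows "(\<integral>\<^sup>+x. f (x - y) \<partial>lborel) = (\<integral>\<^sup>+x. f x \<partial>lborel)" "(\<integral>\<^sup>+x. f (y - x) \<partial>lborel) = (\<integral>\<^sup>+x. f x \<partial>lborel)"
proof -
  have "(\<integral>\<^sup>+x. f x \<partial>lborel) = (\<integral>\<^sup>+x. f x \<partial>density (distr lborel borel (\<lambda>x. -y + 1 *\<^sub>R x)) (\<lambda>_. \<bar>1::real\<bar>^DIM(real^3)))"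
    using lborel_affine[of 1 "-y"] by simp
  then show "(\<integral>\<^sup>+x. f (x - y) \<partial>lborel) = (\<integral>\<^sup>+x. f x \<partial>lborel)"
    by (simp add: nn_integral_density nn_integral_distr)
  have "(\<integral>\<^sup>+x. f x \<partial>lborel) = (\<integral>\<^sup>+x. f x \<partial>density (distr lborel borel (\<lambda>x. y + (-1) *\<^sub>R x)) (\<lambda>_. \<bar>-1::real\<bar>^DIM(real^3)))"
    using lborel_affine[of "-1" "y"] by simp
  then show "(\<integral>\<^sup>+x. f (y - x) \<partial>lborel) = (\<integral>\<^sup>+x. f x \<partial>lborel)"
    by (simp add: nn_integral_density nn_integral_distr)
qed

text \<open>The weight makes Fubini's theorem applicable; it disappears in the limit \<open>e \<longlongrightarrow> 0\<close>.\<close>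

lemma gauss_weighted_plancherel:
  assumes e: "e > 0" and f: "integrable lborel f"
  shows "(\<integral>\<^sup>+\<xi>. ennreal (gauss e \<xi> * (norm (ftrans f \<xi>))\<^sup>2) \<partial>lborel)
       \<le> ennreal ((2 * pi) ^ 3) * (\<integral>\<^sup>+x. ennreal ((norm (f x))\<^sup>2) \<partial>lborel)"
proof -
  note [measurable] = borel_measurable_integrable[OF f]
  let ?P = "lborel \<Otimes>\<^sub>M lborel :: ((real^3) \<times> (real^3)) measure"
  define q where "q p = f (fst p) * cnj (f (snd p))" for p
  interpret Q: pair_sigma_finite "lborel :: (real^3) measure" ?P
    ..
  have fc: "integrable lborel (\<lambda>y. cnj (f y))" using f by simp
  have qi: "integrable ?P q"
    unfolding q_def by (rule lborel_pair.integrable_pair_mult[OF f fc])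
  have [measurable]: "q \<in> borel_measurable ?P" using qi by auto
  \<comment> \<open>Conjugation reverses the phase of the second factor, so the product of the two
    phases depends only on the difference of the points.\<close>
  have sq: "ftrans f \<xi> * cnj (ftrans f \<xi>) = (\<integral>p. exp (- \<i> * complex_of_real (\<xi> \<bullet> (fst p - snd p))) * q p \<partial>?P)" for \<xi>
  proof -
    have "ftrans f \<xi> * cnj (ftrans f \<xi>) = (\<integral>x. exp (- \<i> * complex_of_real (\<xi> \<bullet> x)) * f x \<partial>lborel) *
      (\<integral>y. cnj (exp (- \<i> * complex_of_real (\<xi> \<bullet> y)) * f y) \<partial>lborel)"
      unfolding ftrans_def by (simp del: complex_cnj_mult)
    also have "\<dots> = (\<integral>p. (exp (- \<i> * complex_of_real (\<xi> \<bullet> fst p)) * f (fst p)) * cnj (exp (- \<i> * complex_of_real (\<xi> \<bullet> snd p)) * f (snd p)) \<partial>?P)"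
      by (rule lborel_pair.integrable_pair_mult(2)[symmetric])
         (intro integrable_ftrans[OF f] integrable_cnj)+
    also have "\<dots> = (\<integral>p. exp (- \<i> * complex_of_real (\<xi> \<bullet> (fst p - snd p))) * q p \<partial>?P)"
      by (intro Bochner_Integration.integral_cong)
         (auto simp: q_def exp_cnj inner_diff_right exp_diff exp_minus field_simps)
    finally show ?thesis .
  qed
  \<comment> \<open>Absolutely integrable in all three variables thanks to the Gaussian. Integrating
    \<xi> out first replaces the phases by \<open>gauss_kernel\<close> at the difference of the two
    points.\<close>
  define H where "H \<xi> p = complex_of_real (gauss e \<xi>) * (exp (- \<i> * complex_of_real (\<xi> \<bullet> (fst p - snd p))) * q p)" for \<xi> p
  have Hi: "integrable (lborel \<Otimes>\<^sub>M ?P) (\<lambda>(\<xi>, p). H \<xi> p)"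
    by (rule Bochner_Integration.integrable_bound[OF Q.integrable_pair_mult(1)[OF ftrans_gauss(1)[OF e] qi]])
       (auto simp: H_def case_prod_beta' norm_mult)
  define J where "J = (\<integral>\<xi>. gauss e \<xi> * (norm (ftrans f \<xi>))\<^sup>2 \<partial>lborel)"
  have Hx: "(\<integral>p. H \<xi> p \<partial>?P) = complex_of_real (gauss e \<xi> * (norm (ftrans f \<xi>))\<^sup>2)" for \<xi>
    unfolding H_def integral_mult_right_zero sq[symmetric] by (simp only: of_real_mult complex_norm_square)
  have Ji: "integrable lborel (\<lambda>\<xi>. gauss e \<xi> * (norm (ftrans f \<xi>))\<^sup>2)"
    using Q.integrable_fst[OF Hi] unfolding Hx by (simp only: complex_of_real_integrable_eq)
  have Hp: "(\<integral>\<xi>. H \<xi> p \<partial>lborel) = complex_of_real (gauss_kernel e (fst p - snd p)) * q p" for p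
  proof -
    have "(\<integral>\<xi>. H \<xi> p \<partial>lborel) = ftrans (\<lambda>\<xi>. complex_of_real (gauss e \<xi>)) (fst p - snd p) * q p"
      unfolding H_def ftrans_def
      by (subst integral_mult_left_zero[symmetric]) (simp add: mult_ac inner_commute)
    then show ?thesis by (simp add: ftrans_gauss e)
  qed
  have "complex_of_real J = (\<integral>\<xi>. (\<integral>p. H \<xi> p \<partial>?P) \<partial>lborel)"
    unfolding J_def Hx integral_complex_of_real ..
  also have "\<dots> = (\<integral>p. (\<integral>\<xi>. H \<xi> p \<partial>lborel) \<partial>?P)"
    by (rule Q.Fubini_integral[symmetric]) (use Hi in simp)
  also have "\<dots> = (\<integral>p. complex_of_real (gauss_kernel e (fst p - snd p)) * q p \<partial>?P)"
    unfolding Hp ..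
  finally have JJ: "complex_of_real J = \<dots>" .
  have J0: "J \<ge> 0" unfolding J_def by (auto intro!: integral_nonneg_AE simp: gauss_nonneg)
  have "ennreal J = ennreal (norm (complex_of_real J))" using J0 by simp
  also have "\<dots> \<le> (\<integral>\<^sup>+p. ennreal (norm (complex_of_real (gauss_kernel e (fst p - snd p)) * q p)) \<partial>?P)"
    unfolding JJ by (rule integral_norm_bound_ennreal) (use Q.integrable_snd[OF Hi] in \<open>simp only: Hp\<close>)
  \<comment> \<open>Schur's test: the product |f(x)| |f(y)| is split by ab <= a^2/2 + b^2/2, and in
    each half the kernel is integrated over the variable that f leaves free.\<close>
  also have "\<dots> \<le> (\<integral>\<^sup>+p. ennreal (gauss_kernel e (fst p - snd p)) * ennreal ((norm (f (fst p)))\<^sup>2 / 2)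
        + ennreal (gauss_kernel e (fst p - snd p)) * ennreal ((norm (f (snd p)))\<^sup>2 / 2) \<partial>?P)"
  proof (intro nn_integral_mono)
    fix p
    have "norm (f (fst p)) * norm (f (snd p)) \<le> (norm (f (fst p)))\<^sup>2 / 2 + (norm (f (snd p)))\<^sup>2 / 2"
      using sum_squares_bound[of "norm (f (fst p))" "norm (f (snd p))"] by simp
    then have "gauss_kernel e (fst p - snd p) * (norm (f (fst p)) * norm (f (snd p))) \<le>
      gauss_kernel e (fst p - snd p) * ((norm (f (fst p)))\<^sup>2 / 2 + (norm (f (snd p)))\<^sup>2 / 2)"
      by (intro mult_left_mono gauss_kernel_nonneg e)
    then show "ennreal (norm (complex_of_real (gauss_kernel e (fst p - snd p)) * q p)) \<le>
      ennreal (gauss_kernel e (fst p - snd p)) * ennreal ((norm (f (fst p)))\<^sup>2 / 2)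
        + ennreal (gauss_kernel e (fst p - snd p)) * ennreal ((norm (f (snd p)))\<^sup>2 / 2)"
      using gauss_kernel_nonneg[OF e]
      by (simp add: q_def norm_mult distrib_left flip: ennreal_mult ennreal_plus)
  qed
  also have "\<dots> = (\<integral>\<^sup>+p. ennreal (gauss_kernel e (fst p - snd p)) * ennreal ((norm (f (fst p)))\<^sup>2 / 2) \<partial>?P)
        + (\<integral>\<^sup>+p. ennreal (gauss_kernel e (fst p - snd p)) * ennreal ((norm (f (snd p)))\<^sup>2 / 2) \<partial>?P)"
    by (rule nn_integral_add) measurable
  also have "(\<integral>\<^sup>+p. ennreal (gauss_kernel e (fst p - snd p)) * ennreal ((norm (f (fst p)))\<^sup>2 / 2) \<partial>?P)
     = (\<integral>\<^sup>+x. ennreal ((norm (f x))\<^sup>2 / 2) * (\<integral>\<^sup>+y. ennreal (gauss_kernel e (x - y)) \<partial>lborel) \<partial>lborel)"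
    by (subst lborel.nn_integral_fst[symmetric]) (auto simp: nn_integral_multc mult_ac)
  also have "(\<integral>\<^sup>+p. ennreal (gauss_kernel e (fst p - snd p)) * ennreal ((norm (f (snd p)))\<^sup>2 / 2) \<partial>?P)
     = (\<integral>\<^sup>+y. ennreal ((norm (f y))\<^sup>2 / 2) * (\<integral>\<^sup>+x. ennreal (gauss_kernel e (x - y)) \<partial>lborel) \<partial>lborel)"
    by (subst lborel_pair.nn_integral_snd[symmetric]) (auto simp: nn_integral_multc mult_ac)
  also have "(\<lambda>x. \<integral>\<^sup>+y. ennreal (gauss_kernel e (x - y)) \<partial>lborel) = (\<lambda>x. ennreal ((2 * pi) ^ 3))"
    using integral_lborel_shift(2)[of "\<lambda>z. ennreal (gauss_kernel e z)"] gauss_kernel_integral[OF e] gauss_kernel_nonneg[OF e]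
    by (simp add: nn_integral_eq_integral)
  also have "(\<lambda>y. \<integral>\<^sup>+x. ennreal (gauss_kernel e (x - y)) \<partial>lborel) = (\<lambda>x. ennreal ((2 * pi) ^ 3))"
    using integral_lborel_shift(1)[of "\<lambda>z. ennreal (gauss_kernel e z)"] gauss_kernel_integral[OF e] gauss_kernel_nonneg[OF e]
    by (simp add: nn_integral_eq_integral)
  also have "(\<integral>\<^sup>+x. ennreal ((norm (f x))\<^sup>2 / 2) * ennreal ((2 * pi) ^ 3) \<partial>lborel) +
     (\<integral>\<^sup>+x. ennreal ((norm (f x))\<^sup>2 / 2) * ennreal ((2 * pi) ^ 3) \<partial>lborel)
     = (\<integral>\<^sup>+x. ennreal ((norm (f x))\<^sup>2) * ennreal ((2 * pi) ^ 3) \<partial>lborel)"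
  proof (subst nn_integral_add[symmetric])
    have "ennreal ((norm (f x))\<^sup>2 / 2) * c + ennreal ((norm (f x))\<^sup>2 / 2) * c = ennreal ((norm (f x))\<^sup>2) * c" for c x
      by (simp add: distrib_right[symmetric] ennreal_plus[symmetric] del: ennreal_plus)
    then show "(\<integral>\<^sup>+x. ennreal ((norm (f x))\<^sup>2 / 2) * ennreal ((2 * pi) ^ 3) + ennreal ((norm (f x))\<^sup>2 / 2) * ennreal ((2 * pi) ^ 3) \<partial>lborel)
     = (\<integral>\<^sup>+x. ennreal ((norm (f x))\<^sup>2) * ennreal ((2 * pi) ^ 3) \<partial>lborel)"
      by (simp only:)
  qed measurable
  also have "\<dots> = ennreal ((2 * pi) ^ 3) * (\<integral>\<^sup>+x. ennreal ((norm (f x))\<^sup>2) \<partial>lborel)"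
    by (simp add: nn_integral_multc mult.commute)
  finally have "ennreal J \<le> \<dots>" .
  moreover have "(\<integral>\<^sup>+\<xi>. ennreal (gauss e \<xi> * (norm (ftrans f \<xi>))\<^sup>2) \<partial>lborel) = ennreal J"
    unfolding J_def using Ji by (intro nn_integral_eq_integral) (auto simp: gauss_nonneg)
  ultimately show ?thesis by simp
qed

text \<open>Fatou's lemma for the weights with e = 1/(n+1), which tend to 1 pointwise.\<close>

lemma plancherel_le:
  assumes f: "integrable lborel f"
  shows "(\<integral>\<^sup>+\<xi>. ennreal ((norm (ftrans f \<xi>))\<^sup>2) \<partial>lborel)
       \<le> ennreal ((2 * pi) ^ 3) * (\<integral>\<^sup>+x. ennreal ((norm (f x))\<^sup>2) \<partial>lborel)"
proof -
  note [measurable] = borel_measurable_integrable[OF f]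
  have lim: "(\<lambda>n. ennreal (gauss (1 / real (Suc n)) \<xi> * (norm (ftrans f \<xi>))\<^sup>2)) \<longlonglongrightarrow> ennreal ((norm (ftrans f \<xi>))\<^sup>2)" for \<xi>
  proof -
    have "(\<lambda>n. gauss (1 / real (Suc n)) \<xi> * (norm (ftrans f \<xi>))\<^sup>2) \<longlonglongrightarrow>
      (\<Prod>b\<in>(Basis::(real^3) set). exp (- (0 * (\<xi> \<bullet> b))\<^sup>2 / 2)) * (norm (ftrans f \<xi>))\<^sup>2"
      unfolding gauss_def by (intro tendsto_intros LIMSEQ_Suc[OF lim_1_over_n]) simp_all
    then show ?thesis by (intro tendsto_ennrealI) simp
  qed
  have "(\<integral>\<^sup>+\<xi>. ennreal ((norm (ftrans f \<xi>))\<^sup>2) \<partial>lborel) =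
     (\<integral>\<^sup>+\<xi>. liminf (\<lambda>n. ennreal (gauss (1 / real (Suc n)) \<xi> * (norm (ftrans f \<xi>))\<^sup>2)) \<partial>lborel)"
    by (intro nn_integral_cong) (use lim_imp_Liminf[OF _ lim] in simp)
  also have "\<dots> \<le> liminf (\<lambda>n. \<integral>\<^sup>+\<xi>. ennreal (gauss (1 / real (Suc n)) \<xi> * (norm (ftrans f \<xi>))\<^sup>2) \<partial>lborel)"
    by (rule nn_integral_liminf) measurable
  also have "\<dots> \<le> liminf (\<lambda>n. ennreal ((2 * pi) ^ 3) * (\<integral>\<^sup>+x. ennreal ((norm (f x))\<^sup>2) \<partial>lborel))"
    by (intro Liminf_mono always_eventually allI gauss_weighted_plancherel f) simp
  also have "\<dots> = ennreal ((2 * pi) ^ 3) * (\<integral>\<^sup>+x. ennreal ((norm (f x))\<^sup>2) \<partial>lborel)"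
    by (simp add: Liminf_const)
  finally show ?thesis .
qed

section \<open>The space \<open>L\<^sup>2\<close> and its Fourier transform\<close>

lemma integrable_dominated:
  fixes f :: "'a \<Rightarrow> real" and g :: "'a \<Rightarrow> 'b::{banach, second_countable_topology}"
  assumes "integrable M f" "\<And>x. norm (g x) \<le> f x" "g \<in> borel_measurable M"
  shows "integrable M g"
  by (rule Bochner_Integration.integrable_bound[OF assms(1,3)]) (use assms(2) in \<open>auto intro: order_trans[OF _ abs_ge_self]\<close>)

lemma L2_iff: "w \<in> L2 \<longleftrightarrow> w \<in> borel_measurable borel \<and> (\<integral>\<^sup>+x. ennreal ((norm (w x))\<^sup>2) \<partial>lborel) < \<infinity>"
  unfolding L2_def by (auto simp: integrable_iff_bounded)

lemma L2_measurable: "w \<in> L2 \<Longrightarrow> w \<in> borel_measurable borel"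
  by (simp add: L2_iff)

lemma L2_integrable: "w \<in> L2 \<Longrightarrow> integrable lborel (\<lambda>x. (norm (w x))\<^sup>2)"
  by (simp add: L2_def)

lemma L2_norm_nonneg [simp]: "L2_norm w \<ge> 0"
  by (simp add: L2_norm_def)

lemma L2_norm_sq: "(L2_norm w)\<^sup>2 = (\<integral>x. (norm (w x))\<^sup>2 \<partial>lborel)"
  by (simp add: L2_norm_def)

lemma ennreal_L2_norm_sq:
  "w \<in> L2 \<Longrightarrow> ennreal ((L2_norm w)\<^sup>2) = (\<integral>\<^sup>+x. ennreal ((norm (w x))\<^sup>2) \<partial>lborel)"
  unfolding L2_norm_sq by (subst nn_integral_eq_integral) (auto simp: L2_integrable)

lemma L2_dominated:
  assumes "v \<in> L2" and [measurable]: "w \<in> borel_measurable borel" and "\<And>x. norm (w x) \<le> norm (v x)"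
  shows "w \<in> L2"
proof -
  have "(\<integral>\<^sup>+x. ennreal ((norm (w x))\<^sup>2) \<partial>lborel) \<le> (\<integral>\<^sup>+x. ennreal ((norm (v x))\<^sup>2) \<partial>lborel)"
    by (intro nn_integral_mono ennreal_leI power_mono assms) simp
  then show ?thesis using assms by (auto simp: L2_iff)
qed

lemma L2_add:
  assumes "v \<in> L2" "w \<in> L2"
  shows "(\<lambda>x. v x + w x) \<in> L2"
proof -
  note [measurable] = assms[THEN L2_measurable]
  have "integrable lborel (\<lambda>x. 2 * ((norm (v x))\<^sup>2 + (norm (w x))\<^sup>2))"
    using assms by (auto simp: L2_integrable)
  moreover have "(norm (v x + w x))\<^sup>2 \<le> 2 * ((norm (v x))\<^sup>2 + (norm (w x))\<^sup>2)" for x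
  proof -
    have "(norm (v x + w x))\<^sup>2 \<le> (norm (v x) + norm (w x))\<^sup>2"
      by (intro power_mono norm_triangle_ineq) simp
    also have "\<dots> \<le> 2 * ((norm (v x))\<^sup>2 + (norm (w x))\<^sup>2)"
      using sum_squares_bound[of "norm (v x)" "norm (w x)"] by (simp add: power2_sum)
    finally show ?thesis .
  qed
  ultimately have "integrable lborel (\<lambda>x. (norm (v x + w x))\<^sup>2)"
    by (rule integrable_dominated[where g="\<lambda>x. (norm (v x + w x))\<^sup>2", simplified]) measurable
  then show ?thesis by (simp add: L2_def)
qed

lemma L2_scaleR: "w \<in> L2 \<Longrightarrow> (\<lambda>x. c *\<^sub>R w x) \<in> L2"
  unfolding L2_def by (auto simp: power_mult_distrib)

lemma L2_uminus: "w \<in> L2 \<Longrightarrow> (\<lambda>x. - w x) \<in> L2"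
  using L2_scaleR[of w "-1"] by simp

lemma L2_diff: "v \<in> L2 \<Longrightarrow> w \<in> L2 \<Longrightarrow> (\<lambda>x. v x - w x) \<in> L2"
  using L2_add[of v "\<lambda>x. - w x"] by (simp add: L2_uminus)

lemma L2_zero [simp]: "(\<lambda>x. 0) \<in> L2"
  by (simp add: L2_def)

lemma L2_sum: "(\<And>i. i \<in> I \<Longrightarrow> v i \<in> L2) \<Longrightarrow> (\<lambda>x. \<Sum>i\<in>I. v i x) \<in> L2"
  by (induction I rule: infinite_finite_induct) (auto intro: L2_add)

lemma L2_norm_mult_integrable:
  assumes "v \<in> L2" "w \<in> L2"
  shows "integrable lborel (\<lambda>x. norm (v x) * norm (w x))"
proof -
  note [measurable] = assms[THEN L2_measurable]
  have "integrable lborel (\<lambda>x. (norm (v x))\<^sup>2 + (norm (w x))\<^sup>2)"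
    using assms by (auto simp: L2_integrable)
  moreover have "norm (v x) * norm (w x) \<le> (norm (v x))\<^sup>2 + (norm (w x))\<^sup>2" for x
    using sum_squares_bound[of "norm (v x)" "norm (w x)"] zero_le_power2[of "norm (v x)"] zero_le_power2[of "norm (w x)"]
    by linarith
  ultimately show ?thesis
    by (rule integrable_dominated[where g="\<lambda>x. norm (v x) * norm (w x)", simplified]) measurable
qed

lemma L2_norm_mult_le:
  assumes "v \<in> L2" "w \<in> L2"
  shows "(\<integral>x. norm (v x) * norm (w x) \<partial>lborel) \<le> L2_norm v * L2_norm w"
proof -
  note [measurable] = assms[THEN L2_measurable]
  have "ennreal ((\<integral>x. norm (v x) * norm (w x) \<partial>lborel)\<^sup>2) = (\<integral>\<^sup>+x. ennreal (norm (v x)) * ennreal (norm (w x)) \<partial>lborel)\<^sup>2"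
    using L2_norm_mult_integrable[OF assms]
    by (simp add: ennreal_mult[symmetric] nn_integral_eq_integral ennreal_power)
  also have "\<dots> \<le> (\<integral>\<^sup>+x. ennreal (norm (v x)) ^ 2 \<partial>lborel) * (\<integral>\<^sup>+x. ennreal (norm (w x)) ^ 2 \<partial>lborel)"
    by (rule Cauchy_Schwarz_nn_integral) auto
  also have "\<dots> = ennreal ((L2_norm v * L2_norm w)\<^sup>2)"
    using assms by (simp add: ennreal_power ennreal_L2_norm_sq power_mult_distrib ennreal_mult)
  finally have "(\<integral>x. norm (v x) * norm (w x) \<partial>lborel)\<^sup>2 \<le> (L2_norm v * L2_norm w)\<^sup>2"
    by (simp add: ennreal_le_iff)
  then show ?thesis by (rule power2_le_imp_le) simp
qed

lemma L2_inner_integrable: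
  assumes "v \<in> L2" "w \<in> L2"
  shows "integrable lborel (\<lambda>x. v x \<bullet> w x)"
proof -
  note [measurable] = assms[THEN L2_measurable]
  show ?thesis
    by (rule Bochner_Integration.integrable_bound[OF L2_norm_mult_integrable[OF assms]])
       (auto simp: Cauchy_Schwarz_ineq2)
qed

lemma L2_inner_le:
  assumes "v \<in> L2" "w \<in> L2"
  shows "\<bar>L2_inner v w\<bar> \<le> L2_norm v * L2_norm w"
proof -
  have "\<bar>L2_inner v w\<bar> \<le> (\<integral>x. norm (v x) * norm (w x) \<partial>lborel)"
    unfolding L2_inner_def
    by (rule integral_abs_bound_integral)
       (auto simp: L2_inner_integrable L2_norm_mult_integrable assms Cauchy_Schwarz_ineq2)
  also have "\<dots> \<le> L2_norm v * L2_norm w" by (rule L2_norm_mult_le[OF assms])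
  finally show ?thesis .
qed

lemma L2_inner_commute: "L2_inner v w = L2_inner w v"
  by (simp add: L2_inner_def inner_commute)

lemma L2_inner_add_left:
  "v \<in> L2 \<Longrightarrow> w \<in> L2 \<Longrightarrow> z \<in> L2 \<Longrightarrow> L2_inner (\<lambda>x. v x + w x) z = L2_inner v z + L2_inner w z"
  by (simp add: L2_inner_def inner_add_left L2_inner_integrable)

lemma L2_inner_diff_left:
  "v \<in> L2 \<Longrightarrow> w \<in> L2 \<Longrightarrow> z \<in> L2 \<Longrightarrow> L2_inner (\<lambda>x. v x - w x) z = L2_inner v z - L2_inner w z"
  by (simp add: L2_inner_def inner_diff_left L2_inner_integrable)

lemma L2_inner_add_right:
  "v \<in> L2 \<Longrightarrow> w \<in> L2 \<Longrightarrow> z \<in> L2 \<Longrightarrow> L2_inner z (\<lambda>x. v x + w x) = L2_inner z v + L2_inner z w"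
  by (simp add: L2_inner_def inner_add_right L2_inner_integrable)

lemma L2_inner_diff_right:
  "v \<in> L2 \<Longrightarrow> w \<in> L2 \<Longrightarrow> z \<in> L2 \<Longrightarrow> L2_inner z (\<lambda>x. v x - w x) = L2_inner z v - L2_inner z w"
  by (simp add: L2_inner_def inner_diff_right L2_inner_integrable)

lemma L2_inner_scaleR_left: "L2_inner (\<lambda>x. c *\<^sub>R v x) z = c * L2_inner v z"
  by (simp add: L2_inner_def)

lemma L2_inner_scaleR_right: "L2_inner z (\<lambda>x. c *\<^sub>R v x) = c * L2_inner z v"
  by (simp add: L2_inner_def)

lemma L2_inner_tendsto:
  assumes "\<And>n. f n \<in> L2" "g \<in> L2" "w \<in> L2" and lim: "((\<lambda>n. L2_norm (\<lambda>x. f n x - g x)) \<longlongrightarrow> 0) F"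
  shows "((\<lambda>n. L2_inner (f n) w) \<longlongrightarrow> L2_inner g w) F"
proof -
  have "\<bar>L2_inner (f n) w - L2_inner g w\<bar> \<le> L2_norm (\<lambda>x. f n x - g x) * L2_norm w" for n
    using L2_inner_le[OF L2_diff[OF assms(1) assms(2)] assms(3)] assms
    by (simp add: L2_inner_diff_left)
  then have "((\<lambda>n. L2_inner (f n) w - L2_inner g w) \<longlongrightarrow> 0) F"
    by (intro Lim_null_comparison[OF _ tendsto_mult_left_zero[OF lim, of "L2_norm w"]] always_eventually) simp
  then show ?thesis by (simp add: LIM_zero_iff)
qed

lemma L2_norm_tendsto_0_iff:
  assumes "\<And>n. f n \<in> L2"
  shows "((\<lambda>n. L2_norm (f n)) \<longlongrightarrow> 0) F \<longleftrightarrow> ((\<lambda>n. \<integral>\<^sup>+x. ennreal ((norm (f n x))\<^sup>2) \<partial>lborel) \<longlongrightarrow> 0) F"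
proof -
  have "((\<lambda>n. \<integral>\<^sup>+x. ennreal ((norm (f n x))\<^sup>2) \<partial>lborel) \<longlongrightarrow> 0) F \<longleftrightarrow> ((\<lambda>n. ennreal ((L2_norm (f n))\<^sup>2)) \<longlongrightarrow> ennreal 0) F"
    using assms by (simp add: ennreal_L2_norm_sq)
  also have "\<dots> \<longleftrightarrow> ((\<lambda>n. (L2_norm (f n))\<^sup>2) \<longlongrightarrow> 0) F"
    by (subst tendsto_ennreal_iff) auto
  also have "\<dots> \<longleftrightarrow> ((\<lambda>n. L2_norm (f n)) \<longlongrightarrow> 0) F"
  proof
    assume "((\<lambda>n. (L2_norm (f n))\<^sup>2) \<longlongrightarrow> 0) F"
    from tendsto_real_sqrt[OF this] show "((\<lambda>n. L2_norm (f n)) \<longlongrightarrow> 0) F" by simp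
  next
    assume "((\<lambda>n. L2_norm (f n)) \<longlongrightarrow> 0) F"
    from tendsto_power[OF this, of 2] show "((\<lambda>n. (L2_norm (f n))\<^sup>2) \<longlongrightarrow> 0) F" by simp
  qed
  finally show ?thesis by simp
qed

lemma L2_component:
  fixes w :: "real^3 \<Rightarrow> 'b::euclidean_space ^ 'n"
  shows "w \<in> L2 \<Longrightarrow> (\<lambda>x. w x $ i) \<in> L2"
proof -
  assume w: "w \<in> L2"
  have "(\<lambda>x. w x $ i) \<in> borel_measurable borel"
    by (rule measurable_compose[OF L2_measurable[OF w]])
       (intro borel_measurable_continuous_onI linear_continuous_on bounded_linear_vec_nth)
  then show ?thesis
    by (rule L2_dominated[OF w]) (rule Finite_Cartesian_Product.norm_nth_le)
qed

lemma norm_axis: "norm (axis i x :: 'b::real_normed_vector ^ 'n) = norm x"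
proof -
  have "(\<Sum>j\<in>UNIV. (norm ((axis i x :: 'b ^ 'n) $ j))\<^sup>2) = (\<Sum>j\<in>UNIV. if j = i then (norm x)\<^sup>2 else 0)"
    by (intro sum.cong) (auto simp: axis_def)
  then show ?thesis by (simp add: norm_vec_def L2_set_def)
qed

text \<open>Vector-valued statements are reduced to components by writing a vector as the sum of
  \<open>axis i\<close> of its entries; each of these embeddings is a bounded linear map.\<close>

lemma bounded_linear_axis: "bounded_linear (\<lambda>x::'b::real_normed_vector. axis i x :: 'b ^ 'n)"
proof (rule bounded_linear_intro[where K=1])
  fix x y :: 'b and r :: real
  show "(axis i (x + y) :: 'b ^ 'n) = axis i x + axis i y" by (simp add: vec_eq_iff axis_def)
  show "(axis i (r *\<^sub>R x) :: 'b ^ 'n) = r *\<^sub>R axis i x" by (simp add: vec_eq_iff axis_def)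
  show "norm (axis i x :: 'b ^ 'n) \<le> norm x * 1" by (simp add: norm_axis)
qed

lemma L2_vec:
  fixes w :: "real^3 \<Rightarrow> 'b::euclidean_space ^ 'n"
  assumes "\<And>i. (\<lambda>x. w x $ i) \<in> L2"
  shows "w \<in> L2"
proof -
  have "(\<lambda>x. \<Sum>i\<in>UNIV. axis i (w x $ i)) \<in> L2"
  proof (rule L2_sum)
    fix i
    have m: "(\<lambda>x. axis i (w x $ i)) \<in> borel_measurable borel"
      by (rule measurable_compose[OF L2_measurable[OF assms]])
         (rule borel_measurable_continuous_onI, rule linear_continuous_on, rule bounded_linear_axis)
    show "(\<lambda>x. axis i (w x $ i)) \<in> L2"
      by (rule L2_dominated[OF assms[of i] m]) (simp add: norm_axis)
  qed
  moreover have "(\<Sum>i\<in>UNIV. axis i (w x $ i)) = w x" for x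
    by (simp add: vec_eq_iff axis_def)
  ultimately show ?thesis by simp
qed

section \<open>Completeness of the space of square-integrable functions\<close>

lemma summable_weighted_squares:
  fixes d :: "nat \<Rightarrow> 'b::banach"
  assumes fin: "(\<Sum>k. ennreal (4^k * (norm (d k))\<^sup>2)) \<noteq> \<infinity>"
  shows "summable d"
proof -
  define S where "S = (\<Sum>k. ennreal (4^k * (norm (d k))\<^sup>2))"
  obtain K where K: "K \<ge> 0" "S = ennreal K"
    using fin unfolding S_def[symmetric] by (cases S) auto
  \<comment> \<open>A single weighted term is at most the whole sum K, and the square root of the
    weight 4^k is 2^k.\<close>
  have "norm (d k) \<le> sqrt K * (1/2)^k" for k
  proof -
    have "(\<Sum>i\<in>{k}. ennreal (4^i * (norm (d i))\<^sup>2)) \<le> S"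
      unfolding S_def by (rule sum_le_suminf) auto
    then have "ennreal (4^k * (norm (d k))\<^sup>2) \<le> ennreal K" by (simp add: K(2))
    then have "4^k * (norm (d k))\<^sup>2 \<le> K" using K(1) by (simp only: ennreal_le_iff)
    moreover have "(2^k * norm (d k))\<^sup>2 = 4^k * (norm (d k))\<^sup>2"
      by (simp add: power_mult_distrib power_mult[symmetric] mult.commute[of k] power_mult[of 2 2])
    ultimately have "2^k * norm (d k) \<le> sqrt K"
      by (metis real_le_rsqrt)
    then have "(1/2)^k * (2^k * norm (d k)) \<le> (1/2)^k * sqrt K" by (rule mult_left_mono) simp
    moreover have "(1/2)^k * (2^k * norm (d k)) = norm (d k)"
      by (simp add: mult.assoc[symmetric] power_mult_distrib[symmetric])
    ultimately show ?thesis by (simp only: mult.commute[of "sqrt K"])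
  qed
  moreover have "summable (\<lambda>k. sqrt K * (1/2)^k)" by (rule summable_mult) (simp add: summable_geometric)
  ultimately show ?thesis
    by (metis summable_comparison_test')
qed

text \<open>Riesz-Fischer. Along a fast subsequence the squared increments integrate to at most
  8^(-k); even with the weight 4^k their total is finite, which gives convergence almost everywhere
  through \<open>summable_weighted_squares\<close>.\<close>

lemma L2_complete:
  fixes f :: "nat \<Rightarrow> real^3 \<Rightarrow> 'b::euclidean_space"
  assumes f: "\<And>n. f n \<in> L2"
    and C: "\<And>e::real. e > 0 \<Longrightarrow> \<exists>N. \<forall>m\<ge>N. \<forall>n\<ge>N. (\<integral>\<^sup>+x. ennreal ((norm (f m x - f n x))\<^sup>2) \<partial>lborel) \<le> ennreal e"
  shows "\<exists>g\<in>L2. (\<lambda>n. \<integral>\<^sup>+x. ennreal ((norm (g x - f n x))\<^sup>2) \<partial>lborel) \<longlonglongrightarrow> 0"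
proof -
  note [measurable] = f[THEN L2_measurable]
  have "\<forall>k. \<exists>N. \<forall>m\<ge>N. \<forall>n\<ge>N. (\<integral>\<^sup>+x. ennreal ((norm (f m x - f n x))\<^sup>2) \<partial>lborel) \<le> ennreal ((1/8)^k)"
    by (intro allI C) simp
  then obtain r where r: "\<And>k m n. m \<ge> r k \<Longrightarrow> n \<ge> r k \<Longrightarrow> (\<integral>\<^sup>+x. ennreal ((norm (f m x - f n x))\<^sup>2) \<partial>lborel) \<le> ennreal ((1/8)^k)"
    by metis
  \<comment> \<open>Summing the thresholds and adding k makes s strictly increasing and keeps
    \<open>s k\<close> above \<open>r k\<close>.\<close>
  define s where "s k = (\<Sum>i\<le>k. r i) + k" for k
  have s_r: "r k \<le> s k" for k
    unfolding s_def by (rule trans_le_add1, rule member_le_sum) auto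
  have s_mono: "strict_mono s" unfolding s_def by (rule strict_monoI_Suc) auto
  define d where "d k x = f (s (Suc k)) x - f (s k) x" for k x
  have [measurable]: "d k \<in> borel_measurable borel" for k unfolding d_def by measurable
  have "(\<integral>\<^sup>+x. (\<Sum>k. ennreal (4^k * (norm (d k x))\<^sup>2)) \<partial>lborel) = (\<Sum>k. \<integral>\<^sup>+x. ennreal (4^k * (norm (d k x))\<^sup>2) \<partial>lborel)"
    by (rule nn_integral_suminf) measurable
  also have "\<dots> \<le> (\<Sum>k. ennreal ((1/2)^k))"
  proof (intro suminf_le summableI)
    fix k
    have "s (Suc k) \<ge> r k" using s_r[of k] strict_monoD[OF s_mono, of k "Suc k"] by simp
    then have "(\<integral>\<^sup>+x. ennreal ((norm (d k x))\<^sup>2) \<partial>lborel) \<le> ennreal ((1/8)^k)"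
      unfolding d_def using s_r by (intro r)
    then have "ennreal (4^k) * (\<integral>\<^sup>+x. ennreal ((norm (d k x))\<^sup>2) \<partial>lborel) \<le> ennreal (4^k) * ennreal ((1/8)^k)"
      by (rule mult_left_mono) simp
    also have "\<dots> = ennreal ((1/2)^k)"
      by (simp add: ennreal_mult[symmetric] power_mult_distrib[symmetric])
    finally show "(\<integral>\<^sup>+x. ennreal (4^k * (norm (d k x))\<^sup>2) \<partial>lborel) \<le> ennreal ((1/2)^k)"
      by (simp add: ennreal_mult nn_integral_cmult)
  qed
  also have "\<dots> < \<infinity>"
    by (subst suminf_ennreal2) (auto simp: summable_geometric)
  finally have fin: "(\<integral>\<^sup>+x. (\<Sum>k. ennreal (4^k * (norm (d k x))\<^sup>2)) \<partial>lborel) < \<infinity>" .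
  have "AE x in lborel. (\<Sum>k. ennreal (4^k * (norm (d k x))\<^sup>2)) \<noteq> \<infinity>"
    by (rule nn_integral_PInf_AE[OF _ less_imp_neq[OF fin]]) measurable
  then have conv: "AE x in lborel. convergent (\<lambda>k. f (s k) x)"
  proof (rule eventually_mono)
    fix x assume "(\<Sum>k. ennreal (4^k * (norm (d k x))\<^sup>2)) \<noteq> \<infinity>"
    then have "summable (\<lambda>k. d k x)" by (rule summable_weighted_squares)
    then have "convergent (\<lambda>n. \<Sum>k<n. d k x)" by (simp add: summable_iff_convergent)
    then have "convergent (\<lambda>n. (\<Sum>k<n. d k x) + f (s 0) x)" by (intro convergent_add convergent_const)
    moreover have "(\<Sum>k<n. d k x) + f (s 0) x = f (s n) x" for n
      unfolding d_def by (subst sum_lessThan_telescope) simp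
    ultimately show "convergent (\<lambda>k. f (s k) x)" by simp
  qed
  \<comment> \<open>Where the subsequence diverges the value is arbitrary; this happens on a null
    set, and \<open>lim\<close> keeps g measurable.\<close>
  define g where "g x = lim (\<lambda>k. f (s k) x)" for x
  have [measurable]: "g \<in> borel_measurable borel" unfolding g_def by measurable
  \<comment> \<open>Fatou's lemma in the first index carries the Cauchy estimate over to the
    limit.\<close>
  have fat: "(\<integral>\<^sup>+x. ennreal ((norm (g x - f n x))\<^sup>2) \<partial>lborel) \<le> ennreal e"
    if N: "\<And>m. m \<ge> N \<Longrightarrow> (\<integral>\<^sup>+x. ennreal ((norm (f m x - f n x))\<^sup>2) \<partial>lborel) \<le> ennreal e" for n N e
  proof -
    have "(\<integral>\<^sup>+x. ennreal ((norm (g x - f n x))\<^sup>2) \<partial>lborel) = (\<integral>\<^sup>+x. liminf (\<lambda>k. ennreal ((norm (f (s k) x - f n x))\<^sup>2)) \<partial>lborel)"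
    proof (intro nn_integral_cong_AE, use conv in eventually_elim)
      fix x assume "convergent (\<lambda>k. f (s k) x)"
      then have "(\<lambda>k. f (s k) x) \<longlonglongrightarrow> g x" unfolding g_def by (simp add: convergent_LIMSEQ_iff)
      then have "(\<lambda>k. ennreal ((norm (f (s k) x - f n x))\<^sup>2)) \<longlonglongrightarrow> ennreal ((norm (g x - f n x))\<^sup>2)"
        by (intro tendsto_intros)
      then show "ennreal ((norm (g x - f n x))\<^sup>2) = liminf (\<lambda>k. ennreal ((norm (f (s k) x - f n x))\<^sup>2))"
        by (intro lim_imp_Liminf[symmetric]) auto
    qed
    also have "\<dots> \<le> liminf (\<lambda>k. \<integral>\<^sup>+x. ennreal ((norm (f (s k) x - f n x))\<^sup>2) \<partial>lborel)"
      by (rule nn_integral_liminf) measurable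
    also have "\<dots> \<le> liminf (\<lambda>k. ennreal e)"
      by (intro Liminf_mono eventually_sequentiallyI[of N] N) (use seq_suble[OF s_mono] in \<open>auto intro: order_trans\<close>)
    finally show ?thesis by (simp add: Liminf_const)
  qed
  obtain N0 where N0: "\<forall>m\<ge>N0. \<forall>n\<ge>N0. (\<integral>\<^sup>+x. ennreal ((norm (f m x - f n x))\<^sup>2) \<partial>lborel) \<le> ennreal 1"
    using C[of 1] by auto
  have "(\<integral>\<^sup>+x. ennreal ((norm (g x - f N0 x))\<^sup>2) \<partial>lborel) \<le> ennreal 1"
    by (rule fat[of N0]) (use N0 in auto)
  then have "(\<lambda>x. g x - f N0 x) \<in> L2"
    by (auto simp: L2_iff intro: le_less_trans)
  from L2_add[OF this f[of N0]] have gL: "g \<in> L2" by simp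
  have "(\<lambda>n. \<integral>\<^sup>+x. ennreal ((norm (g x - f n x))\<^sup>2) \<partial>lborel) \<longlonglongrightarrow> 0"
  proof (rule order_tendstoI)
    fix a :: ennreal assume "0 < a"
    then obtain b where b: "0 < b" "b < a" using dense by blast
    then obtain e where e: "b = ennreal e" "0 \<le> e" by (cases b) auto
    with b(1) have "0 < e" by simp
    from C[OF this] obtain N where N: "\<forall>m\<ge>N. \<forall>n\<ge>N. (\<integral>\<^sup>+x. ennreal ((norm (f m x - f n x))\<^sup>2) \<partial>lborel) \<le> b"
      unfolding e by blast
    show "\<forall>\<^sub>F n in sequentially. (\<integral>\<^sup>+x. ennreal ((norm (g x - f n x))\<^sup>2) \<partial>lborel) < a"
    proof (rule eventually_sequentiallyI[of N])
      fix n assume n: "n \<ge> N"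
      have "(\<integral>\<^sup>+x. ennreal ((norm (g x - f n x))\<^sup>2) \<partial>lborel) \<le> ennreal e"
        by (rule fat[of N]) (use N n e in blast)
      then show "(\<integral>\<^sup>+x. ennreal ((norm (g x - f n x))\<^sup>2) \<partial>lborel) < a"
        using b(2) e(1) by (auto dest: le_less_trans)
    qed
  qed simp
  with gL show ?thesis by blast
qed

section \<open>Bounded symbols of compact support\<close>

definition band :: "(real^3 \<Rightarrow> 'b::euclidean_space) \<Rightarrow> bool" where
  "band a \<longleftrightarrow> a \<in> borel_measurable borel \<and> (\<exists>C. \<forall>\<xi>. norm (a \<xi>) \<le> C) \<and> (\<exists>r. \<forall>\<xi>. norm \<xi> > r \<longrightarrow> a \<xi> = 0)"

lemma bandI:
  assumes "a \<in> borel_measurable borel" "\<And>\<xi>. norm (a \<xi>) \<le> C" "\<And>\<xi>. norm \<xi> > r \<Longrightarrow> a \<xi> = 0"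
  shows "band a"
  unfolding band_def using assms by blast

lemma bandE:
  assumes "band a"
  obtains C r where "C \<ge> 0" "r > 0" "\<And>\<xi>. norm (a \<xi>) \<le> C" "\<And>\<xi>. norm \<xi> > r \<Longrightarrow> a \<xi> = 0"
    "\<And>\<xi>. norm (a \<xi>) \<le> C * indicator (cball 0 r) \<xi>"
proof -
  obtain C r where *: "\<And>\<xi>. norm (a \<xi>) \<le> C" "\<And>\<xi>. norm \<xi> > r \<Longrightarrow> a \<xi> = 0"
    using assms unfolding band_def by blast
  show ?thesis
    by (rule that[of "max C 0" "max r 1"]) (use * in \<open>auto simp: indicator_def intro: order_trans[OF _ max.cobounded1] split: if_splits\<close>)
qed

lemma band_measurable: "band a \<Longrightarrow> a \<in> borel_measurable borel"
  by (simp add: band_def)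

lemma integrable_indicator_cball: "integrable lborel (\<lambda>x::real^3. C * indicator (cball 0 r) x :: real)"
proof -
  have "integrable lborel (indicator (cball (0::real^3) r) :: _ \<Rightarrow> real)"
    by (rule integrable_real_indicator) (use emeasure_bounded_finite[OF bounded_cball, of "0::real^3" r] in auto)
  then show ?thesis by simp
qed

lemma band_integrable:
  assumes "band a" shows "integrable lborel a"
proof -
  from bandE[OF assms] obtain C r where "\<And>\<xi>. norm (a \<xi>) \<le> C * indicator (cball 0 r) \<xi>" by metis
  then show ?thesis
    by (rule integrable_dominated[OF integrable_indicator_cball]) (simp add: band_measurable assms)
qed

lemma band_zero [simp]: "band (\<lambda>_. 0)"
  by (rule bandI[of _ 0 0]) auto

text \<open>A continuous h is bounded on the ball that carries a. In particular multiplication by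
  polynomials in \<xi>, hence differentiation of the synthesized field, stays inside the
  class.\<close>

lemma band_mult:
  fixes h :: "real^3 \<Rightarrow> real"
  assumes a: "band a" and h: "continuous_on UNIV h"
  shows "band (\<lambda>\<xi>. h \<xi> *\<^sub>R a \<xi>)"
proof -
  from bandE[OF a] obtain C r where Cr: "C \<ge> 0" "\<And>\<xi>. norm (a \<xi>) \<le> C" "\<And>\<xi>. norm \<xi> > r \<Longrightarrow> a \<xi> = 0" by metis
  have "compact (h ` cball 0 r)"
    by (intro compact_continuous_image continuous_on_subset[OF h]) auto
  then have "bounded (h ` cball 0 r)" by (rule compact_imp_bounded)
  then obtain B where "\<forall>y\<in>h ` cball 0 r. norm y \<le> B"
    unfolding bounded_iff by blast
  then have B: "\<And>\<xi>. norm \<xi> \<le> r \<Longrightarrow> norm (h \<xi>) \<le> B" by auto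
  have [measurable]: "h \<in> borel_measurable borel" using h by (rule borel_measurable_continuous_onI)
  have [measurable]: "a \<in> borel_measurable borel" using a by (rule band_measurable)
  have "norm (h \<xi> *\<^sub>R a \<xi>) \<le> max B 0 * C" for \<xi>
  proof (cases "norm \<xi> \<le> r")
    case True
    then show ?thesis using B[OF True] Cr(2)[of \<xi>] Cr(1) by (auto intro!: mult_mono)
  qed (use Cr in auto)
  then show ?thesis
    by (rule bandI[rotated, where r=r]) (use Cr(3) in auto)
qed

lemma band_linear:
  assumes a: "band a" and L: "bounded_linear L"
  shows "band (\<lambda>\<xi>. L (a \<xi>))"
proof -
  interpret L: bounded_linear L by fact
  from bandE[OF a] obtain C r where Cr: "C \<ge> 0" "\<And>\<xi>. norm (a \<xi>) \<le> C" "\<And>\<xi>. norm \<xi> > r \<Longrightarrow> a \<xi> = 0" by metis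
  obtain K where K: "K \<ge> 0" "\<And>x. norm (L x) \<le> norm x * K" using L.nonneg_bounded by blast
  have "norm (L (a \<xi>)) \<le> C * K" for \<xi>
    using K(2)[of "a \<xi>"] mult_right_mono[OF Cr(2) K(1), of \<xi>] by linarith
  moreover have "(\<lambda>\<xi>. L (a \<xi>)) \<in> borel_measurable borel"
    by (rule measurable_compose[OF band_measurable[OF a]])
       (intro borel_measurable_continuous_onI linear_continuous_on L)
  ultimately show ?thesis
    by (intro bandI[where C="C * K" and r=r]) (use Cr(3) in \<open>auto simp: L.zero\<close>)
qed

lemma band_add:
  assumes a: "band a" and b: "band b"
  shows "band (\<lambda>\<xi>. a \<xi> + b \<xi>)"
proof -
  from bandE[OF a] obtain C r where Cr: "\<And>\<xi>. norm (a \<xi>) \<le> C" "\<And>\<xi>. norm \<xi> > r \<Longrightarrow> a \<xi> = 0" by metis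
  from bandE[OF b] obtain D s where Ds: "\<And>\<xi>. norm (b \<xi>) \<le> D" "\<And>\<xi>. norm \<xi> > s \<Longrightarrow> b \<xi> = 0" by metis
  have "norm (a \<xi> + b \<xi>) \<le> C + D" for \<xi> using Cr(1)[of \<xi>] Ds(1)[of \<xi>] by norm
  moreover have "(\<lambda>\<xi>. a \<xi> + b \<xi>) \<in> borel_measurable borel"
    using a b by (intro borel_measurable_add band_measurable)
  ultimately show ?thesis
    by (intro bandI[where C="C + D" and r="max r s"]) (use Cr(2) Ds(2) in auto)
qed

lemma band_L2:
  assumes a: "band a" shows "a \<in> L2"
proof -
  from bandE[OF a] obtain C r where Cr: "C \<ge> 0" "\<And>\<xi>. norm (a \<xi>) \<le> C * indicator (cball 0 r) \<xi>" by metis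
  have [measurable]: "a \<in> borel_measurable borel" using a by (rule band_measurable)
  have "(norm (a \<xi>))\<^sup>2 \<le> C\<^sup>2 * indicator (cball 0 r) \<xi>" for \<xi>
    using power_mono[OF Cr(2)[of \<xi>], of 2] by (auto simp: indicator_def split: if_splits)
  then have "integrable lborel (\<lambda>\<xi>. (norm (a \<xi>))\<^sup>2)"
    by (intro integrable_dominated[OF integrable_indicator_cball]) auto
  then show ?thesis by (simp add: L2_def)
qed

lemma band_component:
  fixes a :: "real^3 \<Rightarrow> 'b::euclidean_space ^ 'n"
  shows "band a \<Longrightarrow> band (\<lambda>\<xi>. a \<xi> $ i)"
  by (rule band_linear) (auto intro: bounded_linear_vec_nth)

lemma band_vec:
  fixes a :: "real^3 \<Rightarrow> 'b::euclidean_space ^ 'n"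
  assumes "\<And>i. band (\<lambda>\<xi>. a \<xi> $ i)"
  shows "band a"
proof -
  have "band (\<lambda>\<xi>. \<Sum>i\<in>I. axis i (a \<xi> $ i))" for I :: "'n set"
    by (induction I rule: infinite_finite_induct)
       (auto intro!: band_add band_linear[OF assms bounded_linear_axis])
  moreover have "(\<Sum>i\<in>UNIV. axis i (a \<xi> $ i)) = a \<xi>" for \<xi>
    by (simp add: vec_eq_iff axis_def)
  ultimately show ?thesis by (metis (no_types, lifting) ext)
qed

text \<open>\<open>synth\<close> is the adjoint of \<open>fourier\<close> for the real inner products, hence the absence of a factor
  \<open>(2\<pi>)\<^sup>-\<^sup>3\<close>.  It maps bounded symbols of compact support to smooth fields.\<close>

definition synth_s :: "(real^3 \<Rightarrow> complex) \<Rightarrow> real^3 \<Rightarrow> real" where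
  "synth_s a x = Re (ftrans (\<lambda>\<xi>. cnj (a \<xi>)) x)"

definition synth :: "(real^3 \<Rightarrow> complex^3) \<Rightarrow> field" where
  "synth a x = (\<chi> i. synth_s (\<lambda>\<xi>. a \<xi> $ i) x)"

lemma band_cnj: "band a \<Longrightarrow> band (\<lambda>\<xi>. cnj (a \<xi>))"
  using band_linear[OF _ bounded_linear_cnj] .

lemma ftrans_band_L2:
  assumes a: "band a"
  shows "ftrans a \<in> L2"
proof -
  note [measurable] = band_measurable[OF a]
  have "(\<integral>\<^sup>+\<xi>. ennreal ((norm (ftrans a \<xi>))\<^sup>2) \<partial>lborel) \<le> ennreal ((2 * pi) ^ 3) * (\<integral>\<^sup>+x. ennreal ((norm (a x))\<^sup>2) \<partial>lborel)"
    by (rule plancherel_le) (rule band_integrable[OF a])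
  also have "\<dots> < \<infinity>"
    using band_L2[OF a] by (simp add: L2_iff ennreal_mult_less_top del: ennreal_numeral)
  finally show ?thesis by (simp add: L2_iff)
qed

lemma synth_s_L2: "band a \<Longrightarrow> synth_s a \<in> L2"
proof -
  assume a: "band a"
  note [measurable] = band_measurable[OF band_cnj[OF a]]
  show ?thesis
    by (rule L2_dominated[OF ftrans_band_L2[OF band_cnj[OF a]]])
       (auto simp: synth_s_def[abs_def] abs_Re_le_cmod)
qed

lemma synth_L2: "band a \<Longrightarrow> synth a \<in> L2"
  by (rule L2_vec) (simp add: synth_def synth_s_L2 band_component)

text \<open>Fubini's theorem for a kernel that is symmetric in its two variables.\<close>

lemma ftrans_swap:
  assumes f: "integrable lborel f" and a: "integrable lborel a"
  shows "(\<integral>\<xi>. ftrans f \<xi> * a \<xi> \<partial>lborel) = (\<integral>x. f x * ftrans a x \<partial>lborel)"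
proof -
  note [measurable] = borel_measurable_integrable[OF f] borel_measurable_integrable[OF a]
  define H where "H \<xi> x = exp (- \<i> * complex_of_real (\<xi> \<bullet> x)) * f x * a \<xi>" for \<xi> x
  have Hi: "integrable (lborel \<Otimes>\<^sub>M lborel) (\<lambda>(\<xi>, x). H \<xi> x)"
    by (rule Bochner_Integration.integrable_bound[OF lborel_pair.integrable_pair_mult(1)[OF a f]])
       (auto simp: H_def case_prod_beta' norm_mult)
  have "(\<integral>\<xi>. ftrans f \<xi> * a \<xi> \<partial>lborel) = (\<integral>\<xi>. (\<integral>x. H \<xi> x \<partial>lborel) \<partial>lborel)"
    unfolding ftrans_def H_def by simp
  also have "\<dots> = (\<integral>x. (\<integral>\<xi>. H \<xi> x \<partial>lborel) \<partial>lborel)"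
    by (rule lborel_pair.Fubini_integral[symmetric]) (rule Hi)
  also have "\<dots> = (\<integral>x. f x * ftrans a x \<partial>lborel)"
    unfolding ftrans_def H_def
    by (subst integral_mult_right_zero[symmetric]) (simp add: mult_ac inner_commute)
  finally show ?thesis .
qed

lemma norm_vec_sq: "(norm (v :: 'b::real_normed_vector ^ 'n))\<^sup>2 = (\<Sum>i\<in>UNIV. (norm (v $ i))\<^sup>2)"
  by (simp add: norm_vec_def L2_set_def sum_nonneg)

lemma fourier_integral_nth: "fourier_integral w \<xi> $ i = ftrans (\<lambda>x. complex_of_real (w x $ i)) \<xi>"
  by (simp add: fourier_integral_def ftrans_def)

lemma fourier_integral_measurable:
  assumes w: "w \<in> borel_measurable borel"
  shows "fourier_integral w \<in> borel_measurable borel"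
proof -
  have [measurable]: "(\<lambda>x. w x $ i) \<in> borel_measurable borel" for i
    by (rule measurable_compose[OF w])
       (intro borel_measurable_continuous_onI linear_continuous_on bounded_linear_vec_nth)
  have "(\<lambda>\<xi>. \<Sum>i\<in>UNIV. axis i (ftrans (\<lambda>x. complex_of_real (w x $ i)) \<xi>) :: complex^3) \<in> borel_measurable borel"
    by (intro borel_measurable_sum measurable_compose[OF ftrans_measurable])
       (auto intro!: borel_measurable_continuous_onI linear_continuous_on bounded_linear_axis)
  moreover have "(\<Sum>i\<in>UNIV. axis i (ftrans (\<lambda>x. complex_of_real (w x $ i)) \<xi>)) = fourier_integral w \<xi>" for \<xi>
    by (simp add: vec_eq_iff axis_def fourier_integral_nth)
  ultimately show ?thesis by (simp add: fun_eq_iff)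
qed

lemma plancherel_vec_le:
  assumes w: "integrable lborel w"
  shows "(\<integral>\<^sup>+\<xi>. ennreal ((norm (fourier_integral w \<xi>))\<^sup>2) \<partial>lborel)
      \<le> ennreal ((2 * pi) ^ 3) * (\<integral>\<^sup>+x. ennreal ((norm (w x))\<^sup>2) \<partial>lborel)"
proof -
  have wi: "integrable lborel (\<lambda>x. complex_of_real (w x $ i))" for i
    by (intro integrable_of_real integrable_bounded_linear[OF bounded_linear_vec_nth] w)
  note [measurable] = borel_measurable_integrable[OF wi]
  have wm[measurable]: "(\<lambda>x. w x $ i) \<in> borel_measurable borel" for i
    using integrable_bounded_linear[OF bounded_linear_vec_nth w, of i] by auto
  have "(\<integral>\<^sup>+\<xi>. ennreal ((norm (fourier_integral w \<xi>))\<^sup>2) \<partial>lborel)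
      = (\<Sum>i\<in>UNIV. \<integral>\<^sup>+\<xi>. ennreal ((norm (ftrans (\<lambda>x. complex_of_real (w x $ i)) \<xi>))\<^sup>2) \<partial>lborel)"
    by (subst nn_integral_sum[symmetric]) (auto simp: norm_vec_sq fourier_integral_nth sum_ennreal)
  also have "\<dots> \<le> (\<Sum>i\<in>UNIV. ennreal ((2 * pi) ^ 3) * (\<integral>\<^sup>+x. ennreal ((norm (complex_of_real (w x $ i)))\<^sup>2) \<partial>lborel))"
    by (intro sum_mono plancherel_le wi)
  also have "\<dots> = ennreal ((2 * pi) ^ 3) * (\<integral>\<^sup>+x. ennreal ((norm (w x))\<^sup>2) \<partial>lborel)"
    by (subst sum_distrib_left[symmetric], subst nn_integral_sum[symmetric])
       (auto simp: norm_vec_sq sum_ennreal)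
  finally show ?thesis .
qed

section \<open>Extension of the Fourier transform to square-integrable fields\<close>

lemma L2_truncate_integrable:
  assumes w: "w \<in> L2"
  shows "integrable lborel (\<lambda>x. indicat_real (cball 0 r) x *\<^sub>R w x)"
proof -
  note [measurable] = L2_measurable[OF w]
  have "integrable lborel (\<lambda>x. 1 * indicator (cball 0 r) x + (norm (w x))\<^sup>2)"
    by (intro Bochner_Integration.integrable_add integrable_indicator_cball L2_integrable w)
  then show ?thesis
  proof (rule integrable_dominated)
    fix x
    have "norm (w x) \<le> 1 + (norm (w x))\<^sup>2"
      using sum_squares_bound[of "1" "norm (w x)"] norm_ge_zero[of "w x"] zero_le_power2[of "norm (w x)"]
      unfolding power_one mult_1_right by linarith
    then show "norm (indicat_real (cball 0 r) x *\<^sub>R w x) \<le> 1 * indicator (cball 0 r) x + (norm (w x))\<^sup>2"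
      by (simp add: indicator_def)
    have "(\<lambda>x. indicat_real (cball 0 r) x *\<^sub>R w x) \<in> borel_measurable borel"
      by (intro borel_measurable_scaleR borel_measurable_indicator L2_measurable w) auto
    then show "(\<lambda>x. indicat_real (cball 0 r) x *\<^sub>R w x) \<in> borel_measurable lborel" by simp
  qed
qed

lemma L2_truncate_tendsto:
  fixes w :: "real^3 \<Rightarrow> 'b::euclidean_space"
  assumes w: "w \<in> L2"
  shows "(\<lambda>n. \<integral>\<^sup>+x. ennreal ((norm (w x - indicat_real (cball 0 (real n)) x *\<^sub>R w x))\<^sup>2) \<partial>lborel) \<longlonglongrightarrow> 0"
proof -
  note [measurable] = L2_measurable[OF w]
  have "(\<lambda>n. \<integral>\<^sup>+x. ennreal ((norm (w x - indicat_real (cball 0 (real n)) x *\<^sub>R w x))\<^sup>2) \<partial>lborel) \<longlonglongrightarrow> (\<integral>\<^sup>+x. 0 \<partial>(lborel::(real^3) measure))"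
  proof (rule nn_integral_dominated_convergence[where w="\<lambda>x. ennreal ((norm (w x))\<^sup>2)"])
    show "(\<integral>\<^sup>+x. ennreal ((norm (w x))\<^sup>2) \<partial>lborel) < \<infinity>" using w by (simp add: L2_iff)
    show "AE x in lborel. (\<lambda>n. ennreal ((norm (w x - indicat_real (cball 0 (real n)) x *\<^sub>R w x))\<^sup>2)) \<longlonglongrightarrow> 0"
    proof (rule AE_I2)
      fix x :: "real^3"
      obtain N where "norm x \<le> real N" using real_arch_simple by blast
      then have "\<forall>\<^sub>F n in sequentially. ennreal ((norm (w x - indicat_real (cball 0 (real n)) x *\<^sub>R w x))\<^sup>2) = 0"
        by (intro eventually_sequentiallyI[of N]) (auto simp: indicator_def)
      then show "(\<lambda>n. ennreal ((norm (w x - indicat_real (cball 0 (real n)) x *\<^sub>R w x))\<^sup>2)) \<longlonglongrightarrow> 0"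
        by (rule tendsto_eventually)
    qed
  qed (auto simp: indicator_def intro!: AE_I2 ennreal_leI)
  then show ?thesis by simp
qed

lemma L2_truncate: "w \<in> L2 \<Longrightarrow> (\<lambda>x. indicat_real (cball 0 r) x *\<^sub>R w x) \<in> L2"
  by (rule L2_dominated, assumption) (auto simp: indicator_def dest: L2_measurable)

text \<open>Justifies the choice in \<open>fourier\<close>: the truncations to balls are Cauchy in
  L2, Plancherel's inequality transfers this to their Fourier integrals, and
  \<open>L2_complete\<close> supplies the limit.\<close>

lemma is_fourier_fourier:
  assumes w: "w \<in> L2"
  shows "is_fourier w (fourier w)"
proof -
  note wm[measurable] = L2_measurable[OF w]
  define wn where "wn n = (\<lambda>x. indicat_real (cball 0 (real n)) x *\<^sub>R w x)" for n :: nat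
  have wn_int: "integrable lborel (wn n)" for n unfolding wn_def by (rule L2_truncate_integrable[OF w])
  have wn_L2: "wn n \<in> L2" for n unfolding wn_def by (rule L2_truncate[OF w])
  have [measurable]: "wn n \<in> borel_measurable borel" for n by (rule L2_measurable[OF wn_L2])
  define F where "F n = fourier_integral (wn n)" for n
  have F_L2: "F n \<in> L2" for n
  proof -
    have "(\<integral>\<^sup>+\<xi>. ennreal ((norm (F n \<xi>))\<^sup>2) \<partial>lborel) \<le> ennreal ((2 * pi) ^ 3) * (\<integral>\<^sup>+x. ennreal ((norm (wn n x))\<^sup>2) \<partial>lborel)"
      unfolding F_def by (rule plancherel_vec_le[OF wn_int])
    also have "\<dots> < \<infinity>"
      using wn_L2[of n] by (simp add: L2_iff ennreal_mult_less_top)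
    finally show ?thesis by (simp add: L2_iff F_def fourier_integral_measurable)
  qed
  have diff: "F m \<xi> - F n \<xi> = fourier_integral (\<lambda>x. wn m x - wn n x) \<xi>" for m n \<xi>
  proof -
    have i: "integrable lborel (\<lambda>x. complex_of_real (wn n x $ i))" for i n
      by (intro integrable_of_real integrable_bounded_linear[OF bounded_linear_vec_nth] wn_int)
    show ?thesis
      unfolding F_def vec_eq_iff vector_minus_component fourier_integral_nth ftrans_def
      by (intro allI, subst Bochner_Integration.integral_diff[symmetric])
         (use i in \<open>auto simp: algebra_simps simp del: mult_minus_left intro!: integrable_ftrans[simplified]\<close>)
  qed
  define tail where "tail n = (\<integral>\<^sup>+x. ennreal ((norm (w x - wn n x))\<^sup>2) \<partial>lborel)" for n
  have tail0: "tail \<longlonglongrightarrow> 0" unfolding tail_def[abs_def] wn_def by (rule L2_truncate_tendsto[OF w])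
  have cauchy: "\<exists>N. \<forall>m\<ge>N. \<forall>n\<ge>N. (\<integral>\<^sup>+\<xi>. ennreal ((norm (F m \<xi> - F n \<xi>))\<^sup>2) \<partial>lborel) \<le> ennreal e" if e: "e > 0" for e :: real
  proof -
    \<comment> \<open>The tolerance is divided by the constant of
      \<open>plancherel_vec_le\<close>.\<close>
    have "0 < ennreal (e / (2 * pi)^3)" using e by simp
    then obtain N where N: "tail N < ennreal (e / (2 * pi)^3)"
      using order_tendstoD(2)[OF tail0] unfolding eventually_sequentially by (metis order_refl)
    have "(\<integral>\<^sup>+\<xi>. ennreal ((norm (F m \<xi> - F n \<xi>))\<^sup>2) \<partial>lborel) \<le> ennreal e" if mn: "m \<ge> N" "n \<ge> N" for m n
    proof -
      have "(\<integral>\<^sup>+\<xi>. ennreal ((norm (F m \<xi> - F n \<xi>))\<^sup>2) \<partial>lborel) \<le> ennreal ((2 * pi) ^ 3) * (\<integral>\<^sup>+x. ennreal ((norm (wn m x - wn n x))\<^sup>2) \<partial>lborel)"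
        unfolding diff by (rule plancherel_vec_le) (intro Bochner_Integration.integrable_diff wn_int)
      \<comment> \<open>For m, n >= N the two truncations differ only outside the ball of radius N,
        and there by at most w in norm.\<close>
      also have "\<dots> \<le> ennreal ((2 * pi) ^ 3) * tail N"
        unfolding tail_def
        by (intro mult_left_mono nn_integral_mono ennreal_leI power_mono)
           (use mn in \<open>auto simp: wn_def indicator_def\<close>)
      also have "\<dots> \<le> ennreal ((2 * pi) ^ 3) * ennreal (e / (2 * pi)^3)"
        using N by (intro mult_left_mono) auto
      also have "\<dots> = ennreal e" using e by (simp add: ennreal_mult[symmetric] del: power_mult_distrib)
      finally show ?thesis .
    qed
    then show ?thesis by blast
  qed
  from L2_complete[OF F_L2 cauchy] obtain g where "g \<in> L2" "(\<lambda>n. \<integral>\<^sup>+x. ennreal ((norm (g x - F n x))\<^sup>2) \<partial>lborel) \<longlonglongrightarrow> 0"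
    by blast
  then have "is_fourier w g" unfolding is_fourier_def F_def wn_def by simp
  then show ?thesis unfolding fourier_def using someI[of "is_fourier w" g] by simp
qed

lemma fourier_L2: "w \<in> L2 \<Longrightarrow> fourier w \<in> L2"
  using is_fourier_fourier by (simp add: is_fourier_def)

lemma inner_complex_cnj: "(x::complex) \<bullet> y = Re (x * cnj y)"
  by (simp add: inner_complex_def)

text \<open>\<open>ftrans_swap\<close> in each component. The real inner product of complex numbers
  is the real part of a product with a conjugate, which is why \<open>synth_s\<close> conjugates its
  symbol and takes a real part.\<close>

lemma pairing_integrable:
  assumes w: "integrable lborel w" and a: "band a"
  shows "L2_inner (fourier_integral w) a = L2_inner w (synth a)"
proof -
  have wi: "integrable lborel (\<lambda>x. complex_of_real (w x $ i))" for i
    by (intro integrable_of_real integrable_bounded_linear[OF bounded_linear_vec_nth] w)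
  have ai: "integrable lborel (\<lambda>\<xi>. cnj (a \<xi> $ i))" for i
    by (intro band_integrable band_cnj band_component a)
  note [measurable] = borel_measurable_integrable[OF wi] borel_measurable_integrable[OF ai]
  have i1: "integrable lborel (\<lambda>\<xi>. ftrans (\<lambda>x. complex_of_real (w x $ i)) \<xi> * cnj (a \<xi> $ i))" for i
  proof (rule integrable_dominated)
    show "integrable lborel (\<lambda>\<xi>. (\<integral>x. norm (complex_of_real (w x $ i)) \<partial>lborel) * norm (cnj (a \<xi> $ i)))"
      using ai by (intro integrable_mult_right integrable_norm)
  qed (auto simp: norm_mult intro!: mult_right_mono norm_ftrans_le[OF wi, simplified])
  have i2: "integrable lborel (\<lambda>x. complex_of_real (w x $ i) * ftrans (\<lambda>\<xi>. cnj (a \<xi> $ i)) x)" for i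
  proof (rule integrable_dominated)
    show "integrable lborel (\<lambda>x. norm (complex_of_real (w x $ i)) * (\<integral>\<xi>. norm (cnj (a \<xi> $ i)) \<partial>lborel))"
      using wi by (intro integrable_mult_left integrable_norm)
  qed (auto simp: norm_mult intro!: mult_left_mono norm_ftrans_le[OF ai, simplified])
  have "L2_inner (fourier_integral w) a = (\<Sum>i\<in>UNIV. \<integral>\<xi>. Re (ftrans (\<lambda>x. complex_of_real (w x $ i)) \<xi> * cnj (a \<xi> $ i)) \<partial>lborel)"
    unfolding L2_inner_def inner_vec_def inner_complex_cnj fourier_integral_nth
    by (rule Bochner_Integration.integral_sum) (rule integrable_Re[OF i1])
  also have "\<dots> = (\<Sum>i\<in>UNIV. Re (\<integral>\<xi>. ftrans (\<lambda>x. complex_of_real (w x $ i)) \<xi> * cnj (a \<xi> $ i) \<partial>lborel))"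
    by (simp only: integral_Re[OF i1])
  also have "\<dots> = (\<Sum>i\<in>UNIV. Re (\<integral>x. complex_of_real (w x $ i) * ftrans (\<lambda>\<xi>. cnj (a \<xi> $ i)) x \<partial>lborel))"
    by (simp only: ftrans_swap[OF wi ai])
  also have "\<dots> = (\<Sum>i\<in>UNIV. \<integral>x. Re (complex_of_real (w x $ i) * ftrans (\<lambda>\<xi>. cnj (a \<xi> $ i)) x) \<partial>lborel)"
    by (simp only: integral_Re[OF i2])
  also have "\<dots> = L2_inner w (synth a)"
    unfolding L2_inner_def inner_vec_def
    by (subst Bochner_Integration.integral_sum[symmetric])
       (use integrable_Re[OF i2] in \<open>simp_all add: synth_def synth_s_def\<close>)
  finally show ?thesis .
qed

text \<open>This duality takes the place of Fourier inversion: a pairing of the transform with a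
  symbol becomes a pairing of the field itself with a smooth field. Both sides are continuous in w
  for the L2 norm, so truncation reduces the claim to \<open>pairing_integrable\<close>.\<close>

lemma L2_inner_fourier:
  assumes w: "w \<in> L2" and a: "band a"
  shows "L2_inner (fourier w) a = L2_inner w (synth a)"
proof -
  define wn where "wn n = (\<lambda>x. indicat_real (cball 0 (real n)) x *\<^sub>R w x)" for n :: nat
  have wn_int: "integrable lborel (wn n)" for n unfolding wn_def by (rule L2_truncate_integrable[OF w])
  have wn_L2: "wn n \<in> L2" for n unfolding wn_def by (rule L2_truncate[OF w])
  have F_L2: "fourier_integral (wn n) \<in> L2" for n
  proof -
    have "(\<integral>\<^sup>+\<xi>. ennreal ((norm (fourier_integral (wn n) \<xi>))\<^sup>2) \<partial>lborel) \<le> ennreal ((2 * pi) ^ 3) * (\<integral>\<^sup>+x. ennreal ((norm (wn n x))\<^sup>2) \<partial>lborel)"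
      by (rule plancherel_vec_le[OF wn_int])
    also have "\<dots> < \<infinity>"
      using wn_L2[of n] by (simp add: L2_iff ennreal_mult_less_top)
    finally show ?thesis by (simp add: L2_iff fourier_integral_measurable L2_measurable[OF wn_L2])
  qed
  have "(\<lambda>n. \<integral>\<^sup>+\<xi>. ennreal ((norm (fourier_integral (wn n) \<xi> - fourier w \<xi>))\<^sup>2) \<partial>lborel) \<longlonglongrightarrow> 0"
    using is_fourier_fourier[OF w] unfolding is_fourier_def wn_def by (simp add: norm_minus_commute)
  then have "(\<lambda>n. L2_norm (\<lambda>\<xi>. fourier_integral (wn n) \<xi> - fourier w \<xi>)) \<longlonglongrightarrow> 0"
    by (subst L2_norm_tendsto_0_iff) (intro L2_diff F_L2 fourier_L2 w)
  from L2_inner_tendsto[OF F_L2 fourier_L2[OF w] band_L2[OF a] this]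
  have 1: "(\<lambda>n. L2_inner (fourier_integral (wn n)) a) \<longlonglongrightarrow> L2_inner (fourier w) a" .
  have "(\<lambda>n. \<integral>\<^sup>+\<xi>. ennreal ((norm (wn n \<xi> - w \<xi>))\<^sup>2) \<partial>lborel) \<longlonglongrightarrow> 0"
    using L2_truncate_tendsto[OF w] by (simp add: norm_minus_commute wn_def)
  then have "(\<lambda>n. L2_norm (\<lambda>\<xi>. wn n \<xi> - w \<xi>)) \<longlonglongrightarrow> 0"
    by (subst L2_norm_tendsto_0_iff) (intro L2_diff wn_L2 w)
  from L2_inner_tendsto[OF wn_L2 w synth_L2[OF a] this]
  have 2: "(\<lambda>n. L2_inner (wn n) (synth a)) \<longlonglongrightarrow> L2_inner w (synth a)" .
  show ?thesis
    using LIMSEQ_unique[OF 1] 2 pairing_integrable[OF wn_int a] by simp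
qed

section \<open>Smooth functions and weak gradients\<close>

lemma Basis_real3: "(Basis :: (real^3) set) = range (\<lambda>j. axis j 1)"
  by (auto simp: Basis_vec_def)

lemma pderivative_eqI: "(f has_derivative D) (at x) \<Longrightarrow> pderivative j f x = D (axis j 1)"
  unfolding pderivative_def using frechet_derivative_at by metis

text \<open>The basis vectors are the coordinate axes, so the recursion of \<open>Ck\<close> runs
  over \<open>pderivative\<close>.\<close>

lemma Ck_Suc3: "Ck (Suc n) (f :: real^3 \<Rightarrow> 'b::real_normed_vector) \<longleftrightarrow>
    (\<forall>x. f differentiable (at x)) \<and> (\<forall>j. Ck n (pderivative j f))"
  by (simp add: Basis_real3 pderivative_def[abs_def])

lemma Ck_SucD: "Ck (Suc n) f \<Longrightarrow> Ck n f"
proof (induction n arbitrary: f)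
  case 0
  then show ?case
    by (auto simp: continuous_on_eq_continuous_at intro: differentiable_imp_continuous_within)
next
  case (Suc n)
  then show ?case by (metis Ck.simps(2))
qed

lemma smooth_differentiable: "smooth f \<Longrightarrow> f differentiable (at x)"
  using Ck.simps(2)[of 0 f] by (simp add: smooth_def del: Ck.simps)

lemma smooth_continuous: "smooth f \<Longrightarrow> continuous_on UNIV f"
  using Ck.simps(1)[of f] by (simp add: smooth_def del: Ck.simps)

lemma smooth_pderivative: "smooth (f :: real^3 \<Rightarrow> 'b::real_normed_vector) \<Longrightarrow> smooth (pderivative j f)"
  by (simp add: smooth_def) (metis Ck_Suc3)

lemma smooth_measurable: "smooth (f :: 'a::euclidean_space \<Rightarrow> 'b::real_normed_vector) \<Longrightarrow> f \<in> borel_measurable borel"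
  by (intro borel_measurable_continuous_onI smooth_continuous)

section \<open>Calculus of partial derivatives\<close>

lemma pderivative_add:
  "f differentiable (at x) \<Longrightarrow> g differentiable (at x) \<Longrightarrow>
    pderivative j (\<lambda>x. f x + g x) x = pderivative j f x + pderivative j g x"
  by (subst pderivative_eqI[OF has_derivative_add]) (auto simp: frechet_derivative_works pderivative_def)

lemma pderivative_diff:
  "f differentiable (at x) \<Longrightarrow> g differentiable (at x) \<Longrightarrow>
    pderivative j (\<lambda>x. f x - g x) x = pderivative j f x - pderivative j g x"
  by (subst pderivative_eqI[OF has_derivative_diff]) (auto simp: frechet_derivative_works pderivative_def)

lemma pderivative_mult:
  fixes f g :: "real^3 \<Rightarrow> real"
  shows "f differentiable (at x) \<Longrightarrow> g differentiable (at x) \<Longrightarrow>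
    pderivative j (\<lambda>x. f x * g x) x = pderivative j f x * g x + f x * pderivative j g x"
  by (subst pderivative_eqI[OF has_derivative_mult]) (auto simp: frechet_derivative_works pderivative_def)

lemma pderivative_linear:
  "bounded_linear L \<Longrightarrow> f differentiable (at x) \<Longrightarrow> pderivative j (\<lambda>x. L (f x)) x = L (pderivative j f x)"
  by (subst pderivative_eqI[OF bounded_linear.has_derivative]) (auto simp: frechet_derivative_works pderivative_def)

lemma pderivative_cmult:
  fixes f :: "real^3 \<Rightarrow> real"
  shows "f differentiable (at x) \<Longrightarrow> pderivative j (\<lambda>x. c * f x) x = c * pderivative j f x"
  by (rule pderivative_linear[OF bounded_linear_mult_right])

lemma pderivative_const [simp]: "pderivative j (\<lambda>x. c) x = 0"
  by (subst pderivative_eqI[OF has_derivative_const]) simp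

lemma Ck_const: "Ck n (\<lambda>x::real^3. c)"
proof (induction n arbitrary: c)
  case (Suc n)
  have "pderivative j (\<lambda>x. c) = (\<lambda>x. 0)" for j by (rule ext) simp
  then show ?case unfolding Ck_Suc3 using Suc by simp
qed simp

lemma Ck_add: "Ck n f \<Longrightarrow> Ck n g \<Longrightarrow> Ck n (\<lambda>x::real^3. f x + g x)"
proof (induction n arbitrary: f g)
  case 0 then show ?case by (auto intro: continuous_intros)
next
  case (Suc n)
  then have "pderivative j (\<lambda>x. f x + g x) = (\<lambda>x. pderivative j f x + pderivative j g x)" for j
    by (intro ext pderivative_add) (auto simp: Ck_Suc3)
  with Suc show ?case unfolding Ck_Suc3 by auto
qed

lemma Ck_linear:
  assumes L: "bounded_linear L"
  shows "Ck n f \<Longrightarrow> Ck n (\<lambda>x::real^3. L (f x))"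
proof (induction n arbitrary: f)
  case 0 then show ?case by (auto intro: bounded_linear.continuous_on[OF L])
next
  case (Suc n)
  then have "pderivative j (\<lambda>x. L (f x)) = (\<lambda>x. L (pderivative j f x))" for j
    by (intro ext pderivative_linear L) (auto simp: Ck_Suc3)
  moreover have "(\<lambda>x. L (f x)) differentiable (at x)" for x
  proof -
    from Suc.prems obtain D where "(f has_derivative D) (at x)" unfolding Ck_Suc3 differentiable_def by blast
    from bounded_linear.has_derivative[OF L this] show ?thesis unfolding differentiable_def by blast
  qed
  ultimately show ?case using Suc unfolding Ck_Suc3 by simp
qed

lemma Ck_mult:
  fixes f g :: "real^3 \<Rightarrow> real"
  shows "Ck n f \<Longrightarrow> Ck n g \<Longrightarrow> Ck n (\<lambda>x. f x * g x)"
proof (induction n arbitrary: f g)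
  case 0 then show ?case by (auto intro: continuous_intros)
next
  case (Suc n)
  then have "pderivative j (\<lambda>x. f x * g x) = (\<lambda>x. pderivative j f x * g x + f x * pderivative j g x)" for j
    by (intro ext pderivative_mult) (auto simp: Ck_Suc3)
  moreover have "Ck n f" "Ck n g" using Suc.prems by (blast intro: Ck_SucD)+
  ultimately show ?case using Suc unfolding Ck_Suc3 by (auto intro!: Ck_add)
qed

lemma smooth_const [simp]: "smooth (\<lambda>x::real^3. c)" by (simp add: smooth_def Ck_const)
lemma smooth_add: "smooth f \<Longrightarrow> smooth g \<Longrightarrow> smooth (\<lambda>x::real^3. f x + g x)" by (simp add: smooth_def Ck_add)
lemma smooth_linear: "bounded_linear L \<Longrightarrow> smooth f \<Longrightarrow> smooth (\<lambda>x::real^3. L (f x))" by (simp add: smooth_def Ck_linear)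
lemma smooth_mult: "smooth f \<Longrightarrow> smooth g \<Longrightarrow> smooth (\<lambda>x::real^3. f x * g x :: real)" by (simp add: smooth_def Ck_mult)
lemma smooth_sum: "(\<And>i. i \<in> I \<Longrightarrow> smooth (f i)) \<Longrightarrow> smooth (\<lambda>x::real^3. \<Sum>i\<in>I. f i x)"
  by (induction I rule: infinite_finite_induct) (auto intro: smooth_add)

lemma sum_axis: "(\<Sum>i\<in>UNIV. axis i (v $ i)) = (v :: 'b::real_normed_vector ^ 'n)"
  by (simp add: vec_eq_iff axis_def)

lemma smooth_vec:
  fixes f :: "real^3 \<Rightarrow> 'b::real_normed_vector ^ 'n"
  assumes "\<And>i. smooth (\<lambda>x. f x $ i)"
  shows "smooth f"
proof -
  have "smooth (\<lambda>x. \<Sum>i\<in>UNIV. axis i (f x $ i))"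
    by (intro smooth_sum smooth_linear[OF bounded_linear_axis] assms)
  then show ?thesis by (simp add: sum_axis)
qed

lemma smooth_component: "smooth f \<Longrightarrow> smooth (\<lambda>x::real^3. f x $ i)"
  by (rule smooth_linear[OF bounded_linear_vec_nth])

lemma pderivative_component: "smooth f \<Longrightarrow> pderivative j f x $ i = pderivative j (\<lambda>x. f x $ i) x"
  by (rule pderivative_linear[OF bounded_linear_vec_nth, symmetric]) (rule smooth_differentiable)

section \<open>Test functions\<close>

lemma compact_supp_iff: "compact (supp f) \<longleftrightarrow> bounded {x. f x \<noteq> 0}"
  for f :: "'a::euclidean_space \<Rightarrow> 'b::zero"
  by (auto simp: supp_def)

lemma test_funI: "smooth f \<Longrightarrow> bounded {x. f x \<noteq> 0} \<Longrightarrow> f \<in> test_fun"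
  by (simp add: test_fun_def compact_supp_iff)

lemma test_funD: "f \<in> test_fun \<Longrightarrow> smooth f" "f \<in> test_fun \<Longrightarrow> bounded {x. f x \<noteq> 0}"
  by (simp_all add: test_fun_def compact_supp_iff)

lemma pderivative_eq_0:
  assumes "open U" "x \<in> U" "\<And>y. y \<in> U \<Longrightarrow> f y = 0"
  shows "pderivative j f x = 0"
proof -
  have "(f has_derivative (\<lambda>_. 0)) (at x)"
    by (rule has_derivative_transform_within_open[OF has_derivative_const assms(1,2)]) (simp add: assms(3))
  then show ?thesis by (simp add: pderivative_eqI)
qed

text \<open>Agreement on a neighbourhood is the point: it is why truncated and untruncated fields
  are compared on balls later.\<close>

lemma pderivative_cong_open:
  assumes "open U" "x \<in> U" "\<And>y. y \<in> U \<Longrightarrow> f y = g y" "g differentiable (at x)"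
  shows "pderivative j f x = pderivative j g x"
proof -
  have "(g has_derivative frechet_derivative g (at x)) (at x)"
    using assms(4) by (simp add: frechet_derivative_works)
  then have "(f has_derivative frechet_derivative g (at x)) (at x)"
    by (rule has_derivative_transform_within_open[OF _ assms(1,2)]) (simp add: assms(3))
  then show ?thesis by (simp add: pderivative_eqI) (simp add: pderivative_def)
qed

lemma test_fun_pderivative:
  fixes f :: "real^3 \<Rightarrow> 'b::real_normed_vector"
  assumes "f \<in> test_fun"
  shows "pderivative j f \<in> test_fun"
proof (rule test_funI)
  show "smooth (pderivative j f)" by (intro smooth_pderivative test_funD assms)
  have "{x. pderivative j f x \<noteq> 0} \<subseteq> supp f"
  proof (rule ccontr)
    assume "\<not> ?thesis"
    then obtain x where x: "pderivative j f x \<noteq> 0" "x \<in> - supp f" by auto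
    have "pderivative j f x = 0"
      by (rule pderivative_eq_0[OF _ x(2)]) (use closure_subset[of "{x. f x \<noteq> 0}"] in \<open>auto simp: supp_def\<close>)
    with x show False by simp
  qed
  then show "bounded {x. pderivative j f x \<noteq> 0}"
    using assms by (auto simp: test_fun_def intro: bounded_subset compact_imp_bounded)
qed

lemma test_fun_bounded_continuous:
  fixes f :: "real^3 \<Rightarrow> 'b::euclidean_space"
  assumes c: "continuous_on UNIV f" and b: "bounded {x. f x \<noteq> 0}"
  shows "band f"
proof -
  have "compact (supp f)" using b by (simp add: compact_supp_iff)
  then have "bounded (f ` supp f)"
    by (intro compact_imp_bounded compact_continuous_image continuous_on_subset[OF c]) auto
  then obtain B where B: "\<And>x. x \<in> supp f \<Longrightarrow> norm (f x) \<le> B" unfolding bounded_iff by auto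
  obtain r where r: "\<And>x. f x \<noteq> 0 \<Longrightarrow> norm x \<le> r" using b unfolding bounded_iff by auto
  have "norm (f x) \<le> max B 0" for x
    using B[of x] closure_subset[of "{x. f x \<noteq> 0}"] by (cases "f x = 0") (auto simp: supp_def)
  then show ?thesis
    by (rule bandI[rotated, where r=r]) (use r c in \<open>fastforce intro: borel_measurable_continuous_onI\<close>)+
qed

lemma test_fun_band: "f \<in> test_fun \<Longrightarrow> band (f :: real^3 \<Rightarrow> 'b::euclidean_space)"
  by (intro test_fun_bounded_continuous smooth_continuous test_funD)

lemma test_fun_mult:
  fixes f g :: "real^3 \<Rightarrow> real"
  assumes "f \<in> test_fun" "smooth g"
  shows "(\<lambda>x. f x * g x) \<in> test_fun"
proof (rule test_funI)
  show "smooth (\<lambda>x. f x * g x)" by (intro smooth_mult test_funD assms)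
  show "bounded {x. f x * g x \<noteq> 0}"
    by (rule bounded_subset[OF test_funD(2)[OF assms(1)]]) auto
qed

lemma test_fun_component: "f \<in> test_fun \<Longrightarrow> (\<lambda>x::real^3. f x $ i) \<in> test_fun"
proof (rule test_funI)
  assume f: "f \<in> test_fun"
  show "smooth (\<lambda>x. f x $ i)" using f by (intro smooth_component test_funD)
  show "bounded {x. f x $ i \<noteq> 0}"
    by (rule bounded_subset[OF test_funD(2)[OF f]]) auto
qed

lemma test_fun_vec:
  fixes f :: "real^3 \<Rightarrow> 'b::real_normed_vector ^ 'n"
  assumes "\<And>i. (\<lambda>x. f x $ i) \<in> test_fun"
  shows "f \<in> test_fun"
proof (rule test_funI)
  show "smooth f" by (intro smooth_vec test_funD assms)
  have "{x. f x \<noteq> 0} \<subseteq> (\<Union>i\<in>UNIV. {x. f x $ i \<noteq> 0})" by (auto simp: vec_eq_iff)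
  moreover have "bounded (\<Union>i\<in>UNIV. {x. f x $ i \<noteq> 0})"
    by (rule bounded_UN) (auto intro: test_funD assms)
  ultimately show "bounded {x. f x \<noteq> 0}" by (rule bounded_subset[rotated])
qed

lemma test_fun_add: "f \<in> test_fun \<Longrightarrow> g \<in> test_fun \<Longrightarrow> (\<lambda>x::real^3. f x + g x) \<in> test_fun"
proof (rule test_funI)
  assume fg: "f \<in> test_fun" "g \<in> test_fun"
  show "smooth (\<lambda>x. f x + g x)" using fg by (intro smooth_add test_funD)
  have "bounded ({x. f x \<noteq> 0} \<union> {x. g x \<noteq> 0})" using fg by (simp add: test_funD(2))
  then show "bounded {x. f x + g x \<noteq> 0}" by (rule bounded_subset) auto
qed

lemma test_fun_linear: "bounded_linear L \<Longrightarrow> f \<in> test_fun \<Longrightarrow> (\<lambda>x::real^3. L (f x)) \<in> test_fun"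
proof (rule test_funI)
  assume L: "bounded_linear L" and f: "f \<in> test_fun"
  show "smooth (\<lambda>x. L (f x))" by (rule smooth_linear[OF L test_funD(1)[OF f]])
  show "bounded {x. L (f x) \<noteq> 0}"
    by (rule bounded_subset[OF test_funD(2)[OF f]]) (auto simp: linear_0[OF bounded_linear.linear[OF L]])
qed

section \<open>Mean values, symmetry of second derivatives, integration by parts\<close>

lemma line_derivative:
  fixes f :: "real^3 \<Rightarrow> real"
  assumes "f differentiable (at (x + s *\<^sub>R axis j 1))"
  shows "((\<lambda>t. f (x + t *\<^sub>R axis j 1)) has_real_derivative pderivative j f (x + s *\<^sub>R axis j 1)) (at s)"
proof -
  have "(f has_derivative frechet_derivative f (at (x + s *\<^sub>R axis j 1))) (at (x + s *\<^sub>R axis j 1))"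
    using assms by (simp add: frechet_derivative_works)
  then have "((\<lambda>t. f (x + t *\<^sub>R axis j 1)) has_derivative (\<lambda>h. frechet_derivative f (at (x + s *\<^sub>R axis j 1)) (h *\<^sub>R axis j 1))) (at s)"
    by (rule has_derivative_compose[rotated]) (auto intro!: derivative_eq_intros)
  moreover have "frechet_derivative f (at (x + s *\<^sub>R axis j 1)) (h *\<^sub>R axis j 1) = h * pderivative j f (x + s *\<^sub>R axis j 1)" for h
    using linear_cmul[OF linear_frechet_derivative[OF assms], of h "axis j 1"] by (simp add: pderivative_def)
  ultimately show ?thesis by (simp add: has_field_derivative_def mult_commute_abs)
qed

lemma pderivative_MVT:
  fixes f :: "real^3 \<Rightarrow> real"
  assumes f: "\<And>x. f differentiable (at x)" and h: "h > 0"
  shows "\<exists>t. 0 < t \<and> t < h \<and> f (x + h *\<^sub>R axis j 1) - f x = h * pderivative j f (x + t *\<^sub>R axis j 1)"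
proof -
  have "\<exists>z>0. z < h \<and> f (x + h *\<^sub>R axis j 1) - f (x + 0 *\<^sub>R axis j 1) = (h - 0) * pderivative j f (x + z *\<^sub>R axis j 1)"
    by (rule MVT2[OF h]) (rule line_derivative[OF f])
  then show ?thesis by auto
qed

text \<open>Schwarz's theorem from the second difference quotient, which is symmetric in i and j;
  two mean value theorems write it as either mixed derivative at a nearby point. It is used for div
  curl = 0.\<close>

lemma pderivative_commute:
  fixes f :: "real^3 \<Rightarrow> real"
  assumes f: "Ck 2 f"
  shows "pderivative i (pderivative j f) x = pderivative j (pderivative i f) x"
proof -
  have d0: "f differentiable (at y)" and d1: "pderivative j f differentiable (at y)"
    and c: "continuous_on UNIV (pderivative i (pderivative j f))" for i j y
    using f by (auto simp: numeral_2_eq_2 Ck_Suc3 simp del: Ck.simps(2))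
  let ?e = "\<lambda>i. axis i 1 :: real^3"
  define D where "D h = f (x + h *\<^sub>R ?e i + h *\<^sub>R ?e j) - f (x + h *\<^sub>R ?e i) - f (x + h *\<^sub>R ?e j) + f x" for h
  \<comment> \<open>Stated for arbitrary i, j and for any D given by this formula, so that the use
    with swapped indices needs only commutativity of addition.\<close>
  have main: "(\<lambda>n. D (1 / real (Suc n)) / (1 / real (Suc n))\<^sup>2) \<longlonglongrightarrow> pderivative j (pderivative i f) x"
    if D: "\<And>h. D h = f (x + h *\<^sub>R ?e i + h *\<^sub>R ?e j) - f (x + h *\<^sub>R ?e i) - f (x + h *\<^sub>R ?e j) + f x" for D i j
  proof -
    have ex: "\<exists>y. norm (y - x) \<le> 2 * h \<and> D h / h\<^sup>2 = pderivative j (pderivative i f) y" if h: "h > 0" for h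
    proof -
      define g where "g y = f (y + h *\<^sub>R ?e j) - f y" for y
      have dg: "g differentiable (at y)" for y
        unfolding g_def by (intro differentiable_diff d0 differentiable_compose[of f, OF d0]) (auto intro!: derivative_intros)
      have pg: "pderivative i g y = pderivative i f (y + h *\<^sub>R ?e j) - pderivative i f y" for y
      proof -
        have "((\<lambda>y. f (y + h *\<^sub>R ?e j)) has_derivative (\<lambda>v. frechet_derivative f (at (y + h *\<^sub>R ?e j)) v)) (at y)"
          by (rule has_derivative_compose[where g=f and f="\<lambda>y. y + h *\<^sub>R ?e j" and f'="\<lambda>v. v"])
             (auto intro!: derivative_eq_intros simp: frechet_derivative_works[symmetric] d0)
        then have "(g has_derivative (\<lambda>v. frechet_derivative f (at (y + h *\<^sub>R ?e j)) v - frechet_derivative f (at y) v)) (at y)"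
          unfolding g_def by (intro has_derivative_diff) (auto simp: frechet_derivative_works[symmetric] d0)
        from pderivative_eqI[OF this] show ?thesis by (simp add: pderivative_def)
      qed
      obtain s where s: "0 < s" "s < h" "g (x + h *\<^sub>R ?e i) - g x = h * pderivative i g (x + s *\<^sub>R ?e i)"
        using pderivative_MVT[OF dg h] by blast
      obtain t where t: "0 < t" "t < h" "pderivative i f ((x + s *\<^sub>R ?e i) + h *\<^sub>R ?e j) - pderivative i f (x + s *\<^sub>R ?e i)
         = h * pderivative j (pderivative i f) ((x + s *\<^sub>R ?e i) + t *\<^sub>R ?e j)"
        using pderivative_MVT[OF d1 h] by blast
      have "D h = g (x + h *\<^sub>R ?e i) - g x" by (simp add: D g_def)
      also have "\<dots> = h\<^sup>2 * pderivative j (pderivative i f) ((x + s *\<^sub>R ?e i) + t *\<^sub>R ?e j)"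
        unfolding s(3) pg t(3) by (simp add: power2_eq_square)
      finally have "D h / h\<^sup>2 = pderivative j (pderivative i f) ((x + s *\<^sub>R ?e i) + t *\<^sub>R ?e j)" using h by simp
      moreover have "norm ((x + s *\<^sub>R ?e i) + t *\<^sub>R ?e j - x) \<le> 2 * h"
      proof -
        have "norm (s *\<^sub>R ?e i + t *\<^sub>R ?e j) \<le> norm (s *\<^sub>R ?e i) + norm (t *\<^sub>R ?e j)" by (rule norm_triangle_ineq)
        also have "\<dots> \<le> 2 * h" using s t by simp
        finally show ?thesis by simp
      qed
      ultimately show ?thesis by blast
    qed
    have "\<forall>n. \<exists>y. norm (y - x) \<le> 2 * (1 / real (Suc n)) \<and> D (1 / real (Suc n)) / (1 / real (Suc n))\<^sup>2 = pderivative j (pderivative i f) y"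
      by (intro allI ex) simp
    then obtain y where y: "\<And>n. norm (y n - x) \<le> 2 * (1 / real (Suc n))"
      "\<And>n. D (1 / real (Suc n)) / (1 / real (Suc n))\<^sup>2 = pderivative j (pderivative i f) (y n)" by metis
    have "(\<lambda>n. y n - x) \<longlonglongrightarrow> 0"
      by (rule Lim_null_comparison[OF always_eventually[OF allI[OF y(1)]]])
         (intro tendsto_mult_right_zero LIMSEQ_Suc[OF lim_1_over_n])
    then have "y \<longlonglongrightarrow> x" by (simp add: LIM_zero_iff)
    then have "(\<lambda>n. pderivative j (pderivative i f) (y n)) \<longlonglongrightarrow> pderivative j (pderivative i f) x"
      using c[of j i] by (intro isCont_tendsto_compose[of x "pderivative j (pderivative i f)"]) (auto simp: continuous_on_eq_continuous_at)
    then show ?thesis by (simp only: y(2))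
  qed
  have "(\<lambda>n. D (1 / real (Suc n)) / (1 / real (Suc n))\<^sup>2) \<longlonglongrightarrow> pderivative j (pderivative i f) x"
    by (rule main) (simp add: D_def)
  moreover have "(\<lambda>n. D (1 / real (Suc n)) / (1 / real (Suc n))\<^sup>2) \<longlonglongrightarrow> pderivative i (pderivative j f) x"
    by (rule main) (simp add: D_def add_ac)
  ultimately show ?thesis using LIMSEQ_unique by blast
qed

lemma smooth_pderivative_commute:
  "smooth f \<Longrightarrow> pderivative i (pderivative j f) x = pderivative j (pderivative i f) (x :: real^3) " for f :: "real^3 \<Rightarrow> real"
  by (rule pderivative_commute) (simp add: smooth_def)

text \<open>Difference quotients integrate to 0 by translation invariance; the mean value theorem
  supplies the bound for dominated convergence.\<close>

lemma integral_pderivative_test: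
  fixes f :: "real^3 \<Rightarrow> real"
  assumes f: "f \<in> test_fun"
  shows "(\<integral>x. pderivative j f x \<partial>lborel) = 0"
proof -
  let ?e = "axis j 1 :: real^3"
  note fs = test_funD(1)[OF f]
  have d: "f differentiable (at x)" for x by (rule smooth_differentiable[OF fs])
  have [measurable]: "f \<in> borel_measurable borel" "pderivative j f \<in> borel_measurable borel"
    by (intro smooth_measurable fs smooth_pderivative)+
  obtain r where r: "\<And>x. f x \<noteq> 0 \<Longrightarrow> norm x \<le> r" using test_funD(2)[OF f] unfolding bounded_iff by auto
  obtain C where C: "\<And>x. norm (pderivative j f x) \<le> C"
    using bandE[OF test_fun_band[OF test_fun_pderivative[OF f]]] by metis
  have fi: "integrable lborel f" by (intro band_integrable test_fun_band f)
  define t where "t n = 1 / real (Suc n)" for n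
  have t: "0 < t n" "t n \<le> 1" for n unfolding t_def by auto
  have tl: "t \<longlonglongrightarrow> 0" unfolding t_def by (rule LIMSEQ_Suc[OF lim_1_over_n])
  define q where "q n x = (f (x + t n *\<^sub>R ?e) - f x) / t n" for n x
  have sh: "integrable lborel (\<lambda>x. f (x + t n *\<^sub>R ?e))" "(\<integral>x. f (x + t n *\<^sub>R ?e) \<partial>lborel) = (\<integral>x. f x \<partial>lborel)" for n
  proof -
    have e: "(lborel :: (real^3) measure) = distr lborel borel (\<lambda>x. x + t n *\<^sub>R ?e)"
      using lborel_affine[of 1 "t n *\<^sub>R ?e"] by (simp add: add.commute density_1)
    show "integrable lborel (\<lambda>x. f (x + t n *\<^sub>R ?e))"
      using fi by (subst (asm) e) (simp add: integrable_distr_eq)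
    have "(\<integral>x. f x \<partial>lborel) = (\<integral>x. f x \<partial>distr lborel borel (\<lambda>x. x + t n *\<^sub>R ?e))" using e by simp
    then show "(\<integral>x. f (x + t n *\<^sub>R ?e) \<partial>lborel) = (\<integral>x. f x \<partial>lborel)"
      by (simp add: integral_distr)
  qed
  have q0: "(\<integral>x. q n x \<partial>lborel) = 0" for n
    unfolding q_def using sh[of n] fi by simp
  have "(\<lambda>n. \<integral>x. q n x \<partial>lborel) \<longlonglongrightarrow> (\<integral>x. pderivative j f x \<partial>lborel)"
  \<comment> \<open>The shifts have length at most 1, so all quotients vanish outside the ball of
    radius r + 1.\<close>
  proof (rule integral_dominated_convergence[where w="\<lambda>x. C * indicator (cball 0 (r + 1)) x"])
    show "integrable lborel (\<lambda>x::real^3. C * indicator (cball 0 (r + 1)) x :: real)" by (rule integrable_indicator_cball)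
    show "AE x in lborel. (\<lambda>n. q n x) \<longlonglongrightarrow> pderivative j f x"
    proof (rule AE_I2)
      fix x
      have "((\<lambda>h. (f (x + (0 + h) *\<^sub>R ?e) - f (x + 0 *\<^sub>R ?e)) / h) \<longlongrightarrow> pderivative j f (x + 0 *\<^sub>R ?e)) (at 0)"
        using line_derivative[of f x 0 j] d unfolding DERIV_def by simp
      moreover have "filterlim t (at 0) sequentially"
        using tl t(1) by (auto simp: filterlim_at less_imp_neq[symmetric] intro!: always_eventually)
      ultimately show "(\<lambda>n. q n x) \<longlonglongrightarrow> pderivative j f x"
        unfolding q_def by (auto dest: filterlim_compose)
    qed
    show "AE x in lborel. norm (q n x) \<le> C * indicator (cball 0 (r + 1)) x" for n
    proof (rule AE_I2)
      fix x
      show "norm (q n x) \<le> C * indicator (cball 0 (r + 1)) x"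
      proof (cases "norm x \<le> r + 1")
        case True
        obtain s where "f (x + t n *\<^sub>R ?e) - f x = t n * pderivative j f (x + s *\<^sub>R ?e)"
          using pderivative_MVT[of f "t n" x j] d t by blast
        then show ?thesis using True C[of "x + s *\<^sub>R ?e"] t(1)[of n] by (simp add: q_def)
      next
        case False
        have "norm x - norm (t n *\<^sub>R ?e) \<le> norm (x + t n *\<^sub>R ?e)"
          by (metis norm_diff_ineq)
        then have "norm (x + t n *\<^sub>R ?e) > r" using False t[of n] by simp
        then have "f (x + t n *\<^sub>R ?e) = 0" "f x = 0" using r[of x] r[of "x + t n *\<^sub>R ?e"] False by fastforce+
        then show ?thesis using False by (simp add: q_def)
      qed
    qed
  qed (auto simp: q_def)
  then have "(\<lambda>n::nat. 0::real) \<longlonglongrightarrow> (\<integral>x. pderivative j f x \<partial>lborel)" by (simp add: q0)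
  then show ?thesis using LIMSEQ_unique[OF _ tendsto_const] by metis
qed

section \<open>Smoothness of synthesized fields\<close>

lemma ftrans_has_derivative:
  assumes b: "band b"
  shows "(ftrans b has_derivative (\<lambda>v. \<Sum>j\<in>UNIV. (v $ j) *\<^sub>R ftrans (\<lambda>\<xi>. - \<i> * complex_of_real (\<xi> $ j) * b \<xi>) x)) (at x)"
proof -
  have bi: "integrable lborel b" by (rule band_integrable[OF b])
  have b1: "band (\<lambda>\<xi>. - \<i> * complex_of_real (\<xi> $ j) * b \<xi>)" for j
  proof -
    have "band (\<lambda>\<xi>. (\<xi> $ j) *\<^sub>R b \<xi>)" by (rule band_mult[OF b]) (intro continuous_intros)
    from band_linear[OF this bounded_linear_mult_right[of "-\<i>"]] show ?thesis by (simp add: scaleR_conv_of_real mult_ac)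
  qed
  have b2: "integrable lborel (\<lambda>\<xi>. (norm \<xi>)\<^sup>2 * norm (b \<xi>))"
  proof -
    have "band (\<lambda>\<xi>. (norm \<xi>)\<^sup>2 *\<^sub>R b \<xi>)" by (rule band_mult[OF b]) (intro continuous_intros)
    from integrable_norm[OF band_integrable[OF this]] show ?thesis by simp
  qed
  \<comment> \<open>The second moment of b bounds the integrated second-order Taylor remainder of
    the exponential.\<close>
  define M where "M = (\<integral>\<xi>. (norm \<xi>)\<^sup>2 * norm (b \<xi>) \<partial>lborel)"
  let ?D = "\<lambda>v. \<Sum>j\<in>UNIV. (v $ j) *\<^sub>R ftrans (\<lambda>\<xi>. - \<i> * complex_of_real (\<xi> $ j) * b \<xi>) x"
  have Dv: "?D v = (\<integral>\<xi>. exp (- \<i> * complex_of_real (x \<bullet> \<xi>)) * (- \<i> * complex_of_real (v \<bullet> \<xi>) * b \<xi>) \<partial>lborel)"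
    and Di: "integrable lborel (\<lambda>\<xi>. exp (- \<i> * complex_of_real (x \<bullet> \<xi>)) * (- \<i> * complex_of_real (v \<bullet> \<xi>) * b \<xi>))" for v
  proof -
    have e: "exp (- \<i> * complex_of_real (x \<bullet> \<xi>)) * (- \<i> * complex_of_real (v \<bullet> \<xi>) * b \<xi>) =
      (\<Sum>j\<in>UNIV. (v $ j) *\<^sub>R (exp (- \<i> * complex_of_real (x \<bullet> \<xi>)) * (- \<i> * complex_of_real (\<xi> $ j) * b \<xi>)))" for \<xi>
      by (simp add: inner_vec_def sum_distrib_left sum_distrib_right scaleR_conv_of_real mult_ac sum_negf)
    have i: "integrable lborel (\<lambda>\<xi>. (v $ j) *\<^sub>R (exp (- \<i> * complex_of_real (x \<bullet> \<xi>)) * (- \<i> * complex_of_real (\<xi> $ j) * b \<xi>)))" for j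
      by (intro integrable_scaleR_right integrable_ftrans band_integrable b1)
    show "integrable lborel (\<lambda>\<xi>. exp (- \<i> * complex_of_real (x \<bullet> \<xi>)) * (- \<i> * complex_of_real (v \<bullet> \<xi>) * b \<xi>))"
      unfolding e by (intro Bochner_Integration.integrable_sum i)
    show "?D v = (\<integral>\<xi>. exp (- \<i> * complex_of_real (x \<bullet> \<xi>)) * (- \<i> * complex_of_real (v \<bullet> \<xi>) * b \<xi>) \<partial>lborel)"
      unfolding e by (subst Bochner_Integration.integral_sum) (use i in \<open>simp_all only: ftrans_def integral_scaleR_right\<close>)
  qed
  have est: "norm (ftrans b y - ftrans b x - ?D (y - x)) \<le> M * (norm (y - x))\<^sup>2" for y
  proof -
    let ?E = "\<lambda>z \<xi>. exp (- \<i> * complex_of_real (z \<bullet> \<xi>))"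
    have "ftrans b y - ftrans b x - ?D (y - x) = (\<integral>\<xi>. ?E y \<xi> * b \<xi> - ?E x \<xi> * b \<xi> - ?E x \<xi> * (- \<i> * complex_of_real ((y - x) \<bullet> \<xi>) * b \<xi>) \<partial>lborel)"
      unfolding Dv unfolding ftrans_def
      by (simp only: Bochner_Integration.integral_diff[OF Bochner_Integration.integrable_diff Di]
            Bochner_Integration.integral_diff integrable_ftrans[OF bi])
    also have "norm \<dots> \<le> (\<integral>\<xi>. (norm (y - x))\<^sup>2 * ((norm \<xi>)\<^sup>2 * norm (b \<xi>)) \<partial>lborel)"
    proof (rule Bochner_Integration.integral_norm_bound_integral)
      show "integrable lborel (\<lambda>\<xi>. ?E y \<xi> * b \<xi> - ?E x \<xi> * b \<xi> - ?E x \<xi> * (- \<i> * complex_of_real ((y - x) \<bullet> \<xi>) * b \<xi>))"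
        by (intro Bochner_Integration.integrable_diff integrable_ftrans[OF bi] Di)
      show "integrable lborel (\<lambda>\<xi>. (norm (y - x))\<^sup>2 * ((norm \<xi>)\<^sup>2 * norm (b \<xi>)))"
        by (intro integrable_mult_right b2)
      fix \<xi>
      define s where "s = - ((y - x) \<bullet> \<xi>)"
      have ex: "?E y \<xi> = ?E x \<xi> * iexp s"
      proof -
        have "- \<i> * complex_of_real (y \<bullet> \<xi>) = - \<i> * complex_of_real (x \<bullet> \<xi>) + \<i> * complex_of_real s"
          by (simp add: s_def inner_diff_left algebra_simps)
        then show ?thesis by (simp only: exp_add)
      qed
      have "?E y \<xi> * b \<xi> - ?E x \<xi> * b \<xi> - ?E x \<xi> * (- \<i> * complex_of_real ((y - x) \<bullet> \<xi>) * b \<xi>)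
         = ?E x \<xi> * (iexp s - (1 + \<i> * complex_of_real s)) * b \<xi>"
      proof -
        have "complex_of_real s = - complex_of_real ((y - x) \<bullet> \<xi>)" by (simp add: s_def)
        then show ?thesis unfolding ex by (simp only: ring_distribs) (simp add: mult_ac)
      qed
      then have "norm (?E y \<xi> * b \<xi> - ?E x \<xi> * b \<xi> - ?E x \<xi> * (- \<i> * complex_of_real ((y - x) \<bullet> \<xi>) * b \<xi>))
         = norm (iexp s - (1 + \<i> * complex_of_real s)) * norm (b \<xi>)"
        by (simp add: norm_mult)
      \<comment> \<open>The Taylor remainder of the exponential after its linear term.\<close>
      also have "norm (iexp s - (1 + \<i> * complex_of_real s)) \<le> \<bar>s\<bar>\<^sup>2 / 2"
        using iexp_approx1[of s 1] by (simp add: numeral_2_eq_2)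
      also have "\<bar>s\<bar>\<^sup>2 / 2 \<le> (norm (y - x) * norm \<xi>)\<^sup>2"
      proof -
        have "\<bar>s\<bar> \<le> norm (y - x) * norm \<xi>" unfolding s_def using Cauchy_Schwarz_ineq2[of "y - x" \<xi>] by simp
        then have "\<bar>s\<bar>\<^sup>2 \<le> (norm (y - x) * norm \<xi>)\<^sup>2" by (intro power_mono) auto
        then show ?thesis using zero_le_power2[of "norm (y - x) * norm \<xi>"] by linarith
      qed
      finally show "norm (?E y \<xi> * b \<xi> - ?E x \<xi> * b \<xi> - ?E x \<xi> * (- \<i> * complex_of_real ((y - x) \<bullet> \<xi>) * b \<xi>))
        \<le> (norm (y - x))\<^sup>2 * ((norm \<xi>)\<^sup>2 * norm (b \<xi>))"
        by (simp add: power_mult_distrib mult_right_mono mult_ac)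
    qed
    also have "\<dots> = M * (norm (y - x))\<^sup>2" by (simp add: M_def)
    finally show ?thesis .
  qed
  show ?thesis
  proof (rule has_derivativeI_sandwich[where e=1 and H="\<lambda>y. M * norm (y - x)"])
    show "bounded_linear ?D"
      by (intro bounded_linear_sum bounded_linear_scaleR_const bounded_linear_vec_nth)
    show "norm (ftrans b y - ftrans b x - ?D (y - x)) / norm (y - x) \<le> M * norm (y - x)" if "y \<noteq> x" for y
      using est[of y] that by (simp add: divide_le_eq power2_eq_square mult.assoc)
    show "((\<lambda>y. M * norm (y - x)) \<longlongrightarrow> 0) (at x)"
      by (auto intro!: tendsto_eq_intros)
  qed simp
qed

lemma band_iu_mult:
  assumes "band a" shows "band (\<lambda>\<xi>. \<i> * complex_of_real (\<xi> $ j) * a \<xi>)"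
proof -
  have "band (\<lambda>\<xi>. (\<xi> $ j) *\<^sub>R a \<xi>)" by (rule band_mult[OF assms]) (intro continuous_intros)
  from band_linear[OF this bounded_linear_mult_right[of "\<i>"]] show ?thesis by (simp add: scaleR_conv_of_real mult_ac)
qed

lemma synth_s_has_derivative:
  assumes a: "band a"
  shows "(synth_s a has_derivative (\<lambda>v. \<Sum>j\<in>UNIV. v $ j * synth_s (\<lambda>\<xi>. \<i> * complex_of_real (\<xi> $ j) * a \<xi>) x)) (at x)"
proof -
  have "(synth_s a has_derivative (\<lambda>v. Re (\<Sum>j\<in>UNIV. (v $ j) *\<^sub>R ftrans (\<lambda>\<xi>. - \<i> * complex_of_real (\<xi> $ j) * cnj (a \<xi>)) x))) (at x)"
    unfolding synth_s_def[abs_def]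
    by (rule bounded_linear.has_derivative[OF bounded_linear_Re ftrans_has_derivative[OF band_cnj[OF a]]])
  then show ?thesis by (simp add: synth_s_def[abs_def])
qed

lemma pderivative_synth_s:
  assumes a: "band a"
  shows "pderivative j (synth_s a) = synth_s (\<lambda>\<xi>. \<i> * complex_of_real (\<xi> $ j) * a \<xi>)"
proof
  fix x
  let ?s = "\<lambda>i. synth_s (\<lambda>\<xi>. \<i> * complex_of_real (\<xi> $ i) * a \<xi>) x"
  have "pderivative j (synth_s a) x = (\<Sum>i\<in>UNIV. (axis j 1 :: real^3) $ i * ?s i)"
    by (rule pderivative_eqI[OF synth_s_has_derivative[OF a]])
  also have "\<dots> = (\<Sum>i\<in>UNIV. if i = j then ?s i else 0)"
    by (rule sum.cong) (auto simp: axis_def)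
  finally show "pderivative j (synth_s a) x = ?s j" by simp
qed

text \<open>Each derivative multiplies the symbol by i \<xi>_j, which keeps it in
  \<open>band\<close>, so the induction on the order never leaves the class.\<close>

lemma smooth_synth_s:
  assumes "band a" shows "smooth (synth_s a)"
proof -
  have "Ck n (synth_s a)" if "band a" for n a
    using that
  proof (induction n arbitrary: a)
    case 0
    have "continuous_on UNIV (synth_s a)"
      by (rule continuous_at_imp_continuous_on) (blast intro: has_derivative_continuous synth_s_has_derivative[OF 0])
    then show ?case by simp
  next
    case (Suc n)
    have "synth_s a differentiable (at x)" for x
      using synth_s_has_derivative[OF Suc.prems] unfolding differentiable_def by blast
    moreover have "Ck n (pderivative j (synth_s a))" for j
      unfolding pderivative_synth_s[OF Suc.prems] by (rule Suc.IH[OF band_iu_mult[OF Suc.prems]])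
    ultimately show ?case unfolding Ck_Suc3 by blast
  qed
  then show ?thesis using assms by (simp add: smooth_def)
qed

lemma synth_s_bounded:
  assumes a: "band a" shows "\<bar>synth_s a x\<bar> \<le> (\<integral>\<xi>. norm (a \<xi>) \<partial>lborel)"
  using order_trans[OF abs_Re_le_cmod norm_ftrans_le[OF band_integrable[OF band_cnj[OF a]]]]
  by (simp add: synth_s_def)

section \<open>Rescaled test functions and the fundamental lemma of the calculus of
  variations\<close>

lemma affine_has_derivative:
  fixes f :: "real^3 \<Rightarrow> 'b::real_normed_vector"
  assumes "f differentiable (at (t + s *\<^sub>R x))"
  shows "((\<lambda>x. f (t + s *\<^sub>R x)) has_derivative (\<lambda>v. frechet_derivative f (at (t + s *\<^sub>R x)) (s *\<^sub>R v))) (at x)"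
  by (rule has_derivative_compose[where g=f and f="\<lambda>y. t + s *\<^sub>R y" and f'="\<lambda>v. s *\<^sub>R v"])
     (use assms in \<open>auto intro!: derivative_eq_intros simp: frechet_derivative_works\<close>)

lemma pderivative_affine:
  fixes f :: "real^3 \<Rightarrow> 'b::real_normed_vector"
  assumes "f differentiable (at (t + s *\<^sub>R x))"
  shows "pderivative j (\<lambda>x. f (t + s *\<^sub>R x)) x = s *\<^sub>R pderivative j f (t + s *\<^sub>R x)"
  using pderivative_eqI[OF affine_has_derivative[OF assms], of j] linear_cmul[OF linear_frechet_derivative[OF assms], of s "axis j 1"]
  by (simp add: pderivative_def)

lemma Ck_affine: "Ck n f \<Longrightarrow> Ck n (\<lambda>x::real^3. f (t + s *\<^sub>R x))"
proof (induction n arbitrary: f)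
  case 0
  then show ?case by (auto intro!: continuous_on_compose2[of UNIV f] continuous_intros)
next
  case (Suc n)
  then have d: "f differentiable (at x)" for x by (simp add: Ck_Suc3)
  have "(\<lambda>x. f (t + s *\<^sub>R x)) differentiable (at x)" for x
    using affine_has_derivative[OF d] unfolding differentiable_def by blast
  moreover have "Ck n (pderivative j (\<lambda>x. f (t + s *\<^sub>R x)))" for j
  proof -
    have "pderivative j (\<lambda>x. f (t + s *\<^sub>R x)) = (\<lambda>x. s *\<^sub>R pderivative j f (t + s *\<^sub>R x))"
      by (rule ext) (rule pderivative_affine[OF d])
    moreover have "Ck n (\<lambda>x. s *\<^sub>R pderivative j f (t + s *\<^sub>R x))"
      by (rule Ck_linear[OF bounded_linear_scaleR_right]) (use Suc in \<open>unfold Ck_Suc3, blast\<close>)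
    ultimately show ?thesis by simp
  qed
  ultimately show ?case unfolding Ck_Suc3 by blast
qed

lemma smooth_affine: "smooth f \<Longrightarrow> smooth (\<lambda>x::real^3. f (t + s *\<^sub>R x))"
  by (simp add: smooth_def Ck_affine)

lemma test_fun_affine:
  assumes f: "f \<in> test_fun" and s: "s \<noteq> 0"
  shows "(\<lambda>x::real^3. f (t + s *\<^sub>R x)) \<in> test_fun"
proof (rule test_funI)
  show "smooth (\<lambda>x. f (t + s *\<^sub>R x))" by (intro smooth_affine test_funD f)
  obtain r where r: "\<And>y. f y \<noteq> 0 \<Longrightarrow> norm y \<le> r" using test_funD(2)[OF f] unfolding bounded_iff by auto
  show "bounded {x. f (t + s *\<^sub>R x) \<noteq> 0}"
  proof (rule boundedI[where B="(r + norm t) / \<bar>s\<bar>"], safe)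
    fix x assume "f (t + s *\<^sub>R x) \<noteq> 0"
    then have "norm (t + s *\<^sub>R x) \<le> r" by (rule r)
    then have "norm (s *\<^sub>R x) \<le> r + norm t" using norm_triangle_ineq4[of "t + s *\<^sub>R x" t] by simp
    then show "norm x \<le> (r + norm t) / \<bar>s\<bar>" using s by (simp add: pos_le_divide_eq mult.commute)
  qed
qed

lemma lborel_integral_affine:
  fixes f :: "real^3 \<Rightarrow> real"
  assumes [measurable]: "f \<in> borel_measurable borel" and s: "s \<noteq> 0"
  shows "(\<integral>x. f x \<partial>lborel) = \<bar>s\<bar>^3 * (\<integral>x. f (t + s *\<^sub>R x) \<partial>lborel)"
proof -
  have "(\<integral>x. f x \<partial>lborel) = (\<integral>x. f x \<partial>density (distr lborel borel (\<lambda>x. t + s *\<^sub>R x)) (\<lambda>_. ennreal (\<bar>s\<bar>^DIM(real^3))))"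
    using lborel_affine[OF s, of t] by (simp add: ennreal_power)
  also have "\<dots> = \<bar>s\<bar>^3 * (\<integral>x. f (t + s *\<^sub>R x) \<partial>lborel)"
    by (subst integral_density) (auto simp: integral_distr)
  finally show ?thesis .
qed

lemma locally_integrable_ball:
  assumes "locally_integrable (h :: real^3 \<Rightarrow> real)"
  shows "integrable lborel (\<lambda>x. indicator (cball 0 r) x * h x)"
  using assms by (auto simp: locally_integrable_def set_integrable_def)

lemma AE_not_box_frontier: "AE x in lborel. (x::real^3) \<notin> cbox a b - box a b"
proof (rule AE_not_in)
  have "negligible (cbox a b - box a b)" by (rule negligible_frontier_interval)
  then have "cbox a b - box a b \<in> null_sets lebesgue" by (simp add: negligible_iff_null_sets)
  then show "cbox a b - box a b \<in> null_sets lborel" by (subst (asm) null_sets_completion_iff) auto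
qed

lemma enn2real_eqD: "a \<noteq> \<infinity> \<Longrightarrow> b \<noteq> \<infinity> \<Longrightarrow> enn2real a = enn2real b \<Longrightarrow> a = b"
  by (cases a; cases b) auto

text \<open>The test functions are the convolutions of indicators of boxes with rescaled copies of \<open>\<rho>\<close>.\<close>

lemma AE_zero_if_test_integrals_zero:
  fixes h \<rho> :: "real^3 \<Rightarrow> real"
  assumes h: "locally_integrable h" and \<rho>: "\<rho> \<in> test_fun" "\<And>x. \<rho> x \<ge> 0" "(\<integral>x. \<rho> x \<partial>lborel) \<noteq> 0"
    and z: "\<And>\<phi>. \<phi> \<in> test_fun \<Longrightarrow> (\<integral>x. h x * \<phi> x \<partial>lborel) = 0"
  shows "AE x in lborel. h x = 0"
proof -
  have hm[measurable]: "h \<in> borel_measurable borel" using h by (simp add: locally_integrable_def)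
  note [measurable] = smooth_measurable[OF test_funD(1)[OF \<rho>(1)]]
  have \<rho>i: "integrable lborel \<rho>" by (intro band_integrable test_fun_band \<rho>)
  obtain r where r: "\<And>x. \<rho> x \<noteq> 0 \<Longrightarrow> norm x \<le> r" using test_funD(2)[OF \<rho>(1)] unfolding bounded_iff by auto
  have box0: "(\<integral>x. indicator (box a b) x * h x \<partial>lborel) = 0" for a b
  proof -
    let ?B = "box a b"
    obtain R where R: "\<And>x. x \<in> ?B \<Longrightarrow> norm x \<le> R" using bounded_box[of a b] unfolding bounded_iff by auto
    \<comment> \<open>The convolution of the box with the copy of \<rho> of width 1/(m+1), in the
      form in which the limit in m can be taken under the integral.\<close>
    define P where "P m x = (\<integral>z. indicator ?B (x - (1 / real (Suc m)) *\<^sub>R z) * \<rho> z \<partial>lborel)" for m x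
    have Pm[measurable]: "P m \<in> borel_measurable borel" for m
      unfolding P_def by measurable
    have Pi: "integrable lborel (\<lambda>z. indicator ?B (x - (1 / real (Suc m)) *\<^sub>R z) * \<rho> z)" for m x
      by (rule integrable_dominated[OF \<rho>i]) (auto simp: indicator_def \<rho>)
    have P_le: "\<bar>P m x\<bar> \<le> (\<integral>x. \<rho> x \<partial>lborel) * indicator (cball 0 (R + r)) x" for m x
    proof (cases "norm x \<le> R + r")
      case True
      have "\<bar>P m x\<bar> \<le> (\<integral>x. \<rho> x \<partial>lborel)"
        unfolding P_def by (rule integral_abs_bound_integral[OF Pi \<rho>i]) (auto simp: indicator_def \<rho>)
      then show ?thesis using True by simp
    next
      case False
      have "indicator ?B (x - (1 / real (Suc m)) *\<^sub>R z) * \<rho> z = 0" for z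
      proof (rule ccontr)
        assume "\<not> ?thesis"
        then have 1: "norm (x - (1 / real (Suc m)) *\<^sub>R z) \<le> R" "norm z \<le> r" by (auto simp: indicator_def R r split: if_splits)
        have "norm ((1 / real (Suc m)) *\<^sub>R z) \<le> norm z" by (simp add: divide_le_eq mult_le_cancel_left1 mult_nonneg_nonneg)
        then show False using 1 False norm_triangle_sub[of x "(1 / real (Suc m)) *\<^sub>R z"] by linarith
      qed
      then have "P m x = 0" unfolding P_def by (simp only: Bochner_Integration.integral_zero)
      then show ?thesis by (simp add: \<rho>)
    qed
    have hP: "(\<integral>x. h x * P m x \<partial>lborel) = 0" for m
    proof -
      let ?M = "real (Suc m)"
      define H where "H x y = h x * (indicator ?B y * \<rho> (?M *\<^sub>R (x - y)))" for x y
      \<comment> \<open>The substitution y = x - z/(m+1) produces the factor (m+1)^3 and moves the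
        dependence on x into \<rho>, as the use of Fubini's theorem requires.\<close>
      have P_eq: "P m x = ?M^3 * (\<integral>y. indicator ?B y * \<rho> (?M *\<^sub>R (x - y)) \<partial>lborel)" for x
      proof -
        have "(\<integral>y. indicator ?B y * \<rho> (?M *\<^sub>R (x - y)) \<partial>lborel) =
           \<bar>- (1 / ?M)\<bar>^3 * (\<integral>z. indicator ?B (x + (- (1/?M)) *\<^sub>R z) * \<rho> (?M *\<^sub>R (x - (x + (- (1/?M)) *\<^sub>R z))) \<partial>lborel)"
          by (rule lborel_integral_affine) auto
        also have "\<dots> = (1/?M)^3 * P m x" unfolding P_def by simp
        finally show ?thesis by (simp add: power_divide)
      qed
      have Hi: "integrable (lborel \<Otimes>\<^sub>M lborel) (\<lambda>(x, y). H x y)"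
      proof -
        have i1: "integrable lborel (\<lambda>x. complex_of_real (indicator (cball 0 (R + r)) x * h x))"
          by (intro integrable_of_real locally_integrable_ball h)
        have i2: "integrable lborel (\<lambda>y::real^3. complex_of_real (C * indicator (cball 0 R) y))" for C
          by (intro integrable_of_real integrable_indicator_cball)
        obtain C where C: "\<And>x. norm (\<rho> x) \<le> C" using bandE[OF test_fun_band[OF \<rho>(1)]] by metis
        show ?thesis
        proof (rule Bochner_Integration.integrable_bound[OF lborel_pair.integrable_pair_mult(1)[OF i1 i2[of C]]])
          show "AE p in lborel \<Otimes>\<^sub>M lborel. norm (case p of (x, y) \<Rightarrow> H x y) \<le> norm (complex_of_real (indicator (cball 0 (R + r)) (fst p) * h (fst p)) * complex_of_real (C * indicator (cball 0 R) (snd p)))"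
          proof (rule AE_I2)
            fix p :: "(real^3) \<times> (real^3)"
            obtain x y where p: "p = (x, y)" by (cases p)
            have C0: "C \<ge> 0" using C[of 0] norm_ge_zero[of "\<rho> 0"] by linarith
            have "\<bar>H x y\<bar> \<le> \<bar>indicator (cball 0 (R + r)) x * h x\<bar> * \<bar>C * indicator (cball 0 R) y\<bar>"
            proof (cases "H x y = 0")
              case False
              then have "y \<in> ?B" "\<rho> (?M *\<^sub>R (x - y)) \<noteq> 0" by (auto simp: H_def indicator_def split: if_splits)
              then have 1: "y \<in> ?B" "norm (?M *\<^sub>R (x - y)) \<le> r" by (blast intro: r)+
              have "norm (x - y) \<le> ?M * norm (x - y)" by (simp add: mult_le_cancel_right1)
              then have "norm (x - y) \<le> r" using 1(2) by simp
              then have "norm x \<le> R + r" "norm y \<le> R" using R[OF 1(1)] norm_triangle_sub[of x y] by auto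
              then show ?thesis using 1 C[of "?M *\<^sub>R (x - y)"] C0
                by (auto simp: H_def abs_mult intro!: mult_left_mono)
            qed simp
            then show "norm (case p of (x, y) \<Rightarrow> H x y) \<le> norm (complex_of_real (indicator (cball 0 (R + r)) (fst p) * h (fst p)) * complex_of_real (C * indicator (cball 0 R) (snd p)))"
              unfolding p norm_mult norm_of_real real_norm_def by (simp only: prod.case fst_conv snd_conv)
          qed
        qed (auto simp: H_def case_prod_beta')
      qed
      \<comment> \<open>For fixed y the factor next to h is a test function of x, so the hypothesis
        applies.\<close>
      have inner: "(\<integral>x. H x y \<partial>lborel) = 0" for y
      proof -
        have "(\<lambda>x. \<rho> (- (?M *\<^sub>R y) + ?M *\<^sub>R x)) \<in> test_fun" by (rule test_fun_affine[OF \<rho>(1)]) simp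
        from z[OF this] have "(\<integral>x. h x * \<rho> (?M *\<^sub>R (x - y)) \<partial>lborel) = 0" by (simp add: scaleR_diff_right)
        moreover have "H x y = indicator ?B y * (h x * \<rho> (?M *\<^sub>R (x - y)))" for x by (simp add: H_def)
        ultimately show ?thesis by simp
      qed
      have "(\<integral>x. h x * P m x \<partial>lborel) = ?M^3 * (\<integral>x. (\<integral>y. H x y \<partial>lborel) \<partial>lborel)"
        unfolding P_eq H_def by (simp add: mult.left_commute[of _ "?M^3"] del: of_nat_Suc)
      also have "(\<integral>x. (\<integral>y. H x y \<partial>lborel) \<partial>lborel) = (\<integral>y. (\<integral>x. H x y \<partial>lborel) \<partial>lborel)"
        by (rule lborel_pair.Fubini_integral[symmetric]) (rule Hi)
      finally show ?thesis by (simp add: inner)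
    qed
    have "(\<lambda>m. \<integral>x. h x * P m x \<partial>lborel) \<longlonglongrightarrow> (\<integral>x. h x * (indicator ?B x * (\<integral>x. \<rho> x \<partial>lborel)) \<partial>lborel)"
    proof (rule integral_dominated_convergence[where w="\<lambda>x. (\<integral>x. \<rho> x \<partial>lborel) * \<bar>indicator (cball 0 (R + r)) x * h x\<bar>"])
      show "integrable lborel (\<lambda>x. (\<integral>x. \<rho> x \<partial>lborel) * \<bar>indicator (cball 0 (R + r)) x * h x\<bar>)"
        by (intro integrable_mult_right integrable_abs locally_integrable_ball h)
      show "AE x in lborel. norm (h x * P m x) \<le> (\<integral>x. \<rho> x \<partial>lborel) * \<bar>indicator (cball 0 (R + r)) x * h x\<bar>" for m
      proof (rule AE_I2)
        fix x show "norm (h x * P m x) \<le> (\<integral>x. \<rho> x \<partial>lborel) * \<bar>indicator (cball 0 (R + r)) x * h x\<bar>"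
          using mult_right_mono[OF P_le[of m x], of "\<bar>h x\<bar>"] by (simp add: abs_mult mult_ac)
      qed
      \<comment> \<open>On the frontier of the box the indicators need not converge; it is a null
        set.\<close>
      show "AE x in lborel. (\<lambda>m. h x * P m x) \<longlonglongrightarrow> h x * (indicator ?B x * (\<integral>x. \<rho> x \<partial>lborel))"
        using AE_not_box_frontier[of a b]
      proof eventually_elim
        case (elim x)
        have lim: "(\<lambda>m. indicat_real ?B (x - (1 / real (Suc m)) *\<^sub>R z)) \<longlonglongrightarrow> indicator ?B x" for z
        proof -
          have "(\<lambda>m. x - (1 / real (Suc m)) *\<^sub>R z) \<longlonglongrightarrow> x - 0 *\<^sub>R z"
            by (intro tendsto_intros LIMSEQ_Suc[OF lim_1_over_n])
          then have l: "(\<lambda>m. x - (1 / real (Suc m)) *\<^sub>R z) \<longlonglongrightarrow> x" by simp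
          show ?thesis
          proof (cases "x \<in> ?B")
            case True
            have "\<forall>\<^sub>F m in sequentially. x - (1 / real (Suc m)) *\<^sub>R z \<in> ?B"
              by (rule topological_tendstoD[OF l open_box True])
            then show ?thesis using True by (intro tendsto_eventually) (auto elim!: eventually_mono)
          next
            case False
            then have "x \<in> - cbox a b" using elim by auto
            then have "\<forall>\<^sub>F m in sequentially. x - (1 / real (Suc m)) *\<^sub>R z \<in> - cbox a b"
              by (intro topological_tendstoD[OF l]) (auto simp: open_Compl closed_cbox)
            then show ?thesis using False box_subset_cbox[of a b]
              by (intro tendsto_eventually) (auto elim!: eventually_mono simp: indicator_def)
          qed
        qed
        have "(\<lambda>m. P m x) \<longlonglongrightarrow> (\<integral>z. indicator ?B x * \<rho> z \<partial>lborel)"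
          unfolding P_def
        proof (rule integral_dominated_convergence[where w=\<rho>])
          show "AE z in lborel. (\<lambda>m. indicator ?B (x - (1 / real (Suc m)) *\<^sub>R z) * \<rho> z) \<longlonglongrightarrow> indicator ?B x * \<rho> z"
            by (rule AE_I2) (intro tendsto_mult lim tendsto_const)
          show "AE z in lborel. norm (indicator ?B (x - (1 / real (Suc m)) *\<^sub>R z) * \<rho> z) \<le> \<rho> z" for m
            by (rule AE_I2) (auto simp: indicator_def \<rho>)
          show "integrable lborel \<rho>" by (rule \<rho>i)
        qed measurable
        also have "(\<integral>z. indicator ?B x * \<rho> z \<partial>lborel) = indicator ?B x * (\<integral>z. \<rho> z \<partial>lborel)" by simp
        finally show ?case by (intro tendsto_mult tendsto_const)
      qed
    qed measurable
    then have "(\<lambda>m::nat. 0) \<longlonglongrightarrow> (\<integral>x. h x * (indicator ?B x * (\<integral>x. \<rho> x \<partial>lborel)) \<partial>lborel)" by (simp only: hP)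
    then have "(\<integral>x. h x * (indicator ?B x * (\<integral>x. \<rho> x \<partial>lborel)) \<partial>lborel) = 0"
      using LIMSEQ_unique[OF _ tendsto_const] by metis
    moreover have "h x * (indicator ?B x * (\<integral>x. \<rho> x \<partial>lborel)) = (indicator ?B x * h x) * (\<integral>x. \<rho> x \<partial>lborel)" for x by simp
    ultimately show ?thesis using \<rho>(3) by (simp only: integral_mult_left_zero) simp
  qed
  \<comment> \<open>\<open>ennreal\<close> sends negative numbers to 0, so hp and hn are the
    positive and the negative part of h.\<close>
  define hp where "hp x = ennreal (h x)" for x
  define hn where "hn x = ennreal (- h x)" for x
  have [measurable]: "hp \<in> borel_measurable borel" "hn \<in> borel_measurable borel" unfolding hp_def hn_def by measurable
  have fin: "(\<integral>\<^sup>+x. hp x * indicator (box a b) x \<partial>lborel) = (\<integral>\<^sup>+x. hn x * indicator (box a b) x \<partial>lborel)"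
    "(\<integral>\<^sup>+x. hp x * indicator (box a b) x \<partial>lborel) \<noteq> \<infinity>" for a b
  proof -
    obtain R where R: "\<And>x. x \<in> box a b \<Longrightarrow> norm x \<le> R" using bounded_box[of a b] unfolding bounded_iff by auto
    have i: "integrable lborel (\<lambda>x. indicator (box a b) x * h x)"
      by (rule integrable_dominated[OF integrable_abs[OF locally_integrable_ball[OF h, of R]]]) (auto simp: indicator_def R)
    have p: "(\<lambda>x. hp x * indicator (box a b) x) = (\<lambda>x. ennreal (indicator (box a b) x * h x))"
      by (auto simp: fun_eq_iff hp_def indicator_def)
    have n: "(\<lambda>x. hn x * indicator (box a b) x) = (\<lambda>x. ennreal (- (indicator (box a b) x * h x)))"
      by (auto simp: fun_eq_iff hn_def indicator_def)
    from i have fp: "(\<integral>\<^sup>+x. ennreal (indicator (box a b) x * h x) \<partial>lborel) \<noteq> \<infinity>" and fn: "(\<integral>\<^sup>+x. ennreal (- (indicator (box a b) x * h x)) \<partial>lborel) \<noteq> \<infinity>"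
      by (auto simp: real_integrable_def)
    show "(\<integral>\<^sup>+x. hp x * indicator (box a b) x \<partial>lborel) \<noteq> \<infinity>" unfolding p by (rule fp)
    show "(\<integral>\<^sup>+x. hp x * indicator (box a b) x \<partial>lborel) = (\<integral>\<^sup>+x. hn x * indicator (box a b) x \<partial>lborel)"
    proof -
      have "enn2real (\<integral>\<^sup>+x. ennreal (indicator (box a b) x * h x) \<partial>lborel) = enn2real (\<integral>\<^sup>+x. ennreal (- (indicator (box a b) x * h x)) \<partial>lborel)"
        using real_lebesgue_integral_def[OF i] box0[of a b] by simp
      then show ?thesis unfolding p n by (rule enn2real_eqD[OF fp fn])
    qed
  qed
  \<comment> \<open>The boxes form a generator stable under intersection that exhausts the space.
    Measures that agree and are finite on them are equal, and then so are their densities almost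
    everywhere.\<close>
  have "density lborel hp = density lborel hn"
  proof (rule measure_eqI_generator_eq)
    let ?E = "range (\<lambda>(a, b). box a b :: (real^3) set)"
    show "Int_stable ?E" by (auto simp: Int_stable_def box_Int_box)
    show "?E \<subseteq> Pow UNIV" "sets (density lborel hp) = sigma_sets UNIV ?E" "sets (density lborel hn) = sigma_sets UNIV ?E"
      by (simp_all add: borel_eq_box)
    let ?A = "\<lambda>n::nat. box (- (real n *\<^sub>R One)) (real n *\<^sub>R One) :: (real^3) set"
    show "range ?A \<subseteq> ?E" "(\<Union>i. ?A i) = UNIV"
      unfolding UN_box_eq_UNIV by auto
    show "emeasure (density lborel hp) (?A i) \<noteq> \<infinity>" for i using fin(2) by (simp add: emeasure_density)
    show "emeasure (density lborel hp) X = emeasure (density lborel hn) X" if "X \<in> ?E" for X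
      using that fin(1) by (auto simp: emeasure_density)
  qed
  then have "AE x in lborel. hp x = hn x"
    by (intro sigma_finite_measure.density_unique[OF sigma_finite_lborel]) auto
  then show ?thesis
  proof eventually_elim
    case (elim x)
    then show ?case unfolding hp_def hn_def
      by (cases "h x \<ge> 0") (auto simp: ennreal_neg)
  qed
qed

lemma band_locally_integrable: "band f \<Longrightarrow> locally_integrable f"
  unfolding locally_integrable_def set_integrable_def
  by (auto intro!: integrable_mult_indicator[OF _ band_integrable] simp: band_measurable borel_compact)

lemma locally_integrable_scaleR:
  "locally_integrable f \<Longrightarrow> locally_integrable (\<lambda>x. c *\<^sub>R f x)"
  unfolding locally_integrable_def by auto

lemma locally_integrable_mult_test:
  fixes h f :: "real^3 \<Rightarrow> real"
  assumes h: "locally_integrable h" and f: "band f"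
  shows "integrable lborel (\<lambda>x. h x * f x)"
proof -
  obtain C r where C: "C \<ge> 0" "\<And>\<xi>. norm (f \<xi>) \<le> C * indicator (cball 0 r) \<xi>" using bandE[OF f] by metis
  have [measurable]: "h \<in> borel_measurable borel" "f \<in> borel_measurable borel"
    using h f by (auto simp: locally_integrable_def band_measurable)
  show ?thesis
  proof (rule integrable_dominated)
    show "integrable lborel (\<lambda>x. C * \<bar>indicator (cball 0 r) x * h x\<bar>)"
      by (intro integrable_mult_right integrable_abs locally_integrable_ball h)
    fix x show "norm (h x * f x) \<le> C * \<bar>indicator (cball 0 r) x * h x\<bar>"
      using mult_right_mono[OF C(2)[of x], of "\<bar>h x\<bar>"] by (simp add: abs_mult mult_ac)
  qed simp
qed

lemma locally_integrable_linear:
  assumes L: "bounded_linear L" and f: "locally_integrable f"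
  shows "locally_integrable (\<lambda>x. L (f x))"
  unfolding locally_integrable_def
proof (intro conjI allI impI)
  have [measurable]: "f \<in> borel_measurable borel" using f by (simp add: locally_integrable_def)
  have "(\<lambda>x. L (f x)) \<in> borel_measurable borel"
    by (rule measurable_compose[of f _ borel]) (auto intro!: borel_measurable_continuous_onI linear_continuous_on L)
  then show "(\<lambda>x. L (f x)) \<in> borel_measurable lborel" by simp
  fix K :: "(real^3) set" assume "compact K"
  then have "integrable lborel (\<lambda>x. indicator K x *\<^sub>R f x)" using f by (simp add: locally_integrable_def set_integrable_def)
  from integrable_bounded_linear[OF L this] show "set_integrable lborel K (\<lambda>x. L (f x))"
    by (simp add: set_integrable_def linear_cmul[OF bounded_linear.linear[OF L]])
qed

lemma L2_locally_integrable:
  assumes w: "w \<in> L2" shows "locally_integrable w"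
  unfolding locally_integrable_def
proof (intro conjI allI impI)
  show "w \<in> borel_measurable lborel" using L2_measurable[OF w] by simp
  fix K :: "(real^3) set" assume K: "compact K"
  then obtain r where r: "\<forall>x\<in>K. norm x \<le> r" using compact_imp_bounded[OF K] unfolding bounded_iff by blast
  have "(\<lambda>x. indicat_real K x *\<^sub>R w x) = (\<lambda>x. indicat_real K x *\<^sub>R (indicat_real (cball 0 r) x *\<^sub>R w x))"
    using r by (auto simp: indicator_def)
  moreover have "integrable lborel (\<lambda>x. indicat_real K x *\<^sub>R (indicat_real (cball 0 r) x *\<^sub>R w x))"
    by (rule integrable_mult_indicator[OF _ L2_truncate_integrable[OF w]]) (use K in \<open>simp add: borel_compact\<close>)
  ultimately show "set_integrable lborel K w"
    unfolding set_integrable_def by (simp only:)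
qed

section \<open>Jacobians of test fields as weak gradients\<close>

definition jac :: "field \<Rightarrow> real^3 \<Rightarrow> real^3^3" where
  "jac \<phi> x = (\<chi> i j. pderivative j (\<lambda>x. \<phi> x $ i) x)"

lemma jac_test_fun:
  assumes "\<phi> \<in> test_fun" shows "jac \<phi> \<in> test_fun"
proof -
  have "(\<lambda>x. jac \<phi> x $ i $ j) \<in> test_fun" for i j
    unfolding jac_def using test_fun_pderivative[OF test_fun_component[OF assms]] by (simp add: eta_contract_eq)
  then show ?thesis by (intro test_fun_vec)
qed

lemma integral_by_parts_test:
  fixes f g :: "real^3 \<Rightarrow> real"
  assumes f: "f \<in> test_fun" and g: "smooth g"
  shows "(\<integral>x. g x * pderivative j f x \<partial>lborel) = - (\<integral>x. pderivative j g x * f x \<partial>lborel)"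
proof -
  have t: "(\<lambda>x. f x * g x) \<in> test_fun" by (rule test_fun_mult[OF f g])
  have i1: "integrable lborel (\<lambda>x. pderivative j f x * g x)"
    by (intro band_integrable test_fun_band test_fun_mult test_fun_pderivative f g)
  have i2: "integrable lborel (\<lambda>x. f x * pderivative j g x)"
    by (intro band_integrable test_fun_band test_fun_mult smooth_pderivative f g)
  have "0 = (\<integral>x. pderivative j (\<lambda>x. f x * g x) x \<partial>lborel)" using integral_pderivative_test[OF t] by simp
  also have "\<dots> = (\<integral>x. pderivative j f x * g x + f x * pderivative j g x \<partial>lborel)"
    by (simp add: pderivative_mult smooth_differentiable test_funD(1)[OF f] g)
  also have "\<dots> = (\<integral>x. pderivative j f x * g x \<partial>lborel) + (\<integral>x. f x * pderivative j g x \<partial>lborel)"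
    by (rule Bochner_Integration.integral_add[OF i1 i2])
  finally show ?thesis by (simp add: mult.commute)
qed

lemma is_weak_grad_test:
  assumes \<phi>: "\<phi> \<in> test_fun" shows "is_weak_grad \<phi> (jac \<phi>)"
  unfolding is_weak_grad_def
proof (intro conjI allI impI)
  show "locally_integrable \<phi>" "locally_integrable (jac \<phi>)"
    by (intro band_locally_integrable test_fun_band \<phi> jac_test_fun)+
  fix f :: "real^3 \<Rightarrow> real" and i j assume f: "f \<in> test_fun"
  show "(\<integral>x. \<phi> x $ i * pderivative j f x \<partial>lborel) = - (\<integral>x. jac \<phi> x $ i $ j * f x \<partial>lborel)"
    unfolding jac_def by (simp add: integral_by_parts_test[OF f smooth_component[OF test_funD(1)[OF \<phi>]]])
qed

lemma is_weak_grad_scaleR: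
  assumes "is_weak_grad w G" shows "is_weak_grad (\<lambda>x. c *\<^sub>R w x) (\<lambda>x. c *\<^sub>R G x)"
  using assms unfolding is_weak_grad_def by (auto simp: locally_integrable_scaleR mult.assoc)

lemma L2_AE_cong:
  assumes "w \<in> L2" "AE x in lborel. w x = w' x" "w' \<in> borel_measurable borel" shows "w' \<in> L2"
proof -
  have "(\<integral>\<^sup>+x. ennreal ((norm (w' x))\<^sup>2) \<partial>lborel) = (\<integral>\<^sup>+x. ennreal ((norm (w x))\<^sup>2) \<partial>lborel)"
    by (rule nn_integral_cong_AE) (use assms(2) in auto)
  then show ?thesis using assms by (simp add: L2_iff)
qed

lemma L2_norm_AE_cong: "AE x in lborel. v x = w x \<Longrightarrow> v \<in> borel_measurable borel \<Longrightarrow> w \<in> borel_measurable borel \<Longrightarrow> L2_norm v = L2_norm w"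
  unfolding L2_norm_def by (auto intro!: integral_cong_AE arg_cong[where f=sqrt])

lemma L2_norm_scaleR: "L2_norm (\<lambda>x. c *\<^sub>R w x) = \<bar>c\<bar> * L2_norm w"
  unfolding L2_norm_def by (simp add: power_mult_distrib real_sqrt_mult)

lemma L2_inner_AE_cong:
  "AE x in lborel. v x = w x \<Longrightarrow> v \<in> borel_measurable borel \<Longrightarrow> w \<in> borel_measurable borel \<Longrightarrow> z \<in> borel_measurable borel \<Longrightarrow> L2_inner z v = L2_inner z w"
  unfolding L2_inner_def by (intro integral_cong_AE borel_measurable_inner) auto

section \<open>Integrals over time intervals\<close>

lemma continuous_integrable_Ioo:
  fixes f :: "real \<Rightarrow> real"
  assumes f: "continuous_on UNIV f"
  shows "integrable (lebesgue_on {a<..<b}) f"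
    and "(\<integral>t. f t \<partial>lebesgue_on {a<..<b}) = (\<integral>t. indicator {a..b} t *\<^sub>R f t \<partial>lborel)"
proof -
  have fm[measurable]: "f \<in> borel_measurable borel" using f by (rule borel_measurable_continuous_onI)
  have i: "integrable lborel (\<lambda>t. indicator {a..b} t *\<^sub>R f t)"
    by (intro borel_integrable_compact continuous_on_subset[OF f]) auto
  have "integrable lborel (\<lambda>t. indicator {a<..<b} t *\<^sub>R f t)"
    by (rule Bochner_Integration.integrable_bound[OF i]) (auto simp: indicator_def)
  then have "integrable lebesgue (\<lambda>t. indicator {a<..<b} t *\<^sub>R f t)"
    by (subst integrable_completion) auto
  then show "integrable (lebesgue_on {a<..<b}) f"
    by (subst integrable_restrict_space) auto
  have "(\<integral>t. f t \<partial>lebesgue_on {a<..<b}) = (\<integral>t. indicator {a<..<b} t *\<^sub>R f t \<partial>lebesgue)"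
    by (subst integral_restrict_space) auto
  also have "\<dots> = (\<integral>t. indicator {a<..<b} t *\<^sub>R f t \<partial>lborel)"
    by (subst integral_completion) auto
  also have "\<dots> = (\<integral>t. indicator {a..b} t *\<^sub>R f t \<partial>lborel)"
  proof (rule integral_cong_AE)
    have "AE t in lborel. t \<noteq> a" "AE t in lborel. t \<noteq> b" by (rule AE_lborel_singleton)+
    then show "AE t in lborel. indicator {a<..<b} t *\<^sub>R f t = indicator {a..b} t *\<^sub>R f t"
      by eventually_elim (auto simp: indicator_def)
  qed auto
  finally show "(\<integral>t. f t \<partial>lebesgue_on {a<..<b}) = (\<integral>t. indicator {a..b} t *\<^sub>R f t \<partial>lborel)" .
qed

lemma integral_deriv_Ioo:
  fixes F f :: "real \<Rightarrow> real"
  assumes "a \<le> b" "\<And>t. (F has_real_derivative f t) (at t)" "continuous_on UNIV f"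
  shows "(\<integral>t. f t \<partial>lebesgue_on {a<..<b}) = F b - F a"
proof -
  have "(\<integral>t. f t * indicator {a..b} t \<partial>lborel) = F b - F a"
    by (rule integral_FTC_Icc_real) (use assms in \<open>auto simp: continuous_on_eq_continuous_at\<close>)
  then show ?thesis by (subst continuous_integrable_Ioo(2)) (simp_all add: assms mult.commute)
qed

lemma test_fun_real_deriv:
  fixes \<theta> :: "real \<Rightarrow> real" assumes "\<theta> \<in> test_fun"
  shows "(\<theta> has_real_derivative deriv \<theta> t) (at t)" "continuous_on UNIV (deriv \<theta>)"
proof -
  have 1: "Ck 1 \<theta>" using assms by (simp add: test_fun_def smooth_def)
  have d: "(\<theta> has_real_derivative frechet_derivative \<theta> (at t) 1) (at t)" for t
  proof -
    have td: "\<theta> differentiable (at t)" using 1 by simp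
    then have "(\<theta> has_derivative frechet_derivative \<theta> (at t)) (at t)" by (simp add: frechet_derivative_works)
    moreover have "frechet_derivative \<theta> (at t) = (*) (frechet_derivative \<theta> (at t) 1)"
    proof
      fix h
      have "frechet_derivative \<theta> (at t) (h *\<^sub>R 1) = h *\<^sub>R frechet_derivative \<theta> (at t) 1"
        by (rule linear_cmul[OF linear_frechet_derivative[OF td]])
      then show "frechet_derivative \<theta> (at t) h = frechet_derivative \<theta> (at t) 1 * h"
        by (simp add: mult.commute[of h])
    qed
    ultimately show ?thesis by (simp add: has_field_derivative_def)
  qed
  then have e: "deriv \<theta> = (\<lambda>t. frechet_derivative \<theta> (at t) 1)" by (auto intro!: ext DERIV_imp_deriv)
  show "(\<theta> has_real_derivative deriv \<theta> t) (at t)" unfolding e by (rule d)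
  show "continuous_on UNIV (deriv \<theta>)" unfolding e using 1 by simp
qed

text \<open>Besides being the spectral cutoff, \<open>c\<close> is the bump function from which mollifiers and truncations in
  physical space are made.\<close>

locale cutoff =
  fixes k :: "real^3" and \<delta> :: real and c :: "real^3 \<Rightarrow> real"
  assumes \<delta>: "\<delta> > 0" and cut: "is_cutoff k \<delta> c"
begin

lemma compact_cube: "compact (cube k \<delta>)"
proof -
  have "cube k \<delta> = cbox (k - \<delta> *\<^sub>R (\<chi> i. 1)) (k + \<delta> *\<^sub>R (\<chi> i. 1))"
    by (auto simp: cube_def mem_box_cart abs_le_iff algebra_simps)
  then show ?thesis by simp
qed

lemma c_bounds: "0 \<le> c x" "c x \<le> 1" using cut by (auto simp: is_cutoff_def)

lemma c_eq_0: "x \<notin> cube k \<delta> \<Longrightarrow> c x = 0"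
  using cut closure_subset[of "{x. c x \<noteq> 0}"] by (auto simp: is_cutoff_def supp_def)

lemma c_eq_1: "x \<in> cube k (\<delta> / 2) \<Longrightarrow> c x = 1"
  using cut by (auto simp: is_cutoff_def)

lemma c_test: "c \<in> test_fun"
proof (rule test_funI)
  show "smooth c" using cut by (simp add: is_cutoff_def)
  show "bounded {x. c x \<noteq> 0}"
    by (rule bounded_subset[OF compact_imp_bounded[OF compact_cube]]) (use c_eq_0 in blast)
qed

text \<open>c equals 1 on a ball about k, so a vanishing integral would make that ball a null set.
  This is the normalization that \<open>AE_zero_if_test_integrals_zero\<close> asks of its
  mollifier.\<close>

lemma c_integral: "(\<integral>x. c x \<partial>lborel) \<noteq> 0"
proof
  assume z: "(\<integral>x. c x \<partial>lborel) = 0"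
  have i: "integrable lborel c" by (intro band_integrable test_fun_band c_test)
  have "AE x in lborel. c x = 0"
    using integral_nonneg_eq_0_iff_AE[OF i] z c_bounds(1) by simp
  moreover have "c x \<noteq> 0" if "x \<in> ball k (\<delta>/2)" for x
  proof -
    have "\<bar>x $ i - k $ i\<bar> \<le> \<delta> / 2" for i
      using component_le_norm_cart[of "x - k" i] that by (simp add: dist_norm norm_minus_commute)
    then have "x \<in> cube k (\<delta> / 2)" by (simp add: cube_def)
    then show ?thesis by (simp add: c_eq_1)
  qed
  ultimately have "AE x in lborel. x \<notin> ball k (\<delta>/2)" by (auto elim: eventually_mono)
  then have "emeasure lborel (ball k (\<delta>/2)) = 0"
    using AE_iff_null_sets[of "ball k (\<delta>/2)" lborel] by (auto dest: null_setsD1)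
  moreover have "emeasure lborel (ball k (\<delta>/2)) \<noteq> 0"
    using \<delta> by (simp add: emeasure_ball unit_ball_vol_pos less_imp_neq[symmetric])
  ultimately show False by simp
qed

text \<open>Makes the choice in \<open>wgrad\<close> harmless; it is the fundamental lemma in each
  entry, with c as mollifier.\<close>

lemma weak_grad_unique:
  assumes "is_weak_grad w G" "is_weak_grad w G'"
  shows "AE x in lborel. G x = G' x"
proof -
  have "AE x in lborel. G x $ i $ j - G' x $ i $ j = 0" for i j
  proof (rule AE_zero_if_test_integrals_zero[OF _ c_test c_bounds(1) c_integral])
    have 1: "locally_integrable (\<lambda>x. G x $ i $ j)" "locally_integrable (\<lambda>x. G' x $ i $ j)"
      using assms by (auto simp: is_weak_grad_def intro!: locally_integrable_linear[where L="\<lambda>M. M $ i $ j"] bounded_linear_compose[OF bounded_linear_vec_nth bounded_linear_vec_nth])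
    then show "locally_integrable (\<lambda>x. G x $ i $ j - G' x $ i $ j)"
      unfolding locally_integrable_def by (auto intro: set_integral_diff)
    fix \<phi> :: "real^3 \<Rightarrow> real" assume \<phi>: "\<phi> \<in> test_fun"
    have "(\<integral>x. G x $ i $ j * \<phi> x \<partial>lborel) = (\<integral>x. G' x $ i $ j * \<phi> x \<partial>lborel)"
    proof -
      have "(\<integral>x. w x $ i * pderivative j \<phi> x \<partial>lborel) = - (\<integral>x. G x $ i $ j * \<phi> x \<partial>lborel)"
        using assms(1) \<phi> unfolding is_weak_grad_def by blast
      moreover have "(\<integral>x. w x $ i * pderivative j \<phi> x \<partial>lborel) = - (\<integral>x. G' x $ i $ j * \<phi> x \<partial>lborel)"
        using assms(2) \<phi> unfolding is_weak_grad_def by blast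
      ultimately show ?thesis by linarith
    qed
    then show "(\<integral>x. (G x $ i $ j - G' x $ i $ j) * \<phi> x \<partial>lborel) = 0"
      unfolding left_diff_distrib
      by (subst Bochner_Integration.integral_diff) (auto intro!: locally_integrable_mult_test 1 test_fun_band \<phi>)
  qed
  then have "AE x in lborel. \<forall>i j. G x $ i $ j - G' x $ i $ j = 0"
    by (simp add: AE_all_countable)
  then show ?thesis by eventually_elim (simp add: vec_eq_iff)
qed

lemma is_weak_grad_wgrad: "is_weak_grad w G \<Longrightarrow> is_weak_grad w (wgrad w)"
  unfolding wgrad_def using someI[of "is_weak_grad w" G] by simp

lemma wgrad_AE: "is_weak_grad w G \<Longrightarrow> AE x in lborel. wgrad w x = G x"
  by (rule weak_grad_unique[OF is_weak_grad_wgrad])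

lemma wgrad_measurable: "is_weak_grad w G \<Longrightarrow> wgrad w \<in> borel_measurable borel"
  using is_weak_grad_wgrad[of w G] by (simp add: is_weak_grad_def locally_integrable_def)

lemma H1_wgrad:
  assumes "w \<in> H1" shows "is_weak_grad w (wgrad w)" "wgrad w \<in> L2"
proof -
  from assms obtain G where G: "is_weak_grad w G" "G \<in> L2" by (auto simp: H1_def)
  show "is_weak_grad w (wgrad w)" by (rule is_weak_grad_wgrad[OF G(1)])
  have "AE x in lborel. G x = wgrad w x" using wgrad_AE[OF G(1)] by eventually_elim simp
  then show "wgrad w \<in> L2" by (rule L2_AE_cong[OF G(2) _ wgrad_measurable[OF G(1)]])
qed

lemma test_H1: "\<phi> \<in> test_fun \<Longrightarrow> \<phi> \<in> H1"
  unfolding H1_def using is_weak_grad_test band_L2[OF test_fun_band] band_L2[OF test_fun_band[OF jac_test_fun]] by blast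

text \<open>\<open>wgrad\<close> of a multiple is a separate choice, so homogeneity of the gradient
  holds only almost everywhere; the norm does not see the difference.\<close>

lemma H1_norm_scaleR_test:
  assumes \<phi>: "\<phi> \<in> test_fun" shows "H1_norm (\<lambda>x. a *\<^sub>R \<phi> x) = \<bar>a\<bar> * H1_norm \<phi>"
proof -
  have w: "is_weak_grad (\<lambda>x. a *\<^sub>R \<phi> x) (\<lambda>x. a *\<^sub>R wgrad \<phi> x)"
    by (rule is_weak_grad_scaleR[OF is_weak_grad_wgrad[OF is_weak_grad_test[OF \<phi>]]])
  note [measurable] = wgrad_measurable[OF is_weak_grad_test[OF \<phi>]] wgrad_measurable[OF w]
  have "L2_norm (wgrad (\<lambda>x. a *\<^sub>R \<phi> x)) = L2_norm (\<lambda>x. a *\<^sub>R wgrad \<phi> x)"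
    by (rule L2_norm_AE_cong[OF wgrad_AE[OF w]]) auto
  then have "(L2_norm (\<lambda>x. a *\<^sub>R \<phi> x))\<^sup>2 + (L2_norm (wgrad (\<lambda>x. a *\<^sub>R \<phi> x)))\<^sup>2 = a\<^sup>2 * ((L2_norm \<phi>)\<^sup>2 + (L2_norm (wgrad \<phi>))\<^sup>2)"
    by (simp add: L2_norm_scaleR power_mult_distrib distrib_left)
  then show ?thesis unfolding H1_norm_def by (simp add: real_sqrt_mult)
qed

lemma solenoidal_scaleR:
  assumes "\<phi> \<in> solenoidal_test" shows "(\<lambda>x. a *\<^sub>R \<phi> x) \<in> solenoidal_test"
proof -
  have t: "\<phi> \<in> test_fun" using assms by (simp add: solenoidal_test_def)
  have "pderivative j (\<lambda>x. a *\<^sub>R \<phi> x) x = a *\<^sub>R pderivative j \<phi> x" for j x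
    by (rule pderivative_linear[OF bounded_linear_scaleR_right smooth_differentiable[OF test_funD(1)[OF t]]])
  then show ?thesis
    using assms test_fun_linear[OF bounded_linear_scaleR_right t, of a]
    by (simp add: solenoidal_test_def sum_distrib_left[symmetric])
qed

lemma solenoidal_H1_sigma:
  assumes "\<phi> \<in> solenoidal_test" shows "\<phi> \<in> H1_sigma \<inter> L2"
proof -
  have t: "\<phi> \<in> test_fun" using assms by (simp add: solenoidal_test_def)
  \<comment> \<open>The gradient of the zero field is again a choice, so its norm is computed from
    homogeneity with factor 0.\<close>
  have "H1_norm (\<lambda>x. \<phi> x - \<phi> x) = 0" using H1_norm_scaleR_test[OF t, of 0] by simp
  then have "\<forall>e>0. \<exists>\<psi>\<in>solenoidal_test. H1_norm (\<lambda>x. \<phi> x - \<psi> x) < e" using assms by metis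
  then show ?thesis unfolding H1_sigma_def
    using test_H1[OF t] by (simp add: H1_def)
qed

text \<open>Scalar simple functions approximating \<theta>, multiplied by \<phi>, are the simple
  functions that \<open>strongly_measurable\<close> wants; homogeneity of the norm turns their
  convergence into scalar convergence.\<close>

lemma L2_time_test:
  assumes \<phi>: "\<phi> \<in> solenoidal_test" and \<theta>: "continuous_on UNIV \<theta>"
  shows "(\<lambda>t x. \<theta> t *\<^sub>R \<phi> x) \<in> L2_time {0<..<T} (H1_sigma \<inter> L2) H1_norm"
proof -
  have t: "\<phi> \<in> test_fun" using \<phi> by (simp add: solenoidal_test_def)
  have mem: "(\<lambda>x. a *\<^sub>R \<phi> x) \<in> H1_sigma \<inter> L2" for a by (intro solenoidal_H1_sigma solenoidal_scaleR \<phi>)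
  have m: "\<theta> \<in> borel_measurable (lebesgue_on {0<..<T})"
    using borel_measurable_integrable[OF continuous_integrable_Ioo(1)[OF \<theta>]] .
  obtain F where F: "\<And>i. simple_function (lebesgue_on {0<..<T}) (F i)" "\<And>x. x \<in> space (lebesgue_on {0<..<T}) \<Longrightarrow> (\<lambda>i. F i x) \<longlonglongrightarrow> \<theta> x"
    using borel_measurable_implies_sequence_metric[OF m, of 0] by blast
  have "strongly_measurable {0<..<T} (H1_sigma \<inter> L2) H1_norm (\<lambda>t x. \<theta> t *\<^sub>R \<phi> x)"
    unfolding strongly_measurable_def
  proof (intro conjI exI[of _ "\<lambda>n t x. F n t *\<^sub>R \<phi> x"] allI)
    show "AE t in lebesgue_on {0<..<T}. (\<lambda>x. \<theta> t *\<^sub>R \<phi> x) \<in> H1_sigma \<inter> L2" by (rule AE_I2) (rule mem)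
    show "simple_function (lebesgue_on {0<..<T}) (\<lambda>t x. F n t *\<^sub>R \<phi> x)" for n
      by (rule simple_function_compose1[OF F(1), of "\<lambda>a x. a *\<^sub>R \<phi> x"])
    show "(\<lambda>t x. F n t *\<^sub>R \<phi> x) ` {0<..<T} \<subseteq> H1_sigma \<inter> L2" for n using mem by blast
    show "AE t in lebesgue_on {0<..<T}. (\<lambda>n. H1_norm (\<lambda>x. F n t *\<^sub>R \<phi> x - \<theta> t *\<^sub>R \<phi> x)) \<longlonglongrightarrow> 0"
    proof (rule AE_I2)
      fix s assume "s \<in> space (lebesgue_on {0<..<T})"
      from F(2)[OF this] have "(\<lambda>n. \<bar>F n s - \<theta> s\<bar> * H1_norm \<phi>) \<longlonglongrightarrow> 0"
        by (intro tendsto_mult_left_zero) (simp add: LIM_zero_iff tendsto_rabs_zero_iff)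
      then show "(\<lambda>n. H1_norm (\<lambda>x. F n s *\<^sub>R \<phi> x - \<theta> s *\<^sub>R \<phi> x)) \<longlonglongrightarrow> 0"
        by (simp add: scaleR_diff_left[symmetric] H1_norm_scaleR_test t)
    qed
  qed
  moreover have "integrable (lebesgue_on {0<..<T}) (\<lambda>s. (H1_norm (\<lambda>x. \<theta> s *\<^sub>R \<phi> x))\<^sup>2)"
    unfolding H1_norm_scaleR_test[OF t] by (intro continuous_integrable_Ioo(1) continuous_intros \<theta>)
  ultimately show ?thesis by (simp add: L2_time_def)
qed

text \<open>Products \<theta>(t) \<phi>(x) are admissible in the weak formulation. They are the only
  test fields inserted into it; all others are reached through limits in \<phi> and in
  \<theta>.\<close>

lemma H1_time_test_product:
  assumes \<phi>: "\<phi> \<in> solenoidal_test" and \<theta>: "\<And>t. (\<theta> has_real_derivative \<theta>' t) (at t)" "continuous_on UNIV \<theta>'" and T: "T > 0"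
  shows "H1_time_test T (\<lambda>t x. \<theta> t *\<^sub>R \<phi> x) (\<lambda>t x. \<theta>' t *\<^sub>R \<phi> x)"
proof -
  have t: "\<phi> \<in> test_fun" using \<phi> by (simp add: solenoidal_test_def)
  have c: "continuous_on UNIV \<theta>" using \<theta>(1) by (meson DERIV_continuous continuous_at_imp_continuous_on)
  have wd: "is_weak_time_deriv T (\<lambda>t x. \<theta> t *\<^sub>R \<phi> x) (\<lambda>t x. \<theta>' t *\<^sub>R \<phi> x)"
    unfolding is_weak_time_deriv_def
  proof (intro allI impI ballI, elim conjE)
    fix \<eta> :: "real \<Rightarrow> real" and w :: field assume \<eta>: "\<eta> \<in> test_fun" "supp \<eta> \<subseteq> {0<..<T}" and w: "w \<in> L2"
    let ?a = "L2_inner \<phi> w"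
    note d = test_fun_real_deriv[OF \<eta>(1)]
    have ce: "continuous_on UNIV \<eta>" using d(1) by (meson DERIV_continuous continuous_at_imp_continuous_on)
    \<comment> \<open>The support lies in the open interval, so the product rule leaves no boundary
      terms.\<close>
    have z: "\<eta> 0 = 0" "\<eta> T = 0" using \<eta>(2) closure_subset[of "{x. \<eta> x \<noteq> 0}"] by (auto simp: supp_def)
    have "(\<integral>s. (deriv \<eta> s * \<theta> s + \<eta> s * \<theta>' s) * ?a \<partial>lebesgue_on {0<..<T}) = \<eta> T * \<theta> T * ?a - \<eta> 0 * \<theta> 0 * ?a"
      by (rule integral_deriv_Ioo) (use T in \<open>auto intro!: derivative_eq_intros d \<theta> continuous_intros c ce\<close>)
    then have "(\<integral>s. deriv \<eta> s * (\<theta> s * ?a) + \<eta> s * (\<theta>' s * ?a) \<partial>lebesgue_on {0<..<T}) = 0"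
      by (simp add: z algebra_simps)
    moreover have "integrable (lebesgue_on {0<..<T}) (\<lambda>s. deriv \<eta> s * (\<theta> s * ?a))" "integrable (lebesgue_on {0<..<T}) (\<lambda>s. \<eta> s * (\<theta>' s * ?a))"
      by (intro continuous_integrable_Ioo(1) continuous_intros d c ce \<theta>)+
    ultimately show "(\<integral>s. deriv \<eta> s * L2_inner (\<lambda>x. \<theta> s *\<^sub>R \<phi> x) w \<partial>lebesgue_on {0<..<T}) =
        - (\<integral>s. \<eta> s * L2_inner (\<lambda>x. \<theta>' s *\<^sub>R \<phi> x) w \<partial>lebesgue_on {0<..<T})"
      by (simp add: L2_inner_scaleR_left)
  qed
  have lim: "((\<lambda>s. H1_norm (\<lambda>x. \<theta> s *\<^sub>R \<phi> x - \<theta> r *\<^sub>R \<phi> x)) \<longlongrightarrow> 0) (at r within {0..T})" for r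
  proof -
    have "(\<theta> \<longlongrightarrow> \<theta> r) (at r within {0..T})"
      using c by (meson UNIV_I continuous_on_def tendsto_within_subset subset_UNIV)
    then have "((\<lambda>s. \<bar>\<theta> s - \<theta> r\<bar> * H1_norm \<phi>) \<longlongrightarrow> 0) (at r within {0..T})"
      by (intro tendsto_mult_left_zero) (simp add: LIM_zero_iff tendsto_rabs_zero_iff)
    then show ?thesis by (simp add: scaleR_diff_left[symmetric] H1_norm_scaleR_test t)
  qed
  show ?thesis unfolding H1_time_test_def
    using L2_time_test[OF \<phi> c] L2_time_test[OF \<phi> \<theta>(2)] wd lim solenoidal_H1_sigma[OF solenoidal_scaleR[OF \<phi>]] by blast
qed

end

section \<open>The weak equations in divergence form\<close>

definition bmeas :: "(real^3 \<Rightarrow> real) \<Rightarrow> bool" where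
  "bmeas m \<longleftrightarrow> m \<in> borel_measurable borel \<and> (\<exists>C. \<forall>x. \<bar>m x\<bar> \<le> C)"

lemma bmeasE:
  assumes "bmeas m"
  obtains C where "C \<ge> 0" "\<And>x. \<bar>m x\<bar> \<le> C" "m \<in> borel_measurable borel"
  using assms unfolding bmeas_def by (meson abs_ge_zero order_trans)

lemma band_bmeas: "band m \<Longrightarrow> bmeas m"
  by (auto simp: band_def bmeas_def)

text \<open>Meant for two square-integrable factors and one bounded factor, the shape of the
  quadratic terms once the derivative falls on the test field.\<close>

definition trip :: "(real^3 \<Rightarrow> real) \<Rightarrow> (real^3 \<Rightarrow> real) \<Rightarrow> (real^3 \<Rightarrow> real) \<Rightarrow> real" where
  "trip f g m = (\<integral>x. f x * g x * m x \<partial>lborel)"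

lemma trip_integrable:
  assumes f: "f \<in> L2" and g: "g \<in> L2" and m: "bmeas m"
  shows "integrable lborel (\<lambda>x. f x * g x * m x)"
proof -
  obtain C where C: "C \<ge> 0" "\<And>x. \<bar>m x\<bar> \<le> C" and [measurable]: "m \<in> borel_measurable borel" using bmeasE[OF m] by metis
  note [measurable] = L2_measurable[OF f] L2_measurable[OF g]
  show ?thesis
  proof (rule integrable_dominated)
    show "integrable lborel (\<lambda>x. norm (f x) * norm (g x) * C)"
      by (intro integrable_mult_left L2_norm_mult_integrable f g)
    fix x show "norm (f x * g x * m x) \<le> norm (f x) * norm (g x) * C"
      unfolding norm_mult using C by (intro mult_left_mono) auto
  qed simp
qed

lemma trip_le:
  assumes f: "f \<in> L2" and g: "g \<in> L2" and C: "\<And>x. \<bar>m x\<bar> \<le> C" and m: "m \<in> borel_measurable borel"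
  shows "\<bar>trip f g m\<bar> \<le> C * (L2_norm f * L2_norm g)"
proof -
  have C0: "C \<ge> 0" using C[of 0] by linarith
  have "\<bar>trip f g m\<bar> \<le> (\<integral>x. norm (f x) * norm (g x) * C \<partial>lborel)"
    unfolding trip_def
  proof (rule integral_abs_bound_integral)
    show "integrable lborel (\<lambda>x. f x * g x * m x)" using C m by (intro trip_integrable f g) (auto simp: bmeas_def)
    show "integrable lborel (\<lambda>x. norm (f x) * norm (g x) * C)"
      by (intro integrable_mult_left L2_norm_mult_integrable f g)
    fix x show "\<bar>f x * g x * m x\<bar> \<le> norm (f x) * norm (g x) * C"
      unfolding abs_mult real_norm_def using C by (intro mult_left_mono) auto
  qed
  also have "\<dots> = C * (\<integral>x. norm (f x) * norm (g x) \<partial>lborel)" by simp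
  also have "\<dots> \<le> C * (L2_norm f * L2_norm g)"
    by (intro mult_left_mono L2_norm_mult_le f g C0)
  finally show ?thesis .
qed

lemma L2_norm_uminus_diff: "L2_norm (\<lambda>x. v x - w x) = L2_norm (\<lambda>x. w x - v x)"
  unfolding L2_norm_def by (simp add: norm_minus_commute)

lemma L2_norm_triangle:
  assumes v: "v \<in> L2" and w: "w \<in> L2"
  shows "L2_norm (\<lambda>x. v x + w x) \<le> L2_norm v + L2_norm w"
proof (rule power2_le_imp_le)
  have "(L2_norm (\<lambda>x. v x + w x))\<^sup>2 = L2_inner (\<lambda>x. v x + w x) (\<lambda>x. v x + w x)"
    unfolding L2_norm_sq L2_inner_def power2_norm_eq_inner ..
  also have "\<dots> = L2_inner v v + 2 * L2_inner v w + L2_inner w w"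
    using v w by (simp add: L2_inner_add_left L2_inner_add_right L2_add L2_inner_commute[of w v])
  also have "\<dots> \<le> (L2_norm v)\<^sup>2 + 2 * (L2_norm v * L2_norm w) + (L2_norm w)\<^sup>2"
    using L2_inner_le[OF v w] by (simp add: L2_norm_sq L2_inner_def power2_norm_eq_inner)
  finally show "(L2_norm (\<lambda>x. v x + w x))\<^sup>2 \<le> (L2_norm v + L2_norm w)\<^sup>2"
    by (simp add: power2_sum)
qed simp

lemma L2_norm_le_diff:
  assumes v: "v \<in> L2" and w: "w \<in> L2"
  shows "L2_norm v \<le> L2_norm (\<lambda>x. v x - w x) + L2_norm w"
  using L2_norm_triangle[OF L2_diff[OF v w] w] by simp

lemma L2_norm_mono:
  assumes v: "v \<in> L2" and w: "w \<in> borel_measurable borel" and le: "\<And>x. norm (w x) \<le> norm (v x)"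
  shows "L2_norm w \<le> L2_norm v"
  unfolding L2_norm_def
  by (intro real_sqrt_le_mono integral_mono L2_integrable v L2_dominated[OF v w le] power_mono le) auto

lemma L2_norm_component_le:
  fixes w :: "real^3 \<Rightarrow> 'b::euclidean_space ^ 'n"
  assumes w: "w \<in> L2" shows "L2_norm (\<lambda>x. w x $ i) \<le> L2_norm w"
  by (rule L2_norm_mono[OF w L2_measurable[OF L2_component[OF w]]]) (rule Finite_Cartesian_Product.norm_nth_le)

lemma L2_component_tendsto:
  fixes w :: "real^3 \<Rightarrow> 'b::euclidean_space ^ 'n"
  assumes "\<And>n. s n \<in> L2" "w \<in> L2" "(\<lambda>n. L2_norm (\<lambda>x. s n x - w x)) \<longlonglongrightarrow> 0"
  shows "(\<lambda>n::nat. L2_norm (\<lambda>x. s n x $ i - w x $ i)) \<longlonglongrightarrow> 0"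
proof (rule Lim_null_comparison[OF always_eventually assms(3)], rule allI)
  fix n
  show "norm (L2_norm (\<lambda>x. s n x $ i - w x $ i)) \<le> L2_norm (\<lambda>x. s n x - w x)"
    using L2_norm_component_le[OF L2_diff[OF assms(1) assms(2)], of n i] by simp
qed

lemma trip_diff_left: "f \<in> L2 \<Longrightarrow> f' \<in> L2 \<Longrightarrow> g \<in> L2 \<Longrightarrow> bmeas m \<Longrightarrow> trip (\<lambda>x. f x - f' x) g m = trip f g m - trip f' g m"
  unfolding trip_def by (subst Bochner_Integration.integral_diff[symmetric]) (auto simp: trip_integrable left_diff_distrib)

lemma trip_commute: "trip f g m = trip g f m"
  unfolding trip_def by (simp add: mult.commute mult.left_commute)

lemma trip_tendsto:
  assumes f: "\<And>n. f n \<in> L2" "f0 \<in> L2" "(\<lambda>n::nat. L2_norm (\<lambda>x. f n x - f0 x)) \<longlonglongrightarrow> 0"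
    and g: "\<And>n. g n \<in> L2" "g0 \<in> L2" "(\<lambda>n::nat. L2_norm (\<lambda>x. g n x - g0 x)) \<longlonglongrightarrow> 0"
    and m: "bmeas m"
  shows "(\<lambda>n. trip (f n) (g n) m) \<longlonglongrightarrow> trip f0 g0 m"
proof -
  obtain C where C: "C \<ge> 0" "\<And>x. \<bar>m x\<bar> \<le> C" "m \<in> borel_measurable borel" using bmeasE[OF m] by metis
  let ?a = "\<lambda>n. L2_norm (\<lambda>x. f n x - f0 x)" and ?b = "\<lambda>n. L2_norm (\<lambda>x. g n x - g0 x)"
  have est: "norm (trip (f n) (g n) m - trip f0 g0 m) \<le> C * (?a n * (?b n + L2_norm g0)) + C * (?b n * L2_norm f0)" for n
  proof -
    have "trip (f n) (g n) m - trip f0 g0 m = trip (\<lambda>x. f n x - f0 x) (g n) m + trip (\<lambda>x. g n x - g0 x) f0 m"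
      unfolding trip_diff_left[OF f(1,2) g(1) m] trip_diff_left[OF g(1,2) f(2) m]
        trip_commute[of "g n" f0] trip_commute[of g0 f0] by simp
    also have "norm \<dots> \<le> C * (?a n * L2_norm (g n)) + C * (?b n * L2_norm f0)"
      unfolding real_norm_def
      by (intro order_trans[OF abs_triangle_ineq] add_mono trip_le L2_diff f g C)
    also have "\<dots> \<le> C * (?a n * (?b n + L2_norm g0)) + C * (?b n * L2_norm f0)"
      by (intro add_right_mono mult_left_mono L2_norm_le_diff g C) simp
    finally show ?thesis .
  qed
  have "(\<lambda>n. C * (?a n * (?b n + L2_norm g0)) + C * (?b n * L2_norm f0)) \<longlonglongrightarrow> C * (0 * (0 + L2_norm g0)) + C * (0 * L2_norm f0)"
    by (intro tendsto_intros f g)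
  then have "(\<lambda>n. trip (f n) (g n) m - trip f0 g0 m) \<longlonglongrightarrow> 0"
    by (intro Lim_null_comparison[OF always_eventually[OF allI[OF est]]]) simp
  then show ?thesis by (simp add: LIM_zero_iff)
qed

text \<open>With M the Jacobian of \<phi> this is the pairing of q with (p . \<nabla>)
  \<phi>.\<close>

definition flux :: "field \<Rightarrow> field \<Rightarrow> (real^3 \<Rightarrow> real^3^3) \<Rightarrow> real" where
  "flux p q M = (\<Sum>i\<in>UNIV. \<Sum>j\<in>UNIV. trip (\<lambda>x. q x $ i) (\<lambda>x. p x $ j) (\<lambda>x. M x $ i $ j))"

lemma flux_tendsto:
  assumes "\<And>n. p n \<in> L2" "p0 \<in> L2" "(\<lambda>n::nat. L2_norm (\<lambda>x. p n x - p0 x)) \<longlonglongrightarrow> 0"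
    and "\<And>n. q n \<in> L2" "q0 \<in> L2" "(\<lambda>n::nat. L2_norm (\<lambda>x. q n x - q0 x)) \<longlonglongrightarrow> 0"
    and "\<And>i j. bmeas (\<lambda>x. M x $ i $ j)"
  shows "(\<lambda>n. flux (p n) (q n) M) \<longlonglongrightarrow> flux p0 q0 M"
  unfolding flux_def by (intro tendsto_sum trip_tendsto L2_component L2_component_tendsto assms)

lemma flux_le:
  assumes p: "p \<in> L2" and q: "q \<in> L2" and C: "\<And>x i j. \<bar>M x $ i $ j\<bar> \<le> C" and m: "\<And>i j. (\<lambda>x. M x $ i $ j) \<in> borel_measurable borel"
  shows "\<bar>flux p q M\<bar> \<le> 9 * C * (L2_norm p * L2_norm q)"
proof -
  have C0: "C \<ge> 0" using C[of 0 1 1] by linarith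
  have 1: "\<bar>trip (\<lambda>x. q x $ i) (\<lambda>x. p x $ j) (\<lambda>x. M x $ i $ j)\<bar> \<le> C * (L2_norm p * L2_norm q)" for i j
  proof -
    have "\<bar>trip (\<lambda>x. q x $ i) (\<lambda>x. p x $ j) (\<lambda>x. M x $ i $ j)\<bar> \<le> C * (L2_norm (\<lambda>x. q x $ i) * L2_norm (\<lambda>x. p x $ j))"
      by (intro trip_le L2_component p q C m)
    also have "\<dots> \<le> C * (L2_norm q * L2_norm p)"
      by (intro mult_left_mono mult_mono L2_norm_component_le p q C0) auto
    finally show ?thesis by (simp add: mult.commute)
  qed
  have "\<bar>flux p q M\<bar> \<le> (\<Sum>i\<in>(UNIV::3 set). \<Sum>j\<in>(UNIV::3 set). C * (L2_norm p * L2_norm q))"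
    unfolding flux_def by (intro order_trans[OF sum_abs] sum_mono 1)
  then show ?thesis by simp
qed

lemma L2_sigma_sequence:
  assumes "u \<in> L2_sigma"
  obtains v where "\<And>n::nat. v n \<in> solenoidal_test" "(\<lambda>n. L2_norm (\<lambda>x. v n x - u x)) \<longlonglongrightarrow> 0"
proof -
  have "\<forall>n::nat. \<exists>\<phi>\<in>solenoidal_test. L2_norm (\<lambda>x. u x - \<phi> x) < 1 / real (Suc n)"
    using assms unfolding L2_sigma_def by simp
  then obtain v where v: "\<And>n::nat. v n \<in> solenoidal_test" "\<And>n. L2_norm (\<lambda>x. u x - v n x) < 1 / real (Suc n)" by metis
  have "(\<lambda>n. L2_norm (\<lambda>x. v n x - u x)) \<longlonglongrightarrow> 0"
  proof (rule Lim_null_comparison[OF always_eventually LIMSEQ_Suc[OF lim_1_over_n]], rule allI)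
    fix n show "norm (L2_norm (\<lambda>x. v n x - u x)) \<le> 1 / real (Suc n)"
      using v(2)[of n] by (simp add: L2_norm_uminus_diff[of "v n"])
  qed
  with v(1) show thesis by (rule that)
qed

lemma L2_sigma_L2: "u \<in> L2_sigma \<Longrightarrow> u \<in> L2" by (simp add: L2_sigma_def)
lemma solenoidal_L2: "v \<in> solenoidal_test \<Longrightarrow> v \<in> L2" by (simp add: solenoidal_test_def band_L2 test_fun_band)
lemma H1_sigma_H1: "u \<in> H1_sigma \<Longrightarrow> u \<in> H1" by (simp add: H1_sigma_def)
lemma H1_L2: "u \<in> H1 \<Longrightarrow> u \<in> L2" by (simp add: H1_def)

lemma jac_nth: "jac \<phi> x $ i $ j = pderivative j (\<lambda>x. \<phi> x $ i) x" by (simp add: jac_def)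

lemma weak_grad_test:
  "is_weak_grad w G \<Longrightarrow> f \<in> test_fun \<Longrightarrow> (\<integral>x. w x $ i * pderivative j f x \<partial>lborel) = - (\<integral>x. G x $ i $ j * f x \<partial>lborel)"
  unfolding is_weak_grad_def by blast

text \<open>The weak gradient of w is tested with a component of v times f. The product rule leaves
  the derivative of f and a term with the divergence of v, which cancels in the sum over j.\<close>

lemma trip_by_parts_solenoidal:
  assumes v: "v \<in> solenoidal_test" and w: "w \<in> L2" and G: "is_weak_grad w G" and \<phi>: "(f :: real^3 \<Rightarrow> real) \<in> test_fun"
  shows "(\<Sum>j\<in>UNIV. trip (\<lambda>x. G x $ i $ j) (\<lambda>x. v x $ j) f) = - (\<Sum>j\<in>UNIV. trip (\<lambda>x. w x $ i) (\<lambda>x. v x $ j) (pderivative j f))"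
proof -
  have vt: "v \<in> test_fun" using v by (simp add: solenoidal_test_def)
  have vj: "(\<lambda>x. v x $ j) \<in> test_fun" for j by (rule test_fun_component[OF vt])
  note sm = test_funD(1)
  have li: "locally_integrable (\<lambda>x. w x $ i)" by (rule L2_locally_integrable[OF L2_component[OF w]])
  have 1: "trip (\<lambda>x. G x $ i $ j) (\<lambda>x. v x $ j) f =
      - ((\<integral>x. w x $ i * (pderivative j (\<lambda>x. v x $ j) x * f x) \<partial>lborel) + trip (\<lambda>x. w x $ i) (\<lambda>x. v x $ j) (pderivative j f))" for j
  proof -
    have "trip (\<lambda>x. G x $ i $ j) (\<lambda>x. v x $ j) f = - (\<integral>x. w x $ i * pderivative j (\<lambda>x. v x $ j * f x) x \<partial>lborel)"
      using weak_grad_test[OF G test_fun_mult[OF vj sm[OF \<phi>]], of i j j] by (simp add: trip_def mult.assoc)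
    also have "(\<integral>x. w x $ i * pderivative j (\<lambda>x. v x $ j * f x) x \<partial>lborel)
       = (\<integral>x. w x $ i * (pderivative j (\<lambda>x. v x $ j) x * f x) + w x $ i * (v x $ j * pderivative j f x) \<partial>lborel)"
      by (simp add: pderivative_mult smooth_differentiable sm[OF vj] sm[OF \<phi>] distrib_left)
    also have "\<dots> = (\<integral>x. w x $ i * (pderivative j (\<lambda>x. v x $ j) x * f x) \<partial>lborel) + trip (\<lambda>x. w x $ i) (\<lambda>x. v x $ j) (pderivative j f)"
      unfolding trip_def mult.assoc
      by (intro Bochner_Integration.integral_add locally_integrable_mult_test li test_fun_band test_fun_mult
           test_fun_pderivative vj sm \<phi>)
    finally show ?thesis .
  qed
  have "(\<Sum>j\<in>UNIV. \<integral>x. w x $ i * (pderivative j (\<lambda>x. v x $ j) x * f x) \<partial>lborel)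
     = (\<integral>x. (\<Sum>j\<in>UNIV. w x $ i * (pderivative j (\<lambda>x. v x $ j) x * f x)) \<partial>lborel)"
    by (intro Bochner_Integration.integral_sum[symmetric] locally_integrable_mult_test li test_fun_band test_fun_mult
           test_fun_pderivative vj sm \<phi>)
  also have "\<dots> = (\<integral>x. w x $ i * f x * (\<Sum>j\<in>UNIV. pderivative j v x $ j) \<partial>lborel)"
    by (simp add: pderivative_component sm[OF vt] sum_distrib_left mult_ac)
  also have "\<dots> = 0" using v by (simp add: solenoidal_test_def)
  finally have 0: "(\<Sum>j\<in>UNIV. \<integral>x. w x $ i * (pderivative j (\<lambda>x. v x $ j) x * f x) \<partial>lborel) = 0" .
  show ?thesis unfolding 1 sum_negf sum.distrib 0 by simp
qed

context cutoff begin

text \<open>The step to divergence form. v is approximated in L2 by solenoidal test fields, for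
  which the identity is \<open>trip_by_parts_solenoidal\<close>; no derivative falls on v on either
  side, so L2 convergence suffices.\<close>

lemma trilinear_eq:
  assumes v: "v \<in> L2_sigma" and w: "w \<in> H1" and \<phi>: "\<phi> \<in> test_fun"
  shows "trilinear v w \<phi> = - flux v w (jac \<phi>)"
proof -
  let ?G = "wgrad w"
  note G = H1_wgrad[OF w] and wL = H1_L2[OF w] and vL = L2_sigma_L2[OF v]
  have \<phi>i: "(\<lambda>x. \<phi> x $ i) \<in> test_fun" for i by (rule test_fun_component[OF \<phi>])
  have Gij: "(\<lambda>x. ?G x $ i $ j) \<in> L2" for i j by (intro L2_component G(2))
  have "trilinear v w \<phi> = (\<integral>x. (\<Sum>i\<in>UNIV. \<Sum>j\<in>UNIV. ?G x $ i $ j * v x $ j * \<phi> x $ i) \<partial>lborel)"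
    unfolding trilinear_def L2_inner_def by (simp add: inner_vec_def matrix_vector_mult_def sum_distrib_right)
  also have "\<dots> = (\<Sum>i\<in>UNIV. \<Sum>j\<in>UNIV. trip (\<lambda>x. ?G x $ i $ j) (\<lambda>x. v x $ j) (\<lambda>x. \<phi> x $ i))"
    unfolding trip_def
    by (subst Bochner_Integration.integral_sum, intro Bochner_Integration.integrable_sum trip_integrable Gij L2_component vL band_bmeas test_fun_band \<phi>i,
        intro sum.cong refl Bochner_Integration.integral_sum trip_integrable Gij L2_component vL band_bmeas test_fun_band \<phi>i)
  also have "\<dots> = (\<Sum>i\<in>UNIV. - (\<Sum>j\<in>UNIV. trip (\<lambda>x. w x $ i) (\<lambda>x. v x $ j) (pderivative j (\<lambda>x. \<phi> x $ i))))"
  proof (intro sum.cong refl)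
    fix i
    obtain s where s: "\<And>n::nat. s n \<in> solenoidal_test" "(\<lambda>n. L2_norm (\<lambda>x. s n x - v x)) \<longlonglongrightarrow> 0"
      by (rule L2_sigma_sequence[OF v], rule that)
    have sc: "(\<lambda>n. L2_norm (\<lambda>x. s n x $ j - v x $ j)) \<longlonglongrightarrow> 0" for j
      by (rule L2_component_tendsto[OF solenoidal_L2[OF s(1)] vL s(2)])
    have c: "(\<lambda>n. L2_norm (\<lambda>x. f x - f x :: real)) \<longlonglongrightarrow> 0" for f by (simp add: L2_norm_def)
    have 1: "(\<lambda>n. \<Sum>j\<in>UNIV. trip (\<lambda>x. ?G x $ i $ j) (\<lambda>x. s n x $ j) (\<lambda>x. \<phi> x $ i)) \<longlonglongrightarrow> (\<Sum>j\<in>UNIV. trip (\<lambda>x. ?G x $ i $ j) (\<lambda>x. v x $ j) (\<lambda>x. \<phi> x $ i))"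
      by (rule tendsto_sum, rule trip_tendsto[OF Gij Gij c L2_component[OF solenoidal_L2[OF s(1)]] L2_component[OF vL] sc band_bmeas[OF test_fun_band[OF \<phi>i]]])
    have 2: "(\<lambda>n. - (\<Sum>j\<in>UNIV. trip (\<lambda>x. w x $ i) (\<lambda>x. s n x $ j) (pderivative j (\<lambda>x. \<phi> x $ i)))) \<longlonglongrightarrow> - (\<Sum>j\<in>UNIV. trip (\<lambda>x. w x $ i) (\<lambda>x. v x $ j) (pderivative j (\<lambda>x. \<phi> x $ i)))"
      by (rule tendsto_minus, rule tendsto_sum, rule trip_tendsto[OF L2_component[OF wL] L2_component[OF wL] c L2_component[OF solenoidal_L2[OF s(1)]] L2_component[OF vL] sc band_bmeas[OF test_fun_band[OF test_fun_pderivative[OF \<phi>i]]]])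
    show "(\<Sum>j\<in>UNIV. trip (\<lambda>x. ?G x $ i $ j) (\<lambda>x. v x $ j) (\<lambda>x. \<phi> x $ i)) = - (\<Sum>j\<in>UNIV. trip (\<lambda>x. w x $ i) (\<lambda>x. v x $ j) (pderivative j (\<lambda>x. \<phi> x $ i)))"
      using LIMSEQ_unique[OF 1] 2 unfolding trip_by_parts_solenoidal[OF s(1) wL G(1) \<phi>i] by blast
  qed
  also have "\<dots> = - flux v w (jac \<phi>)"
    unfolding flux_def jac_nth sum_negf by (simp add: eta_contract_eq)
  finally show ?thesis .
qed

definition lap :: "field \<Rightarrow> field" where
  "lap \<phi> x = (\<chi> i. \<Sum>j\<in>UNIV. pderivative j (pderivative j (\<lambda>x. \<phi> x $ i)) x)"

lemma lap_test:
  assumes "\<phi> \<in> test_fun" shows "lap \<phi> \<in> test_fun"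
proof -
  have "(\<lambda>x. \<Sum>j\<in>I. pderivative j (pderivative j (\<lambda>x. \<phi> x $ i)) x) \<in> test_fun" for i and I :: "3 set"
  proof (induction I rule: infinite_finite_induct)
    case (insert j I)
    then show ?case by (simp add: test_fun_add test_fun_pderivative test_fun_component assms)
  qed (auto intro: test_funI)
  then show ?thesis by (intro test_fun_vec) (simp add: lap_def)
qed

text \<open>The entries of the Jacobian of \<phi> are themselves test functions, so the weak
  derivative of w can be moved onto them.\<close>

lemma wgrad_inner_eq:
  assumes w: "w \<in> H1" and \<phi>: "\<phi> \<in> test_fun"
  shows "L2_inner (wgrad w) (wgrad (\<lambda>x. a *\<^sub>R \<phi> x)) = - a * L2_inner w (lap \<phi>)"
proof -
  note G = H1_wgrad[OF w] and wL = H1_L2[OF w]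
  let ?G = "wgrad w"
  have \<phi>i: "(\<lambda>x. \<phi> x $ i) \<in> test_fun" for i by (rule test_fun_component[OF \<phi>])
  have g: "is_weak_grad (\<lambda>x. a *\<^sub>R \<phi> x) (\<lambda>x. a *\<^sub>R jac \<phi> x)"
    by (rule is_weak_grad_scaleR[OF is_weak_grad_test[OF \<phi>]])
  have [measurable]: "jac \<phi> \<in> borel_measurable borel" by (intro band_measurable test_fun_band jac_test_fun \<phi>)
  have "L2_inner ?G (wgrad (\<lambda>x. a *\<^sub>R \<phi> x)) = L2_inner ?G (\<lambda>x. a *\<^sub>R jac \<phi> x)"
    by (rule L2_inner_AE_cong[OF wgrad_AE[OF g] wgrad_measurable[OF g] _ L2_measurable[OF G(2)]]) simp
  also have "\<dots> = a * L2_inner ?G (jac \<phi>)" by (rule L2_inner_scaleR_right)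
  also have "L2_inner ?G (jac \<phi>) = (\<Sum>i\<in>UNIV. \<Sum>j\<in>UNIV. \<integral>x. ?G x $ i $ j * pderivative j (\<lambda>x. \<phi> x $ i) x \<partial>lborel)"
  proof -
    have i: "integrable lborel (\<lambda>x. ?G x $ i $ j * pderivative j (\<lambda>x. \<phi> x $ i) x)" for i j
      by (intro locally_integrable_mult_test L2_locally_integrable L2_component G(2) test_fun_band test_fun_pderivative \<phi>i)
    show ?thesis
      unfolding L2_inner_def inner_vec_def jac_nth inner_real_def
      by (subst Bochner_Integration.integral_sum, intro Bochner_Integration.integrable_sum i,
          intro sum.cong refl Bochner_Integration.integral_sum i)
  qed
  also have "\<dots> = (\<Sum>i\<in>UNIV. \<Sum>j\<in>UNIV. - (\<integral>x. w x $ i * pderivative j (pderivative j (\<lambda>x. \<phi> x $ i)) x \<partial>lborel))"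
    using weak_grad_test[OF G(1) test_fun_pderivative[OF \<phi>i]] by simp
  also have "\<dots> = - L2_inner w (lap \<phi>)"
  proof -
    have i: "integrable lborel (\<lambda>x. w x $ i * pderivative j (pderivative j (\<lambda>x. \<phi> x $ i)) x)" for i j
      by (intro locally_integrable_mult_test L2_locally_integrable L2_component wL test_fun_band test_fun_pderivative \<phi>i)
    show ?thesis
      unfolding L2_inner_def inner_vec_def lap_def inner_real_def vec_lambda_beta sum_distrib_left
      by (subst Bochner_Integration.integral_sum, intro Bochner_Integration.integrable_sum i,
          subst Bochner_Integration.integral_sum, rule i, simp add: sum_negf)
  qed
  finally show ?thesis by simp
qed

end

section \<open>Measurability and bounds in time\<close>

lemma measurable_lebesgue_on_AE:
  fixes f g :: "real \<Rightarrow> real"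
  assumes f: "f \<in> borel_measurable (lebesgue_on S)" and S: "S \<in> sets lebesgue" and ae: "AE x in lebesgue_on S. f x = g x"
  shows "g \<in> borel_measurable (lebesgue_on S)"
proof -
  have "(\<lambda>x. if x \<in> S then f x else 0) \<in> borel_measurable lebesgue"
    using f S by (simp add: borel_measurable_if)
  moreover have "AE x in lebesgue. (if x \<in> S then f x else 0) = (if x \<in> S then g x else 0)"
    using ae S by (subst (asm) AE_restrict_space_iff) (auto elim!: eventually_mono)
  ultimately have "(\<lambda>x. if x \<in> S then g x else 0) \<in> borel_measurable lebesgue" by (rule borel_measurable_AE)
  then show ?thesis using S by (simp add: borel_measurable_if)
qed

lemma integral_cong_AE_lebesgue_on:
  fixes f g :: "real \<Rightarrow> real"
  assumes g: "g \<in> borel_measurable (lebesgue_on S)" and S: "S \<in> sets lebesgue" and ae: "AE x in lebesgue_on S. f x = g x"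
  shows "integral\<^sup>L (lebesgue_on S) f = integral\<^sup>L (lebesgue_on S) g"
proof (rule integral_cong_AE[OF _ g ae])
  show "f \<in> borel_measurable (lebesgue_on S)"
    by (rule measurable_lebesgue_on_AE[OF g S]) (use ae in \<open>auto elim: eventually_mono\<close>)
qed

text \<open>Applied to fluxes and to pairings with the force. Along simple functions Q takes
  finitely many values; its joint sequential continuity carries measurability to the limit, and N
  only has to dominate the L2 norm on differences within X.\<close>

lemma strongly_measurable_functional:
  fixes Q :: "field \<Rightarrow> field \<Rightarrow> real"
  assumes v: "strongly_measurable S X N v" and w: "strongly_measurable S Y N' w" and S: "S \<in> sets lebesgue"
    and XY: "X \<subseteq> L2" "Y \<subseteq> L2"
    and N: "\<And>p q. p \<in> X \<Longrightarrow> q \<in> X \<Longrightarrow> L2_norm (\<lambda>x. p x - q x) \<le> N (\<lambda>x. p x - q x)"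
    and N': "\<And>p q. p \<in> Y \<Longrightarrow> q \<in> Y \<Longrightarrow> L2_norm (\<lambda>x. p x - q x) \<le> N' (\<lambda>x. p x - q x)"
    and Q: "\<And>p p0 q q0. (\<And>n::nat. p n \<in> L2) \<Longrightarrow> p0 \<in> L2 \<Longrightarrow> (\<lambda>n. L2_norm (\<lambda>x. p n x - p0 x)) \<longlonglongrightarrow> 0 \<Longrightarrow>
        (\<And>n::nat. q n \<in> L2) \<Longrightarrow> q0 \<in> L2 \<Longrightarrow> (\<lambda>n. L2_norm (\<lambda>x. q n x - q0 x)) \<longlonglongrightarrow> 0 \<Longrightarrow> (\<lambda>n. Q (p n) (q n)) \<longlonglongrightarrow> Q p0 q0"
  shows "(\<lambda>t. Q (v t) (w t)) \<in> borel_measurable (lebesgue_on S)"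
proof -
  from v obtain s where vX: "AE t in lebesgue_on S. v t \<in> X" and s: "\<And>n. simple_function (lebesgue_on S) (s n)" "\<And>n. s n ` S \<subseteq> X"
    and sl: "AE t in lebesgue_on S. (\<lambda>n::nat. N (\<lambda>x. s n t x - v t x)) \<longlonglongrightarrow> 0"
    unfolding strongly_measurable_def by blast
  from w obtain r where wY: "AE t in lebesgue_on S. w t \<in> Y" and r: "\<And>n. simple_function (lebesgue_on S) (r n)" "\<And>n. r n ` S \<subseteq> Y"
    and rl: "AE t in lebesgue_on S. (\<lambda>n::nat. N' (\<lambda>x. r n t x - w t x)) \<longlonglongrightarrow> 0"
    unfolding strongly_measurable_def by blast
  have m: "(\<lambda>t. Q (s n t) (r n t)) \<in> borel_measurable (lebesgue_on S)" for n
    using simple_function_compose1[OF simple_function_Pair[OF s(1) r(1)], of "\<lambda>(a, b). Q a b" n n]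
    by (intro borel_measurable_simple_function) simp
  have "AE t in lebesgue_on S. (\<lambda>n. Q (s n t) (r n t)) \<longlonglongrightarrow> Q (v t) (w t)"
    using vX wY sl rl AE_space[of "lebesgue_on S"]
  proof eventually_elim
    case (elim t)
    have t: "t \<in> S" using elim(5) by simp
    have sX: "s n t \<in> X" and rY: "r n t \<in> Y" for n using s(2)[of n] r(2)[of n] t by auto
    have 1: "(\<lambda>n. L2_norm (\<lambda>x. s n t x - v t x)) \<longlonglongrightarrow> 0"
      by (rule Lim_null_comparison[OF always_eventually elim(3)]) (use N[OF sX elim(1)] in auto)
    have 2: "(\<lambda>n. L2_norm (\<lambda>x. r n t x - w t x)) \<longlonglongrightarrow> 0"
      by (rule Lim_null_comparison[OF always_eventually elim(4)]) (use N'[OF rY elim(2)] in auto)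
    show ?case by (rule Q[OF _ _ 1 _ _ 2]) (use sX rY elim XY in auto)
  qed
  \<comment> \<open>\<open>lim\<close> is measurable regardless of convergence and agrees with the
    functional almost everywhere; completeness of Lebesgue measure concludes.\<close>
  then have "AE t in lebesgue_on S. lim (\<lambda>n. Q (s n t) (r n t)) = Q (v t) (w t)"
    by eventually_elim (rule limI)
  moreover have "(\<lambda>t. lim (\<lambda>n. Q (s n t) (r n t))) \<in> borel_measurable (lebesgue_on S)"
    by (rule borel_measurable_lim_metric) (rule m)
  ultimately show ?thesis by (rule measurable_lebesgue_on_AE[OF _ S, rotated])
qed

definition regular :: "(real \<Rightarrow> field) \<Rightarrow> bool" where
  "regular v \<longleftrightarrow> (\<forall>T>0. v \<in> Linf_time {0..<T} L2_sigma L2_norm \<inter> L2_time {0..<T} H1_sigma H1_norm) \<and> weakly_continuous_rep v"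

lemma AE_lebesgue_on_mono:
  assumes "AE t in lebesgue_on S. P t" "T \<subseteq> S" "S \<in> sets lebesgue" "T \<in> sets lebesgue"
  shows "AE t in lebesgue_on T. P t"
proof -
  have "AE t in lebesgue. t \<in> S \<longrightarrow> P t" using assms(1,3) by (simp add: AE_restrict_space_iff)
  then have "AE t in lebesgue. t \<in> T \<longrightarrow> P t" by eventually_elim (use assms(2) in blast)
  then show ?thesis using assms(4) by (simp add: AE_restrict_space_iff)
qed

lemma Ioo_Ico: "{0<..<T} \<subseteq> {0..<T::real}" by auto

lemma regular_AE:
  assumes v: "regular v" and T: "T > 0"
  shows "AE t in lebesgue_on {0<..<T}. v t \<in> L2_sigma" "AE t in lebesgue_on {0<..<T}. v t \<in> H1_sigma"
    "\<exists>C. AE t in lebesgue_on {0<..<T}. L2_norm (v t) \<le> C"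
proof -
  have L: "strongly_measurable {0..<T} L2_sigma L2_norm v" "strongly_measurable {0..<T} H1_sigma H1_norm v"
    and "\<exists>C. AE t in lebesgue_on {0..<T}. L2_norm (v t) \<le> C"
    using v T unfolding regular_def Linf_time_def L2_time_def by auto
  then obtain C where C: "AE t in lebesgue_on {0..<T}. L2_norm (v t) \<le> C" by blast
  show "AE t in lebesgue_on {0<..<T}. v t \<in> L2_sigma"
    by (rule AE_lebesgue_on_mono[OF _ Ioo_Ico]) (use L in \<open>auto simp: strongly_measurable_def\<close>)
  show "AE t in lebesgue_on {0<..<T}. v t \<in> H1_sigma"
    by (rule AE_lebesgue_on_mono[OF _ Ioo_Ico]) (use L in \<open>auto simp: strongly_measurable_def\<close>)
  show "\<exists>C. AE t in lebesgue_on {0<..<T}. L2_norm (v t) \<le> C"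
    by (rule exI, rule AE_lebesgue_on_mono[OF C Ioo_Ico]) auto
qed

lemma regular_L2: "regular v \<Longrightarrow> t \<ge> 0 \<Longrightarrow> v t \<in> L2"
  by (simp add: regular_def weakly_continuous_rep_def)

lemma regular_continuous: "regular v \<Longrightarrow> w \<in> L2 \<Longrightarrow> continuous_on {0..} (\<lambda>t. L2_inner (v t) w)"
  by (simp add: regular_def weakly_continuous_rep_def)

lemma regular_inner_measurable:
  assumes "regular v" "w \<in> L2"
  shows "(\<lambda>t. L2_inner (v t) w) \<in> borel_measurable (lebesgue_on {0<..<T})"
  by (rule continuous_imp_measurable_on_sets_lebesgue[OF continuous_on_subset[OF regular_continuous[OF assms]]]) auto

lemma measurable_lebesgue_on_mono:
  "f \<in> borel_measurable (lebesgue_on S) \<Longrightarrow> T \<subseteq> S \<Longrightarrow> f \<in> borel_measurable (lebesgue_on T)"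
  by (rule measurable_restrict_mono)

lemma regular_flux_measurable:
  assumes p: "regular p" and q: "regular q" and T: "T > 0" and M: "\<And>i j. bmeas (\<lambda>x. M x $ i $ j)"
  shows "(\<lambda>t. flux (p t) (q t) M) \<in> borel_measurable (lebesgue_on {0<..<T})"
proof (rule measurable_lebesgue_on_mono[OF _ Ioo_Ico])
  have "strongly_measurable {0..<T} L2_sigma L2_norm p" "strongly_measurable {0..<T} L2_sigma L2_norm q"
    using p q T unfolding regular_def Linf_time_def by auto
  then show "(\<lambda>t. flux (p t) (q t) M) \<in> borel_measurable (lebesgue_on {0..<T})"
    by (rule strongly_measurable_functional) (auto simp: L2_sigma_L2 intro: flux_tendsto M)
qed

lemma L2_inner_zero_right [simp]: "L2_inner g (\<lambda>x. 0) = 0" by (simp add: L2_inner_def)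

text \<open>The point is that the supremum in the norm is nonnegative: the set is nonempty by
  \<open>H1\<close> and, controlled by the sets of g and h, bounded above, so that
  \<open>Sup\<close> is a genuine supremum.\<close>

lemma Hm1_L2_norm_ge:
  assumes "g \<in> Hm1_L2" "h \<in> Hm1_L2" and H1: "\<exists>\<phi>\<in>H1. H1_norm \<phi> \<le> 1"
  shows "L2_norm (\<lambda>x. g x - h x) \<le> Hm1_L2_norm (\<lambda>x. g x - h x)"
proof -
  let ?S = "\<lambda>g. {\<bar>L2_inner g \<phi>\<bar> | \<phi>. \<phi> \<in> H1 \<and> H1_norm \<phi> \<le> 1}"
  have L: "g \<in> L2" "h \<in> L2" using assms by (auto simp: Hm1_L2_def)
  from assms obtain A B where A: "\<And>\<phi>. \<phi> \<in> H1 \<Longrightarrow> H1_norm \<phi> \<le> 1 \<Longrightarrow> \<bar>L2_inner g \<phi>\<bar> \<le> A"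
    and B: "\<And>\<phi>. \<phi> \<in> H1 \<Longrightarrow> H1_norm \<phi> \<le> 1 \<Longrightarrow> \<bar>L2_inner h \<phi>\<bar> \<le> B"
    unfolding Hm1_L2_def bdd_above_def by blast
  have bdd: "bdd_above (?S (\<lambda>x. g x - h x))"
  proof (rule bdd_aboveI[of _ "A + B"], safe)
    fix \<phi> assume \<phi>: "\<phi> \<in> H1" "H1_norm \<phi> \<le> 1"
    have "L2_inner (\<lambda>x. g x - h x) \<phi> = L2_inner g \<phi> - L2_inner h \<phi>"
      by (intro L2_inner_diff_left L H1_L2 \<phi>)
    then show "\<bar>L2_inner (\<lambda>x. g x - h x) \<phi>\<bar> \<le> A + B" using A[OF \<phi>] B[OF \<phi>] by linarith
  qed
  obtain \<phi> where \<phi>: "\<phi> \<in> H1" "H1_norm \<phi> \<le> 1" using H1 by blast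
  have "\<bar>L2_inner (\<lambda>x. g x - h x) \<phi>\<bar> \<le> Sup (?S (\<lambda>x. g x - h x))"
    by (rule cSup_upper[OF _ bdd]) (use \<phi> in blast)
  then have "0 \<le> Sup (?S (\<lambda>x. g x - h x))" by linarith
  then show ?thesis by (simp add: Hm1_L2_norm_def)
qed

lemma measurable_continuous_Ioo:
  fixes \<theta> :: "real \<Rightarrow> real" assumes "continuous_on UNIV \<theta>"
  shows "\<theta> \<in> borel_measurable (lebesgue_on {a<..<b})"
  using borel_measurable_integrable[OF continuous_integrable_Ioo(1)[OF assms]] .

lemma bounded_integrable_Ioo:
  fixes g :: "real \<Rightarrow> real"
  assumes "g \<in> borel_measurable (lebesgue_on {a<..<b})" "AE t in lebesgue_on {a<..<b}. \<bar>g t\<bar> \<le> C"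
  shows "integrable (lebesgue_on {a<..<b}) g"
proof -
  have "integrable (lebesgue_on {a<..<b}) (\<lambda>t::real. C)" by (intro continuous_integrable_Ioo continuous_intros)
  then show ?thesis
    by (rule Bochner_Integration.integrable_bound[OF _ assms(1)]) (use assms(2) in \<open>auto elim!: eventually_mono\<close>)
qed

text \<open>The equation tested with \<open>\<theta>(t) \<phi>(x)\<close>, where \<open>L\<close> and \<open>M\<close> stand for the Laplacian and the Jacobian
  of \<open>\<phi>\<close>; as independent arguments they can pass to the limit in different senses.\<close>

definition weak_eq :: "real \<Rightarrow> (real \<Rightarrow> field) \<Rightarrow> (real \<Rightarrow> (real^3 \<Rightarrow> real^3^3) \<Rightarrow> real) \<Rightarrow> (real \<Rightarrow> field) \<Rightarrow> field \<Rightarrow> field \<Rightarrow> field \<Rightarrow> (real^3 \<Rightarrow> real^3^3) \<Rightarrow> bool" where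
  "weak_eq \<kappa> v P f v0 \<phi> L M \<longleftrightarrow> (\<forall>T>0. \<forall>\<theta> \<theta>'. (\<forall>t. (\<theta> has_real_derivative \<theta>' t) (at t)) \<and> continuous_on UNIV \<theta>' \<and> \<theta> T = 0 \<longrightarrow>
     (\<integral>t. (- \<theta>' t * L2_inner (v t) \<phi> - \<theta> t * (\<kappa> * L2_inner (v t) L + P t M)) \<partial>lebesgue_on {0<..<T})
     = \<theta> 0 * L2_inner v0 \<phi> + (\<integral>t. \<theta> t * L2_inner (f t) \<phi> \<partial>lebesgue_on {0<..<T}))"

lemma trip_scale: "trip f g (\<lambda>x. a * m x) = a * trip f g m"
proof -
  have "trip f g (\<lambda>x. a * m x) = (\<integral>x. a * (f x * g x * m x) \<partial>lborel)"
    unfolding trip_def by (simp add: mult.left_commute)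
  then show ?thesis by (simp add: trip_def)
qed

lemma flux_scale: "flux p q (\<lambda>x. a *\<^sub>R M x) = a * flux p q M"
  unfolding flux_def by (simp add: trip_scale sum_distrib_left)

lemma jac_scaleR: "\<phi> \<in> test_fun \<Longrightarrow> jac (\<lambda>x. a *\<^sub>R \<phi> x) = (\<lambda>x. a *\<^sub>R jac \<phi> x)"
  by (auto simp: jac_def vec_eq_iff fun_eq_iff pderivative_cmult smooth_differentiable test_funD(1)[OF test_fun_component])

lemma jac_bmeas: "\<phi> \<in> test_fun \<Longrightarrow> bmeas (\<lambda>x. jac \<phi> x $ i $ j)"
  by (intro band_bmeas test_fun_band test_fun_component jac_test_fun)

section \<open>The weak equations for product test fields\<close>

context cutoff begin

lemma admissible_AE:
  assumes f: "admissible_force f" and T: "T > 0"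
  shows "AE t in lebesgue_on {0<..<T}. f t \<in> L2"
    "\<exists>C. AE t in lebesgue_on {0<..<T}. L2_norm (f t) \<le> C"
    "w \<in> L2 \<Longrightarrow> (\<lambda>t. L2_inner (f t) w) \<in> borel_measurable (lebesgue_on {0<..<T})"
proof -
  have ex: "\<exists>\<phi>\<in>H1. H1_norm \<phi> \<le> 1"
  proof -
    have "(\<lambda>x::real^3. 0::real^3) \<in> test_fun" by (rule test_funI) auto
    then show ?thesis
      using H1_norm_scaleR_test[of "\<lambda>x. 0" 0] test_H1[of "\<lambda>x. 0"] by (intro bexI[of _ "\<lambda>x. 0"]) auto
  qed
  have sm: "strongly_measurable {0..<T} Hm1_L2 Hm1_L2_norm f" and "\<exists>C. AE t in lebesgue_on {0..<T}. Hm1_L2_norm (f t) \<le> C"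
    using f T unfolding admissible_force_def Linf_time_def by auto
  then obtain C where C: "AE t in lebesgue_on {0..<T}. Hm1_L2_norm (f t) \<le> C" by blast
  have X: "AE t in lebesgue_on {0..<T}. f t \<in> Hm1_L2" using sm by (simp add: strongly_measurable_def)
  have "AE t in lebesgue_on {0..<T}. f t \<in> L2" using X by eventually_elim (simp add: Hm1_L2_def)
  then show "AE t in lebesgue_on {0<..<T}. f t \<in> L2" by (rule AE_lebesgue_on_mono[OF _ Ioo_Ico]) auto
  have "AE t in lebesgue_on {0..<T}. L2_norm (f t) \<le> C"
    using X C
  proof eventually_elim
    case (elim t)
    \<comment> \<open>The norm of \<open>f t\<close> is read as the norm of its difference from the
      zero field.\<close>
    have z: "(\<lambda>x. 0) \<in> Hm1_L2" by (auto simp: Hm1_L2_def L2_inner_def intro!: bdd_aboveI[of _ 0])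
    show ?case using Hm1_L2_norm_ge[OF elim(1) z ex] elim(2) by simp
  qed
  then have "AE t in lebesgue_on {0<..<T}. L2_norm (f t) \<le> C" by (rule AE_lebesgue_on_mono[OF _ Ioo_Ico]) auto
  then show "\<exists>C. AE t in lebesgue_on {0<..<T}. L2_norm (f t) \<le> C" by blast
  assume w: "w \<in> L2"
  show "(\<lambda>t. L2_inner (f t) w) \<in> borel_measurable (lebesgue_on {0<..<T})"
  proof (rule measurable_lebesgue_on_mono[OF _ Ioo_Ico])
    show "(\<lambda>t. L2_inner (f t) w) \<in> borel_measurable (lebesgue_on {0..<T})"
      by (rule strongly_measurable_functional[OF sm sm, where Q="\<lambda>g h. L2_inner g w"])
         (auto simp: Hm1_L2_def[THEN eqset_imp_iff] intro: Hm1_L2_norm_ge ex L2_inner_tendsto w)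
  qed
qed

text \<open>The two integrands agree at almost every time only, because only there the slices are
  known to lie in \<open>H1_sigma\<close> and \<open>L2_sigma\<close> and derivatives can be moved
  to \<phi>. The right-hand side makes sense for slices in L2.\<close>

lemma weak_eq_test_aux:
  assumes v: "regular v" and p: "regular p" and q: "regular q" and r: "regular r" and s: "regular s"
    and \<phi>: "\<phi> \<in> solenoidal_test" and T: "T > 0"
    and \<theta>: "continuous_on UNIV \<theta>" "continuous_on UNIV \<theta>'"
  shows "(\<integral>t. (- L2_inner (v t) (\<lambda>x. \<theta>' t *\<^sub>R \<phi> x) + \<kappa> * L2_inner (wgrad (v t)) (wgrad (\<lambda>x. \<theta> t *\<^sub>R \<phi> x))
              + trilinear (p t) (q t) (\<lambda>x. \<theta> t *\<^sub>R \<phi> x) - trilinear (r t) (s t) (\<lambda>x. \<theta> t *\<^sub>R \<phi> x)) \<partial>lebesgue_on {0<..<T})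
    = (\<integral>t. (- \<theta>' t * L2_inner (v t) \<phi> - \<theta> t * (\<kappa> * L2_inner (v t) (lap \<phi>) + (flux (p t) (q t) (jac \<phi>) - flux (r t) (s t) (jac \<phi>)))) \<partial>lebesgue_on {0<..<T})"
proof (rule integral_cong_AE_lebesgue_on)
  have t: "\<phi> \<in> test_fun" using \<phi> by (simp add: solenoidal_test_def)
  note [measurable] = measurable_continuous_Ioo[OF \<theta>(1)] measurable_continuous_Ioo[OF \<theta>(2)]
    regular_inner_measurable[OF v solenoidal_L2[OF \<phi>]] regular_inner_measurable[OF v band_L2[OF test_fun_band[OF lap_test[OF t]]]]
    regular_flux_measurable[OF p q T jac_bmeas[OF t]] regular_flux_measurable[OF r s T jac_bmeas[OF t]]
  show "(\<lambda>t. - \<theta>' t * L2_inner (v t) \<phi> - \<theta> t * (\<kappa> * L2_inner (v t) (lap \<phi>) + (flux (p t) (q t) (jac \<phi>) - flux (r t) (s t) (jac \<phi>))))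
     \<in> borel_measurable (lebesgue_on {0<..<T})" by measurable
  show "AE t in lebesgue_on {0<..<T}. - L2_inner (v t) (\<lambda>x. \<theta>' t *\<^sub>R \<phi> x) + \<kappa> * L2_inner (wgrad (v t)) (wgrad (\<lambda>x. \<theta> t *\<^sub>R \<phi> x))
              + trilinear (p t) (q t) (\<lambda>x. \<theta> t *\<^sub>R \<phi> x) - trilinear (r t) (s t) (\<lambda>x. \<theta> t *\<^sub>R \<phi> x)
     = - \<theta>' t * L2_inner (v t) \<phi> - \<theta> t * (\<kappa> * L2_inner (v t) (lap \<phi>) + (flux (p t) (q t) (jac \<phi>) - flux (r t) (s t) (jac \<phi>)))"
    using regular_AE(2)[OF v T] regular_AE(1)[OF p T] regular_AE(2)[OF q T] regular_AE(1)[OF r T] regular_AE(2)[OF s T]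
  proof eventually_elim
    case (elim \<tau>)
    have tt: "(\<lambda>x. \<theta> \<tau> *\<^sub>R \<phi> x) \<in> test_fun" by (rule test_fun_linear[OF bounded_linear_scaleR_right t])
    show ?case
      unfolding wgrad_inner_eq[OF H1_sigma_H1[OF elim(1)] t] trilinear_eq[OF elim(2) H1_sigma_H1[OF elim(3)] tt]
        trilinear_eq[OF elim(4) H1_sigma_H1[OF elim(5)] tt] jac_scaleR[OF t] flux_scale L2_inner_scaleR_right
      by (simp add: algebra_simps)
  qed
qed simp

lemma weak_eq_test:
  assumes sol: "weak_solution_MHD \<nu> \<eta> f1 f2 u0 b0 u b" and u: "weakly_continuous_rep u" and b: "weakly_continuous_rep b"
    and \<phi>: "\<phi> \<in> solenoidal_test"
  shows "weak_eq \<nu> u (\<lambda>t M. flux (u t) (u t) M - flux (b t) (b t) M) f1 u0 \<phi> (lap \<phi>) (jac \<phi>)"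
    and "weak_eq \<eta> b (\<lambda>t M. flux (u t) (b t) M - flux (b t) (u t) M) f2 b0 \<phi> (lap \<phi>) (jac \<phi>)"
proof -
  have ru: "regular u" and rb: "regular b" using sol u b unfolding weak_solution_MHD_def regular_def by blast+
  have *: "(\<integral>t. (- L2_inner (u t) (\<lambda>x. \<theta>' t *\<^sub>R \<phi> x) + \<nu> * L2_inner (wgrad (u t)) (wgrad (\<lambda>x. \<theta> t *\<^sub>R \<phi> x))
              + trilinear (u t) (u t) (\<lambda>x. \<theta> t *\<^sub>R \<phi> x) - trilinear (b t) (b t) (\<lambda>x. \<theta> t *\<^sub>R \<phi> x)) \<partial>lebesgue_on {0<..<T})
          = L2_inner u0 (\<lambda>x. \<theta> 0 *\<^sub>R \<phi> x) + (\<integral>t. L2_inner (f1 t) (\<lambda>x. \<theta> t *\<^sub>R \<phi> x) \<partial>lebesgue_on {0<..<T}) \<and>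
        (\<integral>t. (- L2_inner (b t) (\<lambda>x. \<theta>' t *\<^sub>R \<phi> x) + \<eta> * L2_inner (wgrad (b t)) (wgrad (\<lambda>x. \<theta> t *\<^sub>R \<phi> x))
              + trilinear (u t) (b t) (\<lambda>x. \<theta> t *\<^sub>R \<phi> x) - trilinear (b t) (u t) (\<lambda>x. \<theta> t *\<^sub>R \<phi> x)) \<partial>lebesgue_on {0<..<T})
          = L2_inner b0 (\<lambda>x. \<theta> 0 *\<^sub>R \<phi> x) + (\<integral>t. L2_inner (f2 t) (\<lambda>x. \<theta> t *\<^sub>R \<phi> x) \<partial>lebesgue_on {0<..<T})"
    if T: "T > 0" and d: "\<forall>t. (\<theta> has_real_derivative \<theta>' t) (at t)" "continuous_on UNIV \<theta>'" "\<theta> T = 0" for T \<theta> \<theta>'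
  proof -
    have h: "H1_time_test T (\<lambda>t x. \<theta> t *\<^sub>R \<phi> x) (\<lambda>t x. \<theta>' t *\<^sub>R \<phi> x)"
      by (rule H1_time_test_product[OF \<phi> d(1)[rule_format] d(2) T])
    have z: "AE x in lborel. \<theta> T *\<^sub>R \<phi> x = 0" using d(3) by simp
    show ?thesis
      using sol T h z unfolding weak_solution_MHD_def by blast
  qed
  have c: "continuous_on UNIV \<theta>" if "\<forall>t. (\<theta> has_real_derivative \<theta>' t) (at t)" for \<theta> \<theta>' :: "real \<Rightarrow> real"
    using that by (meson DERIV_continuous continuous_at_imp_continuous_on)
  show "weak_eq \<nu> u (\<lambda>t M. flux (u t) (u t) M - flux (b t) (b t) M) f1 u0 \<phi> (lap \<phi>) (jac \<phi>)"
    unfolding weak_eq_def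
  proof (intro allI impI, elim conjE)
    fix T :: real and \<theta> \<theta>' :: "real \<Rightarrow> real" assume T: "T > 0" and d: "\<forall>t. (\<theta> has_real_derivative \<theta>' t) (at t)" "continuous_on UNIV \<theta>'" "\<theta> T = 0"
    show "(\<integral>t. (- \<theta>' t * L2_inner (u t) \<phi> - \<theta> t * (\<nu> * L2_inner (u t) (lap \<phi>) + (flux (u t) (u t) (jac \<phi>) - flux (b t) (b t) (jac \<phi>)))) \<partial>lebesgue_on {0<..<T})
      = \<theta> 0 * L2_inner u0 \<phi> + (\<integral>t. \<theta> t * L2_inner (f1 t) \<phi> \<partial>lebesgue_on {0<..<T})"
      using *[OF T d, THEN conjunct1, unfolded weak_eq_test_aux[OF ru ru ru rb rb \<phi> T c[OF d(1)] d(2)]] unfolding L2_inner_scaleR_right .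
  qed
  show "weak_eq \<eta> b (\<lambda>t M. flux (u t) (b t) M - flux (b t) (u t) M) f2 b0 \<phi> (lap \<phi>) (jac \<phi>)"
    unfolding weak_eq_def
  proof (intro allI impI, elim conjE)
    fix T :: real and \<theta> \<theta>' :: "real \<Rightarrow> real" assume T: "T > 0" and d: "\<forall>t. (\<theta> has_real_derivative \<theta>' t) (at t)" "continuous_on UNIV \<theta>'" "\<theta> T = 0"
    show "(\<integral>t. (- \<theta>' t * L2_inner (b t) \<phi> - \<theta> t * (\<eta> * L2_inner (b t) (lap \<phi>) + (flux (u t) (b t) (jac \<phi>) - flux (b t) (u t) (jac \<phi>)))) \<partial>lebesgue_on {0<..<T})
      = \<theta> 0 * L2_inner b0 \<phi> + (\<integral>t. \<theta> t * L2_inner (f2 t) \<phi> \<partial>lebesgue_on {0<..<T})"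
      using *[OF T d, THEN conjunct2, unfolded weak_eq_test_aux[OF rb ru rb rb ru \<phi> T c[OF d(1)] d(2)]] unfolding L2_inner_scaleR_right .
  qed
qed

section \<open>Passage to the limit in the test field\<close>

lemma continuous_bounded_Ioo:
  fixes \<theta> :: "real \<Rightarrow> real" assumes "continuous_on UNIV \<theta>"
  obtains K where "K \<ge> 0" "\<And>t. t \<in> {a<..<b} \<Longrightarrow> \<bar>\<theta> t\<bar> \<le> K"
proof -
  have "bounded (\<theta> ` {a..b})"
    by (intro compact_imp_bounded compact_continuous_image continuous_on_subset[OF assms]) auto
  then obtain K where K: "\<forall>y\<in>\<theta> ` {a..b}. norm y \<le> K" unfolding bounded_iff by blast
  show thesis by (rule that[of "max K 0"]) (use K in \<open>auto intro: order_trans[OF _ max.cobounded1]\<close>)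
qed

definition weak_conv :: "(nat \<Rightarrow> field) \<Rightarrow> field \<Rightarrow> bool" where
  "weak_conv \<phi> \<phi>0 \<longleftrightarrow> (\<forall>n. \<phi> n \<in> L2) \<and> \<phi>0 \<in> L2 \<and> (\<exists>C. \<forall>n. L2_norm (\<phi> n) \<le> C) \<and> (\<forall>w\<in>L2. (\<lambda>n. L2_inner w (\<phi> n)) \<longlonglongrightarrow> L2_inner w \<phi>0)"

text \<open>The product of two L2 fields is merely integrable, so the matrices need a uniform
  pointwise bound where \<open>weak_conv\<close> asks for an L2 bound.\<close>

definition flux_conv :: "(nat \<Rightarrow> real^3 \<Rightarrow> real^3^3) \<Rightarrow> (real^3 \<Rightarrow> real^3^3) \<Rightarrow> bool" where
  "flux_conv M M0 \<longleftrightarrow> (\<forall>n i j. (\<lambda>x. M n x $ i $ j) \<in> borel_measurable borel) \<and> (\<forall>i j. bmeas (\<lambda>x. M0 x $ i $ j)) \<and>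
     (\<exists>C. \<forall>n x i j. \<bar>M n x $ i $ j\<bar> \<le> C) \<and> (\<forall>p\<in>L2. \<forall>q\<in>L2. (\<lambda>n. flux p q (M n)) \<longlonglongrightarrow> flux p q M0)"

text \<open>At almost every time the integrands converge by hypothesis; the essential bounds on the
  slices give a constant majorant on (0,T), so dominated convergence applies to both sides.\<close>

lemma weak_eq_limit:
  assumes eq: "\<And>n. weak_eq \<kappa> v (\<lambda>t M. flux (p t) (q t) M - flux (r t) (s t) M) f v0 (\<phi> n) (L n) (M n)"
    and v: "regular v" and p: "regular p" and q: "regular q" and r: "regular r" and s: "regular s"
    and f: "admissible_force f" and v0: "v0 \<in> L2"
    and \<phi>: "weak_conv \<phi> \<phi>0" and L: "weak_conv L L0" and M: "flux_conv M M0"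
  shows "weak_eq \<kappa> v (\<lambda>t M. flux (p t) (q t) M - flux (r t) (s t) M) f v0 \<phi>0 L0 M0"
  unfolding weak_eq_def
proof (intro allI impI, elim conjE)
  fix T :: real and \<theta> \<theta>' :: "real \<Rightarrow> real" assume T: "T > 0" and d: "\<forall>t. (\<theta> has_real_derivative \<theta>' t) (at t)" "continuous_on UNIV \<theta>'" "\<theta> T = 0"
  have c: "continuous_on UNIV \<theta>" using d(1) by (meson DERIV_continuous continuous_at_imp_continuous_on)
  let ?m = "lebesgue_on {0<..<T}"
  let ?I = "\<lambda>\<phi> L M t. - \<theta>' t * L2_inner (v t) \<phi> - \<theta> t * (\<kappa> * L2_inner (v t) L + (flux (p t) (q t) M - flux (r t) (s t) M))"
  from \<phi> obtain C1 where \<phi>': "\<And>n. \<phi> n \<in> L2" "\<phi>0 \<in> L2" "\<And>n. L2_norm (\<phi> n) \<le> C1" "\<And>w. w \<in> L2 \<Longrightarrow> (\<lambda>n. L2_inner w (\<phi> n)) \<longlonglongrightarrow> L2_inner w \<phi>0"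
    unfolding weak_conv_def by auto
  from L obtain C2 where L': "\<And>n. L n \<in> L2" "L0 \<in> L2" "\<And>n. L2_norm (L n) \<le> C2" "\<And>w. w \<in> L2 \<Longrightarrow> (\<lambda>n. L2_inner w (L n)) \<longlonglongrightarrow> L2_inner w L0"
    unfolding weak_conv_def by auto
  from M obtain C3 where M': "\<And>n i j. (\<lambda>x. M n x $ i $ j) \<in> borel_measurable borel" "\<And>i j. bmeas (\<lambda>x. M0 x $ i $ j)"
    "\<And>n x i j. \<bar>M n x $ i $ j\<bar> \<le> C3" "\<And>p q. p \<in> L2 \<Longrightarrow> q \<in> L2 \<Longrightarrow> (\<lambda>n. flux p q (M n)) \<longlonglongrightarrow> flux p q M0"
    unfolding flux_conv_def by auto
  have Mb: "bmeas (\<lambda>x. M n x $ i $ j)" for n i j unfolding bmeas_def using M' by blast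
  obtain K where K: "K \<ge> 0" "\<And>t. t \<in> {0<..<T} \<Longrightarrow> \<bar>\<theta> t\<bar> \<le> K" using continuous_bounded_Ioo[OF c, of 0 T] by blast
  obtain K' where K': "K' \<ge> 0" "\<And>t. t \<in> {0<..<T} \<Longrightarrow> \<bar>\<theta>' t\<bar> \<le> K'" using continuous_bounded_Ioo[OF d(2), of 0 T] by blast
  have C0: "C1 \<ge> 0" "C2 \<ge> 0" "C3 \<ge> 0" using \<phi>'(3)[of 0] L'(3)[of 0] M'(3)[of 0 0 1 1] L2_norm_nonneg[of "\<phi> 0"] L2_norm_nonneg[of "L 0"] by linarith+
  obtain Cv Cp Cq Cr Cs Cf where Cv: "AE t in ?m. L2_norm (v t) \<le> Cv" and Cp: "AE t in ?m. L2_norm (p t) \<le> Cp" and Cq: "AE t in ?m. L2_norm (q t) \<le> Cq"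
    and Cr: "AE t in ?m. L2_norm (r t) \<le> Cr" and Cs: "AE t in ?m. L2_norm (s t) \<le> Cs" and Cf: "AE t in ?m. L2_norm (f t) \<le> Cf"
    using regular_AE(3)[OF v T] regular_AE(3)[OF p T] regular_AE(3)[OF q T] regular_AE(3)[OF r T] regular_AE(3)[OF s T] admissible_AE(2)[OF f T] by blast
  note [measurable] = measurable_continuous_Ioo[OF c] measurable_continuous_Ioo[OF d(2)]
    regular_inner_measurable[OF v \<phi>'(1)] regular_inner_measurable[OF v L'(1)] regular_inner_measurable[OF v \<phi>'(2)] regular_inner_measurable[OF v L'(2)]
    regular_flux_measurable[OF p q T Mb] regular_flux_measurable[OF r s T Mb] regular_flux_measurable[OF p q T M'(2)] regular_flux_measurable[OF r s T M'(2)]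
    admissible_AE(3)[OF f T \<phi>'(1)] admissible_AE(3)[OF f T \<phi>'(2)]
  let ?B = "K' * (Cv * C1) + K * (\<bar>\<kappa>\<bar> * (Cv * C2) + (9 * C3 * (Cp * Cq) + 9 * C3 * (Cr * Cs)))"
  have l1: "(\<lambda>n. \<integral>t. ?I (\<phi> n) (L n) (M n) t \<partial>?m) \<longlonglongrightarrow> (\<integral>t. ?I \<phi>0 L0 M0 t \<partial>?m)"
  proof (rule integral_dominated_convergence[where w="\<lambda>t. ?B"])
    show "integrable ?m (\<lambda>t. ?B)" by (intro continuous_integrable_Ioo continuous_intros)
    show "(\<lambda>t. ?I \<phi>0 L0 M0 t) \<in> borel_measurable ?m" by measurable
    show "(\<lambda>t. ?I (\<phi> n) (L n) (M n) t) \<in> borel_measurable ?m" for n by measurable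
    show "AE t in ?m. (\<lambda>n. ?I (\<phi> n) (L n) (M n) t) \<longlonglongrightarrow> ?I \<phi>0 L0 M0 t"
    proof (rule AE_I2)
      fix t assume "t \<in> space ?m"
      then have t: "t \<ge> 0" by simp
      show "(\<lambda>n. ?I (\<phi> n) (L n) (M n) t) \<longlonglongrightarrow> ?I \<phi>0 L0 M0 t"
        by (intro tendsto_intros \<phi>'(4) L'(4) M'(4) regular_L2[OF _ t] v p q r s)
    qed
    show "AE t in ?m. norm (?I (\<phi> n) (L n) (M n) t) \<le> ?B" for n
      using Cv Cp Cq Cr Cs AE_space[of ?m]
    proof eventually_elim
      case (elim t)
      then have t: "t \<in> {0<..<T}" "t \<ge> 0" by auto
      have vt: "v t \<in> L2" and pt: "p t \<in> L2" and qt: "q t \<in> L2" and rt: "r t \<in> L2" and st: "s t \<in> L2"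
        using v p q r s t(2) by (auto intro: regular_L2)
      have 1: "\<bar>L2_inner (v t) (\<phi> n)\<bar> \<le> Cv * C1"
        by (rule order_trans[OF L2_inner_le[OF vt \<phi>'(1)]]) (rule mult_mono'[OF elim(1) \<phi>'(3) L2_norm_nonneg L2_norm_nonneg])
      have 2: "\<bar>L2_inner (v t) (L n)\<bar> \<le> Cv * C2"
        by (rule order_trans[OF L2_inner_le[OF vt L'(1)]]) (rule mult_mono'[OF elim(1) L'(3) L2_norm_nonneg L2_norm_nonneg])
      have 3: "\<bar>flux (p t) (q t) (M n)\<bar> \<le> 9 * C3 * (Cp * Cq)"
        by (rule order_trans[OF flux_le[OF pt qt M'(3) M'(1)]]) (intro mult_left_mono mult_mono'[OF elim(2,3) L2_norm_nonneg L2_norm_nonneg], use C0 in simp)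
      have 4: "\<bar>flux (r t) (s t) (M n)\<bar> \<le> 9 * C3 * (Cr * Cs)"
        by (rule order_trans[OF flux_le[OF rt st M'(3) M'(1)]]) (intro mult_left_mono mult_mono'[OF elim(4,5) L2_norm_nonneg L2_norm_nonneg], use C0 in simp)
      have "\<bar>?I (\<phi> n) (L n) (M n) t\<bar> \<le> \<bar>\<theta>' t\<bar> * \<bar>L2_inner (v t) (\<phi> n)\<bar> + \<bar>\<theta> t\<bar> * (\<bar>\<kappa>\<bar> * \<bar>L2_inner (v t) (L n)\<bar> + (\<bar>flux (p t) (q t) (M n)\<bar> + \<bar>flux (r t) (s t) (M n)\<bar>))"
      proof -
        have a: "\<bar>\<kappa> * x + (y - z)\<bar> \<le> \<bar>\<kappa>\<bar> * \<bar>x\<bar> + (\<bar>y\<bar> + \<bar>z\<bar>)" for x y z :: real unfolding abs_mult[symmetric] by linarith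
        have b: "\<bar>- x - y\<bar> \<le> \<bar>x\<bar> + \<bar>y\<bar>" for x y :: real by linarith
        show ?thesis unfolding minus_mult_left[symmetric]
          by (rule order_trans[OF b]) (unfold abs_mult, intro add_left_mono mult_left_mono a abs_ge_zero)
      qed
      also have "\<dots> \<le> ?B"
        by (intro add_mono mult_mono' K K' t(1) 1 2 3 4 add_nonneg_nonneg mult_nonneg_nonneg abs_ge_zero order_refl)
      finally show ?case by simp
    qed
  qed
  have l2: "(\<lambda>n. \<theta> 0 * L2_inner v0 (\<phi> n) + (\<integral>t. \<theta> t * L2_inner (f t) (\<phi> n) \<partial>?m)) \<longlonglongrightarrow> \<theta> 0 * L2_inner v0 \<phi>0 + (\<integral>t. \<theta> t * L2_inner (f t) \<phi>0 \<partial>?m)"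
  proof (intro tendsto_intros \<phi>'(4) v0 integral_dominated_convergence[where w="\<lambda>t. K * (Cf * C1)"])
    show "integrable ?m (\<lambda>t. K * (Cf * C1))" by (intro continuous_integrable_Ioo continuous_intros)
    show "(\<lambda>t. \<theta> t * L2_inner (f t) \<phi>0) \<in> borel_measurable ?m" by measurable
    show "(\<lambda>t. \<theta> t * L2_inner (f t) (\<phi> n)) \<in> borel_measurable ?m" for n by measurable
    show "AE t in ?m. (\<lambda>n. \<theta> t * L2_inner (f t) (\<phi> n)) \<longlonglongrightarrow> \<theta> t * L2_inner (f t) \<phi>0"
      using admissible_AE(1)[OF f T] by eventually_elim (intro tendsto_intros \<phi>'(4))
    show "AE t in ?m. norm (\<theta> t * L2_inner (f t) (\<phi> n)) \<le> K * (Cf * C1)" for n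
      using admissible_AE(1)[OF f T] Cf AE_space[of ?m]
    proof eventually_elim
      case (elim t)
      then have t: "t \<in> {0<..<T}" by auto
      have 1: "\<bar>L2_inner (f t) (\<phi> n)\<bar> \<le> Cf * C1"
        by (rule order_trans[OF L2_inner_le[OF elim(1) \<phi>'(1)]]) (rule mult_mono'[OF elim(2) \<phi>'(3) L2_norm_nonneg L2_norm_nonneg])
      show ?case unfolding real_norm_def abs_mult by (intro mult_mono' K t 1 abs_ge_zero)
    qed
  qed
  have e: "(\<integral>t. ?I (\<phi> n) (L n) (M n) t \<partial>?m) = \<theta> 0 * L2_inner v0 (\<phi> n) + (\<integral>t. \<theta> t * L2_inner (f t) (\<phi> n) \<partial>?m)" for n
    using eq[of n] T d unfolding weak_eq_def by blast
  show "(\<integral>t. ?I \<phi>0 L0 M0 t \<partial>?m) = \<theta> 0 * L2_inner v0 \<phi>0 + (\<integral>t. \<theta> t * L2_inner (f t) \<phi>0 \<partial>?m)"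
    using LIMSEQ_unique[OF l1] l2 unfolding e by blast
qed

end

section \<open>Band-limited solenoidal test fields\<close>

definition unifseq :: "(nat \<Rightarrow> real^3 \<Rightarrow> real) \<Rightarrow> bool" where
  "unifseq F \<longleftrightarrow> (\<exists>C. \<forall>n x. \<bar>F n x\<bar> \<le> C)"

text \<open>One majorant that is both square integrable and bounded serves two purposes: the first
  property leads to \<open>weak_conv\<close>, the second to \<open>flux_conv\<close>.\<close>

definition domseq :: "(nat \<Rightarrow> real^3 \<Rightarrow> real) \<Rightarrow> bool" where
  "domseq F \<longleftrightarrow> (\<exists>G\<in>L2. \<exists>C. \<forall>n x. \<bar>F n x\<bar> \<le> G x \<and> G x \<le> C)"

lemma domseqI: "G \<in> L2 \<Longrightarrow> (\<And>n x. \<bar>F n x\<bar> \<le> G x) \<Longrightarrow> (\<And>x. G x \<le> C) \<Longrightarrow> domseq F"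
  unfolding domseq_def by (intro bexI[of _ G] exI[of _ C]) simp_all

lemma domseq_add:
  assumes "domseq F" "domseq F'" shows "domseq (\<lambda>n x. F n x + F' n x)"
proof -
  from assms obtain G C G' C' where *: "G \<in> L2" "\<And>n x. \<bar>F n x\<bar> \<le> G x \<and> G x \<le> C"
    "G' \<in> L2" "\<And>n x. \<bar>F' n x\<bar> \<le> G' x \<and> G' x \<le> C'" unfolding domseq_def by blast
  have "\<bar>F n x + F' n x\<bar> \<le> G x + G' x" "G x + G' x \<le> C + C'" for n x
    using *(2)[of n x] *(4)[of n x] by linarith+
  then show ?thesis by (rule domseqI[OF L2_add[OF *(1,3)]])
qed

lemma domseq_uminus: "domseq F \<Longrightarrow> domseq (\<lambda>n x. - F n x)"
  by (simp add: domseq_def)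

lemma domseq_zero: "domseq (\<lambda>n x. 0)"
  unfolding domseq_def by (rule bexI[of _ "\<lambda>x. 0"]) auto

lemma domseq_mult:
  assumes "unifseq Z" "domseq F" shows "domseq (\<lambda>n x. Z n x * F n x)"
proof -
  from assms obtain G C B where *: "G \<in> L2" "\<And>n x. \<bar>F n x\<bar> \<le> G x" "\<And>n x. G x \<le> C" "\<And>n x. \<bar>Z n x\<bar> \<le> B"
    unfolding domseq_def unifseq_def by blast
  have B0: "B \<ge> 0" using *(4)[of 0 0] by linarith
  have "\<bar>Z n x * F n x\<bar> \<le> B *\<^sub>R G x" for n x
    unfolding abs_mult real_scaleR_def by (intro mult_mono' *(2,4)) auto
  moreover have "B *\<^sub>R G x \<le> B * C" for x
    unfolding real_scaleR_def by (intro mult_left_mono *(3) B0)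
  ultimately show ?thesis by (rule domseqI[OF L2_scaleR[OF *(1), of B]])
qed

text \<open>A sequence version of a C^m bound: with \<open>unifseq\<close> all derivatives up to
  order m are bounded uniformly in the index, with \<open>domseq\<close> each of them has a
  majorant.\<close>

primrec iter :: "((nat \<Rightarrow> real^3 \<Rightarrow> real) \<Rightarrow> bool) \<Rightarrow> nat \<Rightarrow> (nat \<Rightarrow> real^3 \<Rightarrow> real) \<Rightarrow> bool" where
  "iter P 0 F \<longleftrightarrow> P F"
| "iter P (Suc m) F \<longleftrightarrow> P F \<and> (\<forall>j. iter P m (\<lambda>n. pderivative j (F n)))"

lemma iter_base: "iter P m F \<Longrightarrow> P F" by (cases m) auto

lemma iter_Suc: "iter P (Suc m) F \<Longrightarrow> iter P m F"
proof (induction m arbitrary: F)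
  case (Suc m)
  from Suc.prems have "P F" "\<And>j. iter P (Suc m) (\<lambda>n. pderivative j (F n))" by simp_all
  then show ?case using Suc.IH by simp
qed simp

lemma iter_add:
  "(\<And>n. smooth (F n)) \<Longrightarrow> (\<And>n. smooth (G n)) \<Longrightarrow> iter domseq m F \<Longrightarrow> iter domseq m G \<Longrightarrow> iter domseq m (\<lambda>n x. F n x + G n x)"
proof (induction m arbitrary: F G)
  case 0 then show ?case by (simp add: domseq_add)
next
  case (Suc m)
  have "(\<lambda>n. pderivative j (\<lambda>x. F n x + G n x)) = (\<lambda>n x. pderivative j (F n) x + pderivative j (G n) x)" for j
    by (intro ext pderivative_add smooth_differentiable Suc.prems)
  then show ?case using Suc by (simp add: domseq_add smooth_pderivative)
qed

lemma iter_uminus: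
  "(\<And>n. smooth (F n)) \<Longrightarrow> iter domseq m F \<Longrightarrow> iter domseq m (\<lambda>n x. - F n x)"
proof (induction m arbitrary: F)
  case 0 then show ?case by (simp add: domseq_uminus)
next
  case (Suc m)
  have "(\<lambda>n. pderivative j (\<lambda>x. - F n x)) = (\<lambda>n x. - pderivative j (F n) x)" for j
    by (intro ext pderivative_linear[OF bounded_linear_minus[OF bounded_linear_ident]] smooth_differentiable Suc.prems)
  then show ?case using Suc by (simp add: domseq_uminus smooth_pderivative)
qed

text \<open>Leibniz's rule: a uniformly bounded factor times a dominated one is dominated, and a
  derivative of the product is a sum of two products of the same kind.\<close>

lemma iter_mult:
  "(\<And>n. smooth (Z n)) \<Longrightarrow> (\<And>n. smooth (F n)) \<Longrightarrow> iter unifseq m Z \<Longrightarrow> iter domseq m F \<Longrightarrow> iter domseq m (\<lambda>n x. Z n x * F n x)"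
proof (induction m arbitrary: Z F)
  case 0 then show ?case by (simp add: domseq_mult)
next
  case (Suc m)
  have e: "(\<lambda>n. pderivative j (\<lambda>x. Z n x * F n x)) = (\<lambda>n x. pderivative j (Z n) x * F n x + Z n x * pderivative j (F n) x)" for j
    by (intro ext pderivative_mult smooth_differentiable Suc.prems)
  have "iter domseq m (\<lambda>n x. pderivative j (Z n) x * F n x + Z n x * pderivative j (F n) x)" for j
  proof (rule iter_add)
    show "iter domseq m (\<lambda>n x. pderivative j (Z n) x * F n x)"
      by (rule Suc.IH) (use Suc.prems iter_Suc[OF Suc.prems(4)] in \<open>auto simp: smooth_pderivative\<close>)
    show "iter domseq m (\<lambda>n x. Z n x * pderivative j (F n) x)"
      by (rule Suc.IH) (use Suc.prems iter_Suc[OF Suc.prems(3)] in \<open>auto simp: smooth_pderivative\<close>)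
  qed (auto intro!: smooth_mult smooth_pderivative Suc.prems)
  moreover have "domseq (\<lambda>n x. Z n x * F n x)" using Suc.prems by (intro domseq_mult) (auto dest: iter_base)
  ultimately show ?case by (simp add: e)
qed

lemma iter_synth_s: "band a \<Longrightarrow> iter domseq m (\<lambda>n. synth_s a)"
proof (induction m arbitrary: a)
  case 0
  have "domseq (\<lambda>n. synth_s a)" unfolding domseq_def
    by (rule bexI[of _ "\<lambda>x. \<bar>synth_s a x\<bar>"])
       (use 0 synth_s_bounded[OF 0] L2_dominated[OF synth_s_L2[OF 0], of "\<lambda>x. \<bar>synth_s a x\<bar>"] L2_measurable[OF synth_s_L2[OF 0]] in auto)
  then show ?case by simp
next
  case (Suc m)
  have "domseq (\<lambda>n. synth_s a)" unfolding domseq_def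
    by (rule bexI[of _ "\<lambda>x. \<bar>synth_s a x\<bar>"])
       (use synth_s_bounded[OF Suc.prems] L2_dominated[OF synth_s_L2[OF Suc.prems], of "\<lambda>x. \<bar>synth_s a x\<bar>"] L2_measurable[OF synth_s_L2[OF Suc.prems]] in auto)
  then show ?case using Suc by (simp add: pderivative_synth_s band_iu_mult)
qed

text \<open>The chain rule contributes a factor \<beta> n with each derivative; the coefficient
  \<alpha> n absorbs it and closes the induction.\<close>

lemma iter_scaled_test:
  fixes f :: "real^3 \<Rightarrow> real"
  shows "f \<in> test_fun \<Longrightarrow> (\<And>n. \<bar>\<alpha> n\<bar> \<le> 1) \<Longrightarrow> (\<And>n. \<bar>\<beta> n\<bar> \<le> 1) \<Longrightarrow> iter unifseq m (\<lambda>n x. \<alpha> n * f (k + \<beta> n *\<^sub>R x))"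
proof (induction m arbitrary: f \<alpha>)
  case 0
  obtain C where C: "C \<ge> 0" "\<And>x. norm (f x) \<le> C" using bandE[OF test_fun_band[OF 0(1)]] by metis
  have "\<bar>\<alpha> n * f (k + \<beta> n *\<^sub>R x)\<bar> \<le> 1 * C" for n x
    unfolding abs_mult by (intro mult_mono' 0) (use C(2) in auto)
  then show ?case unfolding iter.simps unifseq_def by blast
next
  case (Suc m)
  have e: "(\<lambda>n. pderivative j (\<lambda>x. \<alpha> n * f (k + \<beta> n *\<^sub>R x))) = (\<lambda>n x. (\<alpha> n * \<beta> n) * pderivative j f (k + \<beta> n *\<^sub>R x))" for j
  proof (intro ext)
    fix n x
    have "pderivative j (\<lambda>x. \<alpha> n * f (k + \<beta> n *\<^sub>R x)) x = \<alpha> n * pderivative j (\<lambda>x. f (k + \<beta> n *\<^sub>R x)) x"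
      by (intro pderivative_cmult smooth_differentiable smooth_affine test_funD Suc.prems)
    then show "pderivative j (\<lambda>x. \<alpha> n * f (k + \<beta> n *\<^sub>R x)) x = (\<alpha> n * \<beta> n) * pderivative j f (k + \<beta> n *\<^sub>R x)"
      by (simp add: pderivative_affine smooth_differentiable test_funD(1)[OF Suc.prems(1)])
  qed
  have "iter unifseq m (\<lambda>n x. (\<alpha> n * \<beta> n) * pderivative j f (k + \<beta> n *\<^sub>R x))" for j
  proof (rule Suc.IH)
    show "pderivative j f \<in> test_fun" by (rule test_fun_pderivative[OF Suc.prems(1)])
    show "\<bar>\<alpha> n * \<beta> n\<bar> \<le> 1" for n unfolding abs_mult using Suc.prems(2)[of n] Suc.prems(3)[of n] by (simp add: mult_le_one)
    show "\<bar>\<beta> n\<bar> \<le> 1" for n by (rule Suc.prems(3))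
  qed
  moreover have "unifseq (\<lambda>n x. \<alpha> n * f (k + \<beta> n *\<^sub>R x))"
  proof -
    obtain C where C: "C \<ge> 0" "\<And>x. norm (f x) \<le> C" using bandE[OF test_fun_band[OF Suc.prems(1)]] by metis
    have "\<bar>\<alpha> n * f (k + \<beta> n *\<^sub>R x)\<bar> \<le> 1 * C" for n x
      unfolding abs_mult by (intro mult_mono' Suc.prems) (use C(2) in auto)
    then show ?thesis unfolding unifseq_def by blast
  qed
  ultimately show ?case unfolding iter.simps e by blast
qed

section \<open>Curls and derivatives of synthesized fields\<close>

definition curl :: "field \<Rightarrow> field" where
  "curl F x = vector [pderivative 2 (\<lambda>x. F x $ 3) x - pderivative 3 (\<lambda>x. F x $ 2) x,
     pderivative 3 (\<lambda>x. F x $ 1) x - pderivative 1 (\<lambda>x. F x $ 3) x,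
     pderivative 1 (\<lambda>x. F x $ 2) x - pderivative 2 (\<lambda>x. F x $ 1) x]"

lemma curl_nth: "curl F x $ 1 = pderivative 2 (\<lambda>x. F x $ 3) x - pderivative 3 (\<lambda>x. F x $ 2) x"
  "curl F x $ 2 = pderivative 3 (\<lambda>x. F x $ 1) x - pderivative 1 (\<lambda>x. F x $ 3) x"
  "curl F x $ 3 = pderivative 1 (\<lambda>x. F x $ 2) x - pderivative 2 (\<lambda>x. F x $ 1) x"
  by (simp_all add: curl_def)

text \<open>All three components have the same shape, so that later arguments need no case
  distinction.\<close>

lemma curl_component:
  obtains j l j' l' where "\<And>F. (\<lambda>x. curl F x $ i) = (\<lambda>x. pderivative j (\<lambda>x. F x $ l) x - pderivative j' (\<lambda>x. F x $ l') x)"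
proof -
  consider "i = 1" | "i = 2" | "i = 3" using exhaust_3 by metis
  then show thesis
  proof cases
    case 1 then show ?thesis by (intro that[of 2 3 3 2]) (simp add: curl_nth)
  next
    case 2 then show ?thesis by (intro that[of 3 1 1 3]) (simp add: curl_nth)
  next
    case 3 then show ?thesis by (intro that[of 1 2 2 1]) (simp add: curl_nth)
  qed
qed

text \<open>div curl = 0 by \<open>smooth_pderivative_commute\<close>.\<close>

lemma curl_test:
  assumes F: "F \<in> test_fun" shows "curl F \<in> solenoidal_test"
proof -
  have Fi: "(\<lambda>x. F x $ i) \<in> test_fun" for i by (rule test_fun_component[OF F])
  have d: "(\<lambda>x. pderivative j (\<lambda>x. F x $ l) x - pderivative j' (\<lambda>x. F x $ l') x) \<in> test_fun" for j l j' l'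
    using test_fun_add[OF test_fun_pderivative[OF Fi] test_fun_linear[OF bounded_linear_minus[OF bounded_linear_ident] test_fun_pderivative[OF Fi]], of j l j' l'] by simp
  have t: "curl F \<in> test_fun"
  proof (rule test_fun_vec)
    fix i show "(\<lambda>x. curl F x $ i) \<in> test_fun" by (rule curl_component[of i]) (simp only: d)
  qed
  have s: "smooth (\<lambda>x. F x $ l)" for l by (rule test_funD(1)[OF Fi])
  have p: "pderivative m (\<lambda>x. pderivative j (\<lambda>x. F x $ l) x - pderivative j' (\<lambda>x. F x $ l') x) x =
     pderivative m (pderivative j (\<lambda>x. F x $ l)) x - pderivative m (pderivative j' (\<lambda>x. F x $ l')) x" for m j l j' l' x
    by (intro pderivative_diff smooth_differentiable smooth_pderivative s)
  have "(\<Sum>j\<in>UNIV. pderivative j (curl F) x $ j) = 0" for x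
    unfolding sum_3 pderivative_component[OF test_funD(1)[OF t]] curl_nth p
    using smooth_pderivative_commute[OF s, of 1 2 3 x] smooth_pderivative_commute[OF s, of 1 3 2 x] smooth_pderivative_commute[OF s, of 2 3 1 x]
    by simp
  with t show ?thesis by (simp add: solenoidal_test_def)
qed

lemma synth_s_diff:
  assumes a: "band a" and b: "band b"
  shows "synth_s a x - synth_s b x = synth_s (\<lambda>\<xi>. a \<xi> - b \<xi>) x"
proof -
  have "ftrans (\<lambda>\<xi>. cnj (a \<xi> - b \<xi>)) x = ftrans (\<lambda>\<xi>. cnj (a \<xi>)) x - ftrans (\<lambda>\<xi>. cnj (b \<xi>)) x"
    unfolding ftrans_def complex_cnj_diff right_diff_distrib
    by (intro Bochner_Integration.integral_diff integrable_ftrans band_integrable band_cnj a b)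
  then show ?thesis by (simp add: synth_s_def)
qed

lemma synth_s_sum:
  assumes a: "\<And>j. j \<in> I \<Longrightarrow> band (a j)"
  shows "(\<Sum>j\<in>I. synth_s (a j) x) = synth_s (\<lambda>\<xi>. \<Sum>j\<in>I. a j \<xi>) x"
proof -
  have "ftrans (\<lambda>\<xi>. cnj (\<Sum>j\<in>I. a j \<xi>)) x = (\<Sum>j\<in>I. ftrans (\<lambda>\<xi>. cnj (a j \<xi>)) x)"
    unfolding ftrans_def cnj_sum sum_distrib_left
    by (intro Bochner_Integration.integral_sum integrable_ftrans band_integrable band_cnj a)
  then show ?thesis by (simp add: synth_s_def)
qed

lemma synth_nth: "synth a x $ i = synth_s (\<lambda>\<xi>. a \<xi> $ i) x" by (simp add: synth_def)

text \<open>The Jacobian of \<open>synth g\<close>, written through symbols so that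
  \<open>Jsynth_bound\<close> can estimate it by a moment of g.\<close>

definition Jsynth :: "(real^3 \<Rightarrow> complex^3) \<Rightarrow> real^3 \<Rightarrow> real^3^3" where
  "Jsynth g x = (\<chi> i j. synth_s (\<lambda>\<xi>. \<i> * complex_of_real (\<xi> $ j) * g \<xi> $ i) x)"

lemma jac_synth: "band g \<Longrightarrow> jac (synth g) = Jsynth g"
  by (simp add: fun_eq_iff jac_def Jsynth_def synth_nth pderivative_synth_s band_component)

lemma lap_synth:
  assumes g: "band g"
  shows "(\<chi> i. \<Sum>j\<in>UNIV. pderivative j (pderivative j (\<lambda>x. synth g x $ i)) x) = synth (\<lambda>\<xi>. - ((norm \<xi>)\<^sup>2 *\<^sub>R g \<xi>)) x"
proof -
  have gi: "band (\<lambda>\<xi>. g \<xi> $ i)" for i by (rule band_component[OF g])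
  have "(\<Sum>j\<in>UNIV. pderivative j (pderivative j (\<lambda>x. synth g x $ i)) x) = synth_s (\<lambda>\<xi>. \<Sum>j\<in>UNIV. \<i> * complex_of_real (\<xi> $ j) * (\<i> * complex_of_real (\<xi> $ j) * g \<xi> $ i)) x" for i
    by (simp only: synth_nth pderivative_synth_s gi band_iu_mult synth_s_sum)
  moreover have "(\<Sum>j\<in>UNIV. \<i> * complex_of_real (\<xi> $ j) * (\<i> * complex_of_real (\<xi> $ j) * g \<xi> $ i)) = (- ((norm \<xi>)\<^sup>2 *\<^sub>R g \<xi>)) $ i" for \<xi> i
  proof -
    have "(\<Sum>j\<in>UNIV. \<i> * complex_of_real (\<xi> $ j) * (\<i> * complex_of_real (\<xi> $ j) * g \<xi> $ i)) = (\<Sum>j\<in>UNIV. - (complex_of_real ((\<xi> $ j)\<^sup>2) * g \<xi> $ i))"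
      by (intro sum.cong refl) (simp add: power2_eq_square algebra_simps)
    also have "\<dots> = - (complex_of_real (\<Sum>j\<in>UNIV. (\<xi> $ j)\<^sup>2) * g \<xi> $ i)"
      by (simp add: sum_negf sum_distrib_right)
    also have "(\<Sum>j\<in>UNIV. (\<xi> $ j)\<^sup>2) = (norm \<xi>)\<^sup>2" by (simp add: norm_vec_sq)
    finally show ?thesis unfolding vector_uminus_component vector_scaleR_component by (simp add: scaleR_conv_of_real)
  qed
  ultimately show ?thesis unfolding vec_eq_iff by (simp only: synth_nth vec_lambda_beta) simp
qed

section \<open>Truncation of potentials in physical space\<close>

context cutoff begin

text \<open>The bump c, recentred from k to the origin and dilated by n + 1; it equals 1 on a cube
  of side (n+1) \<delta> about the origin.\<close>

definition zeta :: "nat \<Rightarrow> real^3 \<Rightarrow> real" where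
  "zeta n x = c (k + (1 / real (Suc n)) *\<^sub>R x)"

lemma zeta_test: "zeta n \<in> test_fun"
  unfolding zeta_def[abs_def] by (rule test_fun_affine[OF c_test]) simp

lemma zeta_iter: "iter unifseq m zeta"
proof -
  have "iter unifseq m (\<lambda>n x. 1 * c (k + (1 / real (Suc n)) *\<^sub>R x))"
    by (rule iter_scaled_test[OF c_test]) (auto simp: divide_le_eq)
  then show ?thesis by (simp add: zeta_def[abs_def])
qed

text \<open>A whole ball about x rather than the point alone, because the derivatives at x of
  truncated and untruncated fields are to agree from some n on.\<close>

lemma zeta_eventually_1: "\<exists>N. \<forall>n\<ge>N. \<forall>y\<in>ball x 1. zeta n y = 1"
proof -
  obtain N :: nat where N: "(norm x + 1) / (\<delta> / 2) \<le> real N" using real_arch_simple by blast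
  have "zeta n y = 1" if "n \<ge> N" "y \<in> ball x 1" for n y
  proof -
    have "norm y \<le> norm x + 1" using that(2) norm_triangle_sub[of y x] by (simp add: dist_norm norm_minus_commute)
    also have "\<dots> \<le> real (Suc n) * (\<delta> / 2)"
    proof -
      have "(norm x + 1) / (\<delta> / 2) \<le> real (Suc n)" using N that(1) by simp
      then show ?thesis using \<delta> by (simp add: pos_divide_le_eq)
    qed
    finally have y: "norm y \<le> real (Suc n) * (\<delta> / 2)" .
    have "\<bar>((1 / real (Suc n)) *\<^sub>R y) $ i\<bar> \<le> \<delta> / 2" for i
    proof -
      have "\<bar>y $ i\<bar> \<le> real (Suc n) * (\<delta> / 2)" using component_le_norm_cart[of y i] y by linarith
      then show ?thesis by (simp add: abs_mult pos_divide_le_eq mult.commute del: of_nat_Suc)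
    qed
    then have "k + (1 / real (Suc n)) *\<^sub>R y \<in> cube k (\<delta> / 2)" by (simp add: cube_def)
    then show ?thesis unfolding zeta_def by (rule c_eq_1)
  qed
  then show ?thesis by blast
qed

text \<open>Equality from some index on, at each point, together with square-integrable majorants:
  dominated convergence in every pairing.\<close>

lemma weak_convI:
  fixes F :: "nat \<Rightarrow> field"
  assumes d: "\<And>i. domseq (\<lambda>n x. F n x $ i)" and m: "\<And>n. F n \<in> borel_measurable borel" and m0: "F0 \<in> borel_measurable borel"
    and l: "\<And>x. \<exists>N. \<forall>n\<ge>N. F n x = F0 x"
  shows "weak_conv F F0"
proof -
  from d have "\<forall>i. \<exists>G. G \<in> L2 \<and> (\<forall>n x. \<bar>F n x $ i\<bar> \<le> G x)" unfolding domseq_def by blast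
  then obtain G where G: "\<And>i. G i \<in> L2" "\<And>i n x. \<bar>F n x $ i\<bar> \<le> G i x" by metis
  define H where "H x = (\<Sum>i\<in>UNIV. G i x)" for x
  have H: "H \<in> L2" unfolding H_def by (intro L2_sum G)
  have H0: "H x \<ge> 0" for x unfolding H_def by (intro sum_nonneg order_trans[OF abs_ge_zero G(2)])
  have FH: "norm (F n x) \<le> H x" for n x
    unfolding H_def by (rule order_trans[OF norm_le_l1_cart sum_mono[OF G(2)]])
  have F0H: "norm (F0 x) \<le> H x" for x using l[of x] FH by (metis order_refl)
  have FL: "F n \<in> L2" for n by (rule L2_dominated[OF H m]) (use FH H0 in auto)
  have F0L: "F0 \<in> L2" by (rule L2_dominated[OF H m0]) (use F0H H0 in auto)
  have b: "L2_norm (F n) \<le> L2_norm H" for n by (rule L2_norm_mono[OF H m]) (use FH H0 in auto)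
  have "(\<lambda>n. L2_inner w (F n)) \<longlonglongrightarrow> L2_inner w F0" if w: "w \<in> L2" for w
    unfolding L2_inner_def
  proof (rule integral_dominated_convergence[where w="\<lambda>x. norm (w x) * norm (H x)"])
    note [measurable] = L2_measurable[OF w] m m0
    show "integrable lborel (\<lambda>x. norm (w x) * norm (H x))" by (rule L2_norm_mult_integrable[OF w H])
    show "AE x in lborel. (\<lambda>n. w x \<bullet> F n x) \<longlonglongrightarrow> w x \<bullet> F0 x"
    proof (rule AE_I2)
      fix x
      from l[of x] have "\<forall>\<^sub>F n in sequentially. w x \<bullet> F n x = w x \<bullet> F0 x"
        unfolding eventually_sequentially by metis
      then show "(\<lambda>n. w x \<bullet> F n x) \<longlonglongrightarrow> w x \<bullet> F0 x" by (rule tendsto_eventually)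
    qed
    show "AE x in lborel. norm (w x \<bullet> F n x) \<le> norm (w x) * norm (H x)" for n
    proof (rule AE_I2)
      fix x
      show "norm (w x \<bullet> F n x) \<le> norm (w x) * norm (H x)"
        unfolding real_norm_def[of "w x \<bullet> F n x"]
        by (rule order_trans[OF Cauchy_Schwarz_ineq2 mult_left_mono]) (use FH[of n x] H0[of x] in auto)
    qed
    show "(\<lambda>x. w x \<bullet> F0 x) \<in> borel_measurable lborel" by simp
    show "(\<lambda>x. w x \<bullet> F n x) \<in> borel_measurable lborel" for n by simp
  qed
  then show ?thesis unfolding weak_conv_def using FL F0L b by blast
qed

text \<open>In each trilinear integral the majorant is the integrable product of the two L2
  components times the uniform bound of the matrix entry.\<close>

lemma flux_convI:
  assumes d: "\<And>i j. domseq (\<lambda>n x. M n x $ i $ j)" and m: "\<And>n i j. (\<lambda>x. M n x $ i $ j) \<in> borel_measurable borel"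
    and m0: "\<And>i j. (\<lambda>x. M0 x $ i $ j) \<in> borel_measurable borel"
    and l: "\<And>x. \<exists>N. \<forall>n\<ge>N. M n x = M0 x"
  shows "flux_conv M M0"
proof -
  from d have "\<forall>i. \<forall>j. \<exists>C. \<forall>n x. \<bar>M n x $ i $ j\<bar> \<le> C" unfolding domseq_def by (meson order_trans)
  then obtain C where C: "\<And>i j n x. \<bar>M n x $ i $ j\<bar> \<le> C i j" by metis
  have Cs: "\<bar>M n x $ i $ j\<bar> \<le> (\<Sum>i\<in>UNIV. \<Sum>j\<in>UNIV. C i j)" for n x i j
  proof -
    have C0: "C i j \<ge> 0" for i j using C[of 0 0 i j] by linarith
    have "C i j \<le> (\<Sum>j\<in>UNIV. C i j)" by (rule member_le_sum) (auto intro: C0)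
    also have "\<dots> \<le> (\<Sum>i\<in>UNIV. \<Sum>j\<in>UNIV. C i j)" by (rule member_le_sum) (auto intro: C0 sum_nonneg)
    finally show ?thesis using C[of n x i j] by linarith
  qed
  have C0: "\<bar>M0 x $ i $ j\<bar> \<le> C i j" for x i j using l[of x] C by (metis order_refl)
  have "(\<lambda>n. flux p q (M n)) \<longlonglongrightarrow> flux p q M0" if p: "p \<in> L2" and q: "q \<in> L2" for p q
    unfolding flux_def
  proof (intro tendsto_sum)
    fix i j
    note [measurable] = m[of _ i j] m0[of i j] L2_measurable[OF L2_component[OF p, of j]] L2_measurable[OF L2_component[OF q, of i]]
    show "(\<lambda>n. trip (\<lambda>x. q x $ i) (\<lambda>x. p x $ j) (\<lambda>x. M n x $ i $ j)) \<longlonglongrightarrow> trip (\<lambda>x. q x $ i) (\<lambda>x. p x $ j) (\<lambda>x. M0 x $ i $ j)"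
      unfolding trip_def
    proof (rule integral_dominated_convergence[where w="\<lambda>x. norm (q x $ i) * norm (p x $ j) * C i j"])
      show "integrable lborel (\<lambda>x. norm (q x $ i) * norm (p x $ j) * C i j)"
        by (intro integrable_mult_left L2_norm_mult_integrable L2_component p q)
      show "AE x in lborel. (\<lambda>n. q x $ i * p x $ j * M n x $ i $ j) \<longlonglongrightarrow> q x $ i * p x $ j * M0 x $ i $ j"
      proof (rule AE_I2)
        fix x
        from l[of x] have "\<forall>\<^sub>F n in sequentially. q x $ i * p x $ j * M n x $ i $ j = q x $ i * p x $ j * M0 x $ i $ j"
          unfolding eventually_sequentially by metis
        then show "(\<lambda>n. q x $ i * p x $ j * M n x $ i $ j) \<longlonglongrightarrow> q x $ i * p x $ j * M0 x $ i $ j" by (rule tendsto_eventually)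
      qed
      show "AE x in lborel. norm (q x $ i * p x $ j * M n x $ i $ j) \<le> norm (q x $ i) * norm (p x $ j) * C i j" for n
        by (rule AE_I2) (auto simp: abs_mult intro!: mult_left_mono C)
      show "(\<lambda>x. q x $ i * p x $ j * M0 x $ i $ j) \<in> borel_measurable lborel" by measurable
      show "(\<lambda>x. q x $ i * p x $ j * M n x $ i $ j) \<in> borel_measurable lborel" for n by measurable
    qed
  qed
  then show ?thesis unfolding flux_conv_def bmeas_def using m m0 Cs C0 by blast
qed

text \<open>The terms in which derivatives fall on the cutoff are dominated and, near each point,
  vanish from some n on; no rate of decay of \<open>synth a\<close> enters.\<close>

lemma curl_approx:
  assumes a: "band a"
  defines "\<phi> n \<equiv> curl (\<lambda>x. zeta n x *\<^sub>R synth a x)"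
  shows "\<phi> n \<in> solenoidal_test"
    and "iter domseq 2 (\<lambda>n x. \<phi> n x $ i)"
    and "\<exists>N. \<forall>n\<ge>N. \<forall>y\<in>ball x 1. \<phi> n y = curl (synth a) y"
proof -
  have comp: "(\<lambda>x. (zeta n x *\<^sub>R synth a x) $ l) = (\<lambda>x. zeta n x * synth_s (\<lambda>\<xi>. a \<xi> $ l) x)" for n l
    by (simp add: synth_nth)
  have sa: "smooth (synth_s (\<lambda>\<xi>. a \<xi> $ l))" for l by (rule smooth_synth_s[OF band_component[OF a]])
  have t: "(\<lambda>x. zeta n x * synth_s (\<lambda>\<xi>. a \<xi> $ l) x) \<in> test_fun" for n l
    by (rule test_fun_mult[OF zeta_test sa])
  have "(\<lambda>x. zeta n x *\<^sub>R synth a x) \<in> test_fun"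
    by (rule test_fun_vec) (simp only: comp t)
  then show "\<phi> n \<in> solenoidal_test" unfolding \<phi>_def by (rule curl_test)
  \<comment> \<open>Three orders for the potential: one is spent on the curl, two remain for the
    Laplacian.\<close>
  have it: "iter domseq 3 (\<lambda>n x. zeta n x * synth_s (\<lambda>\<xi>. a \<xi> $ l) x)" for l
    by (rule iter_mult[OF test_funD(1)[OF zeta_test] sa zeta_iter iter_synth_s[OF band_component[OF a]]])
  have it2: "iter domseq 2 (\<lambda>n. pderivative j (\<lambda>x. zeta n x * synth_s (\<lambda>\<xi>. a \<xi> $ l) x))" for j l
    using it[of l] by (simp add: numeral_3_eq_3 numeral_2_eq_2)
  have sm: "smooth (pderivative j (\<lambda>x. zeta n x * synth_s (\<lambda>\<xi>. a \<xi> $ l) x))" for n j l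
    by (intro smooth_pderivative test_funD t)
  obtain j l j' l' where c: "\<And>F. (\<lambda>x. curl F x $ i) = (\<lambda>x. pderivative j (\<lambda>x. F x $ l) x - pderivative j' (\<lambda>x. F x $ l') x)"
    using curl_component[of i] by metis
  have "iter domseq 2 (\<lambda>n x. pderivative j (\<lambda>x. zeta n x * synth_s (\<lambda>\<xi>. a \<xi> $ l) x) x + - pderivative j' (\<lambda>x. zeta n x * synth_s (\<lambda>\<xi>. a \<xi> $ l') x) x)"
    by (rule iter_add[OF _ _ it2 iter_uminus[OF sm it2]])
       (auto intro: sm smooth_linear[OF bounded_linear_minus[OF bounded_linear_ident] sm])
  then show "iter domseq 2 (\<lambda>n x. \<phi> n x $ i)"
    unfolding \<phi>_def c comp by simp
  obtain N where N: "\<forall>n\<ge>N. \<forall>y\<in>ball x 1. zeta n y = 1" using zeta_eventually_1 by blast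
  have "\<phi> n y = curl (synth a) y" if "n \<ge> N" "y \<in> ball x 1" for n y
  proof -
    have "pderivative j (\<lambda>x. (zeta n x *\<^sub>R synth a x) $ l) y = pderivative j (\<lambda>x. synth a x $ l) y" for j l
    proof (rule pderivative_cong_open[OF open_ball that(2)])
      show "(zeta n z *\<^sub>R synth a z) $ l = synth a z $ l" if "z \<in> ball x 1" for z
        using N \<open>n \<ge> N\<close> that by simp
      show "(\<lambda>x. synth a x $ l) differentiable (at y)"
        unfolding synth_nth by (rule smooth_differentiable[OF sa])
    qed
    then show ?thesis unfolding \<phi>_def curl_def by simp
  qed
  then show "\<exists>N. \<forall>n\<ge>N. \<forall>y\<in>ball x 1. \<phi> n y = curl (synth a) y" by blast
qed

text \<open>Near each point the field, the Jacobian and the Laplacian of the approximants coincide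
  with those of \<open>synth g\<close> from some n on; with the majorants of
  \<open>curl_approx\<close> this gives the three convergences of
  \<open>weak_eq_limit\<close>.\<close>

lemma weak_eq_synth_curl:
  assumes eq: "\<And>\<phi>. \<phi> \<in> solenoidal_test \<Longrightarrow> weak_eq \<kappa> v (\<lambda>t M. flux (p t) (q t) M - flux (r t) (s t) M) f v0 \<phi> (lap \<phi>) (jac \<phi>)"
    and v: "regular v" and p: "regular p" and q: "regular q" and r: "regular r" and s: "regular s"
    and f: "admissible_force f" and v0: "v0 \<in> L2"
    and a: "band a" and g: "band g" and ag: "\<And>x. curl (synth a) x = synth g x"
  shows "weak_eq \<kappa> v (\<lambda>t M. flux (p t) (q t) M - flux (r t) (s t) M) f v0 (synth g) (synth (\<lambda>\<xi>. - ((norm \<xi>)\<^sup>2 *\<^sub>R g \<xi>))) (Jsynth g)"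
proof -
  define \<phi> where "\<phi> n = curl (\<lambda>x. zeta n x *\<^sub>R synth a x)" for n
  note A = curl_approx[OF a, folded \<phi>_def]
  have \<phi>t: "\<phi> n \<in> test_fun" for n using A(1)[of n] by (simp add: solenoidal_test_def)
  have \<phi>i: "(\<lambda>x. \<phi> n x $ i) \<in> test_fun" for n i by (rule test_fun_component[OF \<phi>t])
  have gi: "smooth (\<lambda>x. synth g x $ i)" for i
    unfolding synth_nth by (rule smooth_synth_s[OF band_component[OF g]])
  have gs: "smooth (synth g)" by (rule smooth_vec) (rule gi)
  have near: "\<exists>N. \<forall>n\<ge>N. \<forall>y\<in>ball x 1. \<phi> n y = synth g y" for x using A(3)[of x] by (simp add: ag)
  have l0: "\<exists>N. \<forall>n\<ge>N. \<phi> n x = synth g x" for x using near[of x] by (meson centre_in_ball zero_less_one)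
  have p1: "pderivative j (\<lambda>x. \<phi> n x $ i) y = pderivative j (\<lambda>x. synth g x $ i) y" if "\<forall>y\<in>ball x 1. \<phi> n y = synth g y" "y \<in> ball x 1" for n x y i j
    by (rule pderivative_cong_open[OF open_ball that(2)]) (use that in \<open>auto intro: smooth_differentiable gi\<close>)
  have p2: "pderivative j (pderivative j (\<lambda>x. \<phi> n x $ i)) x = pderivative j (pderivative j (\<lambda>x. synth g x $ i)) x" if "\<forall>y\<in>ball x 1. \<phi> n y = synth g y" for n x i j
    by (rule pderivative_cong_open[OF open_ball, of x x 1]) (use p1[OF that] in \<open>auto intro: smooth_differentiable smooth_pderivative gi\<close>)
  have l1: "\<exists>N. \<forall>n\<ge>N. jac (\<phi> n) x = Jsynth g x" for x
  proof -
    obtain N where N: "\<forall>n\<ge>N. \<forall>y\<in>ball x 1. \<phi> n y = synth g y" using near by blast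
    have "jac (\<phi> n) x = Jsynth g x" if "n \<ge> N" for n
    proof -
      have "\<forall>y\<in>ball x 1. \<phi> n y = synth g y" using N that by blast
      then show ?thesis unfolding jac_synth[OF g, symmetric] jac_def using p1[of x n x] by simp
    qed
    then show ?thesis by blast
  qed
  have l2: "\<exists>N. \<forall>n\<ge>N. lap (\<phi> n) x = synth (\<lambda>\<xi>. - ((norm \<xi>)\<^sup>2 *\<^sub>R g \<xi>)) x" for x
  proof -
    obtain N where N: "\<forall>n\<ge>N. \<forall>y\<in>ball x 1. \<phi> n y = synth g y" using near by blast
    have "lap (\<phi> n) x = synth (\<lambda>\<xi>. - ((norm \<xi>)\<^sup>2 *\<^sub>R g \<xi>)) x" if "n \<ge> N" for n
    proof -
      have "\<forall>y\<in>ball x 1. \<phi> n y = synth g y" using N that by blast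
      then show ?thesis unfolding lap_synth[OF g, symmetric] lap_def using p2[of x n] by simp
    qed
    then show ?thesis by blast
  qed
  have it: "iter domseq 2 (\<lambda>n x. \<phi> n x $ i)" for i by (rule A(2))
  have d1: "domseq (\<lambda>n. pderivative j (\<lambda>x. \<phi> n x $ i))" for i j using it[of i] by (simp add: numeral_2_eq_2)
  have d2: "domseq (\<lambda>n. pderivative j (pderivative j (\<lambda>x. \<phi> n x $ i)))" for i j using it[of i] by (simp add: numeral_2_eq_2)
  have d3: "domseq (\<lambda>n x. \<Sum>j\<in>I. pderivative j (pderivative j (\<lambda>x. \<phi> n x $ i)) x)" for i and I :: "3 set"
    by (induction I rule: infinite_finite_induct) (auto intro: domseq_add d2 domseq_zero)
  have g2: "band (\<lambda>\<xi>. - ((norm \<xi>)\<^sup>2 *\<^sub>R g \<xi>))"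
    by (rule band_linear[OF band_mult[OF g] bounded_linear_minus[OF bounded_linear_ident]]) (intro continuous_intros)
  show ?thesis
  proof (rule weak_eq_limit[OF eq[OF A(1)] v p q r s f v0])
    show "weak_conv \<phi> (synth g)"
      by (rule weak_convI[OF iter_base[OF it] smooth_measurable[OF test_funD(1)[OF \<phi>t]] L2_measurable[OF synth_L2[OF g]] l0])
    show "weak_conv (\<lambda>n. lap (\<phi> n)) (synth (\<lambda>\<xi>. - ((norm \<xi>)\<^sup>2 *\<^sub>R g \<xi>)))"
      by (rule weak_convI[OF _ smooth_measurable[OF test_funD(1)[OF lap_test[OF \<phi>t]]] L2_measurable[OF synth_L2[OF g2]] l2])
         (simp add: lap_def d3)
    show "flux_conv (\<lambda>n. jac (\<phi> n)) (Jsynth g)"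
    proof (rule flux_convI[OF _ _ _ l1])
      show "domseq (\<lambda>n x. jac (\<phi> n) x $ i $ j)" for i j unfolding jac_nth by (rule d1)
      show "(\<lambda>x. jac (\<phi> n) x $ i $ j) \<in> borel_measurable borel" for n i j
        unfolding jac_nth by (rule smooth_measurable[OF smooth_pderivative[OF test_funD(1)[OF \<phi>i]]])
      show "(\<lambda>x. Jsynth g x $ i $ j) \<in> borel_measurable borel" for i j
        unfolding jac_synth[OF g, symmetric] jac_nth by (rule smooth_measurable[OF smooth_pderivative[OF gi]])
    qed
  qed
qed

text \<open>A symbol with \<open>\<xi> \<bullet> g = 0\<close> that vanishes near the origin is the symbol of a curl, with potential
  \<open>i \<xi> \<times> g / |\<xi>|\<^sup>2\<close>; truncating the potential keeps the test field solenoidal.\<close>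

lemma weak_eq_synth:
  assumes eq: "\<And>\<phi>. \<phi> \<in> solenoidal_test \<Longrightarrow> weak_eq \<kappa> v (\<lambda>t M. flux (p t) (q t) M - flux (r t) (s t) M) f v0 \<phi> (lap \<phi>) (jac \<phi>)"
    and reg: "regular v" "regular p" "regular q" "regular r" "regular s"
    and f: "admissible_force f" and v0: "v0 \<in> L2"
    and g: "band g" and \<rho>: "\<rho> > 0" "\<And>\<xi>. norm \<xi> < \<rho> \<Longrightarrow> g \<xi> = 0" and sol: "\<And>\<xi>. (\<Sum>j\<in>UNIV. complex_of_real (\<xi> $ j) * g \<xi> $ j) = 0"
  shows "weak_eq \<kappa> v (\<lambda>t M. flux (p t) (q t) M - flux (r t) (s t) M) f v0 (synth g) (synth (\<lambda>\<xi>. - ((norm \<xi>)\<^sup>2 *\<^sub>R g \<xi>))) (Jsynth g)"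
proof -
  \<comment> \<open>Equal to 1/|\<xi>|^2 wherever g can be nonzero; the maximum removes the
    singularity at 0 and makes h continuous.\<close>
  define h where "h \<xi> = 1 / max ((norm \<xi>)\<^sup>2) (\<rho>\<^sup>2)" for \<xi> :: "real^3"
  have hc: "continuous_on UNIV h"
    unfolding h_def using \<rho>(1) by (intro continuous_intros) (auto simp: max_def not_le intro: less_imp_neq[symmetric])
  define a where "a \<xi> = (vector [h \<xi> *\<^sub>R (\<i> * complex_of_real (\<xi> $ 2) * g \<xi> $ 3 - \<i> * complex_of_real (\<xi> $ 3) * g \<xi> $ 2),
      h \<xi> *\<^sub>R (\<i> * complex_of_real (\<xi> $ 3) * g \<xi> $ 1 - \<i> * complex_of_real (\<xi> $ 1) * g \<xi> $ 3),
      h \<xi> *\<^sub>R (\<i> * complex_of_real (\<xi> $ 1) * g \<xi> $ 2 - \<i> * complex_of_real (\<xi> $ 2) * g \<xi> $ 1)] :: complex^3)" for \<xi>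
  have bd: "band (\<lambda>\<xi>. h \<xi> *\<^sub>R (\<i> * complex_of_real (\<xi> $ j) * g \<xi> $ l - \<i> * complex_of_real (\<xi> $ j') * g \<xi> $ l'))" for j l j' l'
    using band_mult[OF band_add[OF band_iu_mult[OF band_component[OF g]] band_linear[OF band_iu_mult[OF band_component[OF g]] bounded_linear_minus[OF bounded_linear_ident]]] hc, of j l j' l']
    by simp
  have a: "band a"
  proof (rule band_vec)
    fix i :: 3
    consider "i = 1" | "i = 2" | "i = 3" using exhaust_3 by metis
    then show "band (\<lambda>\<xi>. a \<xi> $ i)" by cases (simp_all add: a_def bd)
  qed
  have hg: "complex_of_real (h \<xi> * ((\<xi> $ 1)\<^sup>2 + (\<xi> $ 2)\<^sup>2 + (\<xi> $ 3)\<^sup>2)) * g \<xi> $ i = g \<xi> $ i" for \<xi> i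
  proof (cases "g \<xi> = 0")
    case False
    then have "norm \<xi> \<ge> \<rho>" using \<rho>(2)[of \<xi>] by force
    then have "(norm \<xi>)\<^sup>2 \<ge> \<rho>\<^sup>2" "norm \<xi> \<noteq> 0" using \<rho>(1) by (auto intro: power_mono)
    then have "h \<xi> * (norm \<xi>)\<^sup>2 = 1" by (simp add: h_def max_def)
    then have "h \<xi> * ((\<xi> $ 1)\<^sup>2 + (\<xi> $ 2)\<^sup>2 + (\<xi> $ 3)\<^sup>2) = 1" by (simp add: norm_vec_sq sum_3)
    then show ?thesis by simp
  qed simp
  \<comment> \<open>The vector identity i\<xi> \<times> (i\<xi> \<times> g) = |\<xi>|^2 g - \<xi>
    (\<xi> . g), whose last term vanishes.\<close>
  have key: "\<i> * complex_of_real (\<xi> $ 2) * a \<xi> $ 3 - \<i> * complex_of_real (\<xi> $ 3) * a \<xi> $ 2 = g \<xi> $ 1"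
    "\<i> * complex_of_real (\<xi> $ 3) * a \<xi> $ 1 - \<i> * complex_of_real (\<xi> $ 1) * a \<xi> $ 3 = g \<xi> $ 2"
    "\<i> * complex_of_real (\<xi> $ 1) * a \<xi> $ 2 - \<i> * complex_of_real (\<xi> $ 2) * a \<xi> $ 1 = g \<xi> $ 3" for \<xi>
  proof -
    define x y z H where "x = complex_of_real (\<xi> $ 1)" and "y = complex_of_real (\<xi> $ 2)" and "z = complex_of_real (\<xi> $ 3)" and "H = complex_of_real (h \<xi>)"
    define g1 g2 g3 where "g1 = g \<xi> $ 1" and "g2 = g \<xi> $ 2" and "g3 = g \<xi> $ 3"
    have s: "x * g1 + y * g2 + z * g3 = 0" using sol[of \<xi>] by (simp add: sum_3 x_def y_def z_def g1_def g2_def g3_def)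
    have e: "H * (x\<^sup>2 + y\<^sup>2 + z\<^sup>2) * g1 = g1" "H * (x\<^sup>2 + y\<^sup>2 + z\<^sup>2) * g2 = g2" "H * (x\<^sup>2 + y\<^sup>2 + z\<^sup>2) * g3 = g3"
      using hg[of \<xi> 1] hg[of \<xi> 2] hg[of \<xi> 3] by (simp_all add: x_def y_def z_def H_def g1_def g2_def g3_def)
    have av: "a \<xi> $ 1 = H * (\<i> * y * g3 - \<i> * z * g2)" "a \<xi> $ 2 = H * (\<i> * z * g1 - \<i> * x * g3)" "a \<xi> $ 3 = H * (\<i> * x * g2 - \<i> * y * g1)"
      by (simp_all add: a_def x_def y_def z_def H_def g1_def g2_def g3_def scaleR_conv_of_real)
    have ii: "\<i> * \<i> = -1" by simp
    show "\<i> * complex_of_real (\<xi> $ 2) * a \<xi> $ 3 - \<i> * complex_of_real (\<xi> $ 3) * a \<xi> $ 2 = g \<xi> $ 1"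
      unfolding av x_def[symmetric] y_def[symmetric] z_def[symmetric] g1_def[symmetric] using s e(1) ii by algebra
    show "\<i> * complex_of_real (\<xi> $ 3) * a \<xi> $ 1 - \<i> * complex_of_real (\<xi> $ 1) * a \<xi> $ 3 = g \<xi> $ 2"
      unfolding av x_def[symmetric] y_def[symmetric] z_def[symmetric] g2_def[symmetric] using s e(2) ii by algebra
    show "\<i> * complex_of_real (\<xi> $ 1) * a \<xi> $ 2 - \<i> * complex_of_real (\<xi> $ 2) * a \<xi> $ 1 = g \<xi> $ 3"
      unfolding av x_def[symmetric] y_def[symmetric] z_def[symmetric] g3_def[symmetric] using s e(3) ii by algebra
  qed
  have ag: "curl (synth a) x = synth g x" for x
  proof -
    have ai: "band (\<lambda>\<xi>. a \<xi> $ i)" for i by (rule band_component[OF a])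
    have "pderivative j (\<lambda>x. synth a x $ l) x - pderivative j' (\<lambda>x. synth a x $ l') x
       = synth_s (\<lambda>\<xi>. \<i> * complex_of_real (\<xi> $ j) * a \<xi> $ l - \<i> * complex_of_real (\<xi> $ j') * a \<xi> $ l') x" for j l j' l'
      by (simp add: synth_nth pderivative_synth_s ai synth_s_diff band_iu_mult)
    then show ?thesis
      by (simp only: vec_eq_iff forall_3 curl_nth synth_nth key)
  qed
  show ?thesis by (rule weak_eq_synth_curl[OF eq reg f v0 a g ag])
qed

end

section \<open>Evolution of the Fourier modes\<close>

text \<open>The square of the positive part has one continuous derivative, which is all that
  \<open>weak_eq\<close> demands of a profile in time.\<close>

definition sqp :: "real \<Rightarrow> real" where "sqp z = (max 0 z)\<^sup>2"

text \<open>A quadratic Taylor remainder with constant 1 in all four sign cases; it yields the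
  derivative without separate one-sided limits at 0.\<close>

lemma sqp_remainder: "\<bar>sqp y - sqp z - 2 * max 0 z * (y - z)\<bar> \<le> (y - z)\<^sup>2"
proof -
  consider "z \<ge> 0" "y \<ge> 0" | "z \<ge> 0" "y < 0" | "z < 0" "y \<ge> 0" | "z < 0" "y < 0" by linarith
  then show ?thesis
  proof cases
    case 1
    have "y\<^sup>2 - z\<^sup>2 - 2 * z * (y - z) = (y - z)\<^sup>2" by (simp add: power2_eq_square algebra_simps)
    then show ?thesis using 1 by (simp add: sqp_def max_def)
  next
    case 2
    have "0 \<le> z * (z - 2 * y)" using 2 by (intro mult_nonneg_nonneg) auto
    moreover have "(y - z)\<^sup>2 = y\<^sup>2 + z * (z - 2 * y)" by (simp add: power2_eq_square algebra_simps)
    moreover have "- z\<^sup>2 - 2 * z * (y - z) = z * (z - 2 * y)" by (simp add: power2_eq_square algebra_simps)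
    ultimately show ?thesis using 2 zero_le_power2[of y] by (simp add: sqp_def max_def)
  next
    case 3
    have "y\<^sup>2 \<le> (y - z)\<^sup>2" using 3 by (intro power_mono) auto
    then show ?thesis using 3 by (simp add: sqp_def max_def)
  next
    case 4 then show ?thesis by (simp add: sqp_def max_def)
  qed
qed

lemma sqp_deriv: "(sqp has_real_derivative 2 * max 0 z) (at z)"
  unfolding has_field_derivative_def
proof (rule has_derivativeI_sandwich[where e=1 and H="\<lambda>y. \<bar>y - z\<bar>"])
  show "bounded_linear ((*) (2 * max 0 z))" by (rule bounded_linear_mult_right)
  show "norm (sqp y - sqp z - 2 * max 0 z * (y - z)) / norm (y - z) \<le> \<bar>y - z\<bar>" if "y \<noteq> z" for y
    using sqp_remainder[of y z] that by (simp add: divide_le_eq power2_eq_square abs_mult[symmetric])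
  show "((\<lambda>y. \<bar>y - z\<bar>) \<longlongrightarrow> 0) (at z)" by (auto intro!: tendsto_eq_intros)
qed simp

lemma sqp_le_1: "z \<le> 1 \<Longrightarrow> sqp z \<le> 1" by (auto simp: sqp_def max_def abs_square_le_1 power_le_one)
lemma sqp_nonneg: "sqp z \<ge> 0" by (simp add: sqp_def)

lemma integral_lebesgue_on_indicator:
  fixes f :: "real \<Rightarrow> real"
  assumes "S \<in> sets lebesgue"
  shows "integral\<^sup>L (lebesgue_on S) f = integral\<^sup>L lebesgue (\<lambda>t. indicator S t * f t)"
    "integrable (lebesgue_on S) f \<longleftrightarrow> integrable lebesgue (\<lambda>t. indicator S t * f t)"
  using assms by (simp_all add: integral_restrict_space integrable_restrict_space)

lemma AE_lebesgue_neq: "AE t in lebesgue. t \<noteq> (a::real)"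
  by (rule AE_completion[OF AE_lborel_singleton])

text \<open>\<open>sqp\<close> is continuously differentiable, so \<open>sqp (1 - sqp ((s - t) / \<epsilon>))\<close> is an admissible ramp from 1 to 0.\<close>

lemma ramp_identity:
  fixes y G :: "real \<Rightarrow> real"
  assumes y: "continuous_on {0..} y" and G: "\<And>T. T > 0 \<Longrightarrow> integrable (lebesgue_on {0<..<T}) G"
    and id: "\<And>T \<theta> \<theta>'. T > 0 \<Longrightarrow> (\<And>t. (\<theta> has_real_derivative \<theta>' t) (at t)) \<Longrightarrow> continuous_on UNIV \<theta>' \<Longrightarrow> \<theta> T = 0 \<Longrightarrow>
       (\<integral>t. - \<theta>' t * y t \<partial>lebesgue_on {0<..<T}) = \<theta> 0 * y0 + (\<integral>t. \<theta> t * G t \<partial>lebesgue_on {0<..<T})"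
    and t: "t > 0"
  shows "y t = y0 + (\<integral>s. G s \<partial>lebesgue_on {0<..<t})"
proof -
  \<comment> \<open>A continuous extension to the whole line, so that the results for functions
    continuous on the line apply.\<close>
  define yy where "yy s = y (max 0 s)" for s
  have yyc: "continuous_on UNIV yy" unfolding yy_def
    by (rule continuous_on_compose2[OF y]) (auto intro!: continuous_intros)
  define \<epsilon> where "\<epsilon> n = 1 / real (Suc n)" for n
  have \<epsilon>: "\<epsilon> n > 0" "\<epsilon> n \<le> 1" for n by (auto simp: \<epsilon>_def)
  have \<epsilon>0: "\<epsilon> \<longlonglongrightarrow> 0" unfolding \<epsilon>_def by (rule LIMSEQ_Suc[OF lim_1_over_n])
  define \<theta> where "\<theta> n s = sqp (1 - sqp ((s - t) / \<epsilon> n))" for n s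
  define \<theta>' where "\<theta>' n s = 2 * max 0 (1 - sqp ((s - t) / \<epsilon> n)) * (- (2 * max 0 ((s - t) / \<epsilon> n) * (1 / \<epsilon> n)))" for n s
  have sqc: "continuous_on UNIV sqp" unfolding sqp_def by (intro continuous_intros)
  have sqc': "continuous_on UNIV (\<lambda>s. sqp ((s - t) / \<epsilon> n))" for n
    by (rule continuous_on_compose2[OF sqc]) (use \<epsilon>(1)[of n] in \<open>auto intro!: continuous_intros\<close>)
  have d: "(\<theta> n has_real_derivative \<theta>' n s) (at s)" for n s
    unfolding \<theta>_def \<theta>'_def
    by (rule DERIV_chain2[OF sqp_deriv], rule DERIV_cong[OF DERIV_diff[OF DERIV_const DERIV_chain2[OF sqp_deriv]]])
       (use \<epsilon>(1)[of n] in \<open>auto intro!: derivative_eq_intros\<close>)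
  have c: "continuous_on UNIV (\<theta>' n)" for n
    unfolding \<theta>'_def using \<epsilon>(1)[of n] by (intro continuous_intros sqc') auto
  \<comment> \<open>The horizon chosen in the hypothesis is t + \<epsilon> n, where the ramp has
    just reached 0.\<close>
  have \<theta>T: "\<theta> n (t + \<epsilon> n) = 0" for n using \<epsilon>(1)[of n] by (simp add: \<theta>_def sqp_def)
  have \<theta>1: "\<theta> n s = 1" if "s \<le> t" for n s
    using that \<epsilon>(1)[of n] by (simp add: \<theta>_def sqp_def max_def divide_le_0_iff zero_le_divide_iff)
  have \<theta>b: "0 \<le> \<theta> n s" "\<theta> n s \<le> 1" for n s
    unfolding \<theta>_def by (auto intro!: sqp_nonneg sqp_le_1 simp: sqp_nonneg)
  have \<theta>'0: "\<theta>' n s = 0" if "s \<le> t" for n s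
    using that \<epsilon>(1)[of n] by (simp add: \<theta>'_def max_def divide_le_0_iff zero_le_divide_iff)
  have \<theta>'neg: "- \<theta>' n s \<ge> 0" for n s
    unfolding \<theta>'_def using \<epsilon>(1)[of n] by (simp add: mult_nonneg_nonneg)
  let ?m = "\<lambda>n. lebesgue_on {0<..<t + \<epsilon> n}"
  \<comment> \<open>The function -\<theta>' is nonnegative, has integral 1 and vanishes before t, so
    the left side averages y over (t, t + \<epsilon> n).\<close>
  have lhs: "(\<lambda>n. \<integral>s. - \<theta>' n s * y s \<partial>?m n) \<longlonglongrightarrow> y t"
  proof (rule LIMSEQ_I)
    fix e :: real assume e: "e > 0"
    have "isCont yy t" using yyc by (simp add: continuous_on_eq_continuous_at)
    then obtain r where r: "r > 0" "\<And>s. \<bar>s - t\<bar> < r \<Longrightarrow> \<bar>yy s - yy t\<bar> < e / 2"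
      unfolding continuous_at_eps_delta dist_real_def using e by (meson half_gt_zero)
    obtain N where N: "\<And>n. n \<ge> N \<Longrightarrow> \<epsilon> n < r"
      using order_tendstoD(2)[OF \<epsilon>0 r(1)] unfolding eventually_sequentially by blast
    have "norm ((\<integral>s. - \<theta>' n s * y s \<partial>?m n) - y t) < e" if n: "n \<ge> N" for n
    proof -
      have one: "(\<integral>s. - \<theta>' n s \<partial>?m n) = 1"
        using integral_deriv_Ioo[of 0 "t + \<epsilon> n" "\<lambda>s. - \<theta> n s" "\<lambda>s. - \<theta>' n s"] t \<epsilon>(1)[of n] \<theta>T[of n] \<theta>1[of 0 n]
        by (auto intro!: derivative_eq_intros d continuous_intros c)
      have i1: "integrable (?m n) (\<lambda>s. - \<theta>' n s * yy s)" by (intro continuous_integrable_Ioo continuous_intros c yyc)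
      have i2: "integrable (?m n) (\<lambda>s. - \<theta>' n s * yy t)" by (intro continuous_integrable_Ioo continuous_intros c)
      have i3: "integrable (?m n) (\<lambda>s. - \<theta>' n s * (e / 2))" by (intro continuous_integrable_Ioo continuous_intros c)
      have "(\<integral>s. - \<theta>' n s * y s \<partial>?m n) = (\<integral>s. - \<theta>' n s * yy s \<partial>?m n)"
        by (rule Bochner_Integration.integral_cong) (auto simp: yy_def)
      moreover have "y t = (\<integral>s. - \<theta>' n s * yy t \<partial>?m n)"
        unfolding integral_mult_left_zero one using t by (simp add: yy_def)
      ultimately have "(\<integral>s. - \<theta>' n s * y s \<partial>?m n) - y t = (\<integral>s. - \<theta>' n s * yy s - (- \<theta>' n s * yy t) \<partial>?m n)"
        using Bochner_Integration.integral_diff[OF i1 i2] by simp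
      also have "norm \<dots> \<le> (\<integral>s. - \<theta>' n s * (e / 2) \<partial>?m n)"
      proof (rule Bochner_Integration.integral_norm_bound_integral[OF Bochner_Integration.integrable_diff[OF i1 i2] i3])
        fix s assume s: "s \<in> space (?m n)"
        show "norm (- \<theta>' n s * yy s - (- \<theta>' n s * yy t)) \<le> - \<theta>' n s * (e / 2)"
        proof (cases "s \<le> t")
          case False
          then have "\<bar>yy s - yy t\<bar> \<le> e / 2" using s N[OF n] r(2)[of s] by auto
          then have "- \<theta>' n s * \<bar>yy s - yy t\<bar> \<le> - \<theta>' n s * (e / 2)" by (rule mult_left_mono) (rule \<theta>'neg)
          moreover have "norm (- \<theta>' n s * yy s - (- \<theta>' n s * yy t)) = - \<theta>' n s * \<bar>yy s - yy t\<bar>"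
            unfolding right_diff_distrib[symmetric] norm_mult using \<theta>'neg[of n s] by simp
          ultimately show ?thesis by simp
        qed (simp add: \<theta>'0)
      qed
      also have "\<dots> = e / 2" unfolding integral_mult_left_zero one by simp
      finally show ?thesis using e by simp
    qed
    then show "\<exists>no. \<forall>n\<ge>no. norm ((\<integral>s. - \<theta>' n s * y s \<partial>?m n) - y t) < e" by blast
  qed
  have Gi: "integrable lebesgue (\<lambda>s. indicator {0<..<t + 1} s * G s)"
    using G[of "t + 1"] t by (simp add: integral_lebesgue_on_indicator)
  \<comment> \<open>The moving interval is encoded by indicators, so that dominated convergence
    works on a fixed domain; (0,t+1) contains every interval as \<epsilon> n <= 1.\<close>
  have "(\<lambda>n. \<integral>s. indicator {0<..<t + \<epsilon> n} s * (\<theta> n s * G s) \<partial>lebesgue) \<longlonglongrightarrow> (\<integral>s. indicator {0<..<t} s * G s \<partial>lebesgue)"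
  proof (rule integral_dominated_convergence[where w="\<lambda>s. \<bar>indicator {0<..<t + 1} s * G s\<bar>"])
    note Gm = borel_measurable_integrable[OF Gi]
    show "integrable lebesgue (\<lambda>s. \<bar>indicator {0<..<t + 1} s * G s\<bar>)" by (rule integrable_abs[OF Gi])
    have "(\<lambda>s. indicator {0<..<t} s * (indicator {0<..<t + 1} s * G s)) \<in> borel_measurable lebesgue"
      by (intro borel_measurable_times borel_measurable_indicator Gm) simp
    moreover have "(\<lambda>s. indicator {0<..<t} s * (indicator {0<..<t + 1} s * G s)) = (\<lambda>s. indicator {0<..<t} s * G s)"
      by (auto simp: indicator_def)
    ultimately show "(\<lambda>s. indicator {0<..<t} s * G s) \<in> borel_measurable lebesgue" by simp
    show "(\<lambda>s. indicator {0<..<t + \<epsilon> n} s * (\<theta> n s * G s)) \<in> borel_measurable lebesgue" for n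
    proof -
      have "continuous_on UNIV (\<theta> n)" using d by (meson DERIV_continuous continuous_at_imp_continuous_on)
      then have tm: "\<theta> n \<in> borel_measurable lebesgue"
        by (intro measurable_completion) (simp add: borel_measurable_continuous_onI)
      have "(\<lambda>s. indicator {0<..<t + \<epsilon> n} s * (\<theta> n s * (indicator {0<..<t + 1} s * G s))) \<in> borel_measurable lebesgue"
        by (intro borel_measurable_times borel_measurable_indicator Gm tm) simp
      moreover have "(\<lambda>s. indicator {0<..<t + \<epsilon> n} s * (\<theta> n s * (indicator {0<..<t + 1} s * G s))) = (\<lambda>s. indicator {0<..<t + \<epsilon> n} s * (\<theta> n s * G s))"
        using \<epsilon>(2)[of n] by (auto simp: indicator_def)
      ultimately show ?thesis by simp
    qed
    show "AE s in lebesgue. (\<lambda>n. indicator {0<..<t + \<epsilon> n} s * (\<theta> n s * G s)) \<longlonglongrightarrow> indicator {0<..<t} s * G s"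
      using AE_lebesgue_neq[of t]
    proof eventually_elim
      case (elim s)
      show ?case
      proof (cases "s < t")
        case True
        then have "indicator {0<..<t + \<epsilon> n} s * (\<theta> n s * G s) = indicator {0<..<t} s * G s" for n
          using \<epsilon>(1)[of n] \<theta>1[of s n] by (simp add: indicator_def)
        then show ?thesis by (simp only: tendsto_const)
      next
        case False
        then have "s - t > 0" using elim by simp
        then have "\<forall>\<^sub>F n in sequentially. \<epsilon> n < s - t" by (rule order_tendstoD(2)[OF \<epsilon>0])
        then have "\<forall>\<^sub>F n in sequentially. indicator {0<..<t + \<epsilon> n} s * (\<theta> n s * G s) = indicator {0<..<t} s * G s"
          by eventually_elim (use False in \<open>auto simp: indicator_def\<close>)
        then show ?thesis by (rule tendsto_eventually)
      qed
    qed
    show "AE s in lebesgue. norm (indicator {0<..<t + \<epsilon> n} s * (\<theta> n s * G s)) \<le> \<bar>indicator {0<..<t + 1} s * G s\<bar>" for n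
    proof (rule AE_I2)
      fix s
      have "\<theta> n s * \<bar>G s\<bar> \<le> 1 * \<bar>G s\<bar>" by (intro mult_right_mono \<theta>b) simp
      then show "norm (indicator {0<..<t + \<epsilon> n} s * (\<theta> n s * G s)) \<le> \<bar>indicator {0<..<t + 1} s * G s\<bar>"
        using \<epsilon>(2)[of n] \<theta>b(1)[of n s] by (auto simp: indicator_def abs_mult)
    qed
  qed
  then have rhs: "(\<lambda>n. \<theta> n 0 * y0 + (\<integral>s. \<theta> n s * G s \<partial>?m n)) \<longlonglongrightarrow> y0 + (\<integral>s. G s \<partial>lebesgue_on {0<..<t})"
    using t \<theta>1[of 0] by (simp add: integral_lebesgue_on_indicator) (intro tendsto_add tendsto_const)
  have "(\<integral>s. - \<theta>' n s * y s \<partial>?m n) = \<theta> n 0 * y0 + (\<integral>s. \<theta> n s * G s \<partial>?m n)" for n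
    by (rule id[OF _ d c \<theta>T]) (use t \<epsilon>(1)[of n] in simp)
  then show ?thesis using LIMSEQ_unique[OF lhs] rhs by simp
qed

lemma integral_Ioo_split:
  fixes G :: "real \<Rightarrow> real"
  assumes "0 < a" "a < b" and G: "integrable (lebesgue_on {0<..<b}) G"
  shows "(\<integral>s. G s \<partial>lebesgue_on {0<..<b}) = (\<integral>s. G s \<partial>lebesgue_on {0<..<a}) + (\<integral>s. G s \<partial>lebesgue_on {a<..<b})"
proof -
  have i: "integrable lebesgue (\<lambda>s. indicator {0<..<b} s * G s)" using G by (simp add: integral_lebesgue_on_indicator)
  have sub: "integrable lebesgue (\<lambda>s. indicator S s * G s)" if "S \<subseteq> {0<..<b}" "S \<in> sets lebesgue" for S
  proof -
    have "integrable lebesgue (\<lambda>s. indicator S s *\<^sub>R (indicator {0<..<b} s * G s))"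
      by (rule integrable_mult_indicator[OF that(2) i])
    moreover have "(\<lambda>s. indicator S s *\<^sub>R (indicator {0<..<b} s * G s)) = (\<lambda>s. indicator S s * G s)"
    proof
      fix s show "indicator S s *\<^sub>R (indicator {0<..<b} s * G s) = indicator S s * G s"
        using that(1) by (cases "s \<in> S") auto
    qed
    ultimately show ?thesis by simp
  qed
  have i1: "integrable lebesgue (\<lambda>s. indicator {0<..<a} s * G s)" by (rule sub) (use assms in auto)
  have i2: "integrable lebesgue (\<lambda>s. indicator {a<..<b} s * G s)" by (rule sub) (use assms in auto)
  have "(\<integral>s. indicator {0<..<b} s * G s \<partial>lebesgue) = (\<integral>s. indicator {0<..<a} s * G s + indicator {a<..<b} s * G s \<partial>lebesgue)"
  proof (rule integral_cong_AE)
    show "AE s in lebesgue. indicator {0<..<b} s * G s = indicator {0<..<a} s * G s + indicator {a<..<b} s * G s"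
      using AE_lebesgue_neq[of a] by eventually_elim (use assms in \<open>auto simp: indicator_def\<close>)
  qed (use i i1 i2 in auto)
  also have "\<dots> = (\<integral>s. indicator {0<..<a} s * G s \<partial>lebesgue) + (\<integral>s. indicator {a<..<b} s * G s \<partial>lebesgue)"
    by (rule Bochner_Integration.integral_add[OF i1 i2])
  finally show ?thesis by (simp add: integral_lebesgue_on_indicator)
qed

section \<open>Divergence-free symbols and the equation for the modes\<close>

definition divfree_band :: "(real^3 \<Rightarrow> complex^3) \<Rightarrow> bool" where
  "divfree_band g \<longleftrightarrow> band g \<and> (\<exists>\<rho>>0. \<forall>\<xi>. norm \<xi> < \<rho> \<longrightarrow> g \<xi> = 0) \<and> (\<forall>\<xi>. (\<Sum>j\<in>UNIV. complex_of_real (\<xi> $ j) * g \<xi> $ j) = 0)"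

lemma divfree_bandD: "divfree_band g \<Longrightarrow> band g" by (simp add: divfree_band_def)

lemma divfree_band_mult:
  assumes g: "divfree_band g" and h: "continuous_on UNIV (h :: real^3 \<Rightarrow> real)"
  shows "divfree_band (\<lambda>\<xi>. h \<xi> *\<^sub>R g \<xi>)"
proof -
  have "(\<Sum>j\<in>UNIV. complex_of_real (\<xi> $ j) * (h \<xi> *\<^sub>R g \<xi>) $ j) = complex_of_real (h \<xi>) * (\<Sum>j\<in>UNIV. complex_of_real (\<xi> $ j) * g \<xi> $ j)" for \<xi>
    unfolding sum_distrib_left by (intro sum.cong refl) (simp add: scaleR_conv_of_real[where 'a=complex] mult_ac)
  then show ?thesis using g band_mult[OF divfree_bandD[OF g] h] unfolding divfree_band_def by auto
qed

lemma synth_s_scale: "synth_s (\<lambda>\<xi>. complex_of_real r * a \<xi>) x = r * synth_s a x"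
proof -
  have "ftrans (\<lambda>\<xi>. cnj (complex_of_real r * a \<xi>)) x = complex_of_real r * ftrans (\<lambda>\<xi>. cnj (a \<xi>)) x"
    unfolding ftrans_def by (subst integral_mult_right_zero[symmetric]) (simp add: mult_ac)
  then show ?thesis by (simp add: synth_s_def)
qed

lemma synth_scaleR: "synth (\<lambda>\<xi>. r *\<^sub>R a \<xi>) x = r *\<^sub>R synth a x"
  by (simp add: vec_eq_iff synth_nth scaleR_conv_of_real[where 'a=complex] synth_s_scale)

lemma synth_uminus: "synth (\<lambda>\<xi>. - a \<xi>) x = - synth a x"
  using synth_scaleR[of "-1" a x] by simp

lemma synth_diff:
  assumes "band a" "band b" shows "synth (\<lambda>\<xi>. a \<xi> - b \<xi>) x = synth a x - synth b x"
  by (simp add: vec_eq_iff synth_nth synth_s_diff band_component assms)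

text \<open>Plancherel's inequality from frequency to physical space, applied to the conjugated
  components of the symbol.\<close>

lemma L2_norm_synth_le:
  obtains C where "C \<ge> 0" "\<And>a. band a \<Longrightarrow> L2_norm (synth a) \<le> C * L2_norm a"
proof -
  let ?C = "(2 * pi) ^ 3 :: real"
  have "(L2_norm (synth a))\<^sup>2 \<le> ?C * (L2_norm a)\<^sup>2" if a: "band a" for a
  proof -
    have ai: "band (\<lambda>\<xi>. cnj (a \<xi> $ i))" for i by (intro band_cnj band_component a)
    note [measurable] = band_measurable[OF ai] band_measurable[OF band_component[OF a]] L2_measurable[OF L2_component[OF synth_L2[OF a]]]
    have "ennreal ((L2_norm (synth a))\<^sup>2) = (\<integral>\<^sup>+x. (\<Sum>i\<in>UNIV. ennreal ((norm (synth a x $ i))\<^sup>2)) \<partial>lborel)"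
      unfolding ennreal_L2_norm_sq[OF synth_L2[OF a]] by (simp add: norm_vec_sq sum_ennreal)
    also have "\<dots> = (\<Sum>i\<in>UNIV. \<integral>\<^sup>+x. ennreal ((norm (synth a x $ i))\<^sup>2) \<partial>lborel)"
      by (rule nn_integral_sum) measurable
    also have "\<dots> \<le> (\<Sum>i\<in>UNIV. ennreal ?C * (\<integral>\<^sup>+x. ennreal ((norm (a x $ i))\<^sup>2) \<partial>lborel))"
    proof (rule sum_mono)
      fix i
      have "(\<integral>\<^sup>+x. ennreal ((norm (synth a x $ i))\<^sup>2) \<partial>lborel) \<le> (\<integral>\<^sup>+x. ennreal ((norm (ftrans (\<lambda>\<xi>. cnj (a \<xi> $ i)) x))\<^sup>2) \<partial>lborel)"
        unfolding synth_nth synth_s_def by (intro nn_integral_mono ennreal_leI power_mono) (auto simp: abs_Re_le_cmod)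
      also have "\<dots> \<le> ennreal ?C * (\<integral>\<^sup>+x. ennreal ((norm (cnj (a x $ i)))\<^sup>2) \<partial>lborel)"
        by (rule plancherel_le[OF band_integrable[OF ai]])
      finally show "(\<integral>\<^sup>+x. ennreal ((norm (synth a x $ i))\<^sup>2) \<partial>lborel) \<le> ennreal ?C * (\<integral>\<^sup>+x. ennreal ((norm (a x $ i))\<^sup>2) \<partial>lborel)" by simp
    qed
    also have "\<dots> = ennreal ?C * (\<integral>\<^sup>+x. ennreal ((norm (a x))\<^sup>2) \<partial>lborel)"
      by (subst sum_distrib_left[symmetric], subst nn_integral_sum[symmetric]) (auto simp: norm_vec_sq sum_ennreal)
    also have "\<dots> = ennreal (?C * (L2_norm a)\<^sup>2)"
      unfolding ennreal_L2_norm_sq[OF band_L2[OF a], symmetric] by (simp add: ennreal_mult)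
    finally show ?thesis by (subst (asm) ennreal_le_iff) auto
  qed
  then have "L2_norm (synth a) \<le> sqrt ?C * L2_norm a" if "band a" for a
    using that real_sqrt_le_mono[of "(L2_norm (synth a))\<^sup>2" "?C * (L2_norm a)\<^sup>2"] by (simp add: real_sqrt_mult)
  then show thesis by (intro that[of "sqrt ?C"]) auto
qed

lemma synth_s_bmeas: "band a \<Longrightarrow> bmeas (synth_s a)"
  unfolding bmeas_def using L2_measurable[OF synth_s_L2] synth_s_bounded by blast

lemma Jsynth_bmeas: "band g \<Longrightarrow> bmeas (\<lambda>x. Jsynth g x $ i $ j)"
  using synth_s_bmeas[OF band_iu_mult[OF band_component]] by (simp add: Jsynth_def)

text \<open>Contracting before estimating keeps the constant 1: with P = \<open>p x\<close> and Q =
  \<open>q x\<close> the symbol of the double sum is i (P . \<xi>) (Q . g), at most |P| |Q| |\<xi>|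
  |g|. The factor 9 of the cruder \<open>flux_le\<close> would spoil the final constant.\<close>

lemma Jsynth_bound:
  assumes g: "band g" and p: "p \<in> L2" and q: "q \<in> L2"
  shows "\<bar>flux p q (Jsynth g)\<bar> \<le> L2_norm p * L2_norm q * (\<integral>\<xi>. norm \<xi> * norm (g \<xi>) \<partial>lborel)"
proof -
  let ?N = "\<integral>\<xi>. norm \<xi> * norm (g \<xi>) \<partial>lborel"
  have Ni: "integrable lborel (\<lambda>\<xi>. norm \<xi> * norm (g \<xi>))"
    using integrable_norm[OF band_integrable[OF band_mult[OF g, of norm]]] by (simp add: continuous_on_norm_id)
  have N0: "?N \<ge> 0" by simp
  have gi: "band (\<lambda>\<xi>. g \<xi> $ i)" for i by (rule band_component[OF g])
  have Jm: "bmeas (\<lambda>x. Jsynth g x $ i $ j)" for i j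
    by (rule Jsynth_bmeas[OF g])
  have pw: "\<bar>\<Sum>i\<in>UNIV. \<Sum>j\<in>UNIV. q x $ i * p x $ j * Jsynth g x $ i $ j\<bar> \<le> norm (p x) * norm (q x) * ?N" for x
  proof -
    define P Q where "P = p x" and "Q = q x"
    have b1: "band (\<lambda>\<xi>. complex_of_real (Q $ i * P $ j) * (\<i> * complex_of_real (\<xi> $ j) * g \<xi> $ i))" for i j
      by (rule band_linear[OF band_iu_mult[OF gi] bounded_linear_mult_right])
    have b2: "band (\<lambda>\<xi>. \<Sum>j\<in>J. complex_of_real (Q $ i * P $ j) * (\<i> * complex_of_real (\<xi> $ j) * g \<xi> $ i))" for i and J :: "3 set"
      by (induction J rule: infinite_finite_induct) (auto intro: band_add b1 simp del: of_real_mult)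
    have "(\<Sum>i\<in>UNIV. \<Sum>j\<in>UNIV. Q $ i * P $ j * Jsynth g x $ i $ j) = synth_s (\<lambda>\<xi>. \<Sum>i\<in>UNIV. \<Sum>j\<in>UNIV. complex_of_real (Q $ i * P $ j) * (\<i> * complex_of_real (\<xi> $ j) * g \<xi> $ i)) x"
      unfolding Jsynth_def by (simp only: vec_lambda_beta synth_s_scale[symmetric] synth_s_sum b1 b2)
    also have "\<bar>\<dots>\<bar> \<le> (\<integral>\<xi>. norm (\<Sum>i\<in>UNIV. \<Sum>j\<in>UNIV. complex_of_real (Q $ i * P $ j) * (\<i> * complex_of_real (\<xi> $ j) * g \<xi> $ i)) \<partial>lborel)"
    proof (rule synth_s_bounded)
      have "band (\<lambda>\<xi>. \<Sum>i\<in>I. \<Sum>j\<in>UNIV. complex_of_real (Q $ i * P $ j) * (\<i> * complex_of_real (\<xi> $ j) * g \<xi> $ i))" for I :: "3 set"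
        by (induction I rule: infinite_finite_induct) (auto intro: band_add b2 simp del: of_real_mult)
      then show "band (\<lambda>\<xi>. \<Sum>i\<in>UNIV. \<Sum>j\<in>UNIV. complex_of_real (Q $ i * P $ j) * (\<i> * complex_of_real (\<xi> $ j) * g \<xi> $ i))" .
    qed
    also have "\<dots> \<le> (\<integral>\<xi>. norm P * norm Q * (norm \<xi> * norm (g \<xi>)) \<partial>lborel)"
    proof (rule integral_mono')
      show "integrable lborel (\<lambda>\<xi>. norm P * norm Q * (norm \<xi> * norm (g \<xi>)))" by (intro integrable_mult_right Ni)
      fix \<xi>
      have "(\<Sum>i\<in>UNIV. \<Sum>j\<in>UNIV. complex_of_real (Q $ i * P $ j) * (\<i> * complex_of_real (\<xi> $ j) * g \<xi> $ i))
         = \<i> * complex_of_real (P \<bullet> \<xi>) * (\<Sum>i\<in>UNIV. Q $ i *\<^sub>R g \<xi> $ i)"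
        by (subst sum.swap) (simp add: inner_vec_def sum_distrib_left sum_distrib_right scaleR_conv_of_real mult_ac)
      also have "norm \<dots> = \<bar>P \<bullet> \<xi>\<bar> * norm (\<Sum>i\<in>UNIV. Q $ i *\<^sub>R g \<xi> $ i)" by (simp add: norm_mult)
      also have "\<dots> \<le> (norm P * norm \<xi>) * (norm Q * norm (g \<xi>))"
      proof (rule mult_mono')
        show "\<bar>P \<bullet> \<xi>\<bar> \<le> norm P * norm \<xi>" by (rule Cauchy_Schwarz_ineq2)
        have "norm (\<Sum>i\<in>UNIV. Q $ i *\<^sub>R g \<xi> $ i) \<le> (\<Sum>i\<in>UNIV. \<bar>Q $ i\<bar> * \<bar>norm (g \<xi> $ i)\<bar>)"
          by (rule order_trans[OF norm_sum]) simp
        also have "\<dots> \<le> L2_set (\<lambda>i. Q $ i) UNIV * L2_set (\<lambda>i. norm (g \<xi> $ i)) UNIV" by (rule L2_set_mult_ineq)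
        also have "L2_set (\<lambda>i. Q $ i) UNIV = norm Q" by (simp add: norm_vec_def L2_set_def)
        finally show "norm (\<Sum>i\<in>UNIV. Q $ i *\<^sub>R g \<xi> $ i) \<le> norm Q * norm (g \<xi>)" by (simp add: norm_vec_def)
      qed auto
      finally show "norm (\<Sum>i\<in>UNIV. \<Sum>j\<in>UNIV. complex_of_real (Q $ i * P $ j) * (\<i> * complex_of_real (\<xi> $ j) * g \<xi> $ i)) \<le> norm P * norm Q * (norm \<xi> * norm (g \<xi>))"
        by (simp add: mult_ac)
    qed auto
    finally show ?thesis by (simp add: P_def Q_def)
  qed
  have ti: "integrable lborel (\<lambda>x. q x $ i * p x $ j * Jsynth g x $ i $ j)" for i j
    by (rule trip_integrable[OF L2_component[OF q] L2_component[OF p] Jm])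
  have "flux p q (Jsynth g) = (\<integral>x. (\<Sum>i\<in>UNIV. \<Sum>j\<in>UNIV. q x $ i * p x $ j * Jsynth g x $ i $ j) \<partial>lborel)"
    unfolding flux_def trip_def
    by (subst Bochner_Integration.integral_sum, intro Bochner_Integration.integrable_sum ti, intro sum.cong refl Bochner_Integration.integral_sum[symmetric] ti)
  also have "\<bar>\<dots>\<bar> \<le> (\<integral>x. norm (p x) * norm (q x) * ?N \<partial>lborel)"
    by (rule integral_abs_bound_integral)
       (auto intro!: Bochner_Integration.integrable_sum ti integrable_mult_left L2_norm_mult_integrable p q pw)
  also have "\<dots> = (\<integral>x. norm (p x) * norm (q x) \<partial>lborel) * ?N" by simp
  also have "\<dots> \<le> L2_norm p * L2_norm q * ?N" by (intro mult_right_mono L2_norm_mult_le p q N0)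
  finally show ?thesis .
qed

text \<open>Everything in the equation tested with \<open>synth g\<close> except the time increment
  and the dissipation. Each of the two equations has two quadratic terms of opposite sign, hence
  four field arguments.\<close>

definition source_term :: "(real \<Rightarrow> field) \<Rightarrow> (real \<Rightarrow> field) \<Rightarrow> (real \<Rightarrow> field) \<Rightarrow> (real \<Rightarrow> field) \<Rightarrow> (real \<Rightarrow> field) \<Rightarrow> (real^3 \<Rightarrow> complex^3) \<Rightarrow> real \<Rightarrow> real" where
  "source_term p q r s f g \<tau> = flux (p \<tau>) (q \<tau>) (Jsynth g) - flux (r \<tau>) (s \<tau>) (Jsynth g) + L2_inner (f \<tau>) (synth g)"

text \<open>The symbol of minus the Laplacian of \<open>synth g\<close>.\<close>

definition nsq :: "(real^3 \<Rightarrow> complex^3) \<Rightarrow> real^3 \<Rightarrow> complex^3" where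
  "nsq g \<xi> = (norm \<xi>)\<^sup>2 *\<^sub>R g \<xi>"

text \<open>The equation integrated between two arbitrary times. Chaining such increments with
  different symbols replaces test fields that depend on time.\<close>

definition mode_eq :: "real \<Rightarrow> (real \<Rightarrow> field) \<Rightarrow> (real \<Rightarrow> field) \<Rightarrow> (real \<Rightarrow> field) \<Rightarrow> (real \<Rightarrow> field) \<Rightarrow> (real \<Rightarrow> field) \<Rightarrow> (real \<Rightarrow> field) \<Rightarrow> bool" where
  "mode_eq \<kappa> v p q r s f \<longleftrightarrow> regular v \<and> regular p \<and> regular q \<and> regular r \<and> regular s \<and> admissible_force f \<and>
     (\<forall>g. divfree_band g \<longrightarrow> (\<forall>a b. 0 \<le> a \<longrightarrow> a < b \<longrightarrow>
        L2_inner (v b) (synth g) - L2_inner (v a) (synth g) =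
        (\<integral>\<tau>. source_term p q r s f g \<tau> - \<kappa> * L2_inner (v \<tau>) (synth (nsq g)) \<partial>lebesgue_on {a<..<b})))"

lemma divfree_band_nsq: "divfree_band g \<Longrightarrow> divfree_band (nsq g)"
  unfolding nsq_def[abs_def] by (rule divfree_band_mult) (auto intro!: continuous_intros)

lemma integral_const_Ioo: "a \<le> b \<Longrightarrow> (\<integral>t. C \<partial>lebesgue_on {a<..<b}) = C * (b - a)" for C :: real
  using integral_deriv_Ioo[of a b "\<lambda>t. C * t" "\<lambda>t. C"] by (auto intro!: derivative_eq_intros simp: right_diff_distrib)

lemma integral_AE_le_Ioo:
  fixes G :: "real \<Rightarrow> real"
  assumes "a \<le> b" "integrable (lebesgue_on {a<..<b}) G" "AE t in lebesgue_on {a<..<b}. G t \<le> C"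
  shows "(\<integral>t. G t \<partial>lebesgue_on {a<..<b}) \<le> C * (b - a)"
  unfolding integral_const_Ioo[OF assms(1), symmetric]
  by (rule integral_mono_AE[OF assms(2) _ assms(3)]) (intro continuous_integrable_Ioo continuous_intros)

lemma Ioo_subset: "0 \<le> a \<Longrightarrow> b \<le> T \<Longrightarrow> {a<..<b} \<subseteq> {0<..<T::real}" by auto

context cutoff begin

lemma source_term_measurable:
  assumes "regular p" "regular q" "regular r" "regular s" "admissible_force f" and g: "band g" and T: "T > 0"
  shows "source_term p q r s f g \<in> borel_measurable (lebesgue_on {0<..<T})"
proof -
  note [measurable] = regular_flux_measurable[OF assms(1,2) T Jsynth_bmeas[OF g]] regular_flux_measurable[OF assms(3,4) T Jsynth_bmeas[OF g]]
    admissible_AE(3)[OF assms(5) T synth_L2[OF g]]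
  show ?thesis unfolding source_term_def[abs_def] by measurable
qed

lemma moment_integrable:
  assumes g: "band g" shows "integrable lborel (\<lambda>\<xi>. norm \<xi> * norm (g \<xi>))"
  using integrable_norm[OF band_integrable[OF band_mult[OF g, of norm]]] by (simp add: continuous_on_norm_id)

text \<open>One constant for all symbols dominated by \<psi>: the Euler scheme uses ever more
  symbols as the step shrinks, and its error must be uniform over them.\<close>

lemma source_term_bounded:
  fixes \<psi> :: "real^3 \<Rightarrow> complex^3"
  assumes reg: "regular p" "regular q" "regular r" "regular s" "admissible_force f" and \<psi>: "band \<psi>" and T: "T > 0"
  obtains D where "D \<ge> 0" "\<And>g. band g \<Longrightarrow> (\<And>\<xi>. norm (g \<xi>) \<le> norm (\<psi> \<xi>)) \<Longrightarrow> AE \<tau> in lebesgue_on {0<..<T}. \<bar>source_term p q r s f g \<tau>\<bar> \<le> D"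
proof -
  let ?m = "lebesgue_on {0<..<T}" and ?N = "\<lambda>g. \<integral>\<xi>. norm \<xi> * norm (g \<xi> :: complex^3) \<partial>lborel"
  obtain Cp Cq Cr Cs Cf where C: "AE t in ?m. L2_norm (p t) \<le> Cp" "AE t in ?m. L2_norm (q t) \<le> Cq"
    "AE t in ?m. L2_norm (r t) \<le> Cr" "AE t in ?m. L2_norm (s t) \<le> Cs" "AE t in ?m. L2_norm (f t) \<le> Cf"
    using regular_AE(3)[OF reg(1) T] regular_AE(3)[OF reg(2) T] regular_AE(3)[OF reg(3) T] regular_AE(3)[OF reg(4) T] admissible_AE(2)[OF reg(5) T] by blast
  obtain P where P: "P \<ge> 0" "\<And>a. band a \<Longrightarrow> L2_norm (synth a) \<le> P * L2_norm a" by (rule L2_norm_synth_le) (rule that, assumption, blast)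
  define D where "D = \<bar>Cp\<bar> * \<bar>Cq\<bar> * ?N \<psi> + \<bar>Cr\<bar> * \<bar>Cs\<bar> * ?N \<psi> + \<bar>Cf\<bar> * (P * L2_norm \<psi>)"
  show thesis
  proof (rule that[of D])
    show "D \<ge> 0" unfolding D_def using P by (intro add_nonneg_nonneg mult_nonneg_nonneg) auto
    fix g :: "real^3 \<Rightarrow> complex^3" assume g: "band g" and le: "\<And>\<xi>. norm (g \<xi>) \<le> norm (\<psi> \<xi>)"
    have N: "?N g \<le> ?N \<psi>" by (intro integral_mono moment_integrable g \<psi> mult_left_mono le) auto
    have N0: "?N g \<ge> 0" by simp
    have Lg: "L2_norm (synth g) \<le> P * L2_norm \<psi>"
      by (rule order_trans[OF P(2)[OF g]]) (intro mult_left_mono L2_norm_mono band_L2 \<psi> band_measurable g le P(1))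
    show "AE \<tau> in ?m. \<bar>source_term p q r s f g \<tau>\<bar> \<le> D"
      using C admissible_AE(1)[OF reg(5) T] AE_space[of ?m]
    proof eventually_elim
      case (elim \<tau>)
      then have t: "\<tau> \<ge> 0" by simp
      note L = reg(1,2,3,4)[THEN regular_L2, OF t]
      have b: "x \<le> \<bar>Cx\<bar>" if "x \<le> Cx" for x Cx :: real using that by linarith
      have 1: "\<bar>flux (p \<tau>) (q \<tau>) (Jsynth g)\<bar> \<le> \<bar>Cp\<bar> * \<bar>Cq\<bar> * ?N \<psi>"
        by (rule order_trans[OF Jsynth_bound[OF g L(1,2)]]) (intro mult_mono' N N0 elim(1,2)[THEN b] mult_nonneg_nonneg L2_norm_nonneg)
      have 2: "\<bar>flux (r \<tau>) (s \<tau>) (Jsynth g)\<bar> \<le> \<bar>Cr\<bar> * \<bar>Cs\<bar> * ?N \<psi>"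
        by (rule order_trans[OF Jsynth_bound[OF g L(3,4)]]) (intro mult_mono' N N0 elim(3,4)[THEN b] mult_nonneg_nonneg L2_norm_nonneg)
      have 3: "\<bar>L2_inner (f \<tau>) (synth g)\<bar> \<le> \<bar>Cf\<bar> * (P * L2_norm \<psi>)"
        by (rule order_trans[OF L2_inner_le[OF elim(6) synth_L2[OF g]]]) (intro mult_mono' Lg elim(5)[THEN b] L2_norm_nonneg)
      show ?case using 1 2 3 unfolding source_term_def D_def by linarith
    qed
  qed
qed

text \<open>The datum is the strong limit, and \<open>v 0\<close> the weak limit, along times
  decreasing to 0.\<close>

lemma L2_initial_eq:
  assumes v: "regular v" and v0: "v0 \<in> L2" and lim: "((\<lambda>t. L2_norm (\<lambda>x. v t x - v0 x)) \<longlongrightarrow> 0) (at_right 0)" and w: "w \<in> L2"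
  shows "L2_inner v0 w = L2_inner (v 0) w"
proof -
  \<comment> \<open>Negative times are assigned the datum because \<open>L2_inner_tendsto\<close>
    wants every member of the family in \<open>L2\<close>.\<close>
  define vv where "vv t = (if t \<ge> 0 then v t else v0)" for t
  have ev: "\<forall>\<^sub>F t in at_right (0::real). t > 0" by (rule eventually_at_right_less)
  have "((\<lambda>t. L2_norm (\<lambda>x. vv t x - v0 x)) \<longlongrightarrow> 0) (at_right 0)"
    by (rule Lim_transform_eventually[OF lim]) (use ev in \<open>eventually_elim, simp add: vv_def\<close>)
  then have "((\<lambda>t. L2_inner (vv t) w) \<longlongrightarrow> L2_inner v0 w) (at_right 0)"
    by (rule L2_inner_tendsto[rotated 3]) (use regular_L2[OF v] v0 w in \<open>auto simp: vv_def\<close>)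
  then have 1: "((\<lambda>t. L2_inner (v t) w) \<longlongrightarrow> L2_inner v0 w) (at_right 0)"
    by (rule Lim_transform_eventually) (use ev in \<open>eventually_elim, simp add: vv_def\<close>)
  have "((\<lambda>t. L2_inner (v t) w) \<longlongrightarrow> L2_inner (v 0) w) (at 0 within {0..})"
    using regular_continuous[OF v w] by (simp add: continuous_on_def)
  then have 2: "((\<lambda>t. L2_inner (v t) w) \<longlongrightarrow> L2_inner (v 0) w) (at_right 0)"
    by (rule tendsto_within_subset) auto
  show ?thesis by (rule tendsto_unique[OF trivial_limit_at_right_real 1 2])
qed

text \<open>Combines the extension to band-limited fields with the sharpened ramp in time; the
  increment between a > 0 and b is a difference of two integrals that start at 0.\<close>

lemma mode_eqI:
  assumes eq: "\<And>\<phi>. \<phi> \<in> solenoidal_test \<Longrightarrow> weak_eq \<kappa> v (\<lambda>t M. flux (p t) (q t) M - flux (r t) (s t) M) f v0 \<phi> (lap \<phi>) (jac \<phi>)"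
    and reg: "regular v" "regular p" "regular q" "regular r" "regular s"
    and f: "admissible_force f" and v0: "v0 \<in> L2" and lim: "((\<lambda>t. L2_norm (\<lambda>x. v t x - v0 x)) \<longlongrightarrow> 0) (at_right 0)"
  shows "mode_eq \<kappa> v p q r s f"
proof -
  have "L2_inner (v b) (synth g) - L2_inner (v a) (synth g) =
        (\<integral>\<tau>. source_term p q r s f g \<tau> - \<kappa> * L2_inner (v \<tau>) (synth (nsq g)) \<partial>lebesgue_on {a<..<b})"
    if g: "divfree_band g" and ab: "0 \<le> a" "a < b" for g a b
  proof -
    note gb = divfree_bandD[OF g] and nb = divfree_bandD[OF divfree_band_nsq[OF g]]
    let ?y = "\<lambda>t. L2_inner (v t) (synth g)"
    let ?G = "\<lambda>\<tau>. source_term p q r s f g \<tau> - \<kappa> * L2_inner (v \<tau>) (synth (nsq g))"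
    from g obtain \<rho> where \<rho>: "\<rho> > 0" "\<And>\<xi>. norm \<xi> < \<rho> \<Longrightarrow> g \<xi> = 0" "\<And>\<xi>. (\<Sum>j\<in>UNIV. complex_of_real (\<xi> $ j) * g \<xi> $ j) = 0"
      unfolding divfree_band_def by blast
    have we: "weak_eq \<kappa> v (\<lambda>t M. flux (p t) (q t) M - flux (r t) (s t) M) f v0 (synth g) (synth (\<lambda>\<xi>. - ((norm \<xi>)\<^sup>2 *\<^sub>R g \<xi>))) (Jsynth g)"
      by (rule weak_eq_synth[OF eq reg f v0 gb \<rho>])
    have neg: "synth (\<lambda>\<xi>. - ((norm \<xi>)\<^sup>2 *\<^sub>R g \<xi>)) = (\<lambda>x. (-1) *\<^sub>R synth (nsq g) x)"
      unfolding nsq_def[abs_def] by (simp add: synth_uminus fun_eq_iff)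
    have WL: "(\<lambda>t. L2_inner (f t) (synth g)) \<in> borel_measurable (lebesgue_on {0<..<T})" if "T > 0" for T
      by (rule admissible_AE(3)[OF f that synth_L2[OF gb]])
    have Vi: "integrable (lebesgue_on {0<..<T}) (\<lambda>t. L2_inner (v t) w)" if T: "T > 0" and w: "w \<in> L2" for T w
    proof -
      obtain Cv where Cv: "AE t in lebesgue_on {0<..<T}. L2_norm (v t) \<le> Cv" using regular_AE(3)[OF reg(1) T] by blast
      have "AE t in lebesgue_on {0<..<T}. \<bar>L2_inner (v t) w\<bar> \<le> Cv * L2_norm w"
        using Cv AE_space[of "lebesgue_on {0<..<T}"]
      proof eventually_elim
        case (elim t)
        then have "v t \<in> L2" by (auto intro: regular_L2[OF reg(1)])
        from L2_inner_le[OF this w] show ?case using mult_right_mono[OF elim(1) L2_norm_nonneg[of w]] by linarith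
      qed
      then show ?thesis by (rule bounded_integrable_Ioo[OF regular_inner_measurable[OF reg(1) w]])
    qed
    have Wi: "integrable (lebesgue_on {0<..<T}) (source_term p q r s f g)" if T: "T > 0" for T
    proof -
      obtain D where "D \<ge> 0" "\<And>g'. band g' \<Longrightarrow> (\<And>\<xi>. norm (g' \<xi>) \<le> norm (g \<xi>)) \<Longrightarrow> AE \<tau> in lebesgue_on {0<..<T}. \<bar>source_term p q r s f g' \<tau>\<bar> \<le> D"
        by (rule source_term_bounded[OF reg(2-5) f gb T]) (rule that, assumption, blast)
      then show ?thesis by (intro bounded_integrable_Ioo[OF source_term_measurable[OF reg(2-5) f gb T]]) (use gb in auto)
    qed
    have fi: "integrable (lebesgue_on {0<..<T}) (\<lambda>t. L2_inner (f t) (synth g))" if T: "T > 0" for T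
    proof -
      obtain Cf where Cf: "AE t in lebesgue_on {0<..<T}. L2_norm (f t) \<le> Cf" using admissible_AE(2)[OF f T] by blast
      have "AE t in lebesgue_on {0<..<T}. \<bar>L2_inner (f t) (synth g)\<bar> \<le> Cf * L2_norm (synth g)"
        using Cf admissible_AE(1)[OF f T]
      proof eventually_elim
        case (elim t)
        from L2_inner_le[OF elim(2) synth_L2[OF gb]] show ?case using mult_right_mono[OF elim(1) L2_norm_nonneg[of "synth g"]] by linarith
      qed
      then show ?thesis by (rule bounded_integrable_Ioo[OF WL[OF T]])
    qed
    have Gi: "integrable (lebesgue_on {0<..<T}) ?G" if "T > 0" for T
      by (intro Bochner_Integration.integrable_diff Wi integrable_mult_right Vi that synth_L2 nb)
    have mult_i: "integrable (lebesgue_on {0<..<T}) (\<lambda>t. \<theta> t * F t)" if T: "T > 0" and c: "continuous_on UNIV \<theta>" and F: "integrable (lebesgue_on {0<..<T}) F" for T and \<theta> F :: "real \<Rightarrow> real"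
    proof -
      obtain K where K: "K \<ge> 0" "\<And>t. t \<in> {0<..<T} \<Longrightarrow> \<bar>\<theta> t\<bar> \<le> K" using continuous_bounded_Ioo[OF c, of 0 T] by blast
      note [measurable] = measurable_continuous_Ioo[OF c] borel_measurable_integrable[OF F]
      show ?thesis
      proof (rule Bochner_Integration.integrable_bound)
        show "integrable (lebesgue_on {0<..<T}) (\<lambda>t. K * F t)" by (intro integrable_mult_right F)
        show "AE t in lebesgue_on {0<..<T}. norm (\<theta> t * F t) \<le> norm (K * F t)"
        proof (rule AE_I2)
          fix t assume "t \<in> space (lebesgue_on {0<..<T})"
          then have "\<bar>\<theta> t\<bar> \<le> K" by (intro K) simp
          then show "norm (\<theta> t * F t) \<le> norm (K * F t)" using K(1) by (simp add: abs_mult mult_right_mono)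
        qed
      qed measurable
    qed
    have inc: "?y t = L2_inner v0 (synth g) + (\<integral>s. ?G s \<partial>lebesgue_on {0<..<t})" if "t > 0" for t
    proof (rule ramp_identity[OF regular_continuous[OF reg(1) synth_L2[OF gb]] Gi _ that])
      fix T :: real and \<theta> \<theta>' :: "real \<Rightarrow> real"
      assume T: "T > 0" and d: "\<And>t. (\<theta> has_real_derivative \<theta>' t) (at t)" and c: "continuous_on UNIV \<theta>'" and z: "\<theta> T = 0"
      let ?m = "lebesgue_on {0<..<T}"
      have c0: "continuous_on UNIV \<theta>" using d by (meson DERIV_continuous continuous_at_imp_continuous_on)
      have i1: "integrable ?m (\<lambda>t. - \<theta>' t * ?y t)" by (intro mult_i T continuous_intros c Vi synth_L2 gb)
      have i2: "integrable ?m (\<lambda>t. \<theta> t * ?G t)" by (intro mult_i T c0 Gi)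
      have i3: "integrable ?m (\<lambda>t. \<theta> t * L2_inner (f t) (synth g))" by (intro mult_i T c0 fi)
      have "(\<integral>t. (- \<theta>' t * ?y t - \<theta> t * (\<kappa> * L2_inner (v t) (synth (\<lambda>\<xi>. - ((norm \<xi>)\<^sup>2 *\<^sub>R g \<xi>))) + (flux (p t) (q t) (Jsynth g) - flux (r t) (s t) (Jsynth g)))) \<partial>?m)
          = \<theta> 0 * L2_inner v0 (synth g) + (\<integral>t. \<theta> t * L2_inner (f t) (synth g) \<partial>?m)"
        using we T d c z unfolding weak_eq_def by blast
      also have "(\<lambda>t. - \<theta>' t * ?y t - \<theta> t * (\<kappa> * L2_inner (v t) (synth (\<lambda>\<xi>. - ((norm \<xi>)\<^sup>2 *\<^sub>R g \<xi>))) + (flux (p t) (q t) (Jsynth g) - flux (r t) (s t) (Jsynth g))))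
         = (\<lambda>t. - \<theta>' t * ?y t - (\<theta> t * ?G t - \<theta> t * L2_inner (f t) (synth g)))"
        unfolding neg L2_inner_scaleR_right by (auto simp: source_term_def algebra_simps)
      also have "(\<integral>t. - \<theta>' t * ?y t - (\<theta> t * ?G t - \<theta> t * L2_inner (f t) (synth g)) \<partial>?m)
         = (\<integral>t. - \<theta>' t * ?y t \<partial>?m) - ((\<integral>t. \<theta> t * ?G t \<partial>?m) - (\<integral>t. \<theta> t * L2_inner (f t) (synth g) \<partial>?m))"
        by (simp only: Bochner_Integration.integral_diff[OF i1 Bochner_Integration.integrable_diff[OF i2 i3]] Bochner_Integration.integral_diff[OF i2 i3])
      finally show "(\<integral>t. - \<theta>' t * ?y t \<partial>?m) = \<theta> 0 * L2_inner v0 (synth g) + (\<integral>t. \<theta> t * ?G t \<partial>?m)" by simp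
    qed
    have y0: "L2_inner v0 (synth g) = ?y 0" by (rule L2_initial_eq[OF reg(1) v0 lim synth_L2[OF gb]])
    show ?thesis
    proof (cases "a = 0")
      case True
      then show ?thesis using inc[of b] ab y0 by simp
    next
      case False
      then have a: "a > 0" using ab by simp
      show ?thesis using inc[of b] inc[OF a] integral_Ioo_split[OF a ab(2) Gi] ab by simp
    qed
  qed
  then show ?thesis unfolding mode_eq_def using reg f by blast
qed

lemma mode_eqD:
  assumes "mode_eq \<kappa> v p q r s f"
  shows "regular v" "regular p" "regular q" "regular r" "regular s" "admissible_force f"
    "divfree_band g \<Longrightarrow> 0 \<le> a \<Longrightarrow> a < b \<Longrightarrow> L2_inner (v b) (synth g) - L2_inner (v a) (synth g) =
        (\<integral>\<tau>. source_term p q r s f g \<tau> - \<kappa> * L2_inner (v \<tau>) (synth (nsq g)) \<partial>lebesgue_on {a<..<b})"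
  using assms unfolding mode_eq_def by blast+

section \<open>Time steps and Duhamel's bound\<close>

lemma mode_eq_integrable:
  assumes E: "mode_eq \<kappa> v p q r s f" and g: "band g" and ab: "0 \<le> a" "a < b"
  shows "integrable (lebesgue_on {a<..<b}) (source_term p q r s f g)"
    and "w \<in> L2 \<Longrightarrow> integrable (lebesgue_on {a<..<b}) (\<lambda>\<tau>. L2_inner (v \<tau>) w)"
proof -
  have b: "b > 0" using ab by simp
  note D = mode_eqD[OF E]
  note sub = Ioo_subset[OF ab(1) order_refl]
  obtain K where "K \<ge> 0" "\<And>g'. band g' \<Longrightarrow> (\<And>\<xi>. norm (g' \<xi>) \<le> norm (g \<xi>)) \<Longrightarrow> AE \<tau> in lebesgue_on {0<..<b}. \<bar>source_term p q r s f g' \<tau>\<bar> \<le> K"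
    by (rule source_term_bounded[OF D(2-6) g b]) (rule that, assumption, blast)
  then have "AE \<tau> in lebesgue_on {0<..<b}. \<bar>source_term p q r s f g \<tau>\<bar> \<le> K" using g by blast
  then have "AE \<tau> in lebesgue_on {a<..<b}. \<bar>source_term p q r s f g \<tau>\<bar> \<le> K" by (rule AE_lebesgue_on_mono[OF _ sub]) auto
  then show "integrable (lebesgue_on {a<..<b}) (source_term p q r s f g)"
    by (rule bounded_integrable_Ioo[OF measurable_lebesgue_on_mono[OF source_term_measurable[OF D(2-6) g b] sub]])
  assume w: "w \<in> L2"
  obtain Cv where Cv: "AE t in lebesgue_on {0<..<b}. L2_norm (v t) \<le> Cv" using regular_AE(3)[OF D(1) b] by blast
  have "AE t in lebesgue_on {0<..<b}. \<bar>L2_inner (v t) w\<bar> \<le> Cv * L2_norm w"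
    using Cv AE_space[of "lebesgue_on {0<..<b}"]
  proof eventually_elim
    case (elim t)
    then have "v t \<in> L2" by (auto intro: regular_L2[OF D(1)])
    from L2_inner_le[OF this w] show ?case using mult_right_mono[OF elim(1) L2_norm_nonneg[of w]] by linarith
  qed
  then have "AE t in lebesgue_on {a<..<b}. \<bar>L2_inner (v t) w\<bar> \<le> Cv * L2_norm w" by (rule AE_lebesgue_on_mono[OF _ sub]) auto
  then show "integrable (lebesgue_on {a<..<b}) (\<lambda>\<tau>. L2_inner (v \<tau>) w)"
    by (rule bounded_integrable_Ioo[OF measurable_lebesgue_on_mono[OF regular_inner_measurable[OF D(1) w] sub]])
qed

text \<open>Source and dissipation are essentially bounded in time, uniformly over the symbols
  dominated by \<psi>, since multiplication by |\<xi>|^2 preserves domination.\<close>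

lemma mode_eq_lipschitz:
  assumes E: "mode_eq \<kappa> v p q r s f" and \<psi>: "divfree_band \<psi>" and T: "T > 0"
  obtains D where "D \<ge> 0" "\<And>g a b. divfree_band g \<Longrightarrow> (\<And>\<xi>. norm (g \<xi>) \<le> norm (\<psi> \<xi>)) \<Longrightarrow> 0 \<le> a \<Longrightarrow> a < b \<Longrightarrow> b \<le> T \<Longrightarrow>
      \<bar>L2_inner (v b) (synth g) - L2_inner (v a) (synth g)\<bar> \<le> D * (b - a)"
proof -
  note D = mode_eqD[OF E]
  note \<psi>b = divfree_bandD[OF \<psi>]
  obtain K where K: "K \<ge> 0" "\<And>g. band g \<Longrightarrow> (\<And>\<xi>. norm (g \<xi>) \<le> norm (\<psi> \<xi>)) \<Longrightarrow> AE \<tau> in lebesgue_on {0<..<T}. \<bar>source_term p q r s f g \<tau>\<bar> \<le> K"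
    by (rule source_term_bounded[OF D(2-6) \<psi>b T]) (rule that, assumption, blast)
  obtain P where P: "P \<ge> 0" "\<And>a. band a \<Longrightarrow> L2_norm (synth a) \<le> P * L2_norm a" by (rule L2_norm_synth_le) (rule that, assumption, blast)
  obtain Cv where Cv: "AE t in lebesgue_on {0<..<T}. L2_norm (v t) \<le> Cv" using regular_AE(3)[OF D(1) T] by blast
  note nb = divfree_bandD[OF divfree_band_nsq[OF \<psi>]]
  define M where "M = \<bar>\<kappa>\<bar> * (\<bar>Cv\<bar> * (P * L2_norm (nsq \<psi>)))"
  show thesis
  proof (rule that[of "K + M"])
    show "K + M \<ge> 0" unfolding M_def using K P by (intro add_nonneg_nonneg mult_nonneg_nonneg) auto
    fix g a b assume g: "divfree_band g" and le: "\<And>\<xi>. norm (g \<xi>) \<le> norm (\<psi> \<xi>)" and ab: "0 \<le> a" "a < b" "b \<le> T"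
    note gb = divfree_bandD[OF g] and gnb = divfree_bandD[OF divfree_band_nsq[OF g]]
    note sub = Ioo_subset[OF ab(1) ab(3)]
    have nle: "norm (nsq g \<xi>) \<le> norm (nsq \<psi> \<xi>)" for \<xi> unfolding nsq_def by (simp add: mult_left_mono le)
    have "L2_norm (synth (nsq g)) \<le> P * L2_norm (nsq \<psi>)"
      by (rule order_trans[OF P(2)[OF gnb]]) (intro mult_left_mono L2_norm_mono band_L2 nb band_measurable gnb nle P(1))
    then have bd: "AE \<tau> in lebesgue_on {0<..<T}. \<bar>source_term p q r s f g \<tau> - \<kappa> * L2_inner (v \<tau>) (synth (nsq g))\<bar> \<le> K + M"
    proof -
      assume n: "L2_norm (synth (nsq g)) \<le> P * L2_norm (nsq \<psi>)"
      show ?thesis using K(2)[OF gb le] Cv AE_space[of "lebesgue_on {0<..<T}"]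
      proof eventually_elim
        case (elim \<tau>)
        then have "v \<tau> \<in> L2" by (auto intro: regular_L2[OF D(1)])
        then have "\<bar>L2_inner (v \<tau>) (synth (nsq g))\<bar> \<le> L2_norm (v \<tau>) * L2_norm (synth (nsq g))" by (intro L2_inner_le synth_L2 gnb)
        also have "\<dots> \<le> \<bar>Cv\<bar> * (P * L2_norm (nsq \<psi>))" using elim(2) by (intro mult_mono' n) auto
        finally have "\<bar>\<kappa> * L2_inner (v \<tau>) (synth (nsq g))\<bar> \<le> M" unfolding M_def abs_mult by (rule mult_left_mono) simp
        then show ?case using elim(1) by linarith
      qed
    qed
    then have bd': "AE \<tau> in lebesgue_on {a<..<b}. \<bar>source_term p q r s f g \<tau> - \<kappa> * L2_inner (v \<tau>) (synth (nsq g))\<bar> \<le> K + M"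
      by (rule AE_lebesgue_on_mono[OF _ sub]) auto
    have i: "integrable (lebesgue_on {a<..<b}) (\<lambda>\<tau>. source_term p q r s f g \<tau> - \<kappa> * L2_inner (v \<tau>) (synth (nsq g)))"
      by (intro Bochner_Integration.integrable_diff integrable_mult_right mode_eq_integrable[OF E gb ab(1,2)] synth_L2 gnb)
    have "\<bar>L2_inner (v b) (synth g) - L2_inner (v a) (synth g)\<bar> \<le> (\<integral>\<tau>. \<bar>source_term p q r s f g \<tau> - \<kappa> * L2_inner (v \<tau>) (synth (nsq g))\<bar> \<partial>lebesgue_on {a<..<b})"
      unfolding D(7)[OF g ab(1,2)] using integral_norm_bound[of "lebesgue_on {a<..<b}" "\<lambda>\<tau>. source_term p q r s f g \<tau> - \<kappa> * L2_inner (v \<tau>) (synth (nsq g))"] by simp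
    also have "\<dots> \<le> (K + M) * (b - a)"
      by (rule integral_AE_le_Ioo[OF _ integrable_abs[OF i] bd']) (use ab in simp)
    finally show "\<bar>L2_inner (v b) (synth g) - L2_inner (v a) (synth g)\<bar> \<le> (K + M) * (b - a)" .
  qed
qed

text \<open>One explicit Euler step. Freezing the dissipation at the left endpoint costs at most
  |\<kappa>| L h at each time of the step, by \<open>mode_eq_lipschitz\<close> for
  \<open>nsq \<psi>\<close>, hence |\<kappa>| L h^2 in total. The factor 1 - \<kappa> h |\<xi>|^2 is
  moved onto the symbol.\<close>

lemma mode_eq_step:
  assumes E: "mode_eq \<kappa> v p q r s f" and \<psi>: "divfree_band \<psi>" and T: "T > 0"
  obtains D where "D \<ge> 0" "\<And>g a h. divfree_band g \<Longrightarrow> (\<And>\<xi>. norm (g \<xi>) \<le> norm (\<psi> \<xi>)) \<Longrightarrow> 0 \<le> a \<Longrightarrow> 0 < h \<Longrightarrow> a + h \<le> T \<Longrightarrow>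
      L2_inner (v (a + h)) (synth g) \<le> L2_inner (v a) (synth (\<lambda>\<xi>. (1 - \<kappa> * h * (norm \<xi>)\<^sup>2) *\<^sub>R g \<xi>))
        + (\<integral>\<tau>. source_term p q r s f g \<tau> \<partial>lebesgue_on {a<..<a+h}) + D * h\<^sup>2"
proof -
  note D = mode_eqD[OF E]
  obtain L where L: "L \<ge> 0" "\<And>g a b. divfree_band g \<Longrightarrow> (\<And>\<xi>. norm (g \<xi>) \<le> norm (nsq \<psi> \<xi>)) \<Longrightarrow> 0 \<le> a \<Longrightarrow> a < b \<Longrightarrow> b \<le> T \<Longrightarrow>
      \<bar>L2_inner (v b) (synth g) - L2_inner (v a) (synth g)\<bar> \<le> L * (b - a)"
    by (rule mode_eq_lipschitz[OF E divfree_band_nsq[OF \<psi>] T]) (rule that, assumption, blast)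
  show thesis
  proof (rule that[of "\<bar>\<kappa>\<bar> * L"])
    show "\<bar>\<kappa>\<bar> * L \<ge> 0" using L by simp
    fix g a h assume g: "divfree_band g" and le: "\<And>\<xi>. norm (g \<xi>) \<le> norm (\<psi> \<xi>)" and ah: "0 \<le> a" "0 < h" "a + h \<le> T"
    have ab: "a < a + h" using ah by simp
    note gb = divfree_bandD[OF g] and gnb = divfree_bandD[OF divfree_band_nsq[OF g]]
    have va: "v a \<in> L2" by (rule regular_L2[OF D(1) ah(1)])
    have nle: "norm (nsq g \<xi>) \<le> norm (nsq \<psi> \<xi>)" for \<xi> unfolding nsq_def by (simp add: mult_left_mono le)
    let ?m = "lebesgue_on {a<..<a+h}" and ?z = "\<lambda>\<tau>. L2_inner (v \<tau>) (synth (nsq g))"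
    have iW: "integrable ?m (source_term p q r s f g)" and iz: "integrable ?m ?z"
      by (intro mode_eq_integrable[OF E gb ah(1) ab] synth_L2 gnb)+
    have ic: "integrable ?m (\<lambda>\<tau>. \<kappa> * ?z a)" by (intro continuous_integrable_Ioo continuous_intros)
    have e: "synth (\<lambda>\<xi>. (1 - \<kappa> * h * (norm \<xi>)\<^sup>2) *\<^sub>R g \<xi>) = (\<lambda>x. synth g x - (\<kappa> * h) *\<^sub>R synth (nsq g) x)"
    proof
      fix x
      have "synth (\<lambda>\<xi>. (1 - \<kappa> * h * (norm \<xi>)\<^sup>2) *\<^sub>R g \<xi>) x = synth (\<lambda>\<xi>. g \<xi> - (\<kappa> * h) *\<^sub>R nsq g \<xi>) x"
        by (simp add: nsq_def scaleR_diff_left)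
      also have "\<dots> = synth g x - synth (\<lambda>\<xi>. (\<kappa> * h) *\<^sub>R nsq g \<xi>) x"
        by (rule synth_diff[OF gb band_linear[OF gnb bounded_linear_scaleR_right]])
      finally show "synth (\<lambda>\<xi>. (1 - \<kappa> * h * (norm \<xi>)\<^sup>2) *\<^sub>R g \<xi>) x = synth g x - (\<kappa> * h) *\<^sub>R synth (nsq g) x"
        by (simp add: synth_scaleR)
    qed
    have e2: "L2_inner (v a) (synth (\<lambda>\<xi>. (1 - \<kappa> * h * (norm \<xi>)\<^sup>2) *\<^sub>R g \<xi>)) = L2_inner (v a) (synth g) - \<kappa> * h * ?z a"
      unfolding e using va synth_L2[OF gb] synth_L2[OF gnb] by (simp add: L2_inner_diff_right L2_scaleR L2_inner_scaleR_right)
    have "L2_inner (v (a + h)) (synth g) - L2_inner (v a) (synth g) = (\<integral>\<tau>. source_term p q r s f g \<tau> - \<kappa> * ?z \<tau> \<partial>?m)"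
      by (rule D(7)[OF g ah(1) ab])
    \<comment> \<open>The dissipation at time a is added and subtracted.\<close>
    also have "\<dots> = (\<integral>\<tau>. (source_term p q r s f g \<tau> + (\<kappa> * ?z a - \<kappa> * ?z \<tau>)) - \<kappa> * ?z a \<partial>?m)"
      by (rule Bochner_Integration.integral_cong) auto
    also have "\<dots> = (\<integral>\<tau>. source_term p q r s f g \<tau> \<partial>?m) + (\<integral>\<tau>. \<kappa> * ?z a - \<kappa> * ?z \<tau> \<partial>?m) - \<kappa> * ?z a * h"
    proof -
      have id: "integrable ?m (\<lambda>\<tau>. \<kappa> * ?z a - \<kappa> * ?z \<tau>)" by (intro Bochner_Integration.integrable_diff ic integrable_mult_right iz)
      show ?thesis
        unfolding Bochner_Integration.integral_diff[OF Bochner_Integration.integrable_add[OF iW id] ic] Bochner_Integration.integral_add[OF iW id]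
        using integral_const_Ioo[of a "a + h" "\<kappa> * ?z a"] ah by simp
    qed
    also have "(\<integral>\<tau>. \<kappa> * ?z a - \<kappa> * ?z \<tau> \<partial>?m) \<le> (\<bar>\<kappa>\<bar> * (L * h)) * (a + h - a)"
    proof (rule integral_AE_le_Ioo)
      show "integrable ?m (\<lambda>\<tau>. \<kappa> * ?z a - \<kappa> * ?z \<tau>)" by (intro Bochner_Integration.integrable_diff ic integrable_mult_right iz)
      show "AE \<tau> in ?m. \<kappa> * ?z a - \<kappa> * ?z \<tau> \<le> \<bar>\<kappa>\<bar> * (L * h)"
      proof (rule AE_I2)
        fix \<tau> assume "\<tau> \<in> space ?m"
        then have t: "a < \<tau>" "\<tau> < a + h" by auto
        have "\<bar>?z \<tau> - ?z a\<bar> \<le> L * (\<tau> - a)" by (rule L(2)[OF divfree_band_nsq[OF g] nle ah(1) t(1)]) (use t ah in simp)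
        also have "\<dots> \<le> L * h" using t L(1) by (intro mult_left_mono) auto
        finally have "\<bar>\<kappa>\<bar> * \<bar>?z \<tau> - ?z a\<bar> \<le> \<bar>\<kappa>\<bar> * (L * h)" by (rule mult_left_mono) simp
        moreover have "\<kappa> * ?z a - \<kappa> * ?z \<tau> \<le> \<bar>\<kappa>\<bar> * \<bar>?z \<tau> - ?z a\<bar>"
          unfolding abs_mult[symmetric] right_diff_distrib[symmetric] by (simp add: abs_le_iff right_diff_distrib abs_if)
        ultimately show "\<kappa> * ?z a - \<kappa> * ?z \<tau> \<le> \<bar>\<kappa>\<bar> * (L * h)" by linarith
      qed
    qed (use ah in simp)
    finally show "L2_inner (v (a + h)) (synth g) \<le> L2_inner (v a) (synth (\<lambda>\<xi>. (1 - \<kappa> * h * (norm \<xi>)\<^sup>2) *\<^sub>R g \<xi>))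
        + (\<integral>\<tau>. source_term p q r s f g \<tau> \<partial>lebesgue_on {a<..<a+h}) + (\<bar>\<kappa>\<bar> * L) * h\<^sup>2"
      unfolding e2 by (simp add: power2_eq_square algebra_simps)
  qed
qed

text \<open>The explicit Euler scheme, with \<open>(1 - \<kappa> h |\<xi>|\<^sup>2)\<^sup>j \<psi>\<close> in place of \<open>exp(-\<kappa> j h |\<xi>|\<^sup>2) \<psi>\<close>, avoids test
  fields that depend on time; its error \<open>D h\<^sup>2\<close> per step vanishes in the limit.\<close>

lemma duhamel_bound:
  assumes E1: "mode_eq \<nu> u p1 q1 r1 s1 f1" and E2: "mode_eq \<eta> b p2 q2 r2 s2 f2"
    and \<psi>1: "divfree_band \<psi>1" and \<psi>2: "divfree_band \<psi>2" and T: "T > 0" and \<mu>: "\<mu> > 0"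
    and H: "\<And>x g1 g2. 0 \<le> x \<Longrightarrow> divfree_band g1 \<Longrightarrow> divfree_band g2 \<Longrightarrow> (\<And>\<xi>. norm (g1 \<xi>) \<le> x * norm (\<psi>1 \<xi>)) \<Longrightarrow> (\<And>\<xi>. norm (g2 \<xi>) \<le> x * norm (\<psi>2 \<xi>)) \<Longrightarrow>
       AE \<tau> in lebesgue_on {0<..<T}. source_term p1 q1 r1 s1 f1 g1 \<tau> + source_term p2 q2 r2 s2 f2 g2 \<tau> \<le> K * x"
    and I: "\<And>x g1 g2. 0 \<le> x \<Longrightarrow> divfree_band g1 \<Longrightarrow> divfree_band g2 \<Longrightarrow> (\<And>\<xi>. norm (g1 \<xi>) \<le> x * norm (\<psi>1 \<xi>)) \<Longrightarrow> (\<And>\<xi>. norm (g2 \<xi>) \<le> x * norm (\<psi>2 \<xi>)) \<Longrightarrow>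
       L2_inner (u 0) (synth g1) + L2_inner (b 0) (synth g2) \<le> A * x"
    and B1: "\<And>\<xi>. \<psi>1 \<xi> \<noteq> 0 \<Longrightarrow> \<mu> \<le> \<nu> * (norm \<xi>)\<^sup>2 \<and> \<nu> * (norm \<xi>)\<^sup>2 \<le> B"
    and B2: "\<And>\<xi>. \<psi>2 \<xi> \<noteq> 0 \<Longrightarrow> \<mu> \<le> \<eta> * (norm \<xi>)\<^sup>2 \<and> \<eta> * (norm \<xi>)\<^sup>2 \<le> B"
  shows "L2_inner (u T) (synth \<psi>1) + L2_inner (b T) (synth \<psi>2) \<le> exp (- \<mu> * T) * A + (1 - exp (- \<mu> * T)) * (K / \<mu>)"
proof -
  obtain D1 where D1: "D1 \<ge> 0" "\<And>g a h. divfree_band g \<Longrightarrow> (\<And>\<xi>. norm (g \<xi>) \<le> norm (\<psi>1 \<xi>)) \<Longrightarrow> 0 \<le> a \<Longrightarrow> 0 < h \<Longrightarrow> a + h \<le> T \<Longrightarrow>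
      L2_inner (u (a + h)) (synth g) \<le> L2_inner (u a) (synth (\<lambda>\<xi>. (1 - \<nu> * h * (norm \<xi>)\<^sup>2) *\<^sub>R g \<xi>))
        + (\<integral>\<tau>. source_term p1 q1 r1 s1 f1 g \<tau> \<partial>lebesgue_on {a<..<a+h}) + D1 * h\<^sup>2"
    by (rule mode_eq_step[OF E1 \<psi>1 T]) (rule that, assumption, blast)
  obtain D2 where D2: "D2 \<ge> 0" "\<And>g a h. divfree_band g \<Longrightarrow> (\<And>\<xi>. norm (g \<xi>) \<le> norm (\<psi>2 \<xi>)) \<Longrightarrow> 0 \<le> a \<Longrightarrow> 0 < h \<Longrightarrow> a + h \<le> T \<Longrightarrow>
      L2_inner (b (a + h)) (synth g) \<le> L2_inner (b a) (synth (\<lambda>\<xi>. (1 - \<eta> * h * (norm \<xi>)\<^sup>2) *\<^sub>R g \<xi>))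
        + (\<integral>\<tau>. source_term p2 q2 r2 s2 f2 g \<tau> \<partial>lebesgue_on {a<..<a+h}) + D2 * h\<^sup>2"
    by (rule mode_eq_step[OF E2 \<psi>2 T]) (rule that, assumption, blast)
  let ?Z = "L2_inner (u T) (synth \<psi>1) + L2_inner (b T) (synth \<psi>2)"
  \<comment> \<open>The two conditions on n keep the Euler factors on the supports of the symbols,
    and their common bound x, nonnegative.\<close>
  have main: "?Z \<le> A * (1 + (- \<mu> * T) / real n) ^ n + K * (1 - (1 + (- \<mu> * T) / real n) ^ n) / \<mu> + (D1 + D2) * T\<^sup>2 * (1 / real n)"
    if n: "n > 0" "B * T \<le> real n" "\<mu> * T \<le> real n" for n :: nat
  proof -
    define h where "h = T / real n"
    have h: "h > 0" "B * h \<le> 1" "\<mu> * h \<le> 1" "real n * h = T" using n T by (auto simp: h_def pos_divide_le_eq)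
    define x where "x = 1 - \<mu> * h"
    have "0 < \<mu> * h" by (rule mult_pos_pos[OF \<mu> h(1)])
    then have x: "0 \<le> x" "x \<le> 1" using h(3) unfolding x_def by linarith+
    have x3: "x = 1 + (- \<mu> * T) / real n" by (simp add: x_def h_def)
    define G1 where "G1 j \<xi> = (1 - \<nu> * h * (norm \<xi>)\<^sup>2) ^ j *\<^sub>R \<psi>1 \<xi>" for j \<xi>
    define G2 where "G2 j \<xi> = (1 - \<eta> * h * (norm \<xi>)\<^sup>2) ^ j *\<^sub>R \<psi>2 \<xi>" for j \<xi>
    have gd: "divfree_band (G1 j)" "divfree_band (G2 j)" for j
      unfolding G1_def[abs_def] G2_def[abs_def] by (intro divfree_band_mult \<psi>1 \<psi>2 continuous_intros)+
    \<comment> \<open>On the support of the symbol the factor lies between 0 and x = 1 - \<mu> h, so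
      j steps contract by x^j.\<close>
    have mul: "0 \<le> 1 - \<kappa> * h * n2 \<and> 1 - \<kappa> * h * n2 \<le> x" if "\<mu> \<le> \<kappa> * n2 \<and> \<kappa> * n2 \<le> B" for \<kappa> n2
    proof -
      have "\<mu> * h \<le> (\<kappa> * n2) * h" "(\<kappa> * n2) * h \<le> B * h" using that h(1) by (auto intro: mult_right_mono)
      then show ?thesis using h(2) unfolding x_def by (simp add: mult_ac)
    qed
    have G1le: "norm (G1 j \<xi>) \<le> x ^ j * norm (\<psi>1 \<xi>)" for j \<xi>
    proof (cases "\<psi>1 \<xi> = 0")
      case False
      from mul[OF B1[OF False]] have "\<bar>1 - \<nu> * h * (norm \<xi>)\<^sup>2\<bar> ^ j \<le> x ^ j" by (intro power_mono) auto
      then show ?thesis by (simp add: G1_def power_abs mult_right_mono)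
    qed (simp add: G1_def)
    have G2le: "norm (G2 j \<xi>) \<le> x ^ j * norm (\<psi>2 \<xi>)" for j \<xi>
    proof (cases "\<psi>2 \<xi> = 0")
      case False
      from mul[OF B2[OF False]] have "\<bar>1 - \<eta> * h * (norm \<xi>)\<^sup>2\<bar> ^ j \<le> x ^ j" by (intro power_mono) auto
      then show ?thesis by (simp add: G2_def power_abs mult_right_mono)
    qed (simp add: G2_def)
    have xj: "x ^ j \<le> 1" for j using x by (simp add: power_le_one)
    have G1': "norm (G1 j \<xi>) \<le> norm (\<psi>1 \<xi>)" and G2': "norm (G2 j \<xi>) \<le> norm (\<psi>2 \<xi>)" for j \<xi>
      using G1le[of j \<xi>] mult_right_mono[OF xj[of j], of "norm (\<psi>1 \<xi>)"] G2le[of j \<xi>] mult_right_mono[OF xj[of j], of "norm (\<psi>2 \<xi>)"] by auto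
    \<comment> \<open>Time runs backwards with j: the symbol after j steps is paired with the
      solution at time T - j h, so \<open>Y 0\<close> is the quantity to bound and
      \<open>Y n\<close> involves the initial values only.\<close>
    define Y where "Y j = L2_inner (u (real (n - j) * h)) (synth (G1 j)) + L2_inner (b (real (n - j) * h)) (synth (G2 j))" for j
    have step: "Y j \<le> Y (Suc j) + (K * x ^ j * h + (D1 + D2) * h\<^sup>2)" if j: "j < n" for j
    proof -
      define a where "a = real (n - Suc j) * h"
      have nj: "n - j = Suc (n - Suc j)" using j by simp
      have ah: "real (n - j) * h = a + h" unfolding nj a_def by (simp add: algebra_simps)
      have a0: "a \<ge> 0" using h by (simp add: a_def)
      have aT: "a + h \<le> T" unfolding ah[symmetric] h(4)[symmetric] using h(1) by (intro mult_right_mono) auto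
      have S1: "(\<lambda>\<xi>. (1 - \<nu> * h * (norm \<xi>)\<^sup>2) *\<^sub>R G1 j \<xi>) = G1 (Suc j)" by (auto simp: G1_def)
      have S2: "(\<lambda>\<xi>. (1 - \<eta> * h * (norm \<xi>)\<^sup>2) *\<^sub>R G2 j \<xi>) = G2 (Suc j)" by (auto simp: G2_def)
      have b1: "L2_inner (u (a + h)) (synth (G1 j)) \<le> L2_inner (u a) (synth (G1 (Suc j))) + (\<integral>\<tau>. source_term p1 q1 r1 s1 f1 (G1 j) \<tau> \<partial>lebesgue_on {a<..<a+h}) + D1 * h\<^sup>2"
        using D1(2)[OF gd(1) G1' a0 h(1) aT, of j] unfolding S1 .
      have b2: "L2_inner (b (a + h)) (synth (G2 j)) \<le> L2_inner (b a) (synth (G2 (Suc j))) + (\<integral>\<tau>. source_term p2 q2 r2 s2 f2 (G2 j) \<tau> \<partial>lebesgue_on {a<..<a+h}) + D2 * h\<^sup>2"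
        using D2(2)[OF gd(2) G2' a0 h(1) aT, of j] unfolding S2 .
      have al: "a < a + h" using h by simp
      note i1 = mode_eq_integrable(1)[OF E1 divfree_bandD[OF gd(1)] a0 al, of j] and i2 = mode_eq_integrable(1)[OF E2 divfree_bandD[OF gd(2)] a0 al, of j]
      have "AE \<tau> in lebesgue_on {0<..<T}. source_term p1 q1 r1 s1 f1 (G1 j) \<tau> + source_term p2 q2 r2 s2 f2 (G2 j) \<tau> \<le> K * x ^ j"
        by (rule H[OF _ gd G1le G2le]) (use x in simp)
      then have "AE \<tau> in lebesgue_on {a<..<a+h}. source_term p1 q1 r1 s1 f1 (G1 j) \<tau> + source_term p2 q2 r2 s2 f2 (G2 j) \<tau> \<le> K * x ^ j"
        by (rule AE_lebesgue_on_mono[OF _ Ioo_subset[OF a0 aT]]) auto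
      from integral_AE_le_Ioo[OF _ Bochner_Integration.integrable_add[OF i1 i2] this]
      have "(\<integral>\<tau>. source_term p1 q1 r1 s1 f1 (G1 j) \<tau> \<partial>lebesgue_on {a<..<a+h}) + (\<integral>\<tau>. source_term p2 q2 r2 s2 f2 (G2 j) \<tau> \<partial>lebesgue_on {a<..<a+h}) \<le> K * x ^ j * h"
        unfolding Bochner_Integration.integral_add[OF i1 i2] using h(1) by simp
      with b1 b2 show ?thesis unfolding Y_def ah a_def[symmetric] by (simp add: distrib_right)
    qed
    have tele: "Y 0 \<le> Y m + (\<Sum>j<m. K * x ^ j * h + (D1 + D2) * h\<^sup>2)" if "m \<le> n" for m
      using that
    proof (induction m)
      case (Suc m)
      then show ?case using step[of m] by simp
    qed simp
    have "Y 0 = ?Z" using h(4) by (simp add: Y_def G1_def[abs_def] G2_def[abs_def])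
    moreover have "Y n \<le> A * x ^ n"
      using I[OF _ gd G1le G2le, of n] x(1) by (simp add: Y_def)
    \<comment> \<open>In the geometric series the factor h cancels against 1 - x = \<mu> h; the n
      errors D h^2, with D = D1 + D2, add up to D T^2 / n.\<close>
    moreover have "(\<Sum>j<n. K * x ^ j * h + (D1 + D2) * h\<^sup>2) = K * (1 - x ^ n) / \<mu> + (D1 + D2) * T\<^sup>2 * (1 / real n)"
    proof -
      have x1: "x \<noteq> 1" using \<mu> h(1) by (simp add: x_def)
      have "(\<Sum>j<n. K * x ^ j * h) = K * h * (\<Sum>j<n. x ^ j)" by (simp add: sum_distrib_left mult_ac)
      also have "(\<Sum>j<n. x ^ j) = (1 - x ^ n) / (\<mu> * h)"
        using geometric_sum[OF x1, of n] \<mu> h(1) by (simp add: x_def field_simps)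
      finally have 1: "(\<Sum>j<n. K * x ^ j * h) = K * (1 - x ^ n) / \<mu>" using h(1) by simp
      have "real n * h\<^sup>2 = T\<^sup>2 * (1 / real n)" using n(1) by (simp add: h_def power2_eq_square)
      then have "(\<Sum>j<n. (D1 + D2) * h\<^sup>2) = (D1 + D2) * T\<^sup>2 * (1 / real n)" by (simp add: mult.left_commute[of "real n"])
      then show ?thesis unfolding sum.distrib 1 by (simp only:)
    qed
    ultimately show ?thesis using tele[OF order_refl] unfolding x3[symmetric] by linarith
  qed
  \<comment> \<open>The power x^n is (1 - \<mu> T / n)^n, which tends to exp(-\<mu> T).\<close>
  have lim: "(\<lambda>n. A * (1 + (- \<mu> * T) / real n) ^ n + K * (1 - (1 + (- \<mu> * T) / real n) ^ n) / \<mu> + (D1 + D2) * T\<^sup>2 * (1 / real n))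
     \<longlonglongrightarrow> A * exp (- \<mu> * T) + K * (1 - exp (- \<mu> * T)) / \<mu> + (D1 + D2) * T\<^sup>2 * 0"
    by (intro tendsto_intros tendsto_exp_limit_sequentially lim_1_over_n) (use \<mu> in simp)
  obtain N :: nat where N: "max (B * T) (\<mu> * T) \<le> real N" using real_arch_simple by blast
  have "?Z \<le> A * exp (- \<mu> * T) + K * (1 - exp (- \<mu> * T)) / \<mu> + (D1 + D2) * T\<^sup>2 * 0"
  proof (rule LIMSEQ_le_const[OF lim], rule exI[of _ "Suc N"], intro allI impI)
    fix n assume n: "Suc N \<le> n"
    then have "real N \<le> real n" by simp
    then have "B * T \<le> real n" "\<mu> * T \<le> real n" using N by linarith+
    then show "?Z \<le> A * (1 + (- \<mu> * T) / real n) ^ n + K * (1 - (1 + (- \<mu> * T) / real n) ^ n) / \<mu> + (D1 + D2) * T\<^sup>2 * (1 / real n)"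
      using n by (intro main) auto
  qed
  then show ?thesis by (simp add: mult_ac)
qed

end

section \<open>The spectral bound\<close>

lemma integral_le_nn_integral:
  fixes f :: "'a \<Rightarrow> real"
  assumes "f \<in> borel_measurable M" "\<And>x. f x \<ge> 0" "C \<ge> 0" "(\<integral>\<^sup>+x. ennreal (f x) \<partial>M) \<le> ennreal C"
  shows "integrable M f" "(\<integral>x. f x \<partial>M) \<le> C"
proof -
  show i: "integrable M f"
    by (rule integrableI_nonneg) (use assms in \<open>auto intro: le_less_trans\<close>)
  have "ennreal (\<integral>x. f x \<partial>M) \<le> ennreal C"
    using assms(4) nn_integral_eq_integral[OF i] assms(2) by simp
  then show "(\<integral>x. f x \<partial>M) \<le> C" using assms(3) by (simp add: ennreal_le_iff)
qed

text \<open>Hoelder's inequality for pairs, through Young's inequality for arguments normalized by A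
  and B. Integrability comes out of the same estimate, so the hypotheses can stay in
  \<open>ennreal\<close>; treating the pair jointly matches the sum of p-th powers in
  \<open>e_spec\<close> and \<open>h_spec\<close>.\<close>

lemma holder2:
  fixes a1 a2 b1 b2 :: "'a \<Rightarrow> real"
  assumes p: "p > 1" "q > 1" "1/p + 1/q = 1"
    and [measurable]: "a1 \<in> borel_measurable M" "a2 \<in> borel_measurable M" "b1 \<in> borel_measurable M" "b2 \<in> borel_measurable M"
    and nn: "\<And>x. a1 x \<ge> 0" "\<And>x. a2 x \<ge> 0" "\<And>x. b1 x \<ge> 0" "\<And>x. b2 x \<ge> 0"
    and A: "A > 0" "(\<integral>\<^sup>+x. ennreal (a1 x powr p + a2 x powr p) \<partial>M) \<le> ennreal (A powr p)"
    and B: "B > 0" "(\<integral>\<^sup>+x. ennreal (b1 x powr q + b2 x powr q) \<partial>M) \<le> ennreal (B powr q)"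
  shows "integrable M (\<lambda>x. a1 x * b1 x + a2 x * b2 x)" "(\<integral>x. a1 x * b1 x + a2 x * b2 x \<partial>M) \<le> A * B"
proof -
  have y: "a * b \<le> A * B / (p * A powr p) * a powr p + A * B / (q * B powr q) * b powr q" if "a \<ge> 0" "b \<ge> 0" for a b
  proof -
    have "(a / A) * (b / B) \<le> (a / A) powr p / p + (b / B) powr q / q"
      by (rule Youngs_inequality[OF p]) (use that A B in auto)
    then have "(A * B) * ((a / A) * (b / B)) \<le> (A * B) * ((a / A) powr p / p + (b / B) powr q / q)"
      using A B by (intro mult_left_mono) auto
    then show ?thesis using A B that by (simp add: powr_divide distrib_left mult_ac)
  qed
  define \<alpha> \<beta> where "\<alpha> = A * B / (p * A powr p)" and "\<beta> = A * B / (q * B powr q)"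
  have ab0: "\<alpha> \<ge> 0" "\<beta> \<ge> 0" unfolding \<alpha>_def \<beta>_def using A B p by auto
  have "(\<integral>\<^sup>+x. ennreal (a1 x * b1 x + a2 x * b2 x) \<partial>M) \<le>
     (\<integral>\<^sup>+x. ennreal \<alpha> * ennreal (a1 x powr p + a2 x powr p) + ennreal \<beta> * ennreal (b1 x powr q + b2 x powr q) \<partial>M)"
  proof (rule nn_integral_mono)
    fix x
    have "a1 x * b1 x + a2 x * b2 x \<le> \<alpha> * (a1 x powr p + a2 x powr p) + \<beta> * (b1 x powr q + b2 x powr q)"
      using y[OF nn(1)[of x] nn(3)[of x]] y[OF nn(2)[of x] nn(4)[of x]] unfolding \<alpha>_def \<beta>_def distrib_left by linarith
    then have "ennreal (a1 x * b1 x + a2 x * b2 x) \<le> ennreal (\<alpha> * (a1 x powr p + a2 x powr p) + \<beta> * (b1 x powr q + b2 x powr q))"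
      by (rule ennreal_leI)
    also have "\<dots> = ennreal \<alpha> * ennreal (a1 x powr p + a2 x powr p) + ennreal \<beta> * ennreal (b1 x powr q + b2 x powr q)"
      by (subst ennreal_plus) (auto simp: ennreal_mult ab0 intro!: mult_nonneg_nonneg add_nonneg_nonneg)
    finally show "ennreal (a1 x * b1 x + a2 x * b2 x) \<le> \<dots>" .
  qed
  also have "\<dots> = ennreal \<alpha> * (\<integral>\<^sup>+x. ennreal (a1 x powr p + a2 x powr p) \<partial>M) + ennreal \<beta> * (\<integral>\<^sup>+x. ennreal (b1 x powr q + b2 x powr q) \<partial>M)"
    by (subst nn_integral_add) (auto simp: nn_integral_cmult)
  also have "\<dots> \<le> ennreal \<alpha> * ennreal (A powr p) + ennreal \<beta> * ennreal (B powr q)"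
    by (intro add_mono mult_left_mono A B) auto
  also have "\<dots> = ennreal (\<alpha> * A powr p + \<beta> * B powr q)"
    using ab0 by (simp add: ennreal_mult[symmetric] ennreal_plus[symmetric] del: ennreal_plus)
  \<comment> \<open>The two normalized integrals contribute A B / p and A B / q.\<close>
  also have "\<alpha> * A powr p + \<beta> * B powr q = A * B * (1/p + 1/q)"
    using A B by (simp add: \<alpha>_def \<beta>_def distrib_left)
  also have "\<dots> = A * B" using p by simp
  finally have fin: "(\<integral>\<^sup>+x. ennreal (a1 x * b1 x + a2 x * b2 x) \<partial>M) \<le> ennreal (A * B)" .
  have m: "(\<lambda>x. a1 x * b1 x + a2 x * b2 x) \<in> borel_measurable M" by measurable
  have n: "a1 x * b1 x + a2 x * b2 x \<ge> 0" for x using nn by (intro add_nonneg_nonneg mult_nonneg_nonneg)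
  have AB: "A * B \<ge> 0" using A B by simp
  show "integrable M (\<lambda>x. a1 x * b1 x + a2 x * b2 x)" "(\<integral>x. a1 x * b1 x + a2 x * b2 x \<partial>M) \<le> A * B"
    using integral_le_nn_integral[OF m n AB fin] by auto
qed

text \<open>With its converse this carries estimates between \<open>e_spec\<close> or
  \<open>h_spec\<close> and integrals of p-th powers; a real bound rules out the value
  infinity.\<close>

lemma ennroot_leD:
  assumes p: "p > 0" and A: "A \<ge> 0" and le: "ennroot p X \<le> ennreal A"
  shows "X \<le> ennreal (A powr p)"
proof -
  have "X \<noteq> \<infinity>" using le by (auto simp: ennroot_def top_unique)
  then obtain x where x: "X = ennreal x" "x \<ge> 0" by (cases X) auto
  then have "x powr (1/p) \<le> A" using le A by (simp add: ennroot_def ennreal_le_iff)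
  then have "(x powr (1/p)) powr p \<le> A powr p" using p by (intro powr_mono2) auto
  then show ?thesis using x p by (simp add: powr_powr ennreal_leI)
qed

lemma ennroot_leI:
  assumes p: "p > 0" and A: "A \<ge> 0" and le: "X \<le> ennreal (A powr p)"
  shows "ennroot p X \<le> ennreal A"
proof -
  have "X \<noteq> \<infinity>" using le by (auto simp: top_unique)
  then obtain x where x: "X = ennreal x" "x \<ge> 0" by (cases X) auto
  then have "x \<le> A powr p" using le by (simp add: ennreal_le_iff)
  then have "x powr (1/p) \<le> (A powr p) powr (1/p)" using p x by (intro powr_mono2) auto
  then show ?thesis using x p A by (simp add: ennroot_def powr_powr ennreal_leI)
qed

section \<open>From almost every time to every time; solenoidality in Fourier variables\<close>

lemma AE_lebesgue_on_exists:
  assumes ae: "AE t in lebesgue_on {a<..<b}. P t" and ab: "a < (b::real)"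
  shows "\<exists>t\<in>{a<..<b}. P t"
proof (rule ccontr)
  assume "\<not> ?thesis"
  then have "AE t in lebesgue_on {a<..<b}. False"
    using ae AE_space[of "lebesgue_on {a<..<b}"] by (auto elim: eventually_elim2)
  then have "(\<integral>t. 1 \<partial>lebesgue_on {a<..<b}) = (\<integral>t. (0::real) \<partial>lebesgue_on {a<..<b})"
    by (intro integral_cong_AE) auto
  then show False using integral_const_Ioo[of a b 1] ab by simp
qed

text \<open>Every interval to the right of t contains a time at which F vanishes; continuity does
  the rest.\<close>

lemma continuous_AE_zero:
  fixes F :: "real \<Rightarrow> real"
  assumes F: "continuous_on {0..} F" and ae: "\<And>T. T > 0 \<Longrightarrow> AE t in lebesgue_on {0<..<T}. F t = 0" and t: "t \<ge> 0"
  shows "F t = 0"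
proof -
  have "\<exists>s\<in>{t<..<t + 1 / real (Suc n)}. F s = 0" for n
  proof (rule AE_lebesgue_on_exists)
    show "AE s in lebesgue_on {t<..<t + 1 / real (Suc n)}. F s = 0"
      by (rule AE_lebesgue_on_mono[OF ae[of "t + 1 / real (Suc n)"]]) (use t in \<open>auto intro: add_nonneg_pos\<close>)
  qed simp
  then obtain s where s: "\<And>n. s n \<in> {t<..<t + 1 / real (Suc n)}" "\<And>n. F (s n) = 0" by metis
  have "(\<lambda>n. s n - t) \<longlonglongrightarrow> 0"
  proof (rule Lim_null_comparison[OF always_eventually LIMSEQ_Suc[OF lim_1_over_n]], rule allI)
    fix n show "norm (s n - t) \<le> 1 / real (Suc n)" using s(1)[of n] by simp
  qed
  then have "s \<longlonglongrightarrow> t" by (simp add: LIM_zero_iff)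
  then have "(\<lambda>n. F (s n)) \<longlonglongrightarrow> F t"
    by (rule continuous_on_tendsto_compose[OF F]) (use t s(1) in \<open>auto intro!: always_eventually less_imp_le elim: less_trans le_less_trans\<close>)
  then show ?thesis using s(2) LIMSEQ_unique[OF _ tendsto_const] by simp
qed

text \<open>The symbol \<xi> h belongs to the gradient of the function synthesized from -i h, the -i
  cancelling the i of differentiation. Solenoidal test fields are orthogonal to gradients, and their
  L2 closure inherits this.\<close>

lemma solenoidal_synth_orthogonal:
  assumes v: "v \<in> L2_sigma" and h: "band h"
  shows "L2_inner v (synth (\<lambda>\<xi>. \<chi> j. complex_of_real (\<xi> $ j) * h \<xi>)) = 0"
proof -
  let ?a = "\<lambda>\<xi>. (\<chi> j. complex_of_real (\<xi> $ j) * h \<xi>) :: complex^3"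
  have hb: "band (\<lambda>\<xi>. - \<i> * h \<xi>)" by (rule band_linear[OF h bounded_linear_mult_right])
  have comp: "(\<lambda>x. synth ?a x $ j) = pderivative j (synth_s (\<lambda>\<xi>. - \<i> * h \<xi>))" for j
  proof -
    have "(\<lambda>\<xi>. \<i> * complex_of_real (\<xi> $ j) * (- \<i> * h \<xi>)) = (\<lambda>\<xi>. complex_of_real (\<xi> $ j) * h \<xi>)"
      by (simp add: fun_eq_iff complex_eq_iff)
    then show ?thesis unfolding pderivative_synth_s[OF hb] by (simp add: synth_nth)
  qed
  have ab: "band ?a"
  proof (rule band_vec)
    fix j
    have "band (\<lambda>\<xi>. (\<xi> $ j) *\<^sub>R h \<xi>)" by (rule band_mult[OF h]) (intro continuous_intros)
    then show "band (\<lambda>\<xi>. ?a \<xi> $ j)" by (simp add: scaleR_conv_of_real)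
  qed
  have sm: "smooth (synth_s (\<lambda>\<xi>. - \<i> * h \<xi>))" by (rule smooth_synth_s[OF hb])
  have z: "L2_inner w (synth ?a) = 0" if w: "w \<in> solenoidal_test" for w
  proof -
    have wt: "w \<in> test_fun" using w by (simp add: solenoidal_test_def)
    have wj: "(\<lambda>x. w x $ j) \<in> test_fun" for j by (rule test_fun_component[OF wt])
    let ?q = "synth_s (\<lambda>\<xi>. - \<i> * h \<xi>)"
    have i1: "integrable lborel (\<lambda>x. w x $ j * pderivative j ?q x)" for j
      by (intro band_integrable test_fun_band test_fun_mult wj smooth_pderivative sm)
    have i2: "integrable lborel (\<lambda>x. ?q x * pderivative j (\<lambda>x. w x $ j) x)" for j
      using band_integrable[OF test_fun_band[OF test_fun_mult[OF test_fun_pderivative[OF wj] sm]]] by (simp add: mult.commute)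
    have "L2_inner w (synth ?a) = (\<Sum>j\<in>UNIV. \<integral>x. w x $ j * pderivative j ?q x \<partial>lborel)"
      unfolding L2_inner_def inner_vec_def inner_real_def comp[symmetric]
      by (rule Bochner_Integration.integral_sum) (use i1 in \<open>simp only: comp[symmetric]\<close>)
    also have "\<dots> = (\<Sum>j\<in>UNIV. - (\<integral>x. ?q x * pderivative j (\<lambda>x. w x $ j) x \<partial>lborel))"
      using integral_by_parts_test[OF wj sm] by (simp add: mult.commute)
    also have "\<dots> = - (\<integral>x. (\<Sum>j\<in>UNIV. ?q x * pderivative j (\<lambda>x. w x $ j) x) \<partial>lborel)"
      by (subst Bochner_Integration.integral_sum[OF i2]) (simp add: sum_negf)
    also have "\<dots> = - (\<integral>x. ?q x * (\<Sum>j\<in>UNIV. pderivative j w x $ j) \<partial>lborel)"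
      by (simp add: sum_distrib_left pderivative_component[OF test_funD(1)[OF wt]])
    also have "\<dots> = 0" using w by (simp add: solenoidal_test_def)
    finally show ?thesis .
  qed
  obtain s where s: "\<And>n::nat. s n \<in> solenoidal_test" "(\<lambda>n. L2_norm (\<lambda>x. s n x - v x)) \<longlonglongrightarrow> 0"
    by (rule L2_sigma_sequence[OF v], rule that)
  have lim: "(\<lambda>n. L2_inner (s n) (synth ?a)) \<longlonglongrightarrow> L2_inner v (synth ?a)"
    by (rule L2_inner_tendsto[OF solenoidal_L2[OF s(1)] L2_sigma_L2[OF v] synth_L2[OF ab] s(2)])
  show ?thesis by (rule LIMSEQ_unique[OF lim[unfolded z[OF s(1)]] tendsto_const])
qed

text \<open>Needed because only symbols with \<open>\<xi> \<bullet> g = 0\<close> are admissible for testing.\<close>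

lemma fourier_divfree:
  assumes v: "regular v" and t: "t \<ge> 0"
  shows "AE \<xi> in lborel. (\<Sum>j\<in>UNIV. complex_of_real (\<xi> $ j) * fourier (v t) \<xi> $ j) = 0"
proof -
  have vL: "v t \<in> L2" by (rule regular_L2[OF v t])
  define U where "U = fourier (v t)"
  have U: "U \<in> L2" unfolding U_def by (rule fourier_L2[OF vL])
  have [measurable]: "(\<lambda>\<xi>. U \<xi> $ j) \<in> borel_measurable borel" for j by (rule L2_measurable[OF L2_component[OF U]])
  have [measurable]: "(\<lambda>\<xi>::real^3. \<xi> $ j) \<in> borel_measurable borel" for j
    by (intro borel_measurable_continuous_onI continuous_intros)
  define D where "D \<xi> = (\<Sum>j\<in>UNIV. complex_of_real (\<xi> $ j) * U \<xi> $ j)" for \<xi>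
  have [measurable]: "D \<in> borel_measurable borel" unfolding D_def[abs_def] by measurable
  \<comment> \<open>Restriction to this set makes D a bounded symbol of compact support; the sets
    exhaust the space as n grows.\<close>
  define S where "S n = {\<xi>. norm \<xi> \<le> real n \<and> norm (D \<xi>) \<le> real n}" for n :: nat
  have [measurable]: "S n \<in> sets borel" for n unfolding S_def by measurable
  have "AE \<xi> in lborel. indicator (S n) \<xi> * (norm (D \<xi>))\<^sup>2 = (0::real)" for n
  proof -
    define h where "h \<xi> = indicator (S n) \<xi> *\<^sub>R D \<xi>" for \<xi>
    have h: "band h"
      by (rule bandI[where C="real n" and r="real n"]) (auto simp: h_def[abs_def] S_def indicator_def)
    let ?a = "\<lambda>\<xi>. (\<chi> j. complex_of_real (\<xi> $ j) * h \<xi>) :: complex^3"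
    have ab: "band ?a"
    proof (rule band_vec)
      fix j
      have "band (\<lambda>\<xi>. (\<xi> $ j) *\<^sub>R h \<xi>)" by (rule band_mult[OF h]) (intro continuous_intros)
      then show "band (\<lambda>\<xi>. ?a \<xi> $ j)" by (simp add: scaleR_conv_of_real)
    qed
    \<comment> \<open>Membership in \<open>L2_sigma\<close> is known at almost every time only; weak
      continuity extends the identity to t.\<close>
    have "L2_inner (v t) (synth ?a) = 0"
    proof (rule continuous_AE_zero[OF regular_continuous[OF v synth_L2[OF ab]] _ t])
      fix T :: real assume T: "T > 0"
      show "AE \<tau> in lebesgue_on {0<..<T}. L2_inner (v \<tau>) (synth ?a) = 0"
        using regular_AE(1)[OF v T] by eventually_elim (rule solenoidal_synth_orthogonal[OF _ h])
    qed
    then have z: "L2_inner U ?a = 0" unfolding U_def L2_inner_fourier[OF vL ab] .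
    \<comment> \<open>h was chosen as the truncation of D itself, so that the vanishing pairing is
      the integral of |D|^2 over \<open>S n\<close>.\<close>
    have e: "U \<xi> \<bullet> ?a \<xi> = indicator (S n) \<xi> * (norm (D \<xi>))\<^sup>2" for \<xi>
    proof -
      have "U \<xi> \<bullet> ?a \<xi> = (\<Sum>j\<in>UNIV. Re ((complex_of_real (\<xi> $ j) * U \<xi> $ j) * cnj (h \<xi>)))"
        unfolding inner_vec_def inner_complex_cnj by (intro sum.cong refl) (simp add: mult_ac)
      also have "\<dots> = Re (D \<xi> * cnj (h \<xi>))" unfolding D_def sum_distrib_right Re_sum ..
      also have "\<dots> = indicator (S n) \<xi> * (norm (D \<xi>))\<^sup>2"
      proof (cases "\<xi> \<in> S n")
        case True
        then have "Re (D \<xi> * cnj (h \<xi>)) = Re (complex_of_real ((norm (D \<xi>))\<^sup>2))"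
          unfolding complex_norm_square by (simp add: h_def)
        then show ?thesis using True by simp
      qed (simp add: h_def)
      finally show ?thesis .
    qed
    have i: "integrable lborel (\<lambda>\<xi>. indicator (S n) \<xi> * (norm (D \<xi>))\<^sup>2 :: real)"
      using L2_inner_integrable[OF U band_L2[OF ab]] unfolding e .
    show ?thesis
      using integral_nonneg_eq_0_iff_AE[OF i] z unfolding L2_inner_def e by simp
  qed
  then have "AE \<xi> in lborel. \<forall>n. indicator (S n) \<xi> * (norm (D \<xi>))\<^sup>2 = (0::real)" by (simp only: AE_all_countable) simp
  then have "AE \<xi> in lborel. D \<xi> = 0"
  proof eventually_elim
    case (elim \<xi>)
    obtain n :: nat where "max (norm \<xi>) (norm (D \<xi>)) \<le> real n" using real_arch_simple by blast
    then have "\<xi> \<in> S n" by (simp add: S_def)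
    then show ?case using elim[rule_format, of n] by simp
  qed
  then show ?thesis unfolding D_def U_def .
qed

section \<open>Geometry of the cube and the setting of the estimate\<close>

context cutoff begin

text \<open>Half the diagonal of the cube is sqrt 3 \<delta>, which is less than |k|/2.\<close>

lemma cube_norm:
  assumes k: "\<delta> < norm k / (2 * sqrt 3)" and \<xi>: "\<xi> \<in> cube k \<delta>"
  shows "norm k / 2 \<le> norm \<xi>" "norm \<xi> \<le> 3 / 2 * norm k"
proof -
  have "norm (\<xi> - k) \<le> sqrt 3 * \<delta>"
  proof (rule power2_le_imp_le)
    have "(norm (\<xi> - k))\<^sup>2 = (\<Sum>i\<in>UNIV. \<bar>\<xi> $ i - k $ i\<bar>\<^sup>2)" by (simp add: norm_vec_sq)
    also have "\<dots> \<le> (\<Sum>i\<in>(UNIV::3 set). \<delta>\<^sup>2)"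
      using \<xi> by (intro sum_mono power_mono) (auto simp: cube_def)
    finally show "(norm (\<xi> - k))\<^sup>2 \<le> (sqrt 3 * \<delta>)\<^sup>2" by (simp add: power_mult_distrib)
  qed (use \<delta> in simp)
  moreover have "sqrt 3 * \<delta> \<le> norm k / 2"
    using k by (simp add: pos_less_divide_eq mult_ac)
  ultimately have "norm (\<xi> - k) \<le> norm k / 2" by linarith
  then show "norm k / 2 \<le> norm \<xi>" "norm \<xi> \<le> 3 / 2 * norm k"
    using norm_triangle_sub[of \<xi> k] norm_triangle_sub[of k \<xi>] by (simp_all add: norm_minus_commute)
qed

lemma emeasure_cube: "emeasure lborel (cube k \<delta>) = ennreal ((2 * \<delta>) ^ 3)" and cube_sets [measurable]: "cube k \<delta> \<in> sets borel"
proof -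
  let ?e = "\<chi> i. \<delta> :: real^3"
  have c: "cube k \<delta> = cbox (k - ?e) (k + ?e)"
    by (auto simp: cube_def mem_box_cart abs_le_iff algebra_simps)
  show "cube k \<delta> \<in> sets borel" unfolding c by simp
  have b: "(k - ?e) \<bullet> b \<le> (k + ?e) \<bullet> b \<and> ((k + ?e) - (k - ?e)) \<bullet> b = 2 * \<delta>" if "b \<in> Basis" for b
    using that \<delta> by (auto simp: Basis_real3 inner_axis)
  have "emeasure lborel (cube k \<delta>) = ennreal (\<Prod>b\<in>(Basis::(real^3) set). ((k + ?e) - (k - ?e)) \<bullet> b)"
    unfolding c using b by (subst emeasure_lborel_cbox) auto
  also have "(\<Prod>b\<in>(Basis::(real^3) set). ((k + ?e) - (k - ?e)) \<bullet> b) = (\<Prod>b\<in>(Basis::(real^3) set). 2 * \<delta>)"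
    by (intro prod.cong refl) (use b in blast)
  finally show "emeasure lborel (cube k \<delta>) = ennreal ((2 * \<delta>) ^ 3)" by simp
qed

end

text \<open>One exponent p with its conjugate q at a time. The bound a on the initial spectrum is a
  parameter, so that a single value can be used for all p.\<close>

locale mhd_spectral = cutoff +
  fixes \<nu> \<eta> p q a :: real and f1 f2 u b :: "real \<Rightarrow> field" and R R1 :: "real \<Rightarrow> real"
  assumes pos: "\<nu> > 0" "\<eta> > 0" and \<delta>k: "\<delta> < norm k / (2 * sqrt 3)" and p: "p \<ge> 2" "q > 1" "1 / p + 1 / q = 1"
    and E1: "mode_eq \<nu> u u u b b f1" and E2: "mode_eq \<eta> b u b b u f2"
    and R: "\<And>t. t > 0 \<Longrightarrow> (L2_norm (u t))\<^sup>2 + (L2_norm (b t))\<^sup>2 \<le> (R t)\<^sup>2"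
    and R1: "mono_on {0..} R1"
    and h: "\<And>t. t \<ge> 0 \<Longrightarrow> ennreal (2 powr (1 / p) * (2 * \<delta>) powr (3 / p) * (R t)\<^sup>2) + 2 * h_spec c f1 f2 p t < ennreal (min \<nu> \<eta> / 6 * R1 t)"
    and a: "a > 0" "e_spec c u b p 0 \<le> ennreal a"
begin

lemma k_pos: "norm k > 0"
proof -
  have "0 < norm k / (2 * sqrt 3)" using \<delta> \<delta>k by linarith
  then show ?thesis by (simp add: zero_less_divide_iff)
qed

definition mu :: real where "mu = min \<nu> \<eta> * (norm k)\<^sup>2 / 4"

lemma mu_pos: "mu > 0" using pos k_pos by (simp add: mu_def)

text \<open>The L^p norm of the pair whose two members are the indicator of the cube; it enters when
  Hoelder's inequality is applied to the quadratic terms.\<close>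

definition cp :: real where "cp = 2 powr (1 / p) * (2 * \<delta>) powr (3 / p)"

lemma cp_pos: "cp > 0" using \<delta> by (simp add: cp_def)

lemma cp_powr: "cp powr p = 2 * (2 * \<delta>) ^ 3"
proof -
  have "cp powr p = 2 * (2 * \<delta>) powr 3"
    unfolding cp_def using p \<delta> by (simp add: powr_mult powr_powr)
  then show ?thesis using \<delta> by (simp add: powr_numeral)
qed

lemma c_measurable [measurable]: "c \<in> borel_measurable borel"
  by (rule smooth_measurable[OF test_funD(1)[OF c_test]])

text \<open>H is all that the quadratic terms leave of min(\<nu>,\<eta>) R1 / 6. It dominates h_p
  and, by strictness of the hypothesis, is positive even when the force vanishes, as
  \<open>holder2\<close> requires.\<close>

lemma force_slack:
  assumes "\<tau> \<ge> 0"
  obtains H where "H > 0" "cp * (R \<tau>)\<^sup>2 + H = min \<nu> \<eta> / 6 * R1 \<tau>"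
    "(\<integral>\<^sup>+\<xi>. ennreal ((norm (c \<xi> *\<^sub>R fourier (f1 \<tau>) \<xi>) / norm \<xi>) powr p + (norm (c \<xi> *\<^sub>R fourier (f2 \<tau>) \<xi>) / norm \<xi>) powr p) \<partial>lborel) \<le> ennreal (H powr p)"
proof -
  define H where "H = min \<nu> \<eta> / 6 * R1 \<tau> - cp * (R \<tau>)\<^sup>2"
  let ?h = "h_spec c f1 f2 p \<tau>"
  have lt: "ennreal (cp * (R \<tau>)\<^sup>2) + 2 * ?h < ennreal (min \<nu> \<eta> / 6 * R1 \<tau>)" using h[OF assms] by (simp add: cp_def)
  have c0: "cp * (R \<tau>)\<^sup>2 \<ge> 0" using cp_pos by simp
  have "ennreal (cp * (R \<tau>)\<^sup>2) < ennreal (min \<nu> \<eta> / 6 * R1 \<tau>)"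
    using lt by (rule le_less_trans[rotated]) simp
  then have H: "H > 0" unfolding H_def using c0 by (simp add: ennreal_less_iff)
  have "2 * ?h \<le> ennreal (cp * (R \<tau>)\<^sup>2) + 2 * ?h" by (rule add_increasing) simp_all
  also note lt
  also have "ennreal (min \<nu> \<eta> / 6 * R1 \<tau>) < \<infinity>" by simp
  finally have fin: "2 * ?h < \<infinity>" .
  then have "?h \<noteq> \<infinity>" by (auto simp: ennreal_mult_less_top)
  then obtain hh where hh: "?h = ennreal hh" "hh \<ge> 0" by (cases ?h) auto
  have "ennreal (cp * (R \<tau>)\<^sup>2 + 2 * hh) < ennreal (min \<nu> \<eta> / 6 * R1 \<tau>)"
    using lt hh c0 by (simp add: ennreal_plus ennreal_mult)
  moreover have "cp * (R \<tau>)\<^sup>2 + 2 * hh \<ge> 0" using hh c0 by linarith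
  ultimately have "cp * (R \<tau>)\<^sup>2 + 2 * hh < min \<nu> \<eta> / 6 * R1 \<tau>" by (simp only: ennreal_less_iff)
  then have "hh \<le> H" unfolding H_def using hh by linarith
  then have "?h \<le> ennreal H" using hh by (simp add: ennreal_leI)
  moreover have "ennroot p (\<integral>\<^sup>+\<xi>. ennreal ((norm (c \<xi> *\<^sub>R fourier (f1 \<tau>) \<xi>) powr p + norm (c \<xi> *\<^sub>R fourier (f2 \<tau>) \<xi>) powr p) / norm \<xi> powr p) \<partial>lborel) \<le> ?h"
    unfolding h_spec_def by (rule SUP_upper) (use assms in simp)
  ultimately have "(\<integral>\<^sup>+\<xi>. ennreal ((norm (c \<xi> *\<^sub>R fourier (f1 \<tau>) \<xi>) powr p + norm (c \<xi> *\<^sub>R fourier (f2 \<tau>) \<xi>) powr p) / norm \<xi> powr p) \<partial>lborel) \<le> ennreal (H powr p)"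
    by (intro ennroot_leD) (use p H in auto)
  moreover have "(x powr p + y powr p) / z powr p = (x / z) powr p + (y / z) powr p" if "x \<ge> 0" "y \<ge> 0" "z \<ge> 0" for x y z :: real
    using that by (simp add: powr_divide add_divide_distrib)
  ultimately show thesis using H by (intro that[of H]) (simp_all add: H_def)
qed

text \<open>\<open>\<phi>\<close> is dual to \<open>U\<close> in the sense of \<open>L\<^sup>p\<close>.  Restriction to \<open>S\<close> makes it bounded and exactly solenoidal;
  the exceptional set is exhausted as \<open>N\<close> grows, up to a null set.\<close>

context
  fixes T N :: real and U V :: "real^3 \<Rightarrow> complex^3" and S :: "(real^3) set" and \<phi>1 \<phi>2 \<psi>1 \<psi>2 :: "real^3 \<Rightarrow> complex^3"
  assumes T: "T > 0"
  defines "U \<equiv> \<lambda>\<xi>. c \<xi> *\<^sub>R fourier (u T) \<xi>" and "V \<equiv> \<lambda>\<xi>. c \<xi> *\<^sub>R fourier (b T) \<xi>"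
  defines "S \<equiv> {\<xi> \<in> cube k \<delta>. norm (U \<xi>) \<le> N \<and> norm (V \<xi>) \<le> N \<and>
      (\<Sum>j\<in>UNIV. complex_of_real (\<xi> $ j) * fourier (u T) \<xi> $ j) = 0 \<and> (\<Sum>j\<in>UNIV. complex_of_real (\<xi> $ j) * fourier (b T) \<xi> $ j) = 0}"
  defines "\<phi>1 \<equiv> \<lambda>\<xi>. (indicator S \<xi> * norm (U \<xi>) powr (p - 2)) *\<^sub>R U \<xi>" and "\<phi>2 \<equiv> \<lambda>\<xi>. (indicator S \<xi> * norm (V \<xi>) powr (p - 2)) *\<^sub>R V \<xi>"
  defines "\<psi>1 \<equiv> \<lambda>\<xi>. c \<xi> *\<^sub>R \<phi>1 \<xi>" and "\<psi>2 \<equiv> \<lambda>\<xi>. c \<xi> *\<^sub>R \<phi>2 \<xi>"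
begin

lemma uT: "u T \<in> L2" and bT: "b T \<in> L2"
  using regular_L2[OF mode_eqD(1)[OF E1]] regular_L2[OF mode_eqD(1)[OF E2]] T by auto

lemma fourier_measurable [measurable]: "fourier (u T) \<in> borel_measurable borel" "fourier (b T) \<in> borel_measurable borel"
  by (intro L2_measurable fourier_L2 uT bT)+

lemma UV_measurable [measurable]: "U \<in> borel_measurable borel" "V \<in> borel_measurable borel"
  unfolding U_def V_def by measurable

lemma S_sets [measurable]: "S \<in> sets borel"
proof -
  have [measurable]: "(\<lambda>\<xi>::real^3. \<xi> $ j) \<in> borel_measurable borel" for j
    by (intro borel_measurable_continuous_onI continuous_intros)
  have [measurable]: "(\<lambda>\<xi>. fourier (u T) \<xi> $ j) \<in> borel_measurable borel" "(\<lambda>\<xi>. fourier (b T) \<xi> $ j) \<in> borel_measurable borel" for j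
    by (intro L2_measurable L2_component fourier_L2 uT bT)+
  show ?thesis unfolding S_def by measurable
qed

lemma phi_measurable [measurable]: "\<phi>1 \<in> borel_measurable borel" "\<phi>2 \<in> borel_measurable borel"
  "\<psi>1 \<in> borel_measurable borel" "\<psi>2 \<in> borel_measurable borel"
  unfolding \<psi>1_def \<psi>2_def \<phi>1_def \<phi>2_def by measurable

lemma norm_powr_step: "x \<ge> 0 \<Longrightarrow> x powr (p - 2) * x = x powr (p - 1)" for x :: real
  using powr_add[of x "p - 2" 1] by (cases "x = 0") auto

lemma norm_phi: "norm (\<phi>1 \<xi>) = indicator S \<xi> * norm (U \<xi>) powr (p - 1)" "norm (\<phi>2 \<xi>) = indicator S \<xi> * norm (V \<xi>) powr (p - 1)"
  unfolding \<phi>1_def \<phi>2_def by (simp_all add: abs_mult mult.assoc norm_powr_step)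

text \<open>Conjugacy of the exponents, in the form (p - 1) q = p.\<close>

lemma norm_phi_powr: "norm (\<phi>1 \<xi>) powr q = indicator S \<xi> * norm (U \<xi>) powr p" "norm (\<phi>2 \<xi>) powr q = indicator S \<xi> * norm (V \<xi>) powr p"
proof -
  have "q * (1 / p + 1 / q) = q" using p by simp
  then have "(p - 1) * q = p" using p by (simp add: field_simps)
  then show "norm (\<phi>1 \<xi>) powr q = indicator S \<xi> * norm (U \<xi>) powr p" "norm (\<phi>2 \<xi>) powr q = indicator S \<xi> * norm (V \<xi>) powr p"
    unfolding norm_phi by (auto simp: indicator_def powr_powr)
qed

lemma phi_supp: "\<xi> \<notin> cube k \<delta> \<Longrightarrow> \<phi>1 \<xi> = 0" "\<xi> \<notin> cube k \<delta> \<Longrightarrow> \<phi>2 \<xi> = 0"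
  by (auto simp: \<phi>1_def \<phi>2_def S_def)

lemma norm_psi: "norm (\<psi>1 \<xi>) = c \<xi> * norm (\<phi>1 \<xi>)" "norm (\<psi>2 \<xi>) = c \<xi> * norm (\<phi>2 \<xi>)"
  by (simp_all add: \<psi>1_def \<psi>2_def c_bounds)

lemma norm_psi_le: "norm (\<psi>1 \<xi>) \<le> norm (\<phi>1 \<xi>)" "norm (\<psi>2 \<xi>) \<le> norm (\<phi>2 \<xi>)"
  unfolding norm_psi by (simp_all add: mult_left_le_one_le c_bounds)

text \<open>N is an arbitrary real number here; for negative N the set S is empty and |N| still
  gives a valid bound.\<close>

lemma norm_phi_le: "norm (\<phi>1 \<xi>) \<le> \<bar>N\<bar> powr (p - 1)" "norm (\<phi>2 \<xi>) \<le> \<bar>N\<bar> powr (p - 1)"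
  unfolding norm_phi using p by (auto simp: indicator_def S_def intro!: powr_mono2)

lemma band_phi: "band \<phi>1" "band \<phi>2"
proof -
  have "\<xi> \<notin> cube k \<delta>" if "norm \<xi> > 3/2 * norm k" for \<xi>
    using cube_norm(2)[OF \<delta>k, of \<xi>] that by auto
  then have z: "\<phi>1 \<xi> = 0" "\<phi>2 \<xi> = 0" if "norm \<xi> > 3/2 * norm k" for \<xi>
    using that phi_supp by blast+
  show "band \<phi>1" by (rule bandI[OF phi_measurable(1) norm_phi_le(1) z(1)])
  show "band \<phi>2" by (rule bandI[OF phi_measurable(2) norm_phi_le(2) z(2)])
qed

text \<open>The lower bound |k|/2 on the cube provides the gap around the origin. U is a real
  multiple of the transform, so orthogonality to \<xi> is inherited on S, and off S the symbol is
  0.\<close>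

lemma divfree_band_psi: "divfree_band \<psi>1" "divfree_band \<psi>2"
proof -
  have z: "\<xi> \<notin> cube k \<delta>" if "norm \<xi> < norm k / 2" for \<xi> using cube_norm(1)[OF \<delta>k, of \<xi>] that by auto
  have k2: "norm k / 2 > 0" using k_pos by simp
  have b: "band \<psi>1" "band \<psi>2" unfolding \<psi>1_def \<psi>2_def
    by (intro band_mult band_phi smooth_continuous test_funD c_test)+
  have e: "(\<Sum>j\<in>UNIV. complex_of_real (\<xi> $ j) * (r *\<^sub>R w) $ j) = complex_of_real r * (\<Sum>j\<in>UNIV. complex_of_real (\<xi> $ j) * w $ j)" for \<xi> :: "real^3" and r and w :: "complex^3"
    unfolding sum_distrib_left by (intro sum.cong refl) (simp add: scaleR_conv_of_real[where 'a=complex] mult_ac)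
  have "(\<Sum>j\<in>UNIV. complex_of_real (\<xi> $ j) * \<psi>1 \<xi> $ j) = 0" for \<xi>
    unfolding \<psi>1_def \<phi>1_def U_def e by (cases "\<xi> \<in> S") (auto simp: S_def)
  moreover have "(\<Sum>j\<in>UNIV. complex_of_real (\<xi> $ j) * \<psi>2 \<xi> $ j) = 0" for \<xi>
    unfolding \<psi>2_def \<phi>2_def V_def e by (cases "\<xi> \<in> S") (auto simp: S_def)
  moreover have "\<forall>\<xi>. norm \<xi> < norm k / 2 \<longrightarrow> \<psi>1 \<xi> = 0" "\<forall>\<xi>. norm \<xi> < norm k / 2 \<longrightarrow> \<psi>2 \<xi> = 0"
    using z phi_supp by (auto simp: \<psi>1_def \<psi>2_def)
  ultimately show "divfree_band \<psi>1" "divfree_band \<psi>2" unfolding divfree_band_def using b k2 by blast+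
qed

text \<open>Its finiteness is known in advance, unlike that of the full integral in
  \<open>e_spec\<close>; this is what allows division by one of its powers at the end.\<close>

definition trunc_moment :: real where "trunc_moment = (\<integral>\<xi>. indicator S \<xi> * (norm (U \<xi>) powr p + norm (V \<xi>) powr p) \<partial>lborel)"

lemma trunc_moment_integrable: "integrable lborel (\<lambda>\<xi>. indicator S \<xi> * (norm (U \<xi>) powr p + norm (V \<xi>) powr p))"
proof (rule integrable_dominated[OF integrable_indicator_cball[of "2 * \<bar>N\<bar> powr p" "3/2 * norm k"]])
  fix \<xi>
  show "norm (indicator S \<xi> * (norm (U \<xi>) powr p + norm (V \<xi>) powr p)) \<le> 2 * \<bar>N\<bar> powr p * indicator (cball 0 (3/2 * norm k)) \<xi>"
  proof (cases "\<xi> \<in> S")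
    case True
    then have "norm (U \<xi>) powr p \<le> \<bar>N\<bar> powr p" "norm (V \<xi>) powr p \<le> \<bar>N\<bar> powr p" using p by (auto simp: S_def intro!: powr_mono2)
    moreover have "\<xi> \<in> cball 0 (3/2 * norm k)" using True cube_norm(2)[OF \<delta>k, of \<xi>] by (auto simp: S_def)
    ultimately show ?thesis using True by simp
  qed (simp add: indicator_def)
qed measurable

lemma nn_integral_trunc_moment: "(\<integral>\<^sup>+\<xi>. ennreal (indicator S \<xi> * (norm (U \<xi>) powr p + norm (V \<xi>) powr p)) \<partial>lborel) = ennreal trunc_moment"
  unfolding trunc_moment_def by (rule nn_integral_eq_integral[OF trunc_moment_integrable]) (auto intro!: mult_nonneg_nonneg)

lemma trunc_moment_nonneg: "trunc_moment \<ge> 0"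
  unfolding trunc_moment_def by (intro integral_nonneg_AE) (auto intro!: mult_nonneg_nonneg)

text \<open>The cutoff factor of the symbol combines with the Fourier transform to U, and U paired
  with its dual gives |U|^p.\<close>

lemma test_value: "L2_inner (u T) (synth \<psi>1) + L2_inner (b T) (synth \<psi>2) = trunc_moment"
proof -
  have e: "fourier (w :: field) \<xi> \<bullet> (c \<xi> *\<^sub>R ((indicator S \<xi> * norm (W \<xi>) powr (p - 2)) *\<^sub>R W \<xi>)) = indicator S \<xi> * norm (W \<xi>) powr p"
    if W: "W \<xi> = c \<xi> *\<^sub>R fourier w \<xi>" for w W \<xi>
  proof -
    have "fourier w \<xi> \<bullet> (c \<xi> *\<^sub>R ((indicator S \<xi> * norm (W \<xi>) powr (p - 2)) *\<^sub>R W \<xi>)) = indicator S \<xi> * norm (W \<xi>) powr (p - 2) * (W \<xi> \<bullet> W \<xi>)"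
      unfolding W by simp
    also have "\<dots> = indicator S \<xi> * (norm (W \<xi>) powr (p - 2) * norm (W \<xi>) * norm (W \<xi>))"
      by (simp add: power2_norm_eq_inner[symmetric] power2_eq_square)
    also have "norm (W \<xi>) powr (p - 2) * norm (W \<xi>) * norm (W \<xi>) = norm (W \<xi>) powr p"
      using powr_add[of "norm (W \<xi>)" "p - 1" 1] by (cases "W \<xi> = 0") (simp_all add: norm_powr_step)
    finally show ?thesis .
  qed
  have eU: "fourier (u T) \<xi> \<bullet> \<psi>1 \<xi> = indicator S \<xi> * norm (U \<xi>) powr p" for \<xi>
    unfolding \<psi>1_def \<phi>1_def by (rule e) (simp add: U_def)
  have eV: "fourier (b T) \<xi> \<bullet> \<psi>2 \<xi> = indicator S \<xi> * norm (V \<xi>) powr p" for \<xi>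
    unfolding \<psi>2_def \<phi>2_def by (rule e) (simp add: V_def)
  note g = divfree_band_psi[THEN divfree_bandD]
  have "L2_inner (u T) (synth \<psi>1) + L2_inner (b T) (synth \<psi>2) = L2_inner (fourier (u T)) \<psi>1 + L2_inner (fourier (b T)) \<psi>2"
    using L2_inner_fourier[OF uT g(1)] L2_inner_fourier[OF bT g(2)] by simp
  also have "\<dots> = (\<integral>\<xi>. fourier (u T) \<xi> \<bullet> \<psi>1 \<xi> + fourier (b T) \<xi> \<bullet> \<psi>2 \<xi> \<partial>lborel)"
    unfolding L2_inner_def
    by (rule Bochner_Integration.integral_add[symmetric]) (intro L2_inner_integrable fourier_L2 uT bT band_L2 g)+
  also have "\<dots> = trunc_moment"
    unfolding trunc_moment_def eU eV by (simp only: distrib_left)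
  finally show ?thesis .
qed

lemma phi_q_bound:
  assumes "trunc_moment > 0"
  shows "(\<integral>\<^sup>+\<xi>. ennreal (norm (\<phi>1 \<xi>) powr q + norm (\<phi>2 \<xi>) powr q) \<partial>lborel) \<le> ennreal ((trunc_moment powr (1 / q)) powr q)"
proof -
  have "(\<integral>\<^sup>+\<xi>. ennreal (norm (\<phi>1 \<xi>) powr q + norm (\<phi>2 \<xi>) powr q) \<partial>lborel) = ennreal trunc_moment"
    unfolding norm_phi_powr distrib_left[symmetric] by (rule nn_integral_trunc_moment)
  moreover have "(trunc_moment powr (1 / q)) powr q = trunc_moment" using assms p by (simp add: powr_powr)
  ultimately show ?thesis by simp
qed

text \<open>With I = \<open>trunc_moment\<close> the joint L^q norm of the dual pair is
  I^(1/q).\<close>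

lemma holder_phi:
  assumes I: "trunc_moment > 0" and [measurable]: "a1 \<in> borel_measurable borel" "a2 \<in> borel_measurable borel" and nn: "\<And>x. a1 x \<ge> 0" "\<And>x. a2 x \<ge> 0"
    and A: "A > 0" "(\<integral>\<^sup>+x. ennreal (a1 x powr p + a2 x powr p) \<partial>lborel) \<le> ennreal (A powr p)"
  shows "integrable lborel (\<lambda>\<xi>. a1 \<xi> * norm (\<phi>1 \<xi>) + a2 \<xi> * norm (\<phi>2 \<xi>))" "(\<integral>\<xi>. a1 \<xi> * norm (\<phi>1 \<xi>) + a2 \<xi> * norm (\<phi>2 \<xi>) \<partial>lborel) \<le> A * trunc_moment powr (1 / q)"
proof -
  have p1: "p > 1" using p by simp
  have B: "trunc_moment powr (1 / q) > 0" using I by simp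
  show "integrable lborel (\<lambda>\<xi>. a1 \<xi> * norm (\<phi>1 \<xi>) + a2 \<xi> * norm (\<phi>2 \<xi>))" "(\<integral>\<xi>. a1 \<xi> * norm (\<phi>1 \<xi>) + a2 \<xi> * norm (\<phi>2 \<xi>) \<partial>lborel) \<le> A * trunc_moment powr (1 / q)"
    by (rule holder2[OF p1 p(2,3) _ _ _ _ nn norm_ge_zero norm_ge_zero A B phi_q_bound[OF I]]; simp)+
qed

text \<open>Stated for symbols dominated by x times \<psi>, since the Euler scheme delivers symbols
  with x a power of its contraction factor. The cutoff factor in \<psi> is handed back to the
  transform, which produces \<open>e_spec\<close> at time 0.\<close>

lemma initial_bound:
  assumes I: "trunc_moment > 0" and x: "x \<ge> 0" and g: "band g1" "band g2"
    and le: "\<And>\<xi>. norm (g1 \<xi>) \<le> x * norm (\<psi>1 \<xi>)" "\<And>\<xi>. norm (g2 \<xi>) \<le> x * norm (\<psi>2 \<xi>)"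
  shows "L2_inner (u 0) (synth g1) + L2_inner (b 0) (synth g2) \<le> a * trunc_moment powr (1 / q) * x"
proof -
  have u0: "u 0 \<in> L2" and b0: "b 0 \<in> L2" using regular_L2[OF mode_eqD(1)[OF E1]] regular_L2[OF mode_eqD(1)[OF E2]] by auto
  let ?F = "fourier (u 0)" and ?G = "fourier (b 0)"
  have F: "?F \<in> L2" and G: "?G \<in> L2" by (intro fourier_L2 u0 b0)+
  note [measurable] = L2_measurable[OF F] L2_measurable[OF G]
  have "(\<integral>\<^sup>+\<xi>. ennreal (norm (c \<xi> *\<^sub>R ?F \<xi>) powr p + norm (c \<xi> *\<^sub>R ?G \<xi>) powr p) \<partial>lborel) \<le> ennreal (a powr p)"
    using a p unfolding e_spec_def by (intro ennroot_leD) auto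
  note H = holder_phi[OF I _ _ norm_ge_zero norm_ge_zero a(1) this]
  have i: "integrable lborel (\<lambda>\<xi>. norm (c \<xi> *\<^sub>R ?F \<xi>) * norm (\<phi>1 \<xi>) + norm (c \<xi> *\<^sub>R ?G \<xi>) * norm (\<phi>2 \<xi>))" by (rule H(1)) measurable
  have "L2_inner (u 0) (synth g1) + L2_inner (b 0) (synth g2) = (\<integral>\<xi>. ?F \<xi> \<bullet> g1 \<xi> + ?G \<xi> \<bullet> g2 \<xi> \<partial>lborel)"
    unfolding L2_inner_fourier[OF u0 g(1), symmetric] L2_inner_fourier[OF b0 g(2), symmetric] unfolding L2_inner_def
    by (rule Bochner_Integration.integral_add[symmetric]) (intro L2_inner_integrable F G band_L2 g)+
  also have "\<dots> \<le> (\<integral>\<xi>. x * (norm (c \<xi> *\<^sub>R ?F \<xi>) * norm (\<phi>1 \<xi>) + norm (c \<xi> *\<^sub>R ?G \<xi>) * norm (\<phi>2 \<xi>)) \<partial>lborel)"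
  proof (rule integral_mono)
    show "integrable lborel (\<lambda>\<xi>. ?F \<xi> \<bullet> g1 \<xi> + ?G \<xi> \<bullet> g2 \<xi>)" by (intro Bochner_Integration.integrable_add L2_inner_integrable F G band_L2 g)
    show "integrable lborel (\<lambda>\<xi>. x * (norm (c \<xi> *\<^sub>R ?F \<xi>) * norm (\<phi>1 \<xi>) + norm (c \<xi> *\<^sub>R ?G \<xi>) * norm (\<phi>2 \<xi>)))" by (intro integrable_mult_right i)
    fix \<xi>
    have "?F \<xi> \<bullet> g1 \<xi> \<le> norm (?F \<xi>) * (x * norm (\<psi>1 \<xi>))" "?G \<xi> \<bullet> g2 \<xi> \<le> norm (?G \<xi>) * (x * norm (\<psi>2 \<xi>))"
      by (rule order_trans[OF norm_cauchy_schwarz mult_left_mono[OF le(1)]], simp, rule order_trans[OF norm_cauchy_schwarz mult_left_mono[OF le(2)]], simp)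
    then show "?F \<xi> \<bullet> g1 \<xi> + ?G \<xi> \<bullet> g2 \<xi> \<le> x * (norm (c \<xi> *\<^sub>R ?F \<xi>) * norm (\<phi>1 \<xi>) + norm (c \<xi> *\<^sub>R ?G \<xi>) * norm (\<phi>2 \<xi>))"
      unfolding norm_psi by (simp add: c_bounds distrib_left mult_ac)
  qed
  also have "\<dots> = x * (\<integral>\<xi>. norm (c \<xi> *\<^sub>R ?F \<xi>) * norm (\<phi>1 \<xi>) + norm (c \<xi> *\<^sub>R ?G \<xi>) * norm (\<phi>2 \<xi>) \<partial>lborel)" by (rule integral_mult_right_zero)
  also have "\<dots> \<le> x * (a * trunc_moment powr (1 / q))" by (intro mult_left_mono x H(2)) measurable
  finally show ?thesis by (simp add: mult_ac)
qed

text \<open>The functions paired with the dual symbol are indicators of the cube, whence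
  \<open>cp\<close>; the weight |\<xi>| costs 3|k|/2.\<close>

lemma moment_bound:
  assumes I: "trunc_moment > 0" and x: "x \<ge> 0" and g: "band g1" "band g2"
    and le: "\<And>\<xi>. norm (g1 \<xi>) \<le> x * norm (\<psi>1 \<xi>)" "\<And>\<xi>. norm (g2 \<xi>) \<le> x * norm (\<psi>2 \<xi>)"
  shows "(\<integral>\<xi>. norm \<xi> * norm (g1 \<xi> :: complex^3) \<partial>lborel) + (\<integral>\<xi>. norm \<xi> * norm (g2 \<xi> :: complex^3) \<partial>lborel) \<le> x * (3 / 2 * norm k) * (cp * trunc_moment powr (1 / q))"
proof -
  let ?c = "indicator (cube k \<delta>) :: real^3 \<Rightarrow> real"
  have "(\<integral>\<^sup>+\<xi>. ennreal (?c \<xi> powr p + ?c \<xi> powr p) \<partial>lborel) = (\<integral>\<^sup>+\<xi>. ennreal 2 * indicator (cube k \<delta>) \<xi> \<partial>lborel)"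
    by (intro nn_integral_cong) (auto simp: indicator_def)
  also have "\<dots> = ennreal 2 * emeasure lborel (cube k \<delta>)" by (rule nn_integral_cmult_indicator) simp
  also have "\<dots> = ennreal (cp powr p)" unfolding emeasure_cube cp_powr using \<delta> by (simp add: ennreal_mult[symmetric] del: ennreal_numeral)
  finally have cb: "(\<integral>\<^sup>+\<xi>. ennreal (?c \<xi> powr p + ?c \<xi> powr p) \<partial>lborel) \<le> ennreal (cp powr p)" by simp
  have nnc: "?c \<xi> \<ge> 0" for \<xi> by simp
  note H = holder_phi[OF I _ _ nnc nnc cp_pos cb]
  have i: "integrable lborel (\<lambda>\<xi>. ?c \<xi> * norm (\<phi>1 \<xi>) + ?c \<xi> * norm (\<phi>2 \<xi>))" by (rule H(1)) measurable
  have "(\<integral>\<xi>. norm \<xi> * norm (g1 \<xi>) \<partial>lborel) + (\<integral>\<xi>. norm \<xi> * norm (g2 \<xi>) \<partial>lborel) = (\<integral>\<xi>. norm \<xi> * norm (g1 \<xi>) + norm \<xi> * norm (g2 \<xi>) \<partial>lborel)"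
    by (rule Bochner_Integration.integral_add[symmetric]) (intro moment_integrable g)+
  also have "\<dots> \<le> (\<integral>\<xi>. x * (3 / 2 * norm k) * (?c \<xi> * norm (\<phi>1 \<xi>) + ?c \<xi> * norm (\<phi>2 \<xi>)) \<partial>lborel)"
  proof (rule integral_mono)
    show "integrable lborel (\<lambda>\<xi>. norm \<xi> * norm (g1 \<xi>) + norm \<xi> * norm (g2 \<xi>))" by (intro Bochner_Integration.integrable_add moment_integrable g)
    show "integrable lborel (\<lambda>\<xi>. x * (3 / 2 * norm k) * (?c \<xi> * norm (\<phi>1 \<xi>) + ?c \<xi> * norm (\<phi>2 \<xi>)))" by (intro integrable_mult_right i)
    fix \<xi>
    have l1: "norm (g1 \<xi>) \<le> x * norm (\<phi>1 \<xi>)" by (rule order_trans[OF le(1) mult_left_mono[OF norm_psi_le(1) x]])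
    have l2: "norm (g2 \<xi>) \<le> x * norm (\<phi>2 \<xi>)" by (rule order_trans[OF le(2) mult_left_mono[OF norm_psi_le(2) x]])
    show "norm \<xi> * norm (g1 \<xi>) + norm \<xi> * norm (g2 \<xi>) \<le> x * (3 / 2 * norm k) * (?c \<xi> * norm (\<phi>1 \<xi>) + ?c \<xi> * norm (\<phi>2 \<xi>))"
    proof (cases "\<xi> \<in> cube k \<delta>")
      case True
      have "norm \<xi> * norm (g1 \<xi>) \<le> 3 / 2 * norm k * (x * norm (\<phi>1 \<xi>))" "norm \<xi> * norm (g2 \<xi>) \<le> 3 / 2 * norm k * (x * norm (\<phi>2 \<xi>))"
        by (intro mult_mono' cube_norm(2)[OF \<delta>k True] l1 l2 norm_ge_zero)+
      then show ?thesis using True by (simp add: distrib_left mult_ac)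
    next
      case False
      then have "g1 \<xi> = 0" "g2 \<xi> = 0" using l1 l2 phi_supp[OF False] by auto
      then show ?thesis using False by simp
    qed
  qed
  also have "\<dots> = x * (3 / 2 * norm k) * (\<integral>\<xi>. ?c \<xi> * norm (\<phi>1 \<xi>) + ?c \<xi> * norm (\<phi>2 \<xi>) \<partial>lborel)" by (rule integral_mult_right_zero)
  also have "\<dots> \<le> x * (3 / 2 * norm k) * (cp * trunc_moment powr (1 / q))" by (intro mult_left_mono H(2)) (use x in simp_all)
  finally show ?thesis .
qed

text \<open>The transform of the force is divided by |\<xi>|, as in \<open>h_spec\<close>; the
  compensating factor costs 3|k|/2, the same as for the quadratic terms, so that both contributions
  add up under one constant.\<close>

lemma force_bound:
  assumes I: "trunc_moment > 0" and x: "x \<ge> 0" and g: "band g1" "band g2"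
    and le: "\<And>\<xi>. norm (g1 \<xi>) \<le> x * norm (\<psi>1 \<xi>)" "\<And>\<xi>. norm (g2 \<xi>) \<le> x * norm (\<psi>2 \<xi>)"
    and f: "f1 \<tau> \<in> L2" "f2 \<tau> \<in> L2" and H: "H > 0"
    "(\<integral>\<^sup>+\<xi>. ennreal ((norm (c \<xi> *\<^sub>R fourier (f1 \<tau>) \<xi>) / norm \<xi>) powr p + (norm (c \<xi> *\<^sub>R fourier (f2 \<tau>) \<xi>) / norm \<xi>) powr p) \<partial>lborel) \<le> ennreal (H powr p)"
  shows "L2_inner (f1 \<tau>) (synth g1) + L2_inner (f2 \<tau>) (synth g2) \<le> x * (3 / 2 * norm k) * (H * trunc_moment powr (1 / q))"
proof -
  let ?F = "fourier (f1 \<tau>)" and ?G = "fourier (f2 \<tau>)"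
  have F: "?F \<in> L2" and G: "?G \<in> L2" by (intro fourier_L2 f)+
  note [measurable] = L2_measurable[OF F] L2_measurable[OF G]
  let ?a1 = "\<lambda>\<xi>. norm (c \<xi> *\<^sub>R ?F \<xi>) / norm \<xi>" and ?a2 = "\<lambda>\<xi>. norm (c \<xi> *\<^sub>R ?G \<xi>) / norm \<xi>"
  have nn: "?a1 \<xi> \<ge> 0" "?a2 \<xi> \<ge> 0" for \<xi> by simp_all
  note Ho = holder_phi[OF I _ _ nn H]
  have i: "integrable lborel (\<lambda>\<xi>. ?a1 \<xi> * norm (\<phi>1 \<xi>) + ?a2 \<xi> * norm (\<phi>2 \<xi>))" by (rule Ho(1)) measurable
  have "L2_inner (f1 \<tau>) (synth g1) + L2_inner (f2 \<tau>) (synth g2) = (\<integral>\<xi>. ?F \<xi> \<bullet> g1 \<xi> + ?G \<xi> \<bullet> g2 \<xi> \<partial>lborel)"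
    unfolding L2_inner_fourier[OF f(1) g(1), symmetric] L2_inner_fourier[OF f(2) g(2), symmetric] unfolding L2_inner_def
    by (rule Bochner_Integration.integral_add[symmetric]) (intro L2_inner_integrable F G band_L2 g)+
  also have "\<dots> \<le> (\<integral>\<xi>. x * (3 / 2 * norm k) * (?a1 \<xi> * norm (\<phi>1 \<xi>) + ?a2 \<xi> * norm (\<phi>2 \<xi>)) \<partial>lborel)"
  proof (rule integral_mono)
    show "integrable lborel (\<lambda>\<xi>. ?F \<xi> \<bullet> g1 \<xi> + ?G \<xi> \<bullet> g2 \<xi>)" by (intro Bochner_Integration.integrable_add L2_inner_integrable F G band_L2 g)
    show "integrable lborel (\<lambda>\<xi>. x * (3 / 2 * norm k) * (?a1 \<xi> * norm (\<phi>1 \<xi>) + ?a2 \<xi> * norm (\<phi>2 \<xi>)))" by (intro integrable_mult_right i)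
    fix \<xi>
    \<comment> \<open>One argument for both pairs: multiply and divide by |\<xi>|, which is positive
      on the cube.\<close>
    have gen: "w \<bullet> g \<le> x * (3 / 2 * norm k) * (norm (c \<xi> *\<^sub>R w) / norm \<xi> * n)"
      if gl: "norm g \<le> x * (c \<xi> * n)" and n: "n \<ge> 0" and z: "\<xi> \<notin> cube k \<delta> \<Longrightarrow> n = 0" for w g :: "complex^3" and n
    proof (cases "\<xi> \<in> cube k \<delta>")
      case True
      have x1: "norm \<xi> \<le> 3 / 2 * norm k" "norm \<xi> > 0" using cube_norm[OF \<delta>k True] k_pos by auto
      have "w \<bullet> g \<le> norm w * (x * (c \<xi> * n))" by (rule order_trans[OF norm_cauchy_schwarz mult_left_mono[OF gl]]) simp
      also have "\<dots> = x * norm \<xi> * (norm (c \<xi> *\<^sub>R w) / norm \<xi> * n)" using x1 by (simp add: c_bounds mult_ac)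
      also have "\<dots> \<le> x * (3 / 2 * norm k) * (norm (c \<xi> *\<^sub>R w) / norm \<xi> * n)"
        using x1 n x by (intro mult_right_mono mult_left_mono) auto
      finally show ?thesis .
    next
      case False
      then have "g = 0" using gl z by simp
      then show ?thesis using z[OF False] by simp
    qed
    have "?F \<xi> \<bullet> g1 \<xi> \<le> x * (3 / 2 * norm k) * (?a1 \<xi> * norm (\<phi>1 \<xi>))"
      by (rule gen) (use le(1)[of \<xi>] phi_supp in \<open>auto simp: norm_psi\<close>)
    moreover have "?G \<xi> \<bullet> g2 \<xi> \<le> x * (3 / 2 * norm k) * (?a2 \<xi> * norm (\<phi>2 \<xi>))"
      by (rule gen) (use le(2)[of \<xi>] phi_supp in \<open>auto simp: norm_psi\<close>)
    ultimately show "?F \<xi> \<bullet> g1 \<xi> + ?G \<xi> \<bullet> g2 \<xi> \<le> x * (3 / 2 * norm k) * (?a1 \<xi> * norm (\<phi>1 \<xi>) + ?a2 \<xi> * norm (\<phi>2 \<xi>))"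
      by (simp only: distrib_left)
  qed
  also have "\<dots> = x * (3 / 2 * norm k) * (\<integral>\<xi>. ?a1 \<xi> * norm (\<phi>1 \<xi>) + ?a2 \<xi> * norm (\<phi>2 \<xi>) \<partial>lborel)" by (rule integral_mult_right_zero)
  also have "\<dots> \<le> x * (3 / 2 * norm k) * (H * trunc_moment powr (1 / q))" by (intro mult_left_mono Ho(2)) (use x in simp_all)
  finally show ?thesis .
qed

lemma source_bound:
  assumes I: "trunc_moment > 0" and x: "x \<ge> 0" and g: "band g1" "band g2"
    and le: "\<And>\<xi>. norm (g1 \<xi>) \<le> x * norm (\<psi>1 \<xi>)" "\<And>\<xi>. norm (g2 \<xi>) \<le> x * norm (\<psi>2 \<xi>)"
  shows "AE \<tau> in lebesgue_on {0<..<T}. source_term u u b b f1 g1 \<tau> + source_term u b b u f2 g2 \<tau> \<le> mu * (R1 T / norm k) * trunc_moment powr (1 / q) * x"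
  using admissible_AE(1)[OF mode_eqD(6)[OF E1] T] admissible_AE(1)[OF mode_eqD(6)[OF E2] T] AE_space[of "lebesgue_on {0<..<T}"]
proof eventually_elim
  case (elim \<tau>)
  then have t: "\<tau> > 0" "\<tau> \<ge> 0" "\<tau> \<le> T" by auto
  have ut: "u \<tau> \<in> L2" and bt: "b \<tau> \<in> L2" using regular_L2[OF mode_eqD(1)[OF E1] t(2)] regular_L2[OF mode_eqD(1)[OF E2] t(2)] by auto
  let ?M1 = "\<integral>\<xi>. norm \<xi> * norm (g1 \<xi>) \<partial>lborel" and ?M2 = "\<integral>\<xi>. norm \<xi> * norm (g2 \<xi>) \<partial>lborel"
  let ?B = "trunc_moment powr (1 / q)" and ?nu = "L2_norm (u \<tau>)" and ?nb = "L2_norm (b \<tau>)"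
  have M0: "?M1 \<ge> 0" "?M2 \<ge> 0" by simp_all
  obtain H where H: "H > 0" "cp * (R \<tau>)\<^sup>2 + H = min \<nu> \<eta> / 6 * R1 \<tau>"
    "(\<integral>\<^sup>+\<xi>. ennreal ((norm (c \<xi> *\<^sub>R fourier (f1 \<tau>) \<xi>) / norm \<xi>) powr p + (norm (c \<xi> *\<^sub>R fourier (f2 \<tau>) \<xi>) / norm \<xi>) powr p) \<partial>lborel) \<le> ennreal (H powr p)"
    using force_slack[OF t(2)] by blast
  have w1: "flux (u \<tau>) (u \<tau>) (Jsynth g1) - flux (b \<tau>) (b \<tau>) (Jsynth g1) \<le> (?nu\<^sup>2 + ?nb\<^sup>2) * ?M1"
    using Jsynth_bound[OF g(1) ut ut] Jsynth_bound[OF g(1) bt bt] by (simp add: power2_eq_square distrib_right)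
  \<comment> \<open>The cross terms are bounded through 2ab <= a^2 + b^2, so the magnetic equation
    obeys the same estimate as the velocity equation.\<close>
  have w2: "flux (u \<tau>) (b \<tau>) (Jsynth g2) - flux (b \<tau>) (u \<tau>) (Jsynth g2) \<le> (?nu\<^sup>2 + ?nb\<^sup>2) * ?M2"
  proof -
    have "flux (u \<tau>) (b \<tau>) (Jsynth g2) - flux (b \<tau>) (u \<tau>) (Jsynth g2) \<le> 2 * ?nu * ?nb * ?M2"
      using Jsynth_bound[OF g(2) ut bt] Jsynth_bound[OF g(2) bt ut] by (simp add: mult_ac abs_le_iff)
    also have "\<dots> \<le> (?nu\<^sup>2 + ?nb\<^sup>2) * ?M2" by (intro mult_right_mono sum_squares_bound M0)
    finally show ?thesis .
  qed
  have "(?nu\<^sup>2 + ?nb\<^sup>2) * ?M1 + (?nu\<^sup>2 + ?nb\<^sup>2) * ?M2 = (?nu\<^sup>2 + ?nb\<^sup>2) * (?M1 + ?M2)" by (simp only: distrib_left)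
  also have "\<dots> \<le> (R \<tau>)\<^sup>2 * (x * (3 / 2 * norm k) * (cp * ?B))"
    by (intro mult_mono' R t moment_bound I x g le) (use M0 in auto)
  finally have w3: "(?nu\<^sup>2 + ?nb\<^sup>2) * ?M1 + (?nu\<^sup>2 + ?nb\<^sup>2) * ?M2 \<le> (R \<tau>)\<^sup>2 * (x * (3 / 2 * norm k) * (cp * ?B))" .
  have w4: "L2_inner (f1 \<tau>) (synth g1) + L2_inner (f2 \<tau>) (synth g2) \<le> x * (3 / 2 * norm k) * (H * ?B)"
    by (rule force_bound[OF I x g le elim(1,2) H(1,3)])
  have "source_term u u b b f1 g1 \<tau> + source_term u b b u f2 g2 \<tau> \<le> (R \<tau>)\<^sup>2 * (x * (3 / 2 * norm k) * (cp * ?B)) + x * (3 / 2 * norm k) * (H * ?B)"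
    unfolding source_term_def using w1 w2 w3 w4 by linarith
  also have "\<dots> = x * (3 / 2 * norm k) * ?B * (cp * (R \<tau>)\<^sup>2 + H)" by (simp add: algebra_simps)
  \<comment> \<open>The slack identity turns the bracket into R1 at \<tau>, and monotonicity
    replaces \<tau> by T.\<close>
  also have "\<dots> \<le> x * (3 / 2 * norm k) * ?B * (min \<nu> \<eta> / 6 * R1 T)"
  proof -
    have "R1 \<tau> \<le> R1 T" using mono_onD[OF R1, of \<tau> T] t by simp
    then have "min \<nu> \<eta> / 6 * R1 \<tau> \<le> min \<nu> \<eta> / 6 * R1 T" using pos by (intro mult_left_mono) auto
    then show ?thesis unfolding H(2) by (rule mult_left_mono) (use x in simp)
  qed
  \<comment> \<open>3/2 times 1/6 is 1/4, the factor in \<open>mu\<close>.\<close>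
  also have "\<dots> = mu * (R1 T / norm k) * ?B * x"
    using k_pos by (simp add: mu_def power2_eq_square)
  finally show ?case .
qed

text \<open>Duhamel's bound reads I <= X I^(1/q) with I = \<open>trunc_moment\<close>. A positive
  finite I can be divided out, which leaves I^(1/p) <= X.\<close>

lemma truncated_bound:
  defines "X \<equiv> exp (- mu * T) * a + (1 - exp (- mu * T)) * (R1 T / norm k)"
  assumes X: "X \<ge> 0"
  shows "(\<integral>\<^sup>+\<xi>. ennreal (indicator S \<xi> * (norm (U \<xi>) powr p + norm (V \<xi>) powr p)) \<partial>lborel) \<le> ennreal (X powr p)"
proof (cases "trunc_moment > 0")
  case True
  let ?B = "trunc_moment powr (1 / q)"
  have cube: "\<xi> \<in> cube k \<delta>" if "\<psi>1 \<xi> \<noteq> 0 \<or> \<psi>2 \<xi> \<noteq> 0" for \<xi>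
    using that phi_supp by (auto simp: \<psi>1_def \<psi>2_def)
  have freq: "mu \<le> \<kappa> * (norm \<xi>)\<^sup>2 \<and> \<kappa> * (norm \<xi>)\<^sup>2 \<le> max \<nu> \<eta> * (3 / 2 * norm k)\<^sup>2"
    if \<xi>: "\<xi> \<in> cube k \<delta>" and \<kappa>: "min \<nu> \<eta> \<le> \<kappa>" "\<kappa> \<le> max \<nu> \<eta>" for \<xi> \<kappa>
  proof
    have "(norm k / 2)\<^sup>2 \<le> (norm \<xi>)\<^sup>2" by (intro power_mono cube_norm(1)[OF \<delta>k \<xi>]) simp
    then have "min \<nu> \<eta> * (norm k / 2)\<^sup>2 \<le> \<kappa> * (norm \<xi>)\<^sup>2" using \<kappa>(1) pos by (intro mult_mono') auto
    then show "mu \<le> \<kappa> * (norm \<xi>)\<^sup>2" by (simp add: mu_def power_divide)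
    \<comment> \<open>The upper bound feeds the step size restriction of the Euler scheme.\<close>
    have "(norm \<xi>)\<^sup>2 \<le> (3 / 2 * norm k)\<^sup>2" by (intro power_mono cube_norm(2)[OF \<delta>k \<xi>]) simp
    then show "\<kappa> * (norm \<xi>)\<^sup>2 \<le> max \<nu> \<eta> * (3 / 2 * norm k)\<^sup>2" using \<kappa> pos by (intro mult_mono') auto
  qed
  have "trunc_moment \<le> exp (- mu * T) * (a * ?B) + (1 - exp (- mu * T)) * (mu * (R1 T / norm k) * ?B / mu)"
    unfolding test_value[symmetric]
  proof (rule duhamel_bound[OF E1 E2 divfree_band_psi T mu_pos])
    fix x g1 g2 assume *: "0 \<le> (x::real)" "divfree_band g1" "divfree_band g2" "\<And>\<xi>. norm (g1 \<xi>) \<le> x * norm (\<psi>1 \<xi>)" "\<And>\<xi>. norm (g2 \<xi>) \<le> x * norm (\<psi>2 \<xi>)"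
    \<comment> \<open>Rewriting the goal with \<open>test_value\<close> also expanded
      \<open>trunc_moment\<close> inside the constants; it is folded back here and in the next
      claim.\<close>
    show "AE \<tau> in lebesgue_on {0<..<T}. source_term u u b b f1 g1 \<tau> + source_term u b b u f2 g2 \<tau> \<le> mu * (R1 T / norm k) * (L2_inner (u T) (synth \<psi>1) + L2_inner (b T) (synth \<psi>2)) powr (1 / q) * x"
      unfolding test_value by (rule source_bound[OF True *(1) divfree_bandD[OF *(2)] divfree_bandD[OF *(3)] *(4,5)])
    show "L2_inner (u 0) (synth g1) + L2_inner (b 0) (synth g2) \<le> a * (L2_inner (u T) (synth \<psi>1) + L2_inner (b T) (synth \<psi>2)) powr (1 / q) * x"
      unfolding test_value by (rule initial_bound[OF True *(1) divfree_bandD[OF *(2)] divfree_bandD[OF *(3)] *(4,5)])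
  next
    fix \<xi>
    show "\<psi>1 \<xi> \<noteq> 0 \<Longrightarrow> mu \<le> \<nu> * (norm \<xi>)\<^sup>2 \<and> \<nu> * (norm \<xi>)\<^sup>2 \<le> max \<nu> \<eta> * (3 / 2 * norm k)\<^sup>2"
      by (rule freq) (use cube in auto)
    show "\<psi>2 \<xi> \<noteq> 0 \<Longrightarrow> mu \<le> \<eta> * (norm \<xi>)\<^sup>2 \<and> \<eta> * (norm \<xi>)\<^sup>2 \<le> max \<nu> \<eta> * (3 / 2 * norm k)\<^sup>2"
      by (rule freq) (use cube in auto)
  qed
  also have "\<dots> = X * ?B" using mu_pos by (simp add: X_def algebra_simps diff_divide_distrib)
  finally have "trunc_moment \<le> X * ?B" .
  moreover have "trunc_moment = trunc_moment powr (1 / p) * ?B"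
    using True p(3) by (simp add: powr_add[symmetric])
  ultimately have "trunc_moment powr (1 / p) * ?B \<le> X * ?B" by simp
  then have "trunc_moment powr (1 / p) \<le> X" using True by simp
  then have "(trunc_moment powr (1 / p)) powr p \<le> X powr p" using p by (intro powr_mono2) auto
  then show ?thesis unfolding nn_integral_trunc_moment using True p by (simp add: powr_powr ennreal_leI)
next
  case False
  then have "trunc_moment = 0" using trunc_moment_nonneg by simp
  then show ?thesis unfolding nn_integral_trunc_moment by simp
qed

end

text \<open>Fatou's lemma over the truncation levels; the bound of \<open>truncated_bound\<close> is
  the same at every level.\<close>

lemma e_spec_bound:
  assumes T: "T > 0" and X: "exp (- mu * T) * a + (1 - exp (- mu * T)) * (R1 T / norm k) \<ge> 0"
  shows "e_spec c u b p T \<le> ennreal (exp (- mu * T) * a + (1 - exp (- mu * T)) * (R1 T / norm k))"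
proof -
  let ?X = "exp (- mu * T) * a + (1 - exp (- mu * T)) * (R1 T / norm k)"
  let ?U = "\<lambda>\<xi>. c \<xi> *\<^sub>R fourier (u T) \<xi>" and ?V = "\<lambda>\<xi>. c \<xi> *\<^sub>R fourier (b T) \<xi>"
  define S where "S n = {\<xi> \<in> cube k \<delta>. norm (?U \<xi>) \<le> real n \<and> norm (?V \<xi>) \<le> real n \<and>
      (\<Sum>j\<in>UNIV. complex_of_real (\<xi> $ j) * fourier (u T) \<xi> $ j) = 0 \<and> (\<Sum>j\<in>UNIV. complex_of_real (\<xi> $ j) * fourier (b T) \<xi> $ j) = 0}" for n :: nat
  define F where "F \<xi> = norm (?U \<xi>) powr p + norm (?V \<xi>) powr p" for \<xi>
  have [measurable]: "S n \<in> sets borel" for n unfolding S_def by (rule S_sets[OF T])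
  have [measurable]: "F \<in> borel_measurable borel"
    unfolding F_def using UV_measurable[OF T] by measurable
  have bd: "(\<integral>\<^sup>+\<xi>. ennreal (indicator (S n) \<xi> * F \<xi>) \<partial>lborel) \<le> ennreal (?X powr p)" for n
    unfolding S_def F_def by (rule truncated_bound[OF T X])
  have T0: "T \<ge> 0" using T by simp
  have "AE \<xi> in lborel. liminf (\<lambda>n. ennreal (indicator (S n) \<xi> * F \<xi>)) = ennreal (F \<xi>)"
    using fourier_divfree[OF mode_eqD(1)[OF E1] T0] fourier_divfree[OF mode_eqD(1)[OF E2] T0]
  proof eventually_elim
    case (elim \<xi>)
    have "\<forall>\<^sub>F n in sequentially. ennreal (indicator (S n) \<xi> * F \<xi>) = ennreal (F \<xi>)"
    proof (cases "\<xi> \<in> cube k \<delta>")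
      case True
      obtain N :: nat where N: "max (norm (?U \<xi>)) (norm (?V \<xi>)) \<le> real N" using real_arch_simple by blast
      show ?thesis
      proof (rule eventually_sequentiallyI[of N])
        fix n assume "N \<le> n"
        then have "real N \<le> real n" by simp
        then have "\<xi> \<in> S n" using N True elim unfolding S_def by auto
        then show "ennreal (indicator (S n) \<xi> * F \<xi>) = ennreal (F \<xi>)" by simp
      qed
    next
      case False
      \<comment> \<open>Off the cube the cutoff vanishes, and 0 powr p is 0.\<close>
      then have "F \<xi> = 0" using p by (simp add: F_def c_eq_0)
      then show ?thesis by simp
    qed
    then show ?case by (intro lim_imp_Liminf tendsto_eventually) auto
  qed
  then have "(\<integral>\<^sup>+\<xi>. ennreal (F \<xi>) \<partial>lborel) = (\<integral>\<^sup>+\<xi>. liminf (\<lambda>n. ennreal (indicator (S n) \<xi> * F \<xi>)) \<partial>lborel)"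
    by (intro nn_integral_cong_AE) auto
  also have "\<dots> \<le> liminf (\<lambda>n. \<integral>\<^sup>+\<xi>. ennreal (indicator (S n) \<xi> * F \<xi>) \<partial>lborel)"
    by (rule nn_integral_liminf) measurable
  also have "\<dots> \<le> liminf (\<lambda>n::nat. ennreal (?X powr p))"
    by (intro Liminf_mono always_eventually allI bd)
  also have "\<dots> = ennreal (?X powr p)" by (simp add: Liminf_const)
  finally have "(\<integral>\<^sup>+\<xi>. ennreal (F \<xi>) \<partial>lborel) \<le> ennreal (?X powr p)" .
  then show ?thesis unfolding e_spec_def F_def
    by (intro ennroot_leI X) (use p in auto)
qed

end

theorem theorem2p5:
  fixes \<nu> \<eta> \<delta> :: real and k :: "real^3"
    and f1 f2 u b :: "real \<Rightarrow> real^3 \<Rightarrow> real^3" and u0 b0 :: "real^3 \<Rightarrow> real^3"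
    and c :: "real^3 \<Rightarrow> real" and R R1 :: "real \<Rightarrow> real"
  assumes "\<nu> > 0" and "\<eta> > 0"
    and "admissible_force f1" and "admissible_force f2"
    and "u0 \<in> L2_sigma" and "b0 \<in> L2_sigma"
    and "weak_solution_MHD \<nu> \<eta> f1 f2 u0 b0 u b"
    and "weakly_continuous_rep u" and "weakly_continuous_rep b"
    and "\<And>t. t \<ge> 0 \<Longrightarrow> R t \<ge> 0"
    and "\<And>T. T > 0 \<Longrightarrow>
           (L2_norm (u T))\<^sup>2 + (L2_norm (b T))\<^sup>2
           + min \<nu> \<eta> * (\<integral>s. ((L2_norm (wgrad (u s)))\<^sup>2 + (L2_norm (wgrad (b s)))\<^sup>2) \<partial>lebesgue_on {0..T})
           \<le> (R T)\<^sup>2"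
    and "k \<noteq> 0" and "0 < \<delta>" and "\<delta> < norm k / (2 * sqrt 3)"
    and "is_cutoff k \<delta> c"
    and "mono_on {0..} R1"
    and "\<And>p t. p \<ge> 2 \<Longrightarrow> t \<ge> 0 \<Longrightarrow>
           ennreal (2 powr (1 / p) * (2 * \<delta>) powr (3 / p) * (R t)\<^sup>2) + 2 * h_spec c f1 f2 p t
           < ennreal (min \<nu> \<eta> / 6 * R1 t)"
    and "(SUP p\<in>{2..}. e_spec c u b p 0) < ennreal (R1 0 / norm k)"
  shows "\<forall>t>0. (SUP p\<in>{2..}. e_spec c u b p t) < ennreal (R1 t / norm k)"
proof (intro allI impI)
  fix T :: real assume T: "T > 0"
  note nu = assms(1) and eta = assms(2) and sol = assms(7) and k0 = assms(12) and \<delta> = assms(13) and \<delta>k = assms(14) and cut = assms(15)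
    and R1 = assms(16) and h = assms(17) and init = assms(18)
  interpret cutoff k \<delta> c by standard (rule \<delta>, rule cut)
  have ru: "regular u" and rb: "regular b"
    using sol assms(8,9) unfolding weak_solution_MHD_def regular_def by blast+
  have lim: "((\<lambda>t. L2_norm (\<lambda>x. u t x - u0 x)) \<longlongrightarrow> 0) (at_right 0)" "((\<lambda>t. L2_norm (\<lambda>x. b t x - b0 x)) \<longlongrightarrow> 0) (at_right 0)"
    using sol unfolding weak_solution_MHD_def by blast+
  \<comment> \<open>The order of the four fields records the quadratic terms: u u minus b b for the
    velocity, u b minus b u for the magnetic field.\<close>
  have E1: "mode_eq \<nu> u u u b b f1"
    by (rule mode_eqI[OF weak_eq_test(1)[OF sol assms(8,9)] ru ru ru rb rb assms(3) L2_sigma_L2[OF assms(5)] lim(1)])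
  have E2: "mode_eq \<eta> b u b b u f2"
    by (rule mode_eqI[OF weak_eq_test(2)[OF sol assms(8,9)] rb ru rb rb ru assms(4) L2_sigma_L2[OF assms(6)] lim(2)])
  have en: "(L2_norm (u t))\<^sup>2 + (L2_norm (b t))\<^sup>2 \<le> (R t)\<^sup>2" if "t > 0" for t
  proof -
    have "0 \<le> min \<nu> \<eta> * (\<integral>s. ((L2_norm (wgrad (u s)))\<^sup>2 + (L2_norm (wgrad (b s)))\<^sup>2) \<partial>lebesgue_on {0..t})"
      using nu eta by (intro mult_nonneg_nonneg integral_nonneg_AE) auto
    then show ?thesis using assms(11)[OF that] by linarith
  qed
  have kp: "norm k > 0" using k0 by simp
  define s where "s = (SUP p\<in>{2..}. e_spec c u b p 0)"
  have "s < ennreal (R1 0 / norm k)" unfolding s_def by (rule init)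
  moreover have "0 < ennreal (R1 0 / norm k)" using calculation by (rule le_less_trans[OF zero_le])
  \<comment> \<open>A value strictly between the initial supremum and R1(0)/|k|; the maximum with 0
    makes it positive, as the normalization in Hoelder's inequality requires.\<close>
  ultimately obtain a' where a': "max s 0 < a'" "a' < ennreal (R1 0 / norm k)" using dense[of s "ennreal (R1 0 / norm k)"] by auto
  then obtain a where a: "a' = ennreal a" "a \<ge> 0" by (cases a') (auto simp: top_unique)
  have "0 < a'" using a'(1) by (rule le_less_trans[rotated]) simp
  then have ap: "a > 0" using a by simp
  have aR: "a < R1 0 / norm k" using a' a by (simp add: ennreal_less_iff)
  have R1T: "R1 0 \<le> R1 T" using mono_onD[OF R1, of 0 T] T by simp
  define m where "m = min \<nu> \<eta> * (norm k)\<^sup>2 / 4"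
  define X where "X = exp (- m * T) * a + (1 - exp (- m * T)) * (R1 T / norm k)"
  have mp: "m > 0" using nu eta kp by (simp add: m_def)
  have "a < R1 T / norm k" using aR R1T kp by (meson divide_right_mono less_le_trans norm_ge_zero)
  then have "exp (- m * T) * a < exp (- m * T) * (R1 T / norm k)" by (rule mult_strict_left_mono) simp
  then have XR: "X < R1 T / norm k" unfolding X_def left_diff_distrib mult_1 by linarith
  have X0: "X \<ge> 0"
  proof -
    have "0 \<le> R1 T / norm k" using ap \<open>a < R1 T / norm k\<close> by linarith
    moreover have "exp (- m * T) \<le> 1" using mp T by simp
    ultimately show ?thesis unfolding X_def using ap by (intro add_nonneg_nonneg mult_nonneg_nonneg) auto
  qed
  have "e_spec c u b p T \<le> ennreal X" if p: "p \<ge> 2" for p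
  proof -
    define q where "q = p / (p - 1)"
    have q: "q > 1" "1 / p + 1 / q = 1" using p by (auto simp: q_def field_simps)
    have "e_spec c u b p 0 \<le> s" unfolding s_def by (rule SUP_upper) (use p in simp)
    also have "\<dots> \<le> ennreal a" using a'(1) a by (auto simp: max_def split: if_splits)
    finally have e0: "e_spec c u b p 0 \<le> ennreal a" .
    interpret mhd_spectral k \<delta> c \<nu> \<eta> p q a f1 f2 u b R R1
      by standard (use nu eta \<delta>k p q E1 E2 en R1 h[OF p] ap e0 in auto)
    show ?thesis using e_spec_bound[OF T] X0 unfolding X_def m_def mu_def by simp
  qed
  then have "(SUP p\<in>{2..}. e_spec c u b p T) \<le> ennreal X" by (intro SUP_least) auto
  also have "\<dots> < ennreal (R1 T / norm k)" using XR X0 by (simp add: ennreal_less_iff)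
  finally show "(SUP p\<in>{2..}. e_spec c u b p T) < ennreal (R1 T / norm k)" .
qed

end
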